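(* Let $G$ be an $n$-vertex weighted $2$-tree, let $e^*$ be an edge of $G$ with maximum length, let $\mathcal T$ be the SPQ-tree of $G$ such that the Q-node corresponding to $e^*$ is a child of the root of $\mathcal T$, and let $h^*$ be the height of $\mathcal T$. There exists an $n^{O(2^{h^*})}$-time algorithm that tests whether $G$ admits a planar straight-line realization and, in the positive case, constructs such a realization.
   Context: A $2$-tree is defined recursively: a $3$-cycle is a $2$-tree, and if $G$ is a $2$-tree containing an edge $(u,w)$, then adding a new vertex $v$ and edges $(v,u),(v,w)$ yields a $2$-tree. A weighted graph has a length function $\lambda:E\to\mathbb{R}^+$; a planar straight-line realization is a planar straight-line drawing in which each edge $e$ has Euclidean length $\lambda(e)$. Series-parallel graphs with two poles and their SPQ-trees are defined recursively: an edge $(u,v)$ is a series-parallel graph with poles $u,v$ whose SPQ-tree is a single Q-node (corresponding to that edge); identifying all first poles and all second poles of series-parallel graphs $G_1,\dots,G_k$ gives a series-parallel graph whose SPQ-tree has a P-node root with children the roots of the SPQ-trees of $G_1,\dots,G_k$; identifying the second pole of $G_i$ with the first pole of $G_{i+1}$ for $i<k$ gives a series-parallel graph with poles the first pole of $G_1$ and the second pole of $G_k$, whose SPQ-tree has an S-node root with children the roots of the SPQ-trees of $G_1,\dots,G_k$. For a $2$-tree $G$ and an edge $e^*$, the SPQ-tree of $G$ considered here is the one in which: the root is a P-node; every P-node has at least two children, exactly one being a Q-node and the others S-nodes; every S-node has exactly two children, each a Q-node or a P-node; and the Q-node corresponding to $e^*$ is a child of the root. The height of $\mathcal T$ is the maximum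 number of edges on a root-to-leaf path. Running times are in the real RAM model. *)

theory Defs
  imports "HOL-Analysis.Analysis" "HOL-Library.Landau_Symbols"
begin

section \<open>2-trees and planar straight-line realizations\<close>

text \<open>A finite simple graph is a pair of a vertex set and a set of two-element vertex sets.\<close>

type_synonym 'a graph = "'a set \<times> 'a set set"

inductive two_tree :: "'a graph \<Rightarrow> bool" where
  triangle: "distinct [a, b, c] \<Longrightarrow> two_tree ({a, b, c}, {{a, b}, {b, c}, {a, c}})"
| extend: "\<lbrakk>two_tree (V, E); {u, w} \<in> E; v \<notin> V\<rbrakk>
    \<Longrightarrow> two_tree (insert v V, E \<union> {{v, u}, {v, w}})"

text \<open>
  The edge \<open>e = {u, v}\<close> is drawn as \<open>convex hull (pos ` e)\<close>, the closed segment
  from \<open>pos u\<close> to \<open>pos v\<close>. Distinct edges may meet only at a common endpoint, and no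
  vertex lies on an edge that it is not incident to. The distance on
  \<open>real \<times> real\<close> is the Euclidean one.
\<close>

definition planar_drawing :: "'a graph \<Rightarrow> ('a \<Rightarrow> real \<times> real) \<Rightarrow> bool" where
  "planar_drawing G pos \<longleftrightarrow>
     inj_on pos (fst G) \<and>
     (\<forall>v\<in>fst G. \<forall>e\<in>snd G. pos v \<in> convex hull (pos ` e) \<longrightarrow> v \<in> e) \<and>
     (\<forall>e\<in>snd G. \<forall>f\<in>snd G. e \<noteq> f \<longrightarrow>
        convex hull (pos ` e) \<inter> convex hull (pos ` f) \<subseteq> pos ` (e \<inter> f))"

definition planar_realization ::
  "'a graph \<Rightarrow> ('a set \<Rightarrow> real) \<Rightarrow> ('a \<Rightarrow> real \<times> real) \<Rightarrow> bool" where
  "planar_realization G len pos \<longleftrightarrow>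
     planar_drawing G pos \<and>
     (\<forall>u v. {u, v} \<in> snd G \<longrightarrow> dist (pos u) (pos v) = len {u, v})"


section \<open>Series-parallel graphs and SPQ-trees\<close>

datatype 'a spq_tree =
    is_QNode: QNode "'a set"
  | is_SNode: SNode "'a spq_tree list"
  | is_PNode: PNode "'a spq_tree list"

text \<open>
  \<open>series_parallel u v G T\<close>: \<open>G\<close> is a series-parallel graph with first pole \<open>u\<close> and
  second pole \<open>v\<close>, and \<open>T\<close> is its SPQ-tree. Identification of poles is expressed by gluing
  component graphs that already share the identified poles and are otherwise disjoint. In
  a parallel composition, disjointness of the edge sets prevents a multiple edge
  between the poles from being silently collapsed into a single one.
\<close>

inductive series_parallel :: "'a \<Rightarrow> 'a \<Rightarrow> 'a graph \<Rightarrow> 'a spq_tree \<Rightarrow> bool" where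
  edge: "u \<noteq> v \<Longrightarrow> series_parallel u v ({u, v}, {{u, v}}) (QNode {u, v})"
| parallel: "\<lbrakk>ts \<noteq> []; length Gs = length ts;
     \<forall>i<length ts. series_parallel u v (Gs ! i) (ts ! i);
     \<forall>i j. i < j \<longrightarrow> j < length ts \<longrightarrow>
       fst (Gs ! i) \<inter> fst (Gs ! j) = {u, v} \<and> snd (Gs ! i) \<inter> snd (Gs ! j) = {}\<rbrakk>
    \<Longrightarrow> series_parallel u v (\<Union>(fst ` set Gs), \<Union>(snd ` set Gs)) (PNode ts)"
| series: "\<lbrakk>ts \<noteq> []; length Gs = length ts; length ps = length ts + 1;
     \<forall>i<length ts. series_parallel (ps ! i) (ps ! (i + 1)) (Gs ! i) (ts ! i);
     \<forall>i j. i < j \<longrightarrow> j < length ts \<longrightarrow>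
       fst (Gs ! i) \<inter> fst (Gs ! j) = (if j = i + 1 then {ps ! j} else {})\<rbrakk>
    \<Longrightarrow> series_parallel (hd ps) (last ps) (\<Union>(fst ` set Gs), \<Union>(snd ` set Gs)) (SNode ts)"

fun two_tree_shape :: "'a spq_tree \<Rightarrow> bool" where
  "two_tree_shape (QNode e) \<longleftrightarrow> True"
| "two_tree_shape (SNode ts) \<longleftrightarrow>
     length ts = 2 \<and> (\<forall>t\<in>set ts. (is_QNode t \<or> is_PNode t) \<and> two_tree_shape t)"
| "two_tree_shape (PNode ts) \<longleftrightarrow>
     length ts \<ge> 2 \<and> length (filter is_QNode ts) = 1 \<and>
     (\<forall>t\<in>set ts. (is_QNode t \<or> is_SNode t) \<and> two_tree_shape t)"

definition spq_tree_of :: "'a graph \<Rightarrow> 'a set \<Rightarrow> 'a spq_tree \<Rightarrow> bool" where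
  "spq_tree_of G e T \<longleftrightarrow>
     (\<exists>u v. series_parallel u v G T) \<and> two_tree_shape T \<and>
     (\<exists>ts. T = PNode ts \<and> QNode e \<in> set ts)"

fun height :: "'a spq_tree \<Rightarrow> nat" where
  "height (QNode e) = 0"
| "height (SNode ts) = Suc (Max (height ` set ts))"
| "height (PNode ts) = Suc (Max (height ` set ts))"


section \<open>The real RAM\<close>

text \<open>
  A real RAM has registers and random-access memory of two kinds, one holding natural numbers
  and one holding exact real numbers; every instruction takes one time unit. Addresses
  are natural numbers. As the model must not allow large amounts of work to be packed into
  single instructions, there is no conversion from reals to natural numbers (no
  floor function) and no unit-cost multiplication of natural numbers, and real constants
  in programs are integers. The square root is a primitive because an equilateral triangle
  of side length 1 has no realization whose coordinates are all rational.

  Operands are register indices with the destination first; \<open>NSub\<close> is truncated subtraction.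
  Isabelle's totalizations \<open>x / 0 = 0\<close> and \<open>sqrt (- x) = - sqrt x\<close> are harmless,
  since a program can test the sign of an operand beforehand.
\<close>

datatype instr =
    NConst nat nat
  | NAdd nat nat nat
  | NSub nat nat nat
  | NLoad nat nat
  | NStore nat nat
  | RConst nat int
  | RAdd nat nat nat
  | RSub nat nat nat
  | RMul nat nat nat
  | RDiv nat nat nat
  | RSqrt nat nat
  | RLoad nat nat
  | RStore nat nat
  | Jump nat
  | NJumpLess nat nat nat
  | RJumpLess nat nat nat

record config =
  pc :: nat
  nreg :: "nat \<Rightarrow> nat"
  rreg :: "nat \<Rightarrow> real"
  nmem :: "nat \<Rightarrow> nat"
  rmem :: "nat \<Rightarrow> real"

definition set_nreg :: "nat \<Rightarrow> nat \<Rightarrow> config \<Rightarrow> config" where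
  "set_nreg i x c = c\<lparr>pc := Suc (pc c), nreg := (nreg c)(i := x)\<rparr>"

definition set_rreg :: "nat \<Rightarrow> real \<Rightarrow> config \<Rightarrow> config" where
  "set_rreg i x c = c\<lparr>pc := Suc (pc c), rreg := (rreg c)(i := x)\<rparr>"

fun exec :: "instr \<Rightarrow> config \<Rightarrow> config" where
  "exec (NConst i k) c = set_nreg i k c"
| "exec (NAdd i j k) c = set_nreg i (nreg c j + nreg c k) c"
| "exec (NSub i j k) c = set_nreg i (nreg c j - nreg c k) c"
| "exec (NLoad i j) c = set_nreg i (nmem c (nreg c j)) c"
| "exec (NStore i j) c =
     c\<lparr>pc := Suc (pc c), nmem := (nmem c)(nreg c i := nreg c j)\<rparr>"
| "exec (RConst i k) c = set_rreg i (of_int k) c"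
| "exec (RAdd i j k) c = set_rreg i (rreg c j + rreg c k) c"
| "exec (RSub i j k) c = set_rreg i (rreg c j - rreg c k) c"
| "exec (RMul i j k) c = set_rreg i (rreg c j * rreg c k) c"
| "exec (RDiv i j k) c = set_rreg i (rreg c j / rreg c k) c"
| "exec (RSqrt i j) c = set_rreg i (sqrt (rreg c j)) c"
| "exec (RLoad i j) c = set_rreg i (rmem c (nreg c j)) c"
| "exec (RStore i j) c =
     c\<lparr>pc := Suc (pc c), rmem := (rmem c)(nreg c i := rreg c j)\<rparr>"
| "exec (Jump l) c = c\<lparr>pc := l\<rparr>"
| "exec (NJumpLess i j l) c =
     c\<lparr>pc := (if nreg c i < nreg c j then l else Suc (pc c))\<rparr>"
| "exec (RJumpLess i j l) c =
     c\<lparr>pc := (if rreg c i < rreg c j then l else Suc (pc c))\<rparr>"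

text \<open>The machine halts when the program counter leaves the program.\<close>

definition halted :: "instr list \<Rightarrow> config \<Rightarrow> bool" where
  "halted A c \<longleftrightarrow> length A \<le> pc c"

definition step :: "instr list \<Rightarrow> config \<Rightarrow> config" where
  "step A c = (if halted A c then c else exec (A ! pc c) c)"

text \<open>Started in \<open>c\<close>, the program halts in \<open>c'\<close> after at most \<open>t\<close> time units.\<close>

definition halts_within :: "instr list \<Rightarrow> config \<Rightarrow> nat \<Rightarrow> config \<Rightarrow> bool" where
  "halts_within A c t c' \<longleftrightarrow> (step A ^^ t) c = c' \<and> halted A c'"


section \<open>Input and output encoding\<close>

definition edge_list :: "nat set set \<Rightarrow> (nat \<times> nat) list \<Rightarrow> bool" where
  "edge_list E es \<longleftrightarrow>
     distinct (map (\<lambda>(u, v). {u, v}) es) \<and> set (map (\<lambda>(u, v). {u, v}) es) = E"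

definition mem_of_list :: "'b::zero list \<Rightarrow> nat \<Rightarrow> 'b" where
  "mem_of_list xs i = (if i < length xs then xs ! i else 0)"

text \<open>
  A weighted graph on the vertices \<open>0, \<dots>, n - 1\<close> is given by the numbers of its vertices and
  edges in the first two registers, the endpoints of the edges (in arbitrary order and
  orientation), and the lengths of the edges in the same order.
\<close>

definition input_config :: "nat \<Rightarrow> (nat \<times> nat) list \<Rightarrow> (nat set \<Rightarrow> real) \<Rightarrow> config" where
  "input_config n es len =
     \<lparr>pc = 0,
      nreg = mem_of_list [n, length es],
      rreg = (\<lambda>_. 0),
      nmem = mem_of_list (concat (map (\<lambda>(u, v). [u, v]) es)),
      rmem = mem_of_list (map (\<lambda>(u, v). len {u, v}) es)\<rparr>"

definition output_answer :: "config \<Rightarrow> nat" where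
  "output_answer c = nreg c 0"

definition output_pos :: "config \<Rightarrow> nat \<Rightarrow> real \<times> real" where
  "output_pos c v = (rmem c (2 * v), rmem c (2 * v + 1))"

text \<open>
  \<open>A\<close> answers 1 and produces a realization if there is one, and answers 0 otherwise. The
  algorithm is given only the weighted graph, not the edge or the SPQ-tree
  in terms of which its running time is measured.
\<close>

definition solves_realization_within ::
  "instr list \<Rightarrow> nat \<Rightarrow> (nat \<times> nat) list \<Rightarrow> nat graph \<Rightarrow> (nat set \<Rightarrow> real) \<Rightarrow> nat \<Rightarrow> bool" where
  "solves_realization_within A n es G len t \<longleftrightarrow>
     (\<exists>c. halts_within A (input_config n es len) t c \<and>
          (if \<exists>pos. planar_realization G len pos
           then output_answer c = 1 \<and> planar_realization G len (output_pos c)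
           else output_answer c = 0))"

end

(*
Root the 2-tree at a longest edge and order the remaining vertices so that each new vertex v
spans a triangle on an edge of the part built so far, always choosing the triangle whose two
new sides have maximal sum. A realization is then determined by one sign per vertex, the side
of its base on which it lies. Triangles on one side of a common base are nested, in this order
of their perimeters, so only the outermost vertices of a piece can be seen from outside:
a partial realization of a piece matters only through the signs of at most 4^d of its vertices,
where d is the number of nested bases and 2 d is at most the height of the SPQ-tree. A dynamic
program over the pieces keeps one sound sign vector per such key. Neither the root
edge nor the height is known to the algorithm, so it tries all longest edges with a cap on the
number of table entries, and raises the cap until some root needs no more entries than
the cap allows. The program is written in a small imperative language that is compiled to the RAM.
*)

theory Submission
  imports Defs
begin

text \<open>One sign vector per key suffices because two planar drawings of a piece with equal keys
  can be exchanged inside any planar drawing of the whole graph: their invisible vertices lie inside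
  triangles with visible corners, and no vertex outside the piece lies inside such a triangle. The
  root edge has to be longest for the latter: its ends cannot enter a triangle whose sides are no
  longer than itself, and any other intruder would lead to an earlier triangle on the same base with
  a smaller perimeter. The number \<open>4 ^ d\<close> arises from two signs on each of the two free
  sides of a triangle; with \<open>2 * d\<close> at most the height \<open>h\<close> it becomes
  \<open>2 ^ h\<close>. An unsuccessful attempt is informative: a full table has as many entries,
  distinct in piece or key, as the cap, so the cap is at most the counting bound for that root.
  Hence the edge of the statement forces success just above its own bound, and success with another
  root at a smaller cap is equally welcome. Apart from the loop that raises the cap, every loop has
  a bound fixed in advance, which makes polynomial time a matter of syntax.\<close>

type_synonym point = "real \<times> real"

section \<open>Signed areas and nested triangles\<close>

definition cross :: "point => point => point => real" where
 "cross p q x = (fst q - fst p) * (snd x - snd p) - (snd q - snd p) * (fst x - fst p)"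

lemma cross_rotate: "cross p q x = cross q x p"
 by (simp add: cross_def algebra_simps)

lemma cross_same [simp]: "cross p q p = 0" "cross p q q = 0" "cross p p q = 0"
 by (simp_all add: cross_def)

text \<open>\<open>cross p q x\<close> is twice the signed area over the base \<open>p q\<close>, an
  affine function of the apex. This links barycentric weights with the signs that tell the sides of
  a line.\<close>

lemma cross_affine:
 assumes "a + b + g = 1"
 shows "cross p q (a *\<^sub>R x + b *\<^sub>R y + g *\<^sub>R z) = a * cross p q x + b * cross p q y + g * cross p q z"
proof -
 have a: "a = 1 - b - g" using assms by simp
 show ?thesis unfolding a by (simp add: cross_def algebra_simps)
qed

lemma cross_segment:
 "cross p q ((1 - u) *\<^sub>R x + u *\<^sub>R y) = (1 - u) * cross p q x + u * cross p q y"
 using cross_affine[of "1 - u" u 0 p q x y x] by simp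

lemma cross_closed_segment: "z \<in> closed_segment p q ==> cross p q z = 0"
 by (auto simp: in_segment cross_segment)

text \<open>Cramer's rule. The weight of \<open>t\<close> is spelled out as a quotient of signed
  areas over the common base, since later arguments need its sign; the other two weights may have
  any sign.\<close>

lemma affine_coordinates:
 assumes "cross p q t ~= 0"
 obtains a b where "x = a *\<^sub>R p + b *\<^sub>R q + (cross p q x / cross p q t) *\<^sub>R t"
  "a + b + cross p q x / cross p q t = 1"
proof
 define b where "b = cross p x t / cross p q t"
 define g where "g = cross p q x / cross p q t"
 have D: "cross p q t * b = cross p x t" "cross p q t * g = cross p q x"
  using assms by (simp_all add: b_def g_def)
 have "fst x = fst p + b * (fst q - fst p) + g * (fst t - fst p)"
 proof -
  have "cross p q t * fst x = cross p q t * (fst p + b * (fst q - fst p) + g * (fst t - fst p))"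
   unfolding distrib_left mult.assoc[symmetric] D by (simp add: cross_def algebra_simps)
  then show ?thesis using assms mult_left_cancel by blast
 qed
 moreover have "snd x = snd p + b * (snd q - snd p) + g * (snd t - snd p)"
 proof -
  have "cross p q t * snd x = cross p q t * (snd p + b * (snd q - snd p) + g * (snd t - snd p))"
   unfolding distrib_left mult.assoc[symmetric] D by (simp add: cross_def algebra_simps)
  then show ?thesis using assms mult_left_cancel by blast
 qed
 ultimately show "x = (1 - b - g) *\<^sub>R p + b *\<^sub>R q + g *\<^sub>R t"
  by (simp add: prod_eq_iff algebra_simps)
 show "(1 - b - g) + b + g = 1" by simp
qed

abbreviation triangle :: "point => point => point => point set" where
 "triangle p q c \<equiv> convex hull {p, q, c}"

lemma frontier_triangle:
 "frontier (triangle p q c) = closed_segment p q \<union> closed_segment q c \<union> closed_segment c p"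
 for p q c :: point
 by (rule frontier_of_triangle) simp

lemma interior_triangle_E:
 assumes "x \<in> interior (triangle p q c)"
 obtains a b g where "0 < a" "0 < b" "0 < g" "a + b + g = 1" "x = a *\<^sub>R p + b *\<^sub>R q + g *\<^sub>R c"
proof -
 have x: "x \<in> triangle p q c" "x ~: closed_segment p q" "x ~: closed_segment q c" "x ~: closed_segment c p"
  using assms interior_of_triangle[of p q c] by auto
 then obtain a b g where h: "0 <= a" "0 <= b" "0 <= g" "a + b + g = 1" "x = a *\<^sub>R p + b *\<^sub>R q + g *\<^sub>R c"
  unfolding convex_hull_3 by auto
 have "a ~= 0"
 proof
  assume "a = 0"
  then have "x = (1 - g) *\<^sub>R q + g *\<^sub>R c" "g <= 1" using h by (auto simp: eq_diff_eq)
  then show False using x(3) h(3) by (auto simp: in_segment)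
 qed
 moreover have "b ~= 0"
 proof
  assume "b = 0"
  then have "x = (1 - a) *\<^sub>R c + a *\<^sub>R p" "a <= 1" using h by (auto simp: algebra_simps simp flip: scaleR_left.add)
  then show False using x(4) h(1) by (auto simp: in_segment)
 qed
 moreover have "g ~= 0"
 proof
  assume "g = 0"
  then have "x = (1 - b) *\<^sub>R p + b *\<^sub>R q" "b <= 1" using h by (auto simp: eq_diff_eq)
  then show False using x(2) h(2) by (auto simp: in_segment)
 qed
 ultimately show ?thesis using that[of a b g] h by auto
qed

lemma interior_triangle_I:
 assumes "cross p q c ~= 0" and h: "0 < a" "0 < b" "0 < g" "a + b + g = 1"
 shows "a *\<^sub>R p + b *\<^sub>R q + g *\<^sub>R c \<in> interior (triangle p q c)" (is "?x \<in> _")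
proof -
 have "?x \<in> triangle p q c"
  unfolding convex_hull_3 mem_Collect_eq
  by (rule exI[of _ a], rule exI[of _ b], rule exI[of _ g]) (use h in simp)
 moreover have "cross p q ?x = g * cross p q c" "cross q c ?x = a * cross q c p" "cross c p ?x = b * cross c p q"
  using cross_affine[OF h(4)] by simp_all
 then have "cross p q ?x ~= 0" "cross q c ?x ~= 0" "cross c p ?x ~= 0"
  using assms cross_rotate[of p q c] cross_rotate[of c p q] by auto
 ultimately show ?thesis
  using cross_closed_segment[of ?x] interior_of_triangle[of p q c] by simp blast
qed

text \<open>A point just off the midpoint of \<open>p q\<close> belongs to both triangles: it gets
  the small weight \<open>e\<close> on \<open>c\<close>, and rewriting \<open>c\<close> over
  \<open>p\<close>, \<open>q\<close>, \<open>t\<close> changes the weights of \<open>p\<close> and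
  \<open>q\<close> only by \<open>e * a\<close> and \<open>e * b\<close>.\<close>

lemma interior_triangles_meet:
 assumes "0 < cross p q c * cross p q t"
 shows "interior (triangle p q c) \<inter> interior (triangle p q t) ~= {}"
proof -
 have nz: "cross p q c ~= 0" "cross p q t ~= 0" using assms by auto
 define g where "g = cross p q c / cross p q t"
 have "0 < g" using assms by (simp add: g_def zero_less_mult_iff zero_less_divide_iff)
 obtain a b where c: "c = a *\<^sub>R p + b *\<^sub>R q + g *\<^sub>R t" "a + b + g = 1"
  unfolding g_def using affine_coordinates[OF nz(2)] .
 \<comment> \<open>With this choice \<open>e\<close>, \<open>e * |a|\<close> and
   \<open>e * |b|\<close> add up to one quarter, so that \<open>(1 - e) / 2 + e * a\<close> and
   \<open>(1 - e) / 2 + e * b\<close> stay positive.\<close>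
 define e where "e = 1 / (4 * (1 + \<bar>a\<bar> + \<bar>b\<bar>))"
 have e: "0 < e" "e * (4 * (1 + \<bar>a\<bar> + \<bar>b\<bar>)) = 1" by (auto simp: e_def)
 then have e': "4 * e + 4 * (e * \<bar>a\<bar>) + 4 * (e * \<bar>b\<bar>) = 1" by (simp add: algebra_simps)
 have ab: "0 <= e * \<bar>a\<bar>" "0 <= e * \<bar>b\<bar>" "- (e * \<bar>a\<bar>) <= e * a" "- (e * \<bar>b\<bar>) <= e * b"
 proof -
  have "e * (- \<bar>a\<bar>) <= e * a" "e * (- \<bar>b\<bar>) <= e * b"
   by (intro mult_left_mono; use e(1) in simp)+
  then show "- (e * \<bar>a\<bar>) <= e * a" "- (e * \<bar>b\<bar>) <= e * b" by simp_all
 qed (use e(1) in simp_all)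
 define z where "z = ((1 - e) / 2) *\<^sub>R p + ((1 - e) / 2) *\<^sub>R q + e *\<^sub>R c"
 have "z \<in> interior (triangle p q c)"
  unfolding z_def
 proof (rule interior_triangle_I)
  have "e < 1" using e(1) e' ab(1,2) by linarith
  then show "0 < (1 - e) / 2" "0 < (1 - e) / 2" by simp_all
 qed (use nz e(1) in \<open>auto simp: field_simps\<close>)
 moreover have "z = ((1 - e) / 2 + e * a) *\<^sub>R p + ((1 - e) / 2 + e * b) *\<^sub>R q + (e * g) *\<^sub>R t"
  unfolding z_def c(1) by (simp add: algebra_simps)
 moreover have "\<dots> \<in> interior (triangle p q t)"
 proof (rule interior_triangle_I)
  show "0 < e * g" using e \<open>0 < g\<close> by simp
  have "e * a + e * b + e * g = e" using c(2) by (simp flip: distrib_left)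
  then show "(1 - e) / 2 + e * a + ((1 - e) / 2 + e * b) + e * g = 1" by simp
  have gen: "0 < (1 - e) / 2 + x" if "- A <= x" "4 * e + 4 * A + 4 * B = 1" "0 <= A" "0 <= B" for x A B
   using that e(1) by (simp add: field_simps)
  show "0 < (1 - e) / 2 + e * a" by (rule gen[OF ab(3) e' ab(1,2)])
  show "0 < (1 - e) / 2 + e * b" by (rule gen[OF ab(4) _ ab(2,1)]) (use e' in simp)
 qed (use nz in auto)
 ultimately show ?thesis by auto
qed

text \<open>The triangle inequality from \<open>p\<close> and from \<open>q\<close> bounds the sum
  by \<open>(a + b) * dist p q\<close> plus \<open>g\<close> times the sum at \<open>c\<close>; as
  \<open>a + b\<close> is positive, the strict inequality at \<open>c\<close> makes the result
  strict. This is the geometric reason for sorting triangles on a base by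
  \<open>la + lb\<close>.\<close>

lemma interior_triangle_perimeter:
 assumes "x \<in> interior (triangle p q c)" "dist p q < dist p c + dist q c"
 shows "dist p x + dist q x < dist p c + dist q c"
proof -
 obtain a b g where h: "0 < a" "0 < b" "0 < g" "a + b + g = 1" "x = a *\<^sub>R p + b *\<^sub>R q + g *\<^sub>R c"
  using interior_triangle_E[OF assms(1)] .
 have a: "a = 1 - b - g" using h(4) by simp
 have "p - x = b *\<^sub>R (p - q) + g *\<^sub>R (p - c)"
  unfolding h(5) a by (simp add: algebra_simps)
 then have "dist p x <= b * dist p q + g * dist p c"
  using norm_triangle_ineq[of "b *\<^sub>R (p - q)" "g *\<^sub>R (p - c)"] h by (simp add: dist_norm)
 moreover have b: "b = 1 - a - g" using h(4) by simp
 have "q - x = a *\<^sub>R (q - p) + g *\<^sub>R (q - c)"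
  unfolding h(5) b by (simp add: algebra_simps)
 then have "dist q x <= a * dist p q + g * dist q c"
  using norm_triangle_ineq[of "a *\<^sub>R (q - p)" "g *\<^sub>R (q - c)"] h by (simp add: dist_norm norm_minus_commute)
 moreover have "(a + b) * dist p q < (a + b) * (dist p c + dist q c)"
  using assms(2) h by simp
 ultimately have "dist p x + dist q x < (a + b) * (dist p c + dist q c) + g * (dist p c + dist q c)"
  by (simp add: algebra_simps)
 also have "\<dots> = dist p c + dist q c"
  using h(4) by (simp flip: distrib_right)
 finally show ?thesis .
qed

text \<open>The distance to a convex combination is at most that combination of the distances to the
  corners. Each of these is below \<open>d\<close>, because \<open>x\<close> puts positive weight on
  the corner itself. It will exclude an edge of maximal length from starting inside a triangle and
  ending in it.\<close>

lemma interior_triangle_dist: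
 assumes "x \<in> interior (triangle p q c)" "y \<in> triangle p q c"
  and d: "dist p q <= d" "dist p c <= d" "dist q c <= d" "0 < d"
 shows "dist x y < d"
proof -
 obtain a b g where h: "0 < a" "0 < b" "0 < g" "a + b + g = 1" "x = a *\<^sub>R p + b *\<^sub>R q + g *\<^sub>R c"
  using interior_triangle_E[OF assms(1)] .
 have corner: "dist x (u :: point) < d"
  if "x = k *\<^sub>R u + l *\<^sub>R v + m *\<^sub>R w" "dist u v <= d" "dist u w <= d" "0 < k" "0 < l" "0 < m" "k + l + m = 1"
  for u v w k l m
 proof -
  have k: "k = 1 - l - m" using that by simp
  have "x - u = l *\<^sub>R (v - u) + m *\<^sub>R (w - u)"
   unfolding that(1) k by (simp add: algebra_simps)
  then have "dist x u <= l * dist u v + m * dist u w"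
   using norm_triangle_ineq[of "l *\<^sub>R (v - u)" "m *\<^sub>R (w - u)"] that by (simp add: dist_norm norm_minus_commute)
  also have "\<dots> <= l * d + m * d"
   using that by (intro add_mono mult_left_mono) auto
  also have "\<dots> = (l + m) * d" by (simp add: distrib_right)
  also have "\<dots> < 1 * d"
   using that d(4) by (intro mult_strict_right_mono) auto
  finally show ?thesis by simp
 qed
 have x: "dist x p < d" "dist x q < d" "dist x c < d"
  using corner[of a p b q g c] corner[of b q a p g c] corner[of g c a p b q] h d
  by (auto simp: dist_commute algebra_simps)
 obtain k l m where y: "0 <= k" "0 <= l" "0 <= m" "k + l + m = 1" "y = k *\<^sub>R p + l *\<^sub>R q + m *\<^sub>R c"
  using assms(2) unfolding convex_hull_3 by auto
 define e where "e = max (dist x p) (max (dist x q) (dist x c))"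
 have "x - y = k *\<^sub>R (x - p) + l *\<^sub>R (x - q) + m *\<^sub>R (x - c)"
 proof -
  have "x = (k + l + m) *\<^sub>R x" using y by simp
  then show ?thesis unfolding y(5) by (simp add: algebra_simps)
 qed
 then have "dist x y <= k * dist x p + l * dist x q + m * dist x c"
  using norm_triangle_ineq[of "k *\<^sub>R (x - p) + l *\<^sub>R (x - q)" "m *\<^sub>R (x - c)"]
   norm_triangle_ineq[of "k *\<^sub>R (x - p)" "l *\<^sub>R (x - q)"] y by (simp add: dist_norm)
 also have "\<dots> <= k * e + l * e + m * e"
  using y by (intro add_mono mult_left_mono) (auto simp: e_def)
 also have "\<dots> = e"
  using y(4) by (simp flip: distrib_right)
 also have "e < d" using x by (simp add: e_def)
 finally show ?thesis .
qed

lemma segment_leaves_interior: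
 fixes x y :: "'a :: euclidean_space"
 assumes "x \<in> interior T" "y ~: interior T"
 obtains z where "z \<in> closed_segment x y" "z \<in> frontier T"
proof -
 have "closed_segment x y \<inter> frontier (interior T) ~= {}"
  by (rule connected_Int_frontier) (use assms in \<open>auto simp del: interior_interior\<close>)
 moreover have "frontier (interior T) \<subseteq> frontier T"
  by (auto simp: frontier_def intro: subsetD[OF closure_mono[OF interior_subset]])
 ultimately show ?thesis using that by blast
qed

lemma closed_segment_antisym:
 assumes "y \<in> closed_segment x z" "z \<in> closed_segment x y"
 shows "y = (z :: 'a :: euclidean_space)"
 using assms by (metis between_antisym between_commute between_mem_segment)

text \<open>From an interior point \<open>z\<close> of the segment the way back to \<open>x\<close>
  must cross the frontier, and the only frontier point available is the far end \<open>y\<close>;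
  being on both sides of each other, \<open>y\<close> and \<open>z\<close> coincide. One end is
  allowed on the frontier because edges may end in a corner.\<close>

lemma chord_avoids_interior:
 fixes x y :: "'a :: euclidean_space"
 assumes "x ~: interior T" "y ~: interior T"
  and fr: "closed_segment x y \<inter> frontier T \<subseteq> {y}"
 shows "closed_segment x y \<inter> interior T = {}"
proof (rule ccontr)
 assume "closed_segment x y \<inter> interior T ~= {}"
 then obtain z where z: "z \<in> closed_segment x y" "z \<in> interior T" by blast
 obtain u where u: "u \<in> closed_segment z x" "u \<in> frontier T"
  using segment_leaves_interior[OF z(2) assms(1)] .
 have "closed_segment z x \<subseteq> closed_segment x y"
  using z(1) by (simp add: subset_closed_segment)
 then have "u = y" using u fr by blast
 then have "y \<in> closed_segment x z" using u by (simp add: closed_segment_commute)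
 then have "y = z" using closed_segment_antisym z(1) by blast
 then show False using z assms by simp
qed

text \<open>If \<open>t\<close> is not inside, the sides of \<open>p q t\<close> avoid the interior
  of \<open>p q c\<close>. That interior is connected, meets the triangle \<open>p q t\<close> and
  misses its frontier, so it is contained in it; taking closures brings \<open>c\<close>
  along.\<close>

lemma nested_triangles:
 fixes p q c t :: point
 assumes meet: "interior (triangle p q c) \<inter> interior (triangle p q t) ~= {}"
  and pt: "closed_segment p t \<inter> frontier (triangle p q c) \<subseteq> {p}"
  and qt: "closed_segment q t \<inter> frontier (triangle p q c) \<subseteq> {q}"
  and "c ~: frontier (triangle p q t)" and "t ~: frontier (triangle p q c)"
 shows "t \<in> interior (triangle p q c) | c \<in> interior (triangle p q t)"
proof (rule ccontr)
 assume neg: "\<not> ?thesis"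
 let ?T = "interior (triangle p q c)"
 have corners: "{p, q, c} \<subseteq> frontier (triangle p q c)"
  by (auto simp: frontier_triangle)
 then have out: "p ~: ?T" "q ~: ?T"
  by (auto simp: frontier_def)
 have "closed_segment t p \<inter> ?T = {}"
  by (rule chord_avoids_interior) (use pt out neg in \<open>auto simp: closed_segment_commute\<close>)
 moreover have "closed_segment t q \<inter> ?T = {}"
  by (rule chord_avoids_interior) (use qt out neg in \<open>auto simp: closed_segment_commute\<close>)
 moreover have "closed_segment p q \<inter> ?T = {}"
  using frontier_triangle[of p q c] by (auto simp: frontier_def)
 ultimately have "?T \<inter> frontier (triangle p q t) = {}"
  by (auto simp: frontier_triangle[of p q t] closed_segment_commute)
 moreover have "connected ?T"
  by (intro convex_connected convex_interior convex_convex_hull)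
 ultimately have "?T \<subseteq> triangle p q t"
  using connected_Int_frontier[of ?T "triangle p q t"] meet interior_subset by blast
 then have "closure ?T \<subseteq> triangle p q t"
  by (intro closure_minimal) (auto intro: compact_imp_closed finite_imp_compact_convex_hull)
 moreover have "closure ?T = triangle p q c"
 proof -
  have "?T ~= {}" using meet by auto
  then have "closure ?T = closure (triangle p q c)"
   by (simp add: convex_closure_interior)
  also have "\<dots> = triangle p q c"
   by (intro closure_closed compact_imp_closed finite_imp_compact_convex_hull) auto
  finally show ?thesis .
 qed
 ultimately have "c \<in> triangle p q t"
  using hull_inc[of c "{p, q, c}" convex] by auto
 then have "c \<in> interior (triangle p q t) \<union> frontier (triangle p q t)"
  using closure_subset[of "triangle p q t"] by (auto simp: frontier_def)
 then show False using neg assms by auto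
qed

section \<open>Segment tests by polynomial inequalities\<close>

lemma on_segment_iff:
 "z \<in> closed_segment p q \<longleftrightarrow> cross p q z = 0 &
   (fst p - fst z) * (fst q - fst z) + (snd p - snd z) * (snd q - snd z) <= 0"
proof
 assume "z \<in> closed_segment p q"
 then obtain u where u: "0 <= u" "u <= 1" "z = (1 - u) *\<^sub>R p + u *\<^sub>R q"
  by (auto simp: in_segment)
 have "(fst p - fst z) * (fst q - fst z) + (snd p - snd z) * (snd q - snd z) =
   - (u * (1 - u) * ((fst q - fst p)\<^sup>2 + (snd q - snd p)\<^sup>2))"
  unfolding u(3) by (simp add: algebra_simps power2_eq_square)
 also have "\<dots> <= 0" using u by simp
 finally show "cross p q z = 0 &
   (fst p - fst z) * (fst q - fst z) + (snd p - snd z) * (snd q - snd z) <= 0"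
  using \<open>z \<in> closed_segment p q\<close> cross_closed_segment by blast
next
 assume h: "cross p q z = 0 &
   (fst p - fst z) * (fst q - fst z) + (snd p - snd z) * (snd q - snd z) <= 0"
 define d1 d2 e1 e2 where "d1 = fst q - fst p" and "d2 = snd q - snd p" and "e1 = fst z - fst p"
  and "e2 = snd z - snd p"
 have c: "d1 * e2 = d2 * e1" using h by (simp add: cross_def d1_def d2_def e1_def e2_def)
 have e: "e1 * e1 + e2 * e2 <= e1 * d1 + e2 * d2"
  using h by (simp add: d1_def d2_def e1_def e2_def algebra_simps)
 show "z \<in> closed_segment p q"
 proof (cases "p = q")
  case True
  then have "e1 * e1 + e2 * e2 <= 0" using e by (simp add: d1_def d2_def)
  then have "e1 = 0" "e2 = 0" by (simp_all add: sum_squares_le_zero_iff)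
  then have "z = p" by (simp add: e1_def e2_def prod_eq_iff)
  then show ?thesis by simp
 next
  case False
  define n where "n = d1 * d1 + d2 * d2"
  have n: "0 < n"
   using False by (auto simp: n_def sum_squares_gt_zero_iff d1_def d2_def prod_eq_iff)
  \<comment> \<open>\<open>u\<close> is the parameter of the orthogonal projection of
    \<open>z\<close> to the line. Collinearity makes the projection exact, and the condition on the
    scalar product becomes \<open>u * u <= u\<close>.\<close>
  define u where "u = (e1 * d1 + e2 * d2) / n"
  have un: "u * n = e1 * d1 + e2 * d2" using n by (simp add: u_def)
  have "e1 * n = (u * d1) * n"
  proof -
   have "(u * d1) * n = (e1 * d1 + e2 * d2) * d1" using un by (simp add: mult.assoc mult.commute mult.left_commute)
   also have "\<dots> = e1 * d1 * d1 + d2 * (d1 * e2)" by (simp add: algebra_simps)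
   also have "\<dots> = e1 * n" unfolding c by (simp add: n_def algebra_simps)
   finally show ?thesis by (rule sym)
  qed
  then have e1: "e1 = u * d1" using n by (metis mult_right_cancel less_irrefl)
  have "e2 * n = (u * d2) * n"
  proof -
   have "(u * d2) * n = (e1 * d1 + e2 * d2) * d2" using un by (simp add: mult.assoc mult.commute mult.left_commute)
   also have "\<dots> = d1 * (d2 * e1) + e2 * d2 * d2" by (simp add: algebra_simps)
   also have "\<dots> = e2 * n" unfolding c[symmetric] by (simp add: n_def algebra_simps)
   finally show ?thesis by (rule sym)
  qed
  then have e2: "e2 = u * d2" using n by (metis mult_right_cancel less_irrefl)
  have "u * u * n <= u * n"
   using e unfolding e1 e2 n_def by (simp add: algebra_simps)
  then have uu: "u * u <= u" by (rule mult_right_le_imp_le[OF _ n])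
  then have "0 <= u" using zero_le_square[of u] by linarith
  moreover have "u <= 1"
  proof (rule ccontr)
   assume "\<not> u <= 1"
   then have "1 * u < u * u" by (intro mult_strict_right_mono) auto
   with uu show False by simp
  qed
  moreover have "z = (1 - u) *\<^sub>R p + u *\<^sub>R q"
   using e1 e2 by (auto simp: prod_eq_iff d1_def d2_def e1_def e2_def algebra_simps)
  ultimately show ?thesis by (auto simp: in_segment)
 qed
qed

lemma cross_zero_parameter:
 assumes "cross p q z = 0" "p ~= q"
 obtains s where "z = (1 - s) *\<^sub>R p + s *\<^sub>R q"
proof (cases "fst q = fst p")
 case True
 then have "snd q ~= snd p" "fst z = fst p" using assms by (auto simp: cross_def prod_eq_iff)
 define s where "s = (snd z - snd p) / (snd q - snd p)"
 have s: "s * (snd q - snd p) = snd z - snd p" using \<open>snd q ~= snd p\<close> by (simp add: s_def)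
 show ?thesis using s True \<open>fst z = fst p\<close>
  by (intro that[of s]) (auto simp: prod_eq_iff algebra_simps)
next
 case False
 define s where "s = (fst z - fst p) / (fst q - fst p)"
 have s: "s * (fst q - fst p) = fst z - fst p" using False by (simp add: s_def)
 have "(fst q - fst p) * (snd z - snd p) = (snd q - snd p) * (fst z - fst p)"
  using assms(1) by (simp add: cross_def)
 then have "(fst q - fst p) * (snd z - snd p) = (fst q - fst p) * (s * (snd q - snd p))"
  unfolding s[symmetric] by (simp only: mult_ac)
 then have "snd z - snd p = s * (snd q - snd p)" using False by simp
 then show ?thesis using s
  by (intro that[of s]) (auto simp: prod_eq_iff algebra_simps)
qed

text \<open>The sign test that the program applies to pairs of edges. The hypotheses are secured by
  the separate test for vertices on edges; under them a common point is strictly inside both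
  segments, where strict signs are exact.\<close>

lemma segments_cross_iff:
 assumes "x ~: closed_segment p q" "y ~: closed_segment p q" "p ~: closed_segment x y" "q ~: closed_segment x y"
 shows "closed_segment p q \<inter> closed_segment x y ~= {} \<longleftrightarrow>
  cross p q x * cross p q y < 0 & cross x y p * cross x y q < 0"
proof
 assume "closed_segment p q \<inter> closed_segment x y ~= {}"
 then obtain z u v where z: "z = (1 - u) *\<^sub>R p + u *\<^sub>R q" "0 <= u" "u <= 1"
  "z = (1 - v) *\<^sub>R x + v *\<^sub>R y" "0 <= v" "v <= 1"
  by (fastforce simp: in_segment)
 have half: "cross p q x * cross p q y < 0"
  if z: "z = (1 - u) *\<^sub>R p + u *\<^sub>R q" "0 <= u" "u <= 1" "z = (1 - v) *\<^sub>R x + v *\<^sub>R y" "0 <= v" "v <= 1"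
   and out: "x ~: closed_segment p q" "y ~: closed_segment p q" "p ~: closed_segment x y" "q ~: closed_segment x y"
  for p q x y z :: point and u v
 proof -
  have "z \<in> closed_segment p q" "z \<in> closed_segment x y" using z by (auto simp: in_segment)
  have v: "0 < v" "v < 1"
   using z out \<open>z \<in> closed_segment p q\<close> by (auto simp: order.order_iff_strict)
  have "cross p q z = 0" using \<open>z \<in> closed_segment p q\<close> by (rule cross_closed_segment)
  then have eq: "(1 - v) * cross p q x + v * cross p q y = 0" by (simp add: z(4) cross_segment)
  \<comment> \<open>Otherwise both \<open>x\<close> and \<open>y\<close> lie on the line of
    \<open>p q\<close>, outside the segment. If they are on the same side of it, the two segments
    have no common point; if on different sides, \<open>p\<close> lies between them.\<close>
  have "cross p q x ~= 0"
  proof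
   assume "cross p q x = 0"
   with eq v have "cross p q y = 0" by simp
   have "p ~= q" using \<open>z \<in> closed_segment p q\<close> \<open>z \<in> closed_segment x y\<close> out by auto
   obtain s where s: "x = (1 - s) *\<^sub>R p + s *\<^sub>R q" using cross_zero_parameter \<open>cross p q x = 0\<close> \<open>p ~= q\<close> by blast
   obtain r where r: "y = (1 - r) *\<^sub>R p + r *\<^sub>R q" using cross_zero_parameter \<open>cross p q y = 0\<close> \<open>p ~= q\<close> by blast
   have "\<not> (0 <= s & s <= 1)" using s out(1) unfolding in_segment by blast
   then have sr: "s < 0 | 1 < s" by linarith
   have "\<not> (0 <= r & r <= 1)" using r out(2) unfolding in_segment by blast
   then have rr: "r < 0 | 1 < r" by linarith
   have "(1 - u) *\<^sub>R p + u *\<^sub>R q = (1 - ((1 - v) * s + v * r)) *\<^sub>R p + ((1 - v) * s + v * r) *\<^sub>R q"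
    using z(1,4) unfolding s r by (simp add: algebra_simps)
   then have "(u - ((1 - v) * s + v * r)) *\<^sub>R (q - p) = 0" by (simp add: algebra_simps)
   then have u: "u = (1 - v) * s + v * r" using \<open>p ~= q\<close> by simp
   have pxy: "p = (1 - w) *\<^sub>R x + w *\<^sub>R y" if "(1 - w) * s + w * r = 0" for w
   proof -
    have "(1 - w) *\<^sub>R x + w *\<^sub>R y = p + ((1 - w) * s + w * r) *\<^sub>R (q - p)"
     unfolding s r by (simp add: algebra_simps)
    then show ?thesis using that by simp
   qed
   consider "s < 0" "r < 0" | "1 < s" "1 < r" | "s < 0" "1 < r" | "1 < s" "r < 0" using sr rr by blast
   then show False
   proof cases
    case 1
    then have "(1 - v) * s < 0" "v * r < 0" using v by (simp_all add: mult_pos_neg)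
    then show False using u z by simp
   next
    case 2
    then have "(1 - v) * 1 < (1 - v) * s" "v * 1 < v * r" using v by simp_all
    then show False using u z by simp
   next
    case 3
    then have "0 <= s / (s - r)" "s / (s - r) <= 1" by (auto simp: field_simps)
    moreover have "(1 - s / (s - r)) * s + s / (s - r) * r = 0" using 3 by (simp add: field_simps)
    ultimately show False using pxy[of "s / (s - r)"] out(3) unfolding in_segment by blast
   next
    case 4
    then have "0 <= s / (s - r)" "s / (s - r) <= 1" by (auto simp: field_simps)
    moreover have "(1 - s / (s - r)) * s + s / (s - r) * r = 0" using 4 by (simp add: field_simps)
    ultimately show False using pxy[of "s / (s - r)"] out(3) unfolding in_segment by blast
   qed
  qed
  moreover have "v * (cross p q x * cross p q y) = - ((1 - v) * (cross p q x)\<^sup>2)"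
  proof -
   have "v * cross p q y = - ((1 - v) * cross p q x)" using eq by linarith
   then have "cross p q x * (v * cross p q y) = cross p q x * - ((1 - v) * cross p q x)" by simp
   then show ?thesis by (simp add: power2_eq_square mult_ac)
  qed
  ultimately have "v * (cross p q x * cross p q y) < 0" using v by simp
  then show ?thesis using v by (simp add: mult_less_0_iff)
 qed
 show "cross p q x * cross p q y < 0 & cross x y p * cross x y q < 0"
  using half[OF z assms] half[OF z(4,5,6,1,2,3) assms(3,4,1,2)] by blast
next
 assume h: "cross p q x * cross p q y < 0 & cross x y p * cross x y q < 0"
 have between: "0 <= X / (X - Y) & X / (X - Y) <= 1 & X - Y ~= 0" if "X * Y < 0" for X Y :: real
  using that by (auto simp: mult_less_0_iff field_simps)
 \<comment> \<open>The parameter at which the affine function \<open>cross p q\<close> vanishes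
   between its values of opposite sign at \<open>x\<close> and \<open>y\<close>.\<close>
 define v where "v = cross p q x / (cross p q x - cross p q y)"
 define z where "z = (1 - v) *\<^sub>R x + v *\<^sub>R y"
 have v: "0 <= v" "v <= 1" "cross p q x - cross p q y ~= 0" using between h by (auto simp: v_def)
 then have "v * (cross p q x - cross p q y) = cross p q x" by (simp add: v_def)
 moreover have "cross p q z = (1 - v) * cross p q x + v * cross p q y"
  unfolding z_def by (rule cross_segment)
 ultimately have "cross p q z = 0" by (simp add: algebra_simps)
 moreover have "p ~= q" using h by auto
 ultimately obtain s where s: "z = (1 - s) *\<^sub>R p + s *\<^sub>R q" using cross_zero_parameter by blast
 have "cross x y z = (1 - v) * cross x y x + v * cross x y y"
  unfolding z_def by (rule cross_segment)
 moreover have "cross x y z = (1 - s) * cross x y p + s * cross x y q"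
  unfolding s by (rule cross_segment)
 ultimately have "s * (cross x y p - cross x y q) = cross x y p" by (simp add: algebra_simps)
 then have "s = cross x y p / (cross x y p - cross x y q)"
  using between h by (metis nonzero_mult_div_cancel_right)
 then have "z \<in> closed_segment p q" using between h s by (auto simp: in_segment)
 moreover have "z \<in> closed_segment x y" using v by (auto simp: in_segment z_def)
 ultimately show "closed_segment p q \<inter> closed_segment x y ~= {}" by blast
qed

section \<open>Third corners of triangles and rigid motions\<close>

definition sqdist :: "point => point => real" where
 "sqdist p q = (fst q - fst p) * (fst q - fst p) + (snd q - snd p) * (snd q - snd p)"

text \<open>By the law of cosines, the position of the foot of the altitude along the base, in units
  of the base, where \<open>c\<close> is the square of the base length.\<close>

definition foot :: "real => real => real => real" where
 "foot a b c = (a * a - b * b + c) / (2 * c)"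

text \<open>The squared altitude in units of the base. For \<open>0 < c\<close> and nonnegative
  \<open>a\<close>, \<open>b\<close> its positivity says precisely that the three lengths form a
  nondegenerate triangle.\<close>

definition discr :: "real => real => real => real" where
 "discr a b c = a * a / c - foot a b c * foot a b c"

text \<open>The third corner of a triangle on the side \<open>p q\<close>, from its distances \<open>a\<close> and \<open>b\<close> to \<open>p\<close> and \<open>q\<close>.\<close>

definition apex :: "real => real => bool => point => point => point" where
 "apex a b s p q =
   (let x = foot a b (sqdist p q); y = sqrt (discr a b (sqdist p q)); y' = (if s then - y else y) in
   (fst p + x * (fst q - fst p) - y' * (snd q - snd p),
    snd p + x * (snd q - snd p) + y' * (fst q - fst p)))"

lemma sqdist_dist: "sqdist p q = (dist p q)\<^sup>2"
 by (simp add: sqdist_def dist_prod_def dist_real_def power2_commute flip: power2_eq_square)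

lemma sqdist_pos: "p ~= q ==> 0 < sqdist p q"
 by (simp add: sqdist_dist)

lemma frame_coordinates:
 fixes z :: point
 assumes "sqdist p q ~= 0"
 defines "X \<equiv> ((fst z - fst p) * (fst q - fst p) + (snd z - snd p) * (snd q - snd p)) / sqdist p q"
  and "Y \<equiv> cross p q z / sqdist p q"
 shows "z = (fst p + X * (fst q - fst p) - Y * (snd q - snd p), snd p + X * (snd q - snd p) + Y * (fst q - fst p))"
proof -
 have X: "X * sqdist p q = (fst z - fst p) * (fst q - fst p) + (snd z - snd p) * (snd q - snd p)"
  and Y: "Y * sqdist p q = cross p q z"
  using assms(1) by (simp_all add: X_def Y_def)
 have "fst z * sqdist p q = fst p * sqdist p q + (X * sqdist p q) * (fst q - fst p) - (Y * sqdist p q) * (snd q - snd p)"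
  unfolding X Y by (simp add: sqdist_def cross_def algebra_simps)
 then have "fst z * sqdist p q = (fst p + X * (fst q - fst p) - Y * (snd q - snd p)) * sqdist p q"
  by (simp add: algebra_simps)
 then have 1: "fst z = fst p + X * (fst q - fst p) - Y * (snd q - snd p)"
  using assms(1) mult_right_cancel by blast
 have "snd z * sqdist p q = snd p * sqdist p q + (X * sqdist p q) * (snd q - snd p) + (Y * sqdist p q) * (fst q - fst p)"
  unfolding X Y by (simp add: sqdist_def cross_def algebra_simps)
 then have "snd z * sqdist p q = (snd p + X * (snd q - snd p) + Y * (fst q - fst p)) * sqdist p q"
  by (simp add: algebra_simps)
 then have 2: "snd z = snd p + X * (snd q - snd p) + Y * (fst q - fst p)"
  using assms(1) mult_right_cancel by blast
 show ?thesis using 1 2 by (simp add: prod_eq_iff)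
qed

lemma sqdist_frame:
 fixes X Y :: real and p q :: point
 defines "z \<equiv> (fst p + X * (fst q - fst p) - Y * (snd q - snd p), snd p + X * (snd q - snd p) + Y * (fst q - fst p))"
 shows "sqdist p z = (X * X + Y * Y) * sqdist p q" "sqdist q z = ((X - 1) * (X - 1) + Y * Y) * sqdist p q"
  "cross p q z = Y * sqdist p q"
 by (simp_all add: z_def sqdist_def cross_def algebra_simps)

lemma apex_correct:
 assumes "p ~= q" "0 < discr a b (sqdist p q)" "0 <= a" "0 <= b"
 shows "dist p (apex a b s p q) = a" "dist q (apex a b s p q) = b"
  "cross p q (apex a b s p q) = (if s then - 1 else 1) * sqrt (discr a b (sqdist p q)) * sqdist p q"
proof -
 define c where "c = sqdist p q"
 have c: "0 < c" using assms(1) by (simp add: c_def sqdist_pos)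
 define x where "x = foot a b c"
 define y where "y = (if s then - sqrt (discr a b c) else sqrt (discr a b c))"
 have apex: "apex a b s p q = (fst p + x * (fst q - fst p) - y * (snd q - snd p), snd p + x * (snd q - snd p) + y * (fst q - fst p))"
  by (simp add: apex_def x_def y_def c_def Let_def)
 have y: "y * y = discr a b c" using assms(2) by (simp add: y_def c_def)
 have xy: "(x * x + y * y) * c = a * a"
  unfolding y discr_def x_def[symmetric] using c by (simp add: field_simps)
 have "x * (2 * c) = a * a - b * b + c" using c by (simp add: x_def foot_def)
 then have "((x - 1) * (x - 1) + y * y) * c = b * b"
  using xy by (simp add: algebra_simps)
 then have "sqdist p (apex a b s p q) = a\<^sup>2" "sqdist q (apex a b s p q) = b\<^sup>2"
  using xy unfolding apex sqdist_frame c_def by (simp_all add: power2_eq_square)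
 then show "dist p (apex a b s p q) = a" "dist q (apex a b s p q) = b"
  using assms(3,4) by (simp_all add: sqdist_dist)
 show "cross p q (apex a b s p q) = (if s then - 1 else 1) * sqrt (discr a b (sqdist p q)) * sqdist p q"
  unfolding apex sqdist_frame by (simp add: y_def c_def)
qed

text \<open>In the orthogonal frame of \<open>q - p\<close> and its quarter turn, the two distances
  determine the first coordinate and the square of the second, and the side of the base determines
  the remaining sign. \<open>True\<close> stands for the negative side.\<close>

lemma apex_unique:
 assumes "p ~= q" "cross p q z ~= 0"
 shows "z = apex (dist p z) (dist q z) (cross p q z < 0) p q"
  and "0 < discr (dist p z) (dist q z) (sqdist p q)"
proof -
 define c where "c = sqdist p q"
 have c: "0 < c" using assms(1) by (simp add: c_def sqdist_pos)
 define X where "X = ((fst z - fst p) * (fst q - fst p) + (snd z - snd p) * (snd q - snd p)) / c"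
 define Y where "Y = cross p q z / c"
 have z: "z = (fst p + X * (fst q - fst p) - Y * (snd q - snd p), snd p + X * (snd q - snd p) + Y * (fst q - fst p))"
  unfolding X_def Y_def c_def using c by (intro frame_coordinates) (simp add: c_def)
 have a: "dist p z * dist p z = (X * X + Y * Y) * c"
  and b: "dist q z * dist q z = ((X - 1) * (X - 1) + Y * Y) * c"
  using sqdist_frame(1,2)[where p=p and q=q and X=X and Y=Y] unfolding z[symmetric] c_def sqdist_dist by (simp_all add: power2_eq_square)
 have ft: "foot (dist p z) (dist q z) c = X"
  unfolding foot_def a b using c by (simp add: field_simps)
 then have d: "discr (dist p z) (dist q z) c = Y * Y"
  unfolding discr_def a using c by (simp add: field_simps)
 have "Y ~= 0" using assms c by (simp add: Y_def)
 then show "0 < discr (dist p z) (dist q z) (sqdist p q)"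
  using d by (simp add: c_def) (metis not_real_square_gt_zero)
 have sg: "(if cross p q z < 0 then - sqrt (Y * Y) else sqrt (Y * Y)) = Y"
 proof -
  have "cross p q z < 0 \<longleftrightarrow> Y < 0" using c by (simp add: Y_def divide_less_0_iff)
  then show ?thesis by simp
 qed
 show "z = apex (dist p z) (dist q z) (cross p q z < 0) p q"
  unfolding apex_def Let_def c_def[symmetric] ft d sg by (rule z)
qed

lemma strict_triangle_inequality:
 assumes "cross p q z ~= 0"
 shows "dist p q < dist p z + dist q z"
proof -
 have "\<not> between (p, q) z"
  using assms cross_closed_segment[of z p q] by (auto simp: between_mem_segment)
 then have "dist p q ~= dist p z + dist z q" by (simp add: between)
 then show ?thesis using dist_triangle[of p q z] by (simp add: dist_commute)
qed

lemma collinear_between: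
 assumes "cross p q z = 0"
 shows "z \<in> closed_segment p q | p \<in> closed_segment q z | q \<in> closed_segment p z"
proof (cases "p = q")
 case False
 then obtain s where s: "z = (1 - s) *\<^sub>R p + s *\<^sub>R q" using cross_zero_parameter assms by blast
 consider "s < 0" | "0 <= s" "s <= 1" | "1 < s" by linarith
 then show ?thesis
 proof cases
  case 1
  define w where "w = 1 / (1 - s)"
  have w: "0 <= w" "w <= 1" "w * (1 - s) = 1" using 1 by (auto simp: w_def)
  have "(1 - w) *\<^sub>R q + w *\<^sub>R z = (w * (1 - s)) *\<^sub>R p + (1 - w * (1 - s)) *\<^sub>R q"
   unfolding s by (simp add: algebra_simps)
  then have "p = (1 - w) *\<^sub>R q + w *\<^sub>R z" using w by simp
  then show ?thesis using w by (auto simp: in_segment)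
 next
  case 3
  define w where "w = 1 / s"
  have w: "0 <= w" "w <= 1" "w * s = 1" using 3 by (auto simp: w_def)
  have "(1 - w) *\<^sub>R p + w *\<^sub>R z = (1 - w * s) *\<^sub>R p + (w * s) *\<^sub>R q"
   unfolding s by (simp add: algebra_simps)
  then have "q = (1 - w) *\<^sub>R p + w *\<^sub>R z" using w by simp
  then show ?thesis using w by (auto simp: in_segment)
 qed (use s in \<open>auto simp: in_segment\<close>)
qed simp

text \<open>A second common point puts both segments on one ray from \<open>p\<close>. The segment
  on which that point has the larger parameter is the shorter one, so its end lies on the
  other.\<close>

lemma closed_segments_share_endpoint:
 fixes p q r :: point
 assumes "q ~: closed_segment p r" "r ~: closed_segment p q"
 shows "closed_segment p q \<inter> closed_segment p r \<subseteq> {p}"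
proof
 fix z assume "z \<in> closed_segment p q \<inter> closed_segment p r"
 then obtain u v where z: "z = (1 - u) *\<^sub>R p + u *\<^sub>R q" "0 <= u" "u <= 1"
  "z = (1 - v) *\<^sub>R p + v *\<^sub>R r" "0 <= v" "v <= 1"
  by (fastforce simp: in_segment)
 have claim: "b \<in> closed_segment p a"
  if "(1 - u) *\<^sub>R p + u *\<^sub>R a = (1 - v) *\<^sub>R p + v *\<^sub>R b" "0 <= u" "u <= v" "0 < v" for a b :: point and u v
 proof -
  have "v *\<^sub>R (b - p) = u *\<^sub>R (a - p)" using that by (simp add: algebra_simps)
  then have "(1 / v) *\<^sub>R (v *\<^sub>R (b - p)) = (u / v) *\<^sub>R (a - p)" by simp
  then have "b - p = (u / v) *\<^sub>R (a - p)" using \<open>0 < v\<close> by simp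
  then have "b = (1 - u / v) *\<^sub>R p + (u / v) *\<^sub>R a" by (simp add: algebra_simps)
  moreover have "0 <= u / v" "u / v <= 1" using that by auto
  ultimately show ?thesis by (auto simp: in_segment)
 qed
 have "\<not> (0 < v & u <= v)" using claim[of u q v r] z assms by auto
 moreover have "\<not> (0 < u & v <= u)" using claim[of v r u q] z assms by auto
 ultimately have "u = 0" "v = 0" using z by linarith+
 then show "z \<in> {p}" using z by simp
qed

text \<open>Multiplication by a complex number of modulus 1 and a translation. Reflections are left
  out since they exchange the two sides of every base and hence the signs.\<close>

definition rigid :: "(point => point) => bool" where
 "rigid f \<longleftrightarrow> (\<exists>a b s t. a * a + b * b = 1 &
   (\<forall>v. f v = (a * fst v - b * snd v + s, b * fst v + a * snd v + t)))"

lemma rigid_sqdist: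
 assumes "rigid f"
 shows "sqdist (f p) (f q) = sqdist p q"
proof -
 obtain a b s t where ab: "a * a + b * b = 1" and f: "\<And>v. f v = (a * fst v - b * snd v + s, b * fst v + a * snd v + t)"
  using assms by (auto simp: rigid_def)
 have "sqdist (f p) (f q) = (a * a + b * b) * sqdist p q"
  by (simp add: f sqdist_def algebra_simps)
 then show ?thesis by (simp add: ab)
qed

lemma rigid_inj: "rigid f ==> f p = f q \<longleftrightarrow> p = q"
 using rigid_sqdist[of f p q] by (auto simp: sqdist_dist)

lemma rigid_segment:
 assumes "rigid f"
 shows "closed_segment (f p) (f q) = f ` closed_segment p q"
proof -
 obtain a b s t where f: "\<And>v. f v = (a * fst v - b * snd v + s, b * fst v + a * snd v + t)"
  using assms by (auto simp: rigid_def)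
 have "(1 - u) *\<^sub>R f p + u *\<^sub>R f q = f ((1 - u) *\<^sub>R p + u *\<^sub>R q)" for u
  by (simp add: f algebra_simps)
 then show ?thesis by (simp add: closed_segment_image_interval image_image)
qed

lemma rigid_apex:
 assumes "rigid f"
 shows "apex a b s (f p) (f q) = f (apex a b s p q)"
proof -
 obtain k l x y where f: "\<And>v. f v = (k * fst v - l * snd v + x, l * fst v + k * snd v + y)"
  using assms by (auto simp: rigid_def)
 define X Y where "X = foot a b (sqdist p q)"
  and "Y = (if s then - sqrt (discr a b (sqdist p q)) else sqrt (discr a b (sqdist p q)))"
 show ?thesis
  unfolding apex_def rigid_sqdist[OF assms] Let_def X_def[symmetric] Y_def[symmetric]
  unfolding f by (simp add: algebra_simps)
qed

lemma rigid_exists: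
 assumes "p ~= q" "dist p q = dist p' q'"
 obtains f where "rigid f" "f p = p'" "f q = q'"
proof -
 define c where "c = sqdist p q"
 have c: "0 < c" using assms(1) by (simp add: c_def sqdist_pos)
 have c': "sqdist p' q' = c" using assms(2) by (simp add: c_def sqdist_dist)
 define w1 w2 v1 v2 where "w1 = fst q - fst p" and "w2 = snd q - snd p"
  and "v1 = fst q' - fst p'" and "v2 = snd q' - snd p'"
 have w: "w1 * w1 + w2 * w2 = c" and v: "v1 * v1 + v2 * v2 = c"
  using c' by (simp_all add: c_def sqdist_def w1_def w2_def v1_def v2_def)
 \<comment> \<open>The complex quotient of \<open>q' - p'\<close> by \<open>q - p\<close>, which has
   modulus 1 because the lengths agree.\<close>
 define a b where "a = (w1 * v1 + w2 * v2) / c" and "b = (w1 * v2 - w2 * v1) / c"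
 have ac: "a * c = w1 * v1 + w2 * v2" and bc: "b * c = w1 * v2 - w2 * v1"
  using c by (simp_all add: a_def b_def)
 have "(a * a + b * b) * (c * c) = (a * c) * (a * c) + (b * c) * (b * c)" by (simp add: algebra_simps)
 also have "\<dots> = (w1 * w1 + w2 * w2) * (v1 * v1 + v2 * v2)" unfolding ac bc by (simp add: algebra_simps)
 also have "\<dots> = 1 * (c * c)" unfolding w v by simp
 finally have ab: "a * a + b * b = 1" using c by (metis mult_right_cancel no_zero_divisors less_irrefl)
 have "(a * w1 - b * w2) * c = (a * c) * w1 - (b * c) * w2" by (simp add: algebra_simps)
 also have "\<dots> = v1 * (w1 * w1 + w2 * w2)" unfolding ac bc by (simp add: algebra_simps)
 finally have 1: "a * w1 - b * w2 = v1" unfolding w using c by simp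
 have "(b * w1 + a * w2) * c = (b * c) * w1 + (a * c) * w2" by (simp add: algebra_simps)
 also have "\<dots> = v2 * (w1 * w1 + w2 * w2)" unfolding ac bc by (simp add: algebra_simps)
 finally have 2: "b * w1 + a * w2 = v2" unfolding w using c by simp
 define f where "f = (\<lambda>v. (a * fst v - b * snd v + (fst p' - a * fst p + b * snd p),
   b * fst v + a * snd v + (snd p' - b * fst p - a * snd p)))"
 have "rigid f" using ab unfolding rigid_def f_def by blast
 moreover have "f p = p'" by (simp add: f_def prod_eq_iff)
 moreover have "f q = q'"
  using 1 2 by (simp add: f_def prod_eq_iff w1_def w2_def v1_def v2_def algebra_simps)
 ultimately show ?thesis using that by blast
qed

text \<open>The comparisons with \<open>k\<close> make the recursion terminate for arbitrary
  functions: \<open>pa\<close> and \<open>pb\<close> will be arrays of the program. The root edge is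
  put on the first axis with vertex 0 at the origin, which normalizes a drawing up to a rigid
  motion.\<close>

function position :: "(nat => nat) => (nat => nat) => (nat => real) => (nat => real) =>
  (nat => nat) => nat => point" where
 "position pa pb la lb \<sigma> k =
   (if k = 0 then (0, 0) else if k = 1 then (la 1, 0)
   else if pa k < k & pb k < k
   then apex (la k) (lb k) (\<sigma> k = 2) (position pa pb la lb \<sigma> (pa k)) (position pa pb la lb \<sigma> (pb k))
   else (0, 0))"
 by pat_completeness auto
termination by (relation "Wellfounded.measure (\<lambda>(pa, pb, la, lb, \<sigma>, k). k)") auto

declare position.simps [simp del]

text \<open>A triangle is hidden when an earlier, hence larger, one lies on the same side of its base,
 or when it is attached to a hidden one.\<close>

function visible :: "(nat => nat) => (nat => nat) => (nat => nat) => nat => bool" where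
 "visible pa pb \<sigma> k \<longleftrightarrow> \<sigma> k ~= 0 &
   (\<forall>j<k. pa j = pa k & pb j = pb k --> \<sigma> j ~= \<sigma> k) &
   (pb k < k --> \<sigma> (pb k) = 0 | visible pa pb \<sigma> (pb k))"
 by pat_completeness auto
termination by (relation "Wellfounded.measure (\<lambda>(pa, pb, \<sigma>, k). k)") auto

declare visible.simps [simp del]

text \<open>Vertices are numbered in the order of construction: \<open>k\<close> is attached to the edge from \<open>pa k\<close> to
 \<open>pb k\<close> by sides of lengths \<open>la k\<close> and \<open>lb k\<close>. Vertex 1 is treated as attached twice to vertex 0,
 so that the root edge needs no special case.\<close>

locale parent_structure =
 fixes n :: nat and pa pb :: "nat => nat" and la lb :: "nat => real"
 assumes n2: "2 <= n"
  and base: "pa 0 = 0" "pb 0 = 0" "pa 1 = 0" "pb 1 = 0" "lb 1 = la 1"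
  and parents: "\<And>k. 2 <= k ==> k < n ==>
   pa k < pb k & pb k < k & (pa k = pa (pb k) | pa k = pb (pb k))"
  and siblings: "\<And>j k. 2 <= j ==> j < k ==> k < n ==> pa j = pa k ==> pb j = pb k ==>
   la k + lb k <= la j + lb j"
  and lengths: "\<And>k. 1 <= k ==> k < n ==> 0 < la k & 0 < lb k & la k <= la 1 & lb k <= la 1"
begin

section \<open>Construction orders, pieces and keys\<close>

abbreviation "pos \<equiv> position pa pb la lb"
abbreviation "vis \<equiv> visible pa pb"

definition child :: "nat => nat => bool" where
 "child i k \<longleftrightarrow> 1 <= k & k < n & (i = pa k | i = pb k)"

definition adj :: "nat => nat => bool" where
 "adj i j \<longleftrightarrow> child i j | child j i"

text \<open>Two edges with a common end are covered by the first clause: as neither of the other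
  ends lies on the other edge, they meet in the common end alone
  (\<open>planar_edges\<close>).\<close>

definition planar :: "nat set => (nat => point) => bool" where
 "planar S p \<longleftrightarrow>
   (\<forall>x\<in>S. \<forall>i\<in>S. \<forall>j\<in>S. adj i j --> x ~= i --> x ~= j --> p x ~: closed_segment (p i) (p j)) &
   (\<forall>i\<in>S. \<forall>j\<in>S. \<forall>k\<in>S. \<forall>l\<in>S. adj i j --> adj k l --> {i, j} \<inter> {k, l} = {} -->
    closed_segment (p i) (p j) \<inter> closed_segment (p k) (p l) = {})"

definition realizes :: "(nat => point) => bool" where
 "realizes p \<longleftrightarrow> planar {..<n} p &
   (\<forall>k. 1 <= k --> k < n --> dist (p (pa k)) (p k) = la k & dist (p (pb k)) (p k) = lb k)"

text \<open>Descendants in the tree of triangles. The later end \<open>pb k\<close> of the base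
  serves as the parent of \<open>k\<close>, because \<open>parents\<close> makes the base a side of
  the triangle of \<open>pb k\<close> as soon as that vertex is not an end of the root edge.\<close>

definition sub :: "nat => nat set" where
 "sub t = {k. k < n & (\<exists>i. (pb ^^ i) k = t)}"

text \<open>Starting among the siblings at \<open>v\<close> instead of at the first one turns the
  pieces into a first-child, next-sibling decomposition. The index 0 gives the empty piece and can
  therefore stand for a missing child.\<close>

definition piece :: "nat => nat set" where
 "piece v = {k. \<exists>t. v <= t & 2 <= v & t < n & pa t = pa v & pb t = pb v & k \<in> sub t}"

definition hull_piece :: "nat => nat set" where
 "hull_piece v = insert (pa v) (insert (pb v) (piece v))"

text \<open>The signs 1 and 2 stand for the two sides of a base, 0 for a vertex that is not drawn.\<close>

definition signs_on :: "nat set => (nat => nat) => bool" where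
 "signs_on D \<sigma> \<longleftrightarrow> (\<forall>k. if k \<in> D then \<sigma> k = 1 | \<sigma> k = 2 else \<sigma> k = 0)"

definition restr :: "nat set => (nat => nat) => nat => nat" where
 "restr D \<sigma> k = (if k \<in> D then \<sigma> k else 0)"

definition key :: "(nat => nat) => nat => nat" where
 "key \<sigma> k = (if vis \<sigma> k then \<sigma> k else 0)"

definition base_sqdist :: "(nat => nat) => nat => real" where
 "base_sqdist \<sigma> k = sqdist (pos \<sigma> (pa k)) (pos \<sigma> (pb k))"

definition sound :: "nat => (nat => nat) => bool" where
 "sound v \<sigma> \<longleftrightarrow> planar (hull_piece v) (pos \<sigma>) &
   (\<forall>k\<in>piece v. 0 < discr (la k) (lb k) (base_sqdist \<sigma> k))"

lemma parents': "2 <= k ==> k < n ==> pa k < pb k" "2 <= k ==> k < n ==> pb k < k"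
 "2 <= k ==> k < n ==> pa k < k"
 using parents[of k] by auto

lemma adj_sym: "adj i j \<longleftrightarrow> adj j i"
 by (auto simp: adj_def)

lemma sub_self: "t < n ==> t \<in> sub t"
 by (auto simp: sub_def intro: exI[of _ 0])

lemma sub_step:
 assumes "2 <= k" "k < n"
 shows "k \<in> sub t \<longleftrightarrow> k = t | pb k \<in> sub t"
proof
 assume "k \<in> sub t"
 then obtain i where i: "(pb ^^ i) k = t" by (auto simp: sub_def)
 then show "k = t | pb k \<in> sub t"
  using parents'[OF assms] assms by (cases i) (auto simp: sub_def funpow_swap1)
next
 assume "k = t | pb k \<in> sub t"
 then show "k \<in> sub t"
 proof
  assume "pb k \<in> sub t"
  then obtain i where "(pb ^^ i) (pb k) = t" by (auto simp: sub_def)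
  then have "(pb ^^ Suc i) k = t" by (simp add: funpow_swap1)
  then show ?thesis using assms unfolding sub_def by blast
 qed (use assms sub_self in auto)
qed

lemma sub_roots: "2 <= t ==> 0 ~: sub t & 1 ~: sub t"
proof -
 assume t: "2 <= t"
 have "(pb ^^ i) 0 = 0" for i by (induction i) (auto simp: base)
 moreover have "(pb ^^ i) 1 <= 1" for i by (cases i) (auto simp: base[unfolded One_nat_def] funpow_swap1 calculation)
 ultimately have "(pb ^^ i) 0 ~= t & (pb ^^ i) 1 ~= t" for i
  using t by (metis not_numeral_le_zero numeral_le_one_iff order_trans semiring_norm(69))
 then show ?thesis unfolding sub_def by blast
qed

lemma sub_ge: "k \<in> sub t ==> 2 <= t ==> t <= k"
proof (induction k rule: less_induct)
 case (less k)
 then have k: "2 <= k" "k < n" using sub_roots[of t] by (cases "k = 0"; cases "k = 1"; auto simp: sub_def)+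
 with less show ?case using sub_step[OF k] parents'[OF k] by fastforce
qed

lemma sub_bounds: "k \<in> sub t ==> 2 <= t ==> 2 <= k & k < n"
 using sub_ge[of k t] by (auto simp: sub_def)

text \<open>If only \<open>pa k\<close> were a descendant of \<open>t\<close>, then
  \<open>pb k\<close>, which has \<open>pa k\<close> as one of its own parents, would be a
  descendant by induction.\<close>

lemma sub_up:
 assumes "2 <= t" "2 <= k" "k < n" "pa k \<in> sub t | pb k \<in> sub t"
 shows "k \<in> sub t"
 using assms
proof (induction k rule: less_induct)
 case (less k)
 have "pb k \<in> sub t"
 proof (rule ccontr)
  assume neg: "pb k ~: sub t"
  then have "pa k \<in> sub t" using less by blast
  then have pk: "2 <= pa k" using sub_bounds less by blast
  have k: "pa k < pb k" "pb k < k" "pa k = pa (pb k) | pa k = pb (pb k)"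
   using parents[of k] less by auto
  with pk \<open>pa k \<in> sub t\<close> have "pb k \<in> sub t"
   using less.prems by (intro less.IH) auto
  with neg show False ..
 qed
 then show ?case using sub_step less by blast
qed

lemma sub_parents:
 assumes "2 <= t" "k \<in> sub t" "k ~= t"
 shows "pb k \<in> sub t & pa k \<in> insert (pa t) (insert (pb t) (sub t))"
 using assms
proof (induction k rule: less_induct)
 case (less k)
 have k: "2 <= k" "k < n" using sub_bounds less by auto
 then have pb: "pb k \<in> sub t" using sub_step less by blast
 have "pa k \<in> insert (pa t) (insert (pb t) (sub t))"
 proof (cases "pb k = t")
  case True
  then show ?thesis using parents[OF k] by auto
 next
  case False
  then show ?thesis using less.IH[of "pb k"] pb parents[OF k] less.prems by auto
 qed
 with pb show ?case by blast
qed

lemma sub_disjoint: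
 assumes "2 <= t" "2 <= u" "t < n" "u < n" "t ~= u" "pb t = pb u"
 shows "k ~: sub t \<inter> sub u"
proof (induction k rule: less_induct)
 case (less k)
 show ?case
 proof
  assume k: "k \<in> sub t \<inter> sub u"
  then have kb: "2 <= k" "k < n" using sub_bounds assms by auto
  have out: "pb t ~: sub t" "pb u ~: sub u"
   using sub_ge assms parents'(2) by fastforce+
  have "k ~= t" using k sub_step[of t u] assms out by auto
  moreover have "k ~= u" using k sub_step[of u t] assms out by auto
  ultimately have "pb k \<in> sub t \<inter> sub u" using k sub_step[OF kb] by auto
  then show False using less parents'(2)[OF kb] by blast
 qed
qed

lemma sub_child:
 assumes "2 <= t" "k \<in> sub t" "k ~= t"
 obtains c where "2 <= c" "c < n" "pb c = t" "k \<in> sub c"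
proof -
 have "\<exists>c. 2 <= c & c < n & pb c = t & k \<in> sub c"
  using assms
 proof (induction k rule: less_induct)
  case (less k)
  have k: "2 <= k" "k < n" using sub_bounds less by auto
  show ?case
  proof (cases "pb k = t")
   case True
   then show ?thesis using k sub_self by blast
  next
   case False
   then obtain c where "2 <= c" "c < n" "pb c = t" "pb k \<in> sub c"
    using less.IH[of "pb k"] less.prems sub_step[OF k] parents'(2)[OF k] by auto
   then show ?thesis using sub_step[OF k] by blast
  qed
 qed
 then show ?thesis using that by blast
qed

lemma piece_0 [simp]: "piece 0 = {}"
 by (simp add: piece_def)

lemma pieceE:
 assumes "k \<in> piece v"
 obtains t where "v <= t" "2 <= t" "t < n" "pa t = pa v" "pb t = pb v" "k \<in> sub t" "2 <= v"
 using assms by (auto simp: piece_def)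

lemma piece_bounds: "k \<in> piece v ==> v <= k & 2 <= k & k < n & 2 <= v & v < n"
 using sub_ge sub_bounds by (fastforce elim!: pieceE)

lemma piece_top: "v <= t ==> 2 <= v ==> t < n ==> pa t = pa v ==> pb t = pb v ==> t \<in> piece v"
 using sub_self by (auto simp: piece_def)

lemma poles_notin_piece: "pa v ~: piece v" "pb v ~: piece v"
 using piece_bounds[of "pa v" v] piece_bounds[of "pb v" v] parents'[of v] by fastforce+

lemma piece_up:
 assumes "2 <= k" "k < n" "pa k \<in> piece v | pb k \<in> piece v"
 shows "k \<in> piece v"
proof -
 obtain t where "v <= t" "2 <= t" "t < n" "pa t = pa v" "pb t = pb v" "pa k \<in> sub t | pb k \<in> sub t" "2 <= v"
  using assms(3) by (auto elim!: pieceE)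
 then show ?thesis using sub_up[of t k] assms by (auto simp: piece_def)
qed

lemma piece_parents:
 assumes "k \<in> piece v"
 shows "pb k \<in> insert (pb v) (piece v)" "pa k \<in> hull_piece v"
  "pb k ~: piece v ==> pa k = pa v & pb k = pb v"
proof -
 obtain t where t: "v <= t" "2 <= t" "t < n" "pa t = pa v" "pb t = pb v" "k \<in> sub t" "2 <= v"
  using assms by (auto elim!: pieceE)
 then have sub: "sub t \<subseteq> piece v" by (auto simp: piece_def)
 note p = sub_parents[OF t(2,6)]
 show "pb k \<in> insert (pb v) (piece v)" using p sub t by (cases "k = t") auto
 show "pa k \<in> hull_piece v" using p sub t by (cases "k = t") (auto simp: hull_piece_def)
 show "pa k = pa v & pb k = pb v" if "pb k ~: piece v" using p sub t that by (cases "k = t") auto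
qed

lemma child_bounds: "child i k ==> i < k & k < n"
 using parents'[of k] base by (cases "k = 1") (auto simp: child_def)

lemma adj_bounds: "adj i j ==> i < n & j < n & i ~= j"
 using child_bounds[of i j] child_bounds[of j i] by (auto simp: adj_def)

lemma piece_adj:
 assumes "adj i j" "i \<in> piece v"
 shows "j \<in> hull_piece v"
proof -
 have i: "2 <= i" "i < n" using piece_bounds assms by auto
 from assms(1) consider "child i j" | "child j i" by (auto simp: adj_def)
 then show ?thesis
 proof cases
  case 1
  then have "2 <= j" "j < n" using child_bounds i by fastforce+
  then show ?thesis using 1 piece_up[of j v] assms by (auto simp: child_def hull_piece_def)
 next
  case 2
  then show ?thesis using piece_parents(1,2)[OF assms(2)] by (auto simp: child_def hull_piece_def)
 qed
qed

lemma sub_adj: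
 assumes "adj i j" "i \<in> sub t" "2 <= t"
 shows "j \<in> sub t | j = pa t | j = pb t"
proof -
 have i: "2 <= i" "i < n" using sub_bounds assms by auto
 from assms(1) consider "child i j" | "child j i" by (auto simp: adj_def)
 then show ?thesis
 proof cases
  case 1
  then have "2 <= j" "j < n" using child_bounds i by fastforce+
  then show ?thesis using 1 sub_up[of t j] assms by (auto simp: child_def)
 next
  case 2
  then show ?thesis using sub_parents[OF assms(3,2)] by (cases "i = t") (auto simp: child_def)
 qed
qed

text \<open>All chains of parents end at the root edge, and vertex 2 is the earliest triangle on it.
  The table entries for 2 therefore decide about the whole graph.\<close>

lemma piece_2: "3 <= n ==> piece 2 = {2..<n}"
proof -
 assume n: "3 <= n"
 have two: "pa 2 = 0" "pb 2 = 1" using parents[of 2] n base by auto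
 have "k \<in> piece 2" if "2 <= k" "k < n" for k
  using that
 proof (induction k rule: less_induct)
  case (less k)
  show ?case
  proof (cases "2 <= pb k")
   case True
   then have "pb k \<in> piece 2" using less parents'(2)[of k] by auto
   then show ?thesis using piece_up less by blast
  next
   case False
   then have "pb k = 1" "pa k = 0" using parents[of k] less by auto
   then show ?thesis using two less by (intro piece_top) auto
  qed
 qed
 then show ?thesis using piece_bounds by fastforce
qed

subsection \<open>Decomposition of a piece\<close>

text \<open>Applied to the base of \<open>v\<close> itself this is the next sibling of
  \<open>v\<close>. The default 0 fits \<open>piece 0 = {}\<close>.\<close>

definition first_child :: "nat => nat => nat => nat" where
 "first_child x y v =
   (if \<exists>w. v < w & w < n & pa w = x & pb w = y
   then LEAST w. v < w & w < n & pa w = x & pb w = y else 0)"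

lemma first_child_cases:
 obtains "first_child x y v = 0" "\<And>w. v < w ==> w < n ==> pa w = x ==> pb w = y ==> False"
 | u where "first_child x y v = u" "v < u" "u < n" "pa u = x" "pb u = y"
  "\<And>w. v < w ==> w < n ==> pa w = x ==> pb w = y ==> u <= w"
proof (cases "\<exists>w. v < w & w < n & pa w = x & pb w = y")
 case True
 let ?P = "\<lambda>w. v < w & w < n & pa w = x & pb w = y"
 have "?P (LEAST w. ?P w)" using True by (rule LeastI_ex)
 moreover have "(LEAST w. ?P w) <= w" if "?P w" for w using that by (rule Least_le)
 ultimately show ?thesis using that(2) True by (auto simp: first_child_def)
next
 case False
 then have "first_child x y v = 0" by (simp only: first_child_def if_False)
 then show ?thesis using that(1) False by blast
qed

lemma piece_first_child:
 assumes "2 <= v"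
 shows "piece (first_child x y v) = {k. \<exists>t. v < t & t < n & pa t = x & pb t = y & k \<in> sub t}"
proof (cases rule: first_child_cases[of x y v])
 case (2 u)
 then show ?thesis using assms by (auto simp: piece_def intro: less_le_trans)
qed auto

text \<open>The recurrence of the dynamic program: besides \<open>v\<close> there are its later
  siblings and the triangles on its two free sides. The former are kept apart from the descendants
  of \<open>v\<close> by \<open>sub_disjoint\<close>; the two free sides differ in the earlier end
  \<open>pa\<close>.\<close>

lemma piece_decompose:
 assumes v: "2 <= v" "v < n"
 defines "p1 \<equiv> first_child (pa v) (pb v) v" and "p2 \<equiv> first_child (pa v) v v"
  and "p3 \<equiv> first_child (pb v) v v"
 shows "piece v = insert v (piece p1 \<union> piece p2 \<union> piece p3)"
  and "v ~: piece p1" "v ~: piece p2" "v ~: piece p3"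
  and "piece p1 \<inter> piece p2 = {}" "piece p1 \<inter> piece p3 = {}" "piece p2 \<inter> piece p3 = {}"
proof -
 note P = piece_first_child[OF v(1)]
 have D1: "piece p1 = {k. \<exists>t. v < t & t < n & pa t = pa v & pb t = pb v & k \<in> sub t}"
  and D2: "piece p2 = {k. \<exists>t. v < t & t < n & pa t = pa v & pb t = v & k \<in> sub t}"
  and D3: "piece p3 = {k. \<exists>t. v < t & t < n & pa t = pb v & pb t = v & k \<in> sub t}"
  unfolding p1_def p2_def p3_def P by auto
 have in_sub: "k \<in> sub v" "k ~= v" if k: "k \<in> piece p2 \<union> piece p3" for k
 proof -
  obtain t where t: "v < t" "t < n" "pb t = v" "k \<in> sub t" using k D2 D3 by auto
  have "2 <= t" using t v by auto
  have "sub t \<subseteq> sub v"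
  proof
   fix j assume "j \<in> sub t"
   then obtain i where "(pb ^^ i) j = t" "j < n" by (auto simp: sub_def)
   then have "(pb ^^ Suc i) j = v" using t by simp
   then show "j \<in> sub v" using \<open>j < n\<close> unfolding sub_def by blast
  qed
  then show "k \<in> sub v" using t by auto
  show "k ~= v" using sub_ge[OF t(4) \<open>2 <= t\<close>] t by auto
 qed
 have out_sub: "k ~: sub v" if k: "k \<in> piece p1" for k
 proof -
  obtain t where "v < t" "t < n" "pb t = pb v" "k \<in> sub t" using k D1 by auto
  then show ?thesis using sub_disjoint[of v t k] v by auto
 qed
 show "v ~: piece p1" "v ~: piece p2" "v ~: piece p3" using in_sub out_sub sub_self v by blast+
 show "piece p1 \<inter> piece p2 = {}" "piece p1 \<inter> piece p3 = {}" using in_sub out_sub by blast+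
 show "piece p2 \<inter> piece p3 = {}"
 proof -
  have "k ~: piece p2 \<inter> piece p3" for k
  proof
   assume "k \<in> piece p2 \<inter> piece p3"
   then obtain t u where "v < t" "t < n" "pa t = pa v" "pb t = v" "k \<in> sub t"
    "v < u" "u < n" "pa u = pb v" "pb u = v" "k \<in> sub u"
    using D2 D3 by auto
   moreover from this parents'(1)[OF v] have "t ~= u" by auto
   ultimately show False using sub_disjoint[of t u k] v by auto
  qed
  then show ?thesis by blast
 qed
 show "piece v = insert v (piece p1 \<union> piece p2 \<union> piece p3)"
 proof (intro equalityI subsetI)
  fix k assume "k \<in> piece v"
  then obtain t where t: "v <= t" "2 <= t" "t < n" "pa t = pa v" "pb t = pb v" "k \<in> sub t"
   by (auto elim!: pieceE)
  show "k \<in> insert v (piece p1 \<union> piece p2 \<union> piece p3)"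
  proof (cases "t = v & k ~= v")
   case True
   then obtain c where c: "2 <= c" "c < n" "pb c = v" "k \<in> sub c" using t sub_child by blast
   then have "v < c" "pa c = pa v | pa c = pb v" using parents[OF c(1,2)] by auto
   then show ?thesis using c D2 D3 by auto
  next
   case False
   then show ?thesis using t D1 by (cases "t = v") auto
  qed
 next
  fix k assume k: "k \<in> insert v (piece p1 \<union> piece p2 \<union> piece p3)"
  show "k \<in> piece v"
  proof (cases "k \<in> piece p1")
   case True
   then obtain t where "v < t" "t < n" "pa t = pa v" "pb t = pb v" "k \<in> sub t"
    unfolding D1 by blast
   then show ?thesis using v unfolding piece_def by (blast intro: less_imp_le)
  next
   case False
   then have "k \<in> sub v" using k in_sub sub_self v by auto
   then show ?thesis using v by (auto simp: piece_def)
  qed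
 qed
qed

subsection \<open>Drawings determined by signs\<close>

lemma pos_simps:
 "pos \<sigma> 0 = (0, 0)" "pos \<sigma> 1 = (la 1, 0)"
 "2 <= k ==> k < n ==> pos \<sigma> k = apex (la k) (lb k) (\<sigma> k = 2) (pos \<sigma> (pa k)) (pos \<sigma> (pb k))"
proof -
 show "pos \<sigma> 0 = (0, 0)" by (rule trans[OF position.simps]) simp
 show "pos \<sigma> 1 = (la 1, 0)" by (rule trans[OF position.simps]) simp
 show "pos \<sigma> k = apex (la k) (lb k) (\<sigma> k = 2) (pos \<sigma> (pa k)) (pos \<sigma> (pb k))" if "2 <= k" "k < n"
  by (rule trans[OF position.simps]) (use parents'[OF that] that in simp)
qed

definition edge_length :: "nat => nat => real" where
 "edge_length i j = (if i = pa j then la j else lb j)"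

text \<open>Nondegeneracy is a condition on the lengths alone: once the earlier triangles are
  nondegenerate, every base has its prescribed length whatever the signs are. One valid drawing thus
  makes all sign vectors meaningful.\<close>

definition strict :: bool where
 "strict \<longleftrightarrow> (\<forall>k. 2 <= k --> k < n --> 0 < discr (la k) (lb k) ((edge_length (pa k) (pb k))\<^sup>2))"

lemma base_child: "2 <= k ==> k < n ==> child (pa k) (pb k)"
 using parents[of k] by (auto simp: child_def)

lemma edge_length_pos: "child i j ==> 0 < edge_length i j & edge_length i j <= la 1"
 using lengths[of j] by (auto simp: edge_length_def child_def)

definition lengths_ok :: "(nat => point) => nat => bool" where
 "lengths_ok p k \<longleftrightarrow> (1 <= k --> k < n --> dist (p (pa k)) (p k) = la k & dist (p (pb k)) (p k) = lb k)"

lemma lengths_ok_dist: "lengths_ok p j ==> child i j ==> dist (p i) (p j) = edge_length i j"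
 by (auto simp: lengths_ok_def child_def edge_length_def)

lemma lengths_ok_1: "lengths_ok (pos \<sigma>) 1"
 using lengths[of 1] by (auto simp: lengths_ok_def base[unfolded One_nat_def] pos_simps pos_simps(2)[unfolded One_nat_def] dist_Pair_Pair)

lemma lengths_ok_step:
 assumes k: "2 <= k" "k < n" "lengths_ok (pos \<sigma>) (pb k)"
 shows "base_sqdist \<sigma> k = (edge_length (pa k) (pb k))\<^sup>2" "pos \<sigma> (pa k) ~= pos \<sigma> (pb k)"
  "0 < discr (la k) (lb k) (base_sqdist \<sigma> k) ==> lengths_ok (pos \<sigma>) k"
proof -
 note c = base_child[OF k(1,2)]
 have d: "dist (pos \<sigma> (pa k)) (pos \<sigma> (pb k)) = edge_length (pa k) (pb k)"
  using lengths_ok_dist[OF k(3) c] .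
 then show "base_sqdist \<sigma> k = (edge_length (pa k) (pb k))\<^sup>2"
  by (simp add: base_sqdist_def sqdist_dist)
 show ne: "pos \<sigma> (pa k) ~= pos \<sigma> (pb k)"
  using d edge_length_pos[OF c] by auto
 show "lengths_ok (pos \<sigma>) k" if "0 < discr (la k) (lb k) (base_sqdist \<sigma> k)"
  using apex_correct(1,2)[OF ne, of "la k" "lb k" "\<sigma> k = 2"] that lengths[of k] k
  by (auto simp: lengths_ok_def pos_simps base_sqdist_def)
qed

lemma valid_lengths:
 assumes "\<And>k. 2 <= k ==> k < n ==> 0 < discr (la k) (lb k) (base_sqdist \<sigma> k)" "k < n"
 shows "lengths_ok (pos \<sigma>) k"
 using assms(2)
proof (induction k rule: less_induct)
 case (less k)
 consider "k = 0" | "k = 1" | "2 <= k" by linarith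
 then show ?case
 proof cases
  case 3
  then show ?thesis using less parents'(2)[of k] lengths_ok_step(3) assms(1) by auto
 qed (use lengths_ok_1 in \<open>auto simp: lengths_ok_def[of _ 0]\<close>)
qed

lemma valid_strict:
 assumes "\<And>k. 2 <= k ==> k < n ==> 0 < discr (la k) (lb k) (base_sqdist \<sigma> k)"
 shows strict
 unfolding strict_def
proof (intro allI impI)
 fix k assume k: "2 <= k" "k < n"
 then have "pb k < n" using parents'(2)[of k] by simp
 from lengths_ok_step(1)[OF k valid_lengths[OF assms this]]
 show "0 < discr (la k) (lb k) ((edge_length (pa k) (pb k))\<^sup>2)"
  using assms[OF k] by simp
qed

lemma strict_lengths:
 assumes strict "k < n"
 shows "lengths_ok (pos \<sigma>) k"
 using assms(2)
proof (induction k rule: less_induct)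
 case (less k)
 consider "k = 0" | "k = 1" | "2 <= k" by linarith
 then show ?case
 proof cases
  case 3
  then have ok: "lengths_ok (pos \<sigma>) (pb k)" using less parents'(2)[of k] by auto
  show ?thesis
   using lengths_ok_step(3)[OF 3 less.prems ok] lengths_ok_step(1)[OF 3 less.prems ok]
    assms(1) 3 less.prems by (auto simp: strict_def)
 qed (use lengths_ok_1 in \<open>auto simp: lengths_ok_def[of _ 0]\<close>)
qed

lemma strict_discr:
 assumes strict "2 <= k" "k < n"
 shows "0 < discr (la k) (lb k) (base_sqdist \<sigma> k)"
proof -
 have "pb k < n" using parents'(2)[of k] assms by simp
 from lengths_ok_step(1)[OF assms(2,3) strict_lengths[OF assms(1) this]]
 show ?thesis using assms by (auto simp: strict_def)
qed

lemma strict_child: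
 assumes strict "child i j"
 shows "dist (pos \<sigma> i) (pos \<sigma> j) = edge_length i j"
 using lengths_ok_dist[OF strict_lengths assms(2)] assms child_bounds by blast

lemma strict_corner:
 assumes strict "2 <= k" "k < n"
 shows "dist (pos \<sigma> (pa k)) (pos \<sigma> k) = la k" "dist (pos \<sigma> (pb k)) (pos \<sigma> k) = lb k"
  "pos \<sigma> (pa k) ~= pos \<sigma> (pb k)"
  "\<exists>y>0. cross (pos \<sigma> (pa k)) (pos \<sigma> (pb k)) (pos \<sigma> k) = (if \<sigma> k = 2 then - y else y)"
proof -
 have pb: "pb k < n" using parents'(2)[of k] assms by simp
 show "dist (pos \<sigma> (pa k)) (pos \<sigma> k) = la k" "dist (pos \<sigma> (pb k)) (pos \<sigma> k) = lb k"
  using strict_lengths[OF assms(1,3)] assms by (auto simp: lengths_ok_def)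
 show ne: "pos \<sigma> (pa k) ~= pos \<sigma> (pb k)"
  using lengths_ok_step(2)[OF assms(2,3) strict_lengths[OF assms(1) pb]] .
 have "cross (pos \<sigma> (pa k)) (pos \<sigma> (pb k)) (pos \<sigma> k) =
   (if \<sigma> k = 2 then - 1 else 1) * (sqrt (discr (la k) (lb k) (base_sqdist \<sigma> k)) * base_sqdist \<sigma> k)"
  using apex_correct(3)[OF ne, of "la k" "lb k" "\<sigma> k = 2"] strict_discr[OF assms] lengths[of k] assms
  by (simp add: pos_simps base_sqdist_def)
 moreover have "0 < sqrt (discr (la k) (lb k) (base_sqdist \<sigma> k)) * base_sqdist \<sigma> k"
  using strict_discr[OF assms] sqdist_pos[OF ne] by (simp add: base_sqdist_def)
 ultimately show "\<exists>y>0. cross (pos \<sigma> (pa k)) (pos \<sigma> (pb k)) (pos \<sigma> k) = (if \<sigma> k = 2 then - y else y)"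
  by (intro exI[of _ "sqrt (discr (la k) (lb k) (base_sqdist \<sigma> k)) * base_sqdist \<sigma> k"]) auto
qed

lemma planar_rigid:
 assumes "rigid f" "\<And>k. k \<in> S ==> r k = f (p k)"
 shows "planar S r \<longleftrightarrow> planar S p"
proof -
 have inj: "inj f" by (rule injI) (simp add: rigid_inj[OF assms(1)])
 show ?thesis
  unfolding planar_def
  by (simp add: assms(2) rigid_segment[OF assms(1)] inj_image_mem_iff[OF inj] image_Int[OF inj, symmetric])
qed

text \<open>The base has the same length in both drawings, so a rigid motion matches its ends;
  \<open>apex\<close> commutes with rigid motions, and equal signs propagate the match through the
  piece.\<close>

lemma piece_congruent:
 assumes strict and v: "2 <= v" "v < n" and eq: "\<And>k. k \<in> piece v ==> \<sigma> k = \<tau> k"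
 obtains f where "rigid f" "\<And>k. k \<in> hull_piece v ==> pos \<sigma> k = f (pos \<tau> k)"
proof -
 note c = base_child[OF v]
 have "dist (pos \<tau> (pa v)) (pos \<tau> (pb v)) = dist (pos \<sigma> (pa v)) (pos \<sigma> (pb v))"
  using strict_child[OF assms(1) c] by simp
 then obtain f where f: "rigid f" "f (pos \<tau> (pa v)) = pos \<sigma> (pa v)" "f (pos \<tau> (pb v)) = pos \<sigma> (pb v)"
  using rigid_exists[OF strict_corner(3)[OF assms(1) v]] by metis
 have "pos \<sigma> k = f (pos \<tau> k)" if "k \<in> hull_piece v" for k
  using that
 proof (induction k rule: less_induct)
  case (less k)
  show ?case
  proof (cases "k \<in> piece v")
   case True
   then have k: "2 <= k" "k < n" using piece_bounds by auto
   have "pb k \<in> hull_piece v" "pa k \<in> hull_piece v"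
    using piece_parents[OF True] by (auto simp: hull_piece_def)
   then have "pos \<sigma> (pa k) = f (pos \<tau> (pa k))" "pos \<sigma> (pb k) = f (pos \<tau> (pb k))"
    using less.IH parents'[OF k] by auto
   then show ?thesis using eq[OF True] rigid_apex[OF f(1)] k by (simp add: pos_simps)
  next
   case False
   then show ?thesis using less f by (auto simp: hull_piece_def)
  qed
 qed
 then show ?thesis using that f(1) by blast
qed

lemma planar_vertex:
 assumes "planar S p" "x \<in> S" "i \<in> S" "j \<in> S" "adj i j" "x ~= i" "x ~= j"
 shows "p x ~: closed_segment (p i) (p j)"
 using assms(1)[unfolded planar_def, THEN conjunct1, THEN bspec, OF assms(2), THEN bspec, OF assms(3),
   THEN bspec, OF assms(4)] assms(5-7) by simp

lemma planar_disjoint: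
 assumes "planar S p" "i \<in> S" "j \<in> S" "k \<in> S" "l \<in> S" "adj i j" "adj k l" "{i, j} \<inter> {k, l} = {}"
 shows "closed_segment (p i) (p j) \<inter> closed_segment (p k) (p l) = {}"
 using assms(1)[unfolded planar_def, THEN conjunct2, THEN bspec, OF assms(2), THEN bspec, OF assms(3),
   THEN bspec, OF assms(4), THEN bspec, OF assms(5)] assms(6-8) by simp

lemma planar_subset:
 assumes "planar S p" "T \<subseteq> S"
 shows "planar T p"
 unfolding planar_def
proof (intro conjI ballI impI)
 fix x i j assume "x \<in> T" "i \<in> T" "j \<in> T" "adj i j" "x ~= i" "x ~= j"
 then show "p x ~: closed_segment (p i) (p j)" using planar_vertex[OF assms(1), of x i j] assms(2) by blast
next
 fix i j k l assume "i \<in> T" "j \<in> T" "k \<in> T" "l \<in> T" "adj i j" "adj k l" "{i, j} \<inter> {k, l} = {}"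
 then show "closed_segment (p i) (p j) \<inter> closed_segment (p k) (p l) = {}"
  using planar_disjoint[OF assms(1), of i j k l] assms(2) by blast
qed

lemma planar_cong:
 assumes "planar S p" "\<And>k. k \<in> S ==> p k = r k"
 shows "planar S r"
 using assms(1) unfolding planar_def by (simp add: assms(2))

lemma planar_edges:
 assumes "planar S p" "i \<in> S" "j \<in> S" "k \<in> S" "l \<in> S" "adj i j" "adj k l" "{i, j} ~= {k, l}"
  and z: "z \<in> closed_segment (p i) (p j)" "z \<in> closed_segment (p k) (p l)"
 shows "\<exists>x. x \<in> {i, j} \<inter> {k, l} & z = p x"
proof (cases "{i, j} \<inter> {k, l} = {}")
 case True
 then show ?thesis using planar_disjoint[OF assms(1-7)] z by blast
next
 case False
 have shared: "z = p x" if "adj x y" "adj x w" "y ~= w" "{x, y, w} \<subseteq> S"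
  "z \<in> closed_segment (p x) (p y)" "z \<in> closed_segment (p x) (p w)" for x y w
  using closed_segments_share_endpoint[of "p y" "p x" "p w"] planar_vertex[OF assms(1), of y x w]
   planar_vertex[OF assms(1), of w x y] that adj_bounds[of x y] adj_bounds[of x w] by auto
 have "adj j i" "adj l k" using assms adj_sym by blast+
 from False consider "i = k" | "i = l" | "j = k" | "j = l" by blast
 then show ?thesis
 proof cases
  case 1
  then show ?thesis using shared[of i j l] assms by auto
 next
  case 2
  then show ?thesis using shared[of i j k] assms \<open>adj l k\<close> by (auto simp: closed_segment_commute)
 next
  case 3
  then show ?thesis using shared[of j i l] assms \<open>adj j i\<close> by (auto simp: closed_segment_commute)
 next
  case 4
  then show ?thesis using shared[of j i k] assms \<open>adj l k\<close> \<open>adj j i\<close> by (auto simp: closed_segment_commute)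
 qed
qed

section \<open>What can lie inside a triangle of a planar drawing\<close>

definition inner :: "(nat => point) => nat => point set" where
 "inner p c = interior (triangle (p (pa c)) (p (pb c)) (p c))"

definition corners :: "nat => nat set" where
 "corners c = {pa c, pb c, c}"

lemma corners_adj: "2 <= c ==> c < n ==> adj (pa c) (pb c) & adj (pb c) c & adj (pa c) c"
 using base_child[of c] by (auto simp: adj_def child_def)

lemma corners_not_inner: "x \<in> corners c ==> p x ~: inner p c"
proof -
 assume x: "x \<in> corners c"
 have "p x \<in> frontier (triangle (p (pa c)) (p (pb c)) (p c))"
  unfolding frontier_triangle using x by (auto simp: corners_def)
 then show ?thesis by (auto simp: inner_def frontier_def)
qed

text \<open>Since \<open>x\<close> is no corner, the edge is not a side of the triangle. Distinct
  edges meet only in a common vertex, and that vertex must be \<open>y\<close>.\<close>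

lemma edge_meets_triangle:
 assumes "planar S p" "2 <= c" "c < n" "corners c \<subseteq> S" "x \<in> S" "y \<in> S" "adj x y" "x ~: corners c"
  and "z \<in> closed_segment (p x) (p y)" "z \<in> frontier (triangle (p (pa c)) (p (pb c)) (p c))"
 shows "z = p y & y \<in> corners c"
proof -
 have S: "pa c \<in> S" "pb c \<in> S" "c \<in> S" using assms by (auto simp: corners_def)
 have x: "x ~= pa c" "x ~= pb c" "x ~= c" using assms by (auto simp: corners_def)
 note adj = corners_adj[OF assms(2,3)]
 have main: "z = p y & y \<in> corners c"
  if kl: "z \<in> closed_segment (p k) (p l)" "adj k l" "k \<in> corners c" "l \<in> corners c" for k l
 proof -
  have "{x, y} ~= {k, l}" using kl assms(8) by (auto simp: doubleton_eq_iff)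
  then obtain u where "u \<in> {x, y} \<inter> {k, l}" "z = p u"
   using planar_edges[OF assms(1,5,6) _ _ assms(7) kl(2) _ assms(9) kl(1)] kl(3,4) assms(4) by blast
  then show ?thesis using kl(3,4) assms(8) by auto
 qed
 have "pa c \<in> corners c" "pb c \<in> corners c" "c \<in> corners c" by (simp_all add: corners_def)
 moreover have "z \<in> closed_segment (p (pa c)) (p (pb c)) | z \<in> closed_segment (p (pb c)) (p c) |
   z \<in> closed_segment (p (pa c)) (p c)"
  using assms(10) unfolding frontier_triangle by (simp add: closed_segment_commute)
 ultimately show ?thesis using main adj by blast
qed

lemma edge_from_inner:
 assumes "planar S p" "2 <= c" "c < n" "corners c \<subseteq> S" "x \<in> S" "y \<in> S" "adj x y" "p x \<in> inner p c"
 shows "p y \<in> inner p c | y \<in> corners c"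
proof (rule disjCI)
 assume y: "y ~: corners c"
 have x: "x ~: corners c" using corners_not_inner assms(8) by blast
 show "p y \<in> inner p c"
 proof (rule ccontr)
  assume "p y ~: inner p c"
  then obtain z where "z \<in> closed_segment (p x) (p y)"
   "z \<in> frontier (triangle (p (pa c)) (p (pb c)) (p c))"
   using segment_leaves_interior assms(8) unfolding inner_def by blast
  then show False using edge_meets_triangle[OF assms(1-7) x] y by blast
 qed
qed

lemma edge_avoids_inner:
 assumes "planar S p" "2 <= c" "c < n" "corners c \<subseteq> S" "x \<in> S" "y \<in> S" "adj x y"
  and "p x ~: inner p c" "p y ~: inner p c" "x ~: corners c"
 shows "closed_segment (p x) (p y) \<inter> inner p c = {}"
 unfolding inner_def
proof (rule chord_avoids_interior)
 show "closed_segment (p x) (p y) \<inter> frontier (triangle (p (pa c)) (p (pb c)) (p c)) \<subseteq> {p y}"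
  using edge_meets_triangle[OF assms(1-7,10)] by blast
qed (use assms in \<open>auto simp: inner_def\<close>)

lemma inner_shorter:
 assumes strict "2 <= c" "c < n" "p = pos \<sigma>" "x \<in> inner p c"
 shows "dist (p (pa c)) x + dist (p (pb c)) x < la c + lb c"
proof -
 note s = strict_corner[OF assms(1-3), of \<sigma>]
 have "cross (p (pa c)) (p (pb c)) (p c) ~= 0" using s(4) assms(4) by (auto split: if_splits)
 from strict_triangle_inequality[OF this] interior_triangle_perimeter[of x "p (pa c)" "p (pb c)" "p c"]
 show ?thesis using s assms(4,5) by (simp add: inner_def)
qed

text \<open>The two triangles overlap near their common base, and planarity lets
  \<open>nested_triangles\<close> put one apex inside the other triangle. The earlier apex cannot be
  the inner one, as it has the greater or equal sum of sides; ties do no harm because interior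
  points have a strictly smaller sum.\<close>

lemma nested_siblings:
 assumes strict "planar S p" "p = pos \<sigma>" "2 <= c" "c < t" "t < n" "pa c = pa t" "pb c = pb t"
  and "(\<sigma> c = 2) = (\<sigma> t = 2)" "corners c \<subseteq> S" "t \<in> S"
 shows "p t \<in> inner p c"
proof -
 let ?a = "p (pa c)" and ?b = "p (pb c)"
 have t2: "2 <= t" and cn: "c < n" using assms by auto
 have S: "pa c \<in> S" "pb c \<in> S" "c \<in> S" "t \<in> S" using assms by (auto simp: corners_def)
 have ct: "corners t \<subseteq> S" using assms by (auto simp: corners_def)
 note sc = strict_corner[OF assms(1,4) cn, of \<sigma>] and st = strict_corner[OF assms(1) t2 assms(6), of \<sigma>]
 have "0 < cross ?a ?b (p c) * cross ?a ?b (p t)"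
  using sc(4) st(4) assms(3,7,8,9) by (auto split: if_splits simp: mult_neg_neg)
 then have meet: "inner p c \<inter> inner p t ~= {}"
  using interior_triangles_meet unfolding inner_def assms(7,8)[symmetric] by blast
 have tc: "t ~: corners c" and ctt: "c ~: corners t"
  using assms parents'[OF assms(4) cn] parents'[OF t2 assms(6)] by (auto simp: corners_def)
 note m = edge_meets_triangle[OF assms(2,4) cn assms(10) \<open>t \<in> S\<close>]
 note m' = edge_meets_triangle[OF assms(2) t2 assms(6) ct \<open>c \<in> S\<close>]
 have adjs: "adj t (pa c)" "adj t (pb c)" "adj c (pa c)"
  using corners_adj[OF t2 assms(6)] corners_adj[OF assms(4) cn] assms(7,8) adj_sym by auto
 have fc: "frontier (triangle ?a ?b (p c)) = frontier (triangle (p (pa c)) (p (pb c)) (p c))" ..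
 have 1: "closed_segment ?a (p t) \<inter> frontier (triangle ?a ?b (p c)) \<subseteq> {?a}"
  using m[OF S(1) adjs(1) tc] by (auto simp: closed_segment_commute)
 have 2: "closed_segment ?b (p t) \<inter> frontier (triangle ?a ?b (p c)) \<subseteq> {?b}"
  using m[OF S(2) adjs(2) tc] by (auto simp: closed_segment_commute)
 have 3: "p c ~: frontier (triangle ?a ?b (p t))"
 proof
  assume "p c \<in> frontier (triangle ?a ?b (p t))"
  then have "p c = ?a" using m'[OF S(1) adjs(3) ctt, of "p c"] assms(7,8) by simp
  then show False using sc(1) assms(3,4) lengths[of c] cn by auto
 qed
 have 4: "p t ~: frontier (triangle ?a ?b (p c))"
 proof
  assume "p t \<in> frontier (triangle ?a ?b (p c))"
  then have "p t = ?a" using m[OF S(1) adjs(1) tc, of "p t"] by simp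
  then show False using st(1) assms(3,7) lengths[of t] t2 assms(6) by auto
 qed
 have "p t \<in> inner p c | p c \<in> inner p t"
  using nested_triangles[OF _ 1 2 3 4] meet unfolding inner_def assms(7,8)[symmetric] by blast
 moreover have "p c ~: inner p t"
 proof
  assume "p c \<in> inner p t"
  from inner_shorter[OF assms(1) t2 assms(6,3) this]
  have "la c + lb c < la t + lb t" using sc assms(3,7,8) by simp
  with siblings[of c t] assms show False by auto
 qed
 ultimately show ?thesis by blast
qed

end

context parent_structure
begin

subsection \<open>Exchanging hidden parts\<close>

lemma vis_nonzero: "vis \<sigma> k ==> \<sigma> k ~= 0"
 by (subst (asm) visible.simps) simp

lemma key_eq:
 assumes "key \<sigma> = key \<tau>"
 shows "vis \<sigma> k = vis \<tau> k" "vis \<sigma> k ==> \<sigma> k = \<tau> k"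
 using fun_cong[OF assms, of k] vis_nonzero[of \<sigma> k] vis_nonzero[of \<tau> k]
 by (auto simp: key_def split: if_splits)

lemma signs_onD: "signs_on D \<sigma> ==> k \<in> D ==> \<sigma> k = 1 | \<sigma> k = 2"
 "signs_on D \<sigma> ==> k ~: D ==> \<sigma> k = 0"
 by (auto simp: signs_on_def split: if_splits dest: spec[of _ k])

lemma signs_on_nonzero: "signs_on D \<sigma> ==> \<sigma> k ~= 0 \<longleftrightarrow> k \<in> D"
 using signs_onD[of D \<sigma> k] by fastforce

lemma vis_iff:
 assumes "signs_on (piece v) \<tau>" "k \<in> piece v"
 shows "vis \<tau> k \<longleftrightarrow> (\<forall>j<k. pa j = pa k & pb j = pb k --> \<tau> j ~= \<tau> k) & (pb k \<in> piece v --> vis \<tau> (pb k))"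
proof -
 have "pb k < k" using piece_bounds[OF assms(2)] parents'(2) by blast
 then show ?thesis
  using assms signs_on_nonzero[OF assms(1), of k] signs_on_nonzero[OF assms(1), of "pb k"]
  by (subst visible.simps) auto
qed

text \<open>Climb along \<open>pb\<close> as long as the parent is hidden. The vertex
  \<open>t\<close> reached in this way owes its invisibility to an earlier sibling with the same
  sign, and the least such sibling is visible.\<close>

lemma hidden_cover:
 assumes \<tau>: "signs_on (piece v) \<tau>" and "h \<in> piece v" "\<not> vis \<tau> h"
 obtains c t where "c \<in> piece v" "vis \<tau> c" "t \<in> piece v" "c < t" "pa c = pa t" "pb c = pb t"
  "\<tau> c = \<tau> t" "h \<in> sub t" "pb c \<in> piece v --> vis \<tau> (pb c)"
proof -
 have "\<exists>c t. c \<in> piece v & vis \<tau> c & t \<in> piece v & c < t & pa c = pa t & pb c = pb t &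
   \<tau> c = \<tau> t & h \<in> sub t & (pb c \<in> piece v --> vis \<tau> (pb c))"
  using assms(2,3)
 proof (induction h rule: less_induct)
  case (less h)
  have h: "2 <= h" "h < n" using piece_bounds less by auto
  show ?case
  proof (cases "pb h \<in> piece v & \<not> vis \<tau> (pb h)")
   case True
   then show ?thesis
    using less.IH[of "pb h"] parents'(2)[OF h] sub_step[OF h] by blast
  next
   case False
   let ?P = "\<lambda>j. j < h & pa j = pa h & pb j = pb h & \<tau> j = \<tau> h"
   define c where "c = (LEAST j. ?P j)"
   have "\<exists>j. ?P j" using less.prems vis_iff[OF \<tau> less.prems(1)] False by blast
   then have c: "?P c" unfolding c_def by (rule LeastI_ex)
   have least: "\<not> ?P j" if "j < c" for j using not_less_Least that unfolding c_def by blast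
   have "\<tau> c ~= 0" using c signs_on_nonzero[OF \<tau>, of h] less.prems by auto
   then have cP: "c \<in> piece v" using signs_on_nonzero[OF \<tau>] by blast
   have "vis \<tau> c"
    unfolding vis_iff[OF \<tau> cP]
   proof (intro conjI allI impI)
    fix j assume "j < c" "pa j = pa c & pb j = pb c"
    then show "\<tau> j ~= \<tau> c" using least[of j] c by auto
   qed (use c False in auto)
   then show ?thesis using c cP less.prems sub_self[OF h(2)] False by (intro exI[of _ c] exI[of _ h]) auto
  qed
 qed
 then obtain c t where *: "c \<in> piece v & vis \<tau> c & t \<in> piece v & c < t & pa c = pa t &
   pb c = pb t & \<tau> c = \<tau> t & h \<in> sub t & (pb c \<in> piece v --> vis \<tau> (pb c))"
  by blast
 show ?thesis by (rule that[of c t]) (use * in auto)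
qed

text \<open>The other end \<open>pa k\<close> of the base is itself a parent of \<open>pb k\<close>,
  so visibility is inherited along the chain.\<close>

lemma vis_parents:
 assumes \<tau>: "signs_on (piece v) \<tau>" and "k \<in> piece v" "pb k \<in> piece v ==> vis \<tau> (pb k)"
 shows "pa k \<in> piece v ==> vis \<tau> (pa k)"
 using assms(2,3)
proof (induction k rule: less_induct)
 case (less k)
 have k: "2 <= k" "k < n" using piece_bounds less by auto
 show ?case
 proof (cases "pb k \<in> piece v")
  case True
  have b: "vis \<tau> (pb k)" using less True by blast
  have "pb (pb k) \<in> piece v ==> vis \<tau> (pb (pb k))"
   using b vis_iff[OF \<tau> True] by blast
  then show ?thesis
   using less.IH[of "pb k"] parents[OF k] True less.prems by auto
 next
  case False
  then have "pa k = pa v" using piece_parents(3) less by blast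
  then show ?thesis using poles_notin_piece less by simp
 qed
qed

text \<open>The exchange moves only the hidden vertices \<open>H\<close>. Each of them is inside a
  triangle with unmoved corners that the rest of the graph does not enter, and its edges stay in
  that triangle. A conflict between moved and unmoved parts is thereby excluded; all other conflicts
  would already occur in the drawing of the piece or in the old drawing.\<close>

lemma swap:
 assumes strict and v: "2 <= v" "v < n"
  and \<sigma>: "planar {..<n} (pos \<sigma>)"
  and \<tau>: "signs_on (piece v) \<tau>" "planar (hull_piece v) (pos \<tau>)"
  and keys: "key \<tau> = key (restr (piece v) \<sigma>)"
 shows "planar {..<n} (pos (\<lambda>k. if k \<in> piece v then \<tau> k else \<sigma> k))"
proof -
 define \<rho> where "\<rho> = (\<lambda>k. if k \<in> piece v then \<tau> k else \<sigma> k)"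
 define p r where "p = pos \<sigma>" and "r = pos \<rho>"
 define H where "H = {k \<in> piece v. \<not> vis \<tau> k}"
 have pl: "planar {..<n} p" using \<sigma> by (simp add: p_def)
 obtain f where "rigid f" "\<And>k. k \<in> hull_piece v ==> r k = f (pos \<tau> k)"
  using piece_congruent[OF assms(1) v, of \<rho> \<tau>] by (auto simp: \<rho>_def r_def)
 then have rpl: "planar (hull_piece v) r" using planar_rigid[of f "hull_piece v" r "pos \<tau>"] \<tau>(2) by blast
 have hull_n: "hull_piece v \<subseteq> {..<n}"
  using piece_bounds parents'[OF v] v by (auto simp: hull_piece_def)
 have parents_H: "pb k ~: H" "pa k ~: H" if "k \<in> piece v" "k ~: H" for k
  using that vis_iff[OF \<tau>(1) that(1)] vis_parents[OF \<tau>(1) that(1)] by (auto simp: H_def)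
 \<comment> \<open>A vertex outside \<open>H\<close> has both ends of its base outside
   \<open>H\<close>, and its sign is unchanged because equal keys mean equal signs at visible
   vertices.\<close>
 have rp: "r k = p k" if "k < n" "k ~: H" for k
  using that
 proof (induction k rule: less_induct)
  case (less k)
  consider "k = 0" | "k = 1" | "2 <= k" by linarith
  then show ?case
  proof cases
   case 3
   note b = parents'[OF 3 less.prems(1)]
   have "pa k ~: H & pb k ~: H"
   proof (cases "k \<in> piece v")
    case False
    then show ?thesis using piece_up[OF 3 less.prems(1)] by (auto simp: H_def)
   qed (use parents_H less.prems in blast)
   then have "r (pa k) = p (pa k)" "r (pb k) = p (pb k)" using less b by auto
   moreover have "\<rho> k = \<sigma> k"
   proof (cases "k \<in> piece v")
    case True
    then have "vis \<tau> k" using less.prems by (simp add: H_def)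
    then show ?thesis using key_eq(2)[OF keys] True by (simp add: \<rho>_def restr_def)
   qed (simp add: \<rho>_def)
   ultimately show ?thesis using pos_simps(3)[OF 3 less.prems(1)] by (simp add: p_def r_def)
  qed (simp_all add: p_def r_def pos_simps pos_simps(2)[unfolded One_nat_def])
 qed
 have p_adj: "p x ~= p y" if "x < n" "adj y z" "x ~= y" "x ~= z" for x y z
  using planar_vertex[OF pl, of x y z] that adj_bounds[of y z] by auto

 \<comment> \<open>\<open>c\<close> is a visible triangle and \<open>t\<close> a hidden sibling of
   it with \<open>h\<close> among its descendants. The new drawing puts all of \<open>sub t\<close>
   inside the triangle of \<open>c\<close>, the old one puts nothing from outside the piece
   there.\<close>
 have shield: "\<exists>c t. 2 <= c & c < n & 2 <= t & t < n & corners c \<subseteq> hull_piece v & corners c \<inter> H = {} &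
   pa t = pa c & pb t = pb c & h \<in> sub t & sub t \<subseteq> piece v & r ` sub t \<subseteq> inner r c &
   inner r c = inner p c & (\<forall>x<n. x ~: piece v --> p x ~: inner p c)" if hH: "h \<in> H" for h
 proof -
  have h: "h \<in> piece v" "\<not> vis \<tau> h" using hH by (auto simp: H_def)
  obtain c t where ct: "c \<in> piece v" "vis \<tau> c" "t \<in> piece v" "c < t" "pa c = pa t" "pb c = pb t"
   "\<tau> c = \<tau> t" "h \<in> sub t" "pb c \<in> piece v --> vis \<tau> (pb c)"
   using hidden_cover[OF \<tau>(1) h] .
  have c: "2 <= c" "c < n" and t: "2 <= t" "t < n" using piece_bounds ct by auto
  have "c ~: H" using ct by (simp add: H_def)
  then have cH: "corners c \<inter> H = {}" using parents_H[OF ct(1)] by (auto simp: corners_def)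
  have cS: "corners c \<subseteq> hull_piece v"
   using ct(1) piece_parents[OF ct(1)] by (auto simp: corners_def hull_piece_def)
  have subt: "sub t \<subseteq> piece v"
  proof
   fix k assume "k \<in> sub t"
   obtain u where "v <= u" "2 <= u" "u < n" "pa u = pa v" "pb u = pb v" "t \<in> sub u"
    using ct(3) by (auto elim!: pieceE)
   moreover have "k \<in> sub u" if "t \<in> sub u" for u
    using that \<open>k \<in> sub t\<close> unfolding sub_def by (auto simp flip: funpow_add[THEN fun_cong, unfolded o_apply])
   ultimately show "k \<in> piece v" using v by (auto simp: piece_def)
  qed
  have same: "inner r c = inner p c"
   using rp cH c parents'[OF c] by (auto simp: inner_def corners_def)
  have "r t \<in> inner r c"
  proof (rule nested_siblings[OF assms(1) rpl r_def])
   show "(\<rho> c = 2) = (\<rho> t = 2)" using ct by (simp add: \<rho>_def)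
   show "t \<in> hull_piece v" using ct by (simp add: hull_piece_def)
  qed (use ct c t cS in auto)
  have inside: "r k \<in> inner r c" if "k \<in> sub t" for k
   using that
  proof (induction k rule: less_induct)
   case (less k)
   show ?case
   proof (cases "k = t")
    case False
    have k: "2 <= k" "k < n" using sub_bounds less.prems t by auto
    have pbk: "pb k \<in> sub t" using sub_parents[OF t(1) less.prems False] by blast
    have "k ~: corners c"
    proof -
     have "t <= k" using sub_ge less.prems t by blast
     moreover have "k ~= c" using ct(4) \<open>t <= k\<close> by auto
     ultimately show ?thesis using parents'[OF t] ct by (auto simp: corners_def)
    qed
    moreover have "r (pb k) \<in> inner r c" using less.IH[OF parents'(2)[OF k] pbk] .
    moreover have "k \<in> hull_piece v" "pb k \<in> hull_piece v" using subt pbk less.prems by (auto simp: hull_piece_def)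
    moreover have "adj (pb k) k" using corners_adj[OF k] by blast
    ultimately show ?thesis using edge_from_inner[OF rpl c cS, of "pb k" k] by blast
   qed (use \<open>r t \<in> inner r c\<close> in simp)
  qed
  \<comment> \<open>Neighbours of an intruder are again inside the triangle or are corners of it.
    Induction along the construction order therefore leaves two possibilities: an end of the root
    edge, or a vertex on the base of \<open>c\<close>.\<close>
  have outside: "p x ~: inner p c" if "x < n" "x ~: piece v" for x
   using that
  proof (induction x rule: less_induct)
   case (less x)
   show ?case
   proof
    assume x: "p x \<in> inner p c"
    then have xc: "x ~: corners c" using corners_not_inner by blast
    have cn: "corners c \<subseteq> {..<n}" using cS hull_n by blast
    note go = edge_from_inner[OF pl c cn _ _ _ x]
    show False
    proof (cases "x < 2")
     case True
     \<comment> \<open>The other end of the root edge. It lies in the closed triangle, hence at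
       distance less than \<open>la 1\<close> from \<open>x\<close>, although \<open>la 1\<close> is
       the length of the root edge.\<close>
     define y where "y = 1 - x"
     have xy: "x = 0 & y = 1 | x = 1 & y = 0" using True by (auto simp: y_def)
     have "child 0 1" using n2 by (simp add: child_def base[unfolded One_nat_def])
     then have "adj x y" using xy by (auto simp: adj_def)
     then have "p y \<in> inner p c | y \<in> corners c" using go[of y] less.prems xy n2 by auto
     moreover have "p ` corners c \<subseteq> triangle (p (pa c)) (p (pb c)) (p c)"
      by (auto simp: corners_def intro: hull_inc)
     ultimately have "p y \<in> triangle (p (pa c)) (p (pb c)) (p c)"
      using interior_subset unfolding inner_def by blast
     moreover have "dist (p (pa c)) (p (pb c)) <= la 1" "dist (p (pa c)) (p c) <= la 1" "dist (p (pb c)) (p c) <= la 1"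
      using strict_child[OF assms(1) base_child[OF c]] edge_length_pos[OF base_child[OF c]]
       strict_corner[OF assms(1) c] lengths[of c] c by (auto simp: p_def)
     moreover have "0 < la 1" using lengths[of 1] n2 by simp
     ultimately have "dist (p x) (p y) < la 1"
      using interior_triangle_dist x unfolding inner_def by blast
     moreover have "dist (p 0) (p 1) = la 1"
      using strict_child[OF assms(1) \<open>child 0 1\<close>] by (simp add: edge_length_def p_def base[unfolded One_nat_def])
     ultimately show False using xy by (auto simp: dist_commute)
    next
     case False
     then have x2: "2 <= x" by simp
     note b = parents'[OF x2 less.prems(1)]
     \<comment> \<open>A parent other than these two corners would be an earlier intruder; it cannot
       be \<open>c\<close>, which belongs to the piece.\<close>
     have nb: "z \<in> {pa c, pb c}" if z: "z = pa x | z = pb x" for z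
     proof (rule ccontr)
      assume zc: "z ~: {pa c, pb c}"
      have "z ~: piece v" using piece_up[OF x2 less.prems(1)] less.prems z by blast
      then have "z ~: corners c" using zc ct(1) by (auto simp: corners_def)
      moreover have "adj x z" using corners_adj[OF x2 less.prems(1)] z adj_sym by blast
      ultimately have "p z \<in> inner p c" using go[of z] less.prems b z by auto
      then show False using less.IH[of z] b z less.prems \<open>z ~: piece v\<close> by auto
     qed
     have "pa x \<in> {pa c, pb c}" "pb x \<in> {pa c, pb c}" by (rule nb, simp)+
     then have eq: "pa x = pa c" "pb x = pb c"
      using b parents'[OF c] by auto
     have "pb c ~: piece v" using piece_up[OF x2 less.prems(1)] less.prems eq by auto
     then have "pa c = pa v" "pb c = pb v" using piece_parents(3)[OF ct(1)] by auto
     \<comment> \<open>The common base turns out to be the base of the piece. A vertex on it outside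
       the piece precedes \<open>v\<close>, hence \<open>c\<close>, so its sum of sides is at least
       that of \<open>c\<close>, which an interior point cannot have.\<close>
     then have "\<not> v <= x" using piece_top[of v x] v less.prems eq by auto
     then have "x < c" using piece_bounds[OF ct(1)] by simp
     then have "la c + lb c <= la x + lb x" using siblings[OF x2 _ c(2)] eq by simp
     moreover have "la x + lb x < la c + lb c"
      using inner_shorter[OF assms(1) c p_def x] strict_corner(1,2)[OF assms(1) x2 less.prems(1), of \<sigma>] eq
      by (simp add: p_def)
     ultimately show False by simp
    qed
   qed
  qed
  show ?thesis
   using c t cH cS ct same inside outside subt by (intro exI[of _ c] exI[of _ t]) auto
 qed

 \<comment> \<open>The far end of an edge at a hidden vertex is inside the triangle or a corner of
   it, so convexity keeps everything but possibly that end in the open triangle.\<close>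
 have hidden_edge: "\<exists>c. 2 <= c & c < n & corners c \<subseteq> hull_piece v & corners c \<inter> H = {} & r i \<in> inner r c &
   inner r c = inner p c & (\<forall>x<n. x ~: piece v --> p x ~: inner p c) &
   closed_segment (r i) (r j) \<subseteq> insert (r j) (inner p c) &
   (r j \<in> inner p c | j \<in> corners c)" if i: "i \<in> H" "adj i j" for i j
 proof -
  obtain c t where c: "2 <= c" "c < n" "2 <= t" "t < n" "corners c \<subseteq> hull_piece v" "corners c \<inter> H = {}"
   "pa t = pa c" "pb t = pb c" "i \<in> sub t" "sub t \<subseteq> piece v" "r ` sub t \<subseteq> inner r c"
   "inner r c = inner p c" "\<forall>x<n. x ~: piece v --> p x ~: inner p c"
   using shield[OF i(1)] by blast
  have ri: "r i \<in> inner r c" using c by blast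
  have j: "j \<in> sub t | j = pa c | j = pb c" using sub_adj[OF i(2) c(9,3)] c by simp
  then have rj: "r j \<in> inner r c | j \<in> corners c" using c by (auto simp: corners_def)
  have "r j \<in> closure (triangle (r (pa c)) (r (pb c)) (r c))"
  proof (cases "j \<in> corners c")
   case True
   then have "r j \<in> triangle (r (pa c)) (r (pb c)) (r c)"
    by (auto simp: corners_def intro: hull_inc)
   then show ?thesis using closure_subset by blast
  next
   case False
   then show ?thesis using rj interior_subset closure_subset unfolding inner_def by blast
  qed
  then have "open_segment (r i) (r j) \<subseteq> inner r c"
   using in_interior_closure_convex_segment[OF convex_convex_hull] ri unfolding inner_def by blast
  then have "closed_segment (r i) (r j) \<subseteq> insert (r j) (inner r c)"
   using ri by (auto simp: open_segment_def)
  then show ?thesis using c ri rj by (intro exI[of _ c]) auto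
 qed

 \<comment> \<open>Since \<open>k\<close> is not even a pole, \<open>piece_adj\<close> keeps
   \<open>l\<close> out of the piece as well. The edge is thus drawn as in the old drawing and
   avoids the triangle.\<close>
 have cross_free: "closed_segment (r i) (r j) \<inter> closed_segment (r k) (r l) = {}"
  if ij: "i \<in> H" "adj i j" and kl: "k ~: hull_piece v" "adj k l" "{i, j} \<inter> {k, l} = {}" for i j k l
 proof -
  obtain c where c: "2 <= c" "c < n" "corners c \<subseteq> hull_piece v" "corners c \<inter> H = {}" "r i \<in> inner r c"
   "inner r c = inner p c" "\<forall>x<n. x ~: piece v --> p x ~: inner p c"
   "closed_segment (r i) (r j) \<subseteq> insert (r j) (inner p c)" "r j \<in> inner p c | j \<in> corners c"
   using hidden_edge[OF ij] by blast
  have l: "l ~: piece v" using piece_adj[of l k v] kl adj_sym by blast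
  have k: "k ~: piece v" "k ~: corners c" using kl c by (auto simp: hull_piece_def)
  have n: "k < n" "l < n" using adj_bounds kl by auto
  have eq: "r k = p k" "r l = p l" using rp k l n by (auto simp: H_def)
  have avoid: "closed_segment (r k) (r l) \<inter> inner p c = {}"
   unfolding eq by (rule edge_avoids_inner[OF pl c(1,2)]) (use c k l n hull_n kl in auto)
  moreover have "r j ~: closed_segment (r k) (r l)"
  proof (cases "r j \<in> inner p c")
   case False
   then have j: "j \<in> corners c" "j ~: H" using c by auto
   then have "r j = p j" "j < n" using rp c hull_n by auto
   then show ?thesis unfolding eq using planar_vertex[OF pl, of j k l] n kl by auto
  qed (use avoid in blast)
  ultimately show ?thesis using c(8) by blast
 qed
 have vertex_free: "r x ~: closed_segment (r i) (r j)"
  if ij: "i \<in> H" "adj i j" and x: "x < n" "x ~: hull_piece v" for i j x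
 proof -
  obtain c where c: "2 <= c" "c < n" "corners c \<subseteq> hull_piece v" "corners c \<inter> H = {}" "r i \<in> inner r c"
   "inner r c = inner p c" "\<forall>x<n. x ~: piece v --> p x ~: inner p c"
   "closed_segment (r i) (r j) \<subseteq> insert (r j) (inner p c)" "r j \<in> inner p c | j \<in> corners c"
   using hidden_edge[OF ij] by blast
  have x': "x ~: piece v" "x ~: corners c" using x c by (auto simp: hull_piece_def)
  have eq: "r x = p x" using rp x' x by (auto simp: H_def)
  have out: "p x ~: inner p c" using c x x' by blast
  moreover have "p x ~= r j"
  proof (cases "r j \<in> inner p c")
   case False
   then have j: "j \<in> corners c" "j ~: H" using c by auto
   then have "r j = p j" using rp c hull_n by auto
   obtain z where z: "adj j z" "z \<in> corners c"
    using j(1) corners_adj[OF c(1,2)] adj_sym by (auto simp: corners_def)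
   then show ?thesis using p_adj[OF x(1) z(1)] x' j \<open>r j = p j\<close> by auto
  qed (use out in auto)
  ultimately show ?thesis unfolding eq using c(8) by blast
 qed
 have hidden_free: "r x ~: closed_segment (r i) (r j)"
  if x: "x \<in> H" and ij: "i ~: hull_piece v" "adj i j" for i j x
 proof -
  obtain c t where c: "2 <= c" "c < n" "corners c \<subseteq> hull_piece v" "x \<in> sub t" "r ` sub t \<subseteq> inner r c"
   "inner r c = inner p c" "\<forall>x<n. x ~: piece v --> p x ~: inner p c"
   using shield[OF x] by blast
  have j: "j ~: piece v" using piece_adj[of j i v] ij adj_sym by blast
  have i: "i ~: piece v" "i ~: corners c" using ij c by (auto simp: hull_piece_def)
  have n: "i < n" "j < n" using adj_bounds ij by auto
  have eq: "r i = p i" "r j = p j" using rp i j n by (auto simp: H_def)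
  have "closed_segment (r i) (r j) \<inter> inner p c = {}"
   unfolding eq by (rule edge_avoids_inner[OF pl c(1,2)]) (use c i j n hull_n ij in auto)
  then show ?thesis using c by blast
 qed
 have H_hull: "j \<in> hull_piece v" if "i \<in> H" "adj i j" for i j
  using piece_adj that by (auto simp: H_def)
 have Hp: "H \<subseteq> hull_piece v" by (auto simp: H_def hull_piece_def)
 have "planar {..<n} r"
  unfolding planar_def
 proof (intro conjI ballI impI)
  fix x i j assume a: "x \<in> {..<n}" "i \<in> {..<n}" "j \<in> {..<n}" "adj i j" "x ~= i" "x ~= j"
  have a': "adj j i" using a adj_sym by blast
  show "r x ~: closed_segment (r i) (r j)"
  proof (cases "{x, i, j} \<subseteq> hull_piece v")
   case True
   then show ?thesis using planar_vertex[OF rpl, of x i j] a by auto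
  next
   case out: False
   show ?thesis
   proof (cases "{x, i, j} \<inter> H = {}")
    case True
    then show ?thesis using planar_vertex[OF pl a] rp a by auto
   next
    case False
    then consider "i \<in> H" | "j \<in> H" | "x \<in> H" by blast
    then show ?thesis
    proof cases
     case 1
     then show ?thesis using out H_hull[OF 1 a(4)] Hp vertex_free[OF 1 a(4), of x] a by auto
    next
     case 2
     then show ?thesis using out H_hull[OF 2 a'] Hp vertex_free[OF 2 a', of x] a
      by (auto simp: closed_segment_commute)
    next
     case 3
     then show ?thesis using out Hp hidden_free[OF 3 _ a(4)] hidden_free[OF 3 _ a']
      by (auto simp: closed_segment_commute)
    qed
   qed
  qed
 next
  fix i j k l
  assume a: "i \<in> {..<n}" "j \<in> {..<n}" "k \<in> {..<n}" "l \<in> {..<n}" "adj i j" "adj k l" "{i, j} \<inter> {k, l} = {}"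
  have free: "closed_segment (r i) (r j) \<inter> closed_segment (r k) (r l) = {}"
   if ij: "i \<in> H" "adj i j" and kl: "adj k l" "{i, j} \<inter> {k, l} = {}" for i j k l
  proof (cases "{k, l} \<subseteq> hull_piece v")
   case True
   then show ?thesis using planar_disjoint[OF rpl, of i j k l] ij kl H_hull[OF ij] Hp by auto
  next
   case False
   then consider "k ~: hull_piece v" | "l ~: hull_piece v" by blast
   then show ?thesis
   proof cases
    case 1
    then show ?thesis using cross_free[OF ij] kl by blast
   next
    case 2
    have "adj l k" "{i, j} \<inter> {l, k} = {}" using kl adj_sym by auto
    then show ?thesis using cross_free[OF ij 2] by (simp add: closed_segment_commute)
   qed
  qed
  have a': "adj j i" "adj l k" using a adj_sym by blast+
  show "closed_segment (r i) (r j) \<inter> closed_segment (r k) (r l) = {}"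
  proof (cases "{i, j, k, l} \<inter> H = {}")
   case True
   then have "r i = p i" "r j = p j" "r k = p k" "r l = p l" using rp a by auto
   then show ?thesis using planar_disjoint[OF pl a] by simp
  next
   case False
   then consider "i \<in> H" | "j \<in> H" | "k \<in> H" | "l \<in> H" by blast
   then show ?thesis
   proof cases
    case 1
    then show ?thesis using free[of i j k l] a by blast
   next
    case 2
    then show ?thesis using free[of j i k l] a a' by (auto simp: closed_segment_commute insert_commute)
   next
    case 3
    then show ?thesis using free[of k l i j] a by (auto simp: Int_commute)
   next
    case 4
    then have "closed_segment (r l) (r k) \<inter> closed_segment (r i) (r j) = {}"
     using free[of l k i j] a a' by blast
    then show ?thesis by (simp add: closed_segment_commute Int_commute)
   qed
  qed
 qed
 then show ?thesis by (simp add: r_def \<rho>_def)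
qed

end

context parent_structure
begin

subsection \<open>Completeness of the tables\<close>

lemma signs_on_restr: "signs_on E \<sigma> ==> D \<subseteq> E ==> signs_on D (restr D \<sigma>)"
 using signs_onD[of E \<sigma>] by (auto simp: signs_on_def restr_def)

text \<open>Restriction to a sub-piece can only uncover vertices: earlier siblings with the same
  sign may be dropped, none are added. A vertex visible in the sub-piece may well be hidden in the
  larger piece.\<close>

lemma vis_restr:
 assumes A: "signs_on (piece v) A" and uv: "piece u \<subseteq> piece v" and "k \<in> piece u" "vis A k"
 shows "vis (restr (piece u) A) k"
 using assms(3,4)
proof (induction k rule: less_induct)
 case (less k)
 note u = signs_on_restr[OF A uv]
 have k: "k \<in> piece v" "2 <= k" "k < n" using uv less.prems piece_bounds by auto
 have A0: "A k ~= 0" using vis_nonzero less.prems by blast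
 note visA = vis_iff[OF A k(1)]
 show ?case
  unfolding vis_iff[OF u less.prems(1)]
 proof (intro conjI allI impI)
  fix j assume "j < k" "pa j = pa k & pb j = pb k"
  then have "A j ~= A k" using visA less.prems(2) by blast
  then show "restr (piece u) A j ~= restr (piece u) A k"
   using A0 less.prems(1) by (simp add: restr_def)
 next
  assume "pb k \<in> piece u"
  then show "vis (restr (piece u) A) (pb k)"
   using less.IH[OF parents'(2)[OF k(2,3)]] visA less.prems(2) uv by blast
 qed
qed

text \<open>Together with a vertex, \<open>piece u\<close> contains its later siblings, so a vertex
  outside has all its earlier siblings outside and sees no change. A vertex inside is visible within
  the sub-piece, where the keys agree.\<close>

lemma vis_transfer:
 assumes A: "signs_on (piece v) A" and B: "signs_on (piece v) B" and uv: "piece u \<subseteq> piece v"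
  and out: "\<And>k. k ~: piece u ==> A k = B k"
  and keys: "key (restr (piece u) A) = key (restr (piece u) B)"
  and "k \<in> piece v" "vis A k"
 shows "vis B k & A k = B k"
 using assms(6,7)
proof (induction k rule: less_induct)
 case (less k)
 have k: "2 <= k" "k < n" using less.prems piece_bounds by auto
 note visA = vis_iff[OF A less.prems(1)] and visB = vis_iff[OF B less.prems(1)]
 have pb: "pb k \<in> piece v --> vis B (pb k)"
  using less.IH[of "pb k"] parents'(2)[OF k] less.prems(2) visA by blast
 show ?case
 proof (cases "k \<in> piece u")
  case False
  have "B j ~= B k" if j: "j < k" "pa j = pa k" "pb j = pb k" for j
  proof -
   have "j ~: piece u"
   proof
    assume ju: "j \<in> piece u"
    show False
    proof (cases "pb j \<in> piece u")
     case True
     then show False using piece_up[OF k] j False by auto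
    next
     case nb: False
     then have "pa k = pa u" "pb k = pb u" using piece_parents(3)[OF ju] j by auto
     moreover have "u <= k" "2 <= u" using piece_bounds[OF ju] j by auto
     ultimately show False using piece_top[of u k] k False by auto
    qed
   qed
   then show ?thesis using out[of j] out[OF False] visA less.prems(2) j by auto
  qed
  then show ?thesis using pb visB out[OF False] by blast
 next
  case True
  have "vis (restr (piece u) A) k" using vis_restr[OF A uv True less.prems(2)] .
  then have vu: "vis (restr (piece u) B) k" and eq: "A k = B k"
   using key_eq[OF keys, of k] True by (auto simp: restr_def)
  note visu = vis_iff[OF signs_on_restr[OF B uv] True]
  have "B j ~= B k" if j: "j < k" "pa j = pa k" "pb j = pb k" for j
  proof (cases "j \<in> piece u")
   case jT: True
   then show ?thesis using visu vu j True by (auto simp: restr_def)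
  next
   case False
   then show ?thesis using out[OF False] eq visA less.prems(2) j by auto
  qed
  then show ?thesis using pb visB eq by blast
 qed
qed

lemma key_transfer:
 assumes A: "signs_on (piece v) A" and B: "signs_on (piece v) B" and uv: "piece u \<subseteq> piece v"
  and out: "\<And>k. k ~: piece u ==> A k = B k"
  and keys: "key (restr (piece u) A) = key (restr (piece u) B)"
 shows "key A = key B"
proof
 fix k
 have nz: "vis A k ==> k \<in> piece v" "vis B k ==> k \<in> piece v"
  using vis_nonzero signs_on_nonzero[OF A] signs_on_nonzero[OF B] by blast+
 show "key A k = key B k"
 proof (cases "vis A k")
  case True
  then show ?thesis using vis_transfer[OF A B uv out keys nz(1) True] by (simp add: key_def)
 next
  case False
  have "\<not> vis B k"
   using vis_transfer[OF B A uv out[symmetric] keys[symmetric]] nz(2) False by blast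
  then show ?thesis using False by (simp add: key_def)
 qed
qed

text \<open>Addition merges the three vectors because their supports are disjoint and undrawn
  vertices have sign 0; the program does the same.\<close>

definition join :: "nat => nat => (nat => nat) => (nat => nat) => (nat => nat) => nat => nat" where
 "join v s X Y Z k = (if k = v then s else X k + Y k + Z k)"

text \<open>Which representative of a key is stored depends on the order of the loops. Completeness
  rests only on these two properties, soundness of the entries and closure under sound joins up to
  the key.\<close>

definition table :: "(nat => (nat => nat) set) => nat => bool" where
 "table L v \<longleftrightarrow> (\<forall>\<sigma>\<in>L v. signs_on (piece v) \<sigma> & sound v \<sigma>) &
   (\<forall>X\<in>L (first_child (pa v) (pb v) v). \<forall>Y\<in>L (first_child (pa v) v v).
   \<forall>Z\<in>L (first_child (pb v) v v). \<forall>s\<in>{1, 2}.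
    sound v (join v s X Y Z) --> (\<exists>\<tau>\<in>L v. key \<tau> = key (join v s X Y Z)))"

lemma swap_table:
 assumes strict and \<sigma>: "signs_on (piece 2) \<sigma>" "planar {..<n} (pos \<sigma>)" and v: "2 <= v" "v < n"
  and u: "u = 0 | 2 <= u & u < n" "piece u \<subseteq> piece v" and n: "3 <= n"
  and \<tau>: "signs_on (piece u) \<tau>" "u ~= 0 --> sound u \<tau>" "key \<tau> = key (restr (piece u) \<sigma>)"
 defines "\<sigma>' \<equiv> \<lambda>k. if k \<in> piece u then \<tau> k else \<sigma> k"
 shows "signs_on (piece 2) \<sigma>'" "planar {..<n} (pos \<sigma>')"
  "key (restr (piece v) \<sigma>') = key (restr (piece v) \<sigma>)" "restr (piece u) \<sigma>' = \<tau>"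
proof -
 have sub: "piece w \<subseteq> piece 2" for w
  using piece_bounds[of _ w] unfolding piece_2[OF n] by fastforce
 show s': "signs_on (piece 2) \<sigma>'"
  unfolding signs_on_def
 proof
  fix k show "if k \<in> piece 2 then \<sigma>' k = 1 | \<sigma>' k = 2 else \<sigma>' k = 0"
   using sub[of u] signs_onD[OF \<tau>(1), of k] signs_onD[OF \<sigma>(1), of k] by (auto simp: \<sigma>'_def)
 qed
 show "planar {..<n} (pos \<sigma>')"
 proof (cases "u = 0")
  case True
  then have "\<sigma>' = \<sigma>" by (simp add: \<sigma>'_def)
  then show ?thesis using \<sigma> by simp
 next
  case False
  then show ?thesis
   unfolding \<sigma>'_def using u \<tau> \<sigma>(2) assms(1) by (intro swap) (auto simp: sound_def)
 qed
 show r: "restr (piece u) \<sigma>' = \<tau>"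
  using signs_onD(2)[OF \<tau>(1)] by (auto simp: restr_def \<sigma>'_def fun_eq_iff)
 have rr: "restr (piece u) (restr (piece v) \<rho>) = restr (piece u) \<rho>" for \<rho>
  using u(2) by (auto simp: restr_def fun_eq_iff)
 show "key (restr (piece v) \<sigma>') = key (restr (piece v) \<sigma>)"
 proof (rule key_transfer[OF signs_on_restr[OF s' sub] signs_on_restr[OF \<sigma>(1) sub] u(2)])
  show "key (restr (piece u) (restr (piece v) \<sigma>')) = key (restr (piece u) (restr (piece v) \<sigma>))"
   unfolding rr r using \<tau>(3) .
 qed (auto simp: restr_def \<sigma>'_def)
qed

text \<open>The drawing is transformed step by step: each of the three sub-pieces is replaced by its
  stored representative, every swap keeping the whole drawing planar and the key of the piece. What
  results in the piece is a join of entries, for which closure yields a representative.\<close>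

lemma tables_complete:
 assumes strict and n: "3 <= n" and L0: "L 0 = {\<lambda>_. 0}"
  and L: "\<And>v. 2 <= v ==> v < n ==> table L v"
  and \<sigma>: "signs_on (piece 2) \<sigma>" "planar {..<n} (pos \<sigma>)" and v: "v = 0 | 2 <= v & v < n"
 shows "\<exists>\<tau>\<in>L v. key \<tau> = key (restr (piece v) \<sigma>)"
 using v \<sigma>
\<comment> \<open>Children have larger indices, so \<open>n - v\<close> decreases; the missing child
  0 gets the least measure. \<sigma> is generalized because it differs from one child to the
  next.\<close>
proof (induction "if v = 0 then 0 else n - v" arbitrary: v \<sigma> rule: less_induct)
 case less
 have sub: "piece w \<subseteq> piece 2" for w
  using piece_bounds[of _ w] unfolding piece_2[OF n] by fastforce
 show ?case
 proof (cases "v = 0")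
  case True
  have "restr {} \<sigma> = (\<lambda>_. 0)" by (auto simp: restr_def)
  then show ?thesis using True L0 by simp
 next
  case False
  then have v: "2 <= v" "v < n" using less.prems by auto
  define p1 p2 p3 where "p1 = first_child (pa v) (pb v) v" and "p2 = first_child (pa v) v v"
   and "p3 = first_child (pb v) v v"
  note D = piece_decompose[OF v, folded p1_def p2_def p3_def]
  have fc: "first_child x y v = 0 | (v < first_child x y v & first_child x y v < n)" for x y
   by (cases rule: first_child_cases[of x y v]) auto
  have pick: "\<exists>\<tau>\<in>L u. signs_on (piece u) \<tau> & (u ~= 0 --> sound u \<tau>) & key \<tau> = key (restr (piece u) \<rho>)"
   if u: "u = 0 | (v < u & u < n)" and \<rho>: "signs_on (piece 2) \<rho>" "planar {..<n} (pos \<rho>)" for u \<rho>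
  proof -
   have "\<exists>\<tau>\<in>L u. key \<tau> = key (restr (piece u) \<rho>)"
    using less.hyps[OF _ _ \<rho>, of u] u v by auto
   moreover have "signs_on (piece u) \<tau> & (u ~= 0 --> sound u \<tau>)" if "\<tau> \<in> L u" for \<tau>
   proof (cases "u = 0")
    case True
    then show ?thesis using that L0 by (simp add: signs_on_def)
   next
    case False
    then show ?thesis using that L[of u] u v by (auto simp: table_def)
   qed
   ultimately show ?thesis by blast
  qed
  have u: "p1 = 0 | 2 <= p1 & p1 < n" "p2 = 0 | 2 <= p2 & p2 < n" "p3 = 0 | 2 <= p3 & p3 < n"
   using fc v unfolding p1_def p2_def p3_def by (meson le_trans less_imp_le)+
  have uv: "piece p1 \<subseteq> piece v" "piece p2 \<subseteq> piece v" "piece p3 \<subseteq> piece v" using D(1) by auto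
  have fcs: "p1 = 0 | v < p1 & p1 < n" "p2 = 0 | v < p2 & p2 < n" "p3 = 0 | v < p3 & p3 < n"
   unfolding p1_def p2_def p3_def by (rule fc)+
  obtain X where X: "X \<in> L p1" "signs_on (piece p1) X" "p1 ~= 0 --> sound p1 X" "key X = key (restr (piece p1) \<sigma>)"
   using pick[OF fcs(1) less.prems(2,3)] by blast
  define \<sigma>1 where "\<sigma>1 = (\<lambda>k. if k \<in> piece p1 then X k else \<sigma> k)"
  note s1 = swap_table[OF assms(1) less.prems(2,3) v u(1) uv(1) n X(2,3,4), folded \<sigma>1_def]
  obtain Y where Y: "Y \<in> L p2" "signs_on (piece p2) Y" "p2 ~= 0 --> sound p2 Y" "key Y = key (restr (piece p2) \<sigma>1)"
   using pick[OF fcs(2) s1(1,2)] by blast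
  define \<sigma>2 where "\<sigma>2 = (\<lambda>k. if k \<in> piece p2 then Y k else \<sigma>1 k)"
  note s2 = swap_table[OF assms(1) s1(1,2) v u(2) uv(2) n Y(2,3,4), folded \<sigma>2_def]
  obtain Z where Z: "Z \<in> L p3" "signs_on (piece p3) Z" "p3 ~= 0 --> sound p3 Z" "key Z = key (restr (piece p3) \<sigma>2)"
   using pick[OF fcs(3) s2(1,2)] by blast
  define \<sigma>3 where "\<sigma>3 = (\<lambda>k. if k \<in> piece p3 then Z k else \<sigma>2 k)"
  note s3 = swap_table[OF assms(1) s2(1,2) v u(3) uv(3) n Z(2,3,4), folded \<sigma>3_def]
  let ?\<tau> = "restr (piece v) \<sigma>3"
  \<comment> \<open>The sub-pieces do not contain \<open>v\<close>, so its sign is still that of the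
    original \<sigma>.\<close>
  have join: "?\<tau> = join v (\<sigma> v) X Y Z"
  proof
   fix k
   show "?\<tau> k = join v (\<sigma> v) X Y Z k"
    using D signs_onD(2)[OF X(2), of k] signs_onD(2)[OF Y(2), of k] signs_onD(2)[OF Z(2), of k]
    by (auto simp: restr_def join_def \<sigma>1_def \<sigma>2_def \<sigma>3_def)
  qed
  have eq: "\<And>k. k \<in> piece v ==> ?\<tau> k = \<sigma>3 k" by (simp add: restr_def)
  obtain f where "rigid f" "\<And>k. k \<in> hull_piece v ==> pos ?\<tau> k = f (pos \<sigma>3 k)"
   using piece_congruent[of v ?\<tau> \<sigma>3] assms(1) v eq by blast
  moreover have "hull_piece v \<subseteq> {..<n}"
   using piece_bounds parents'[OF v] v by (auto simp: hull_piece_def)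
  ultimately have "planar (hull_piece v) (pos ?\<tau>)"
   using planar_rigid planar_subset s3(2) by metis
  moreover have "0 < discr (la k) (lb k) (base_sqdist ?\<tau> k)" if "k \<in> piece v" for k
   using strict_discr[OF assms(1)] piece_bounds[OF that] by blast
  ultimately have "sound v ?\<tau>" by (simp add: sound_def)
  moreover have "\<sigma> v \<in> {1, 2}" using signs_onD(1)[OF less.prems(2), of v] piece_2[OF n] v by auto
  ultimately obtain \<tau> where "\<tau> \<in> L v" "key \<tau> = key ?\<tau>"
   using L[OF v] X(1) Y(1) Z(1) unfolding join table_def p1_def p2_def p3_def by blast
  then show ?thesis using s1(3) s2(3) s3(3) by auto
 qed
qed

lemma planar_cross:
 assumes "planar {..<n} p" "2 <= k" "k < n"
 shows "p (pa k) ~= p (pb k)" "cross (p (pa k)) (p (pb k)) (p k) ~= 0"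
proof -
 have b: "pa k < n" "pb k < n" "pa k ~= pb k" "pa k ~= k" "pb k ~= k"
  using parents'[OF assms(2,3)] assms by auto
 note adj = corners_adj[OF assms(2,3)]
 have v: "p (pb k) ~: closed_segment (p (pa k)) (p k)" "p (pa k) ~: closed_segment (p (pb k)) (p k)"
  "p k ~: closed_segment (p (pa k)) (p (pb k))"
  using planar_vertex[OF assms(1), of "pb k" "pa k" k] planar_vertex[OF assms(1), of "pa k" "pb k" k]
   planar_vertex[OF assms(1), of k "pa k" "pb k"] b adj assms by auto
 then show "p (pa k) ~= p (pb k)" by auto
 show "cross (p (pa k)) (p (pb k)) (p k) ~= 0" using collinear_between v by blast
qed

text \<open>Reading off on which side of its base each vertex lies gives the signs. A rigid motion
  that normalizes the root edge then matches the realization with \<open>pos\<close>, vertex by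
  vertex through \<open>apex_unique\<close>.\<close>

lemma realizes_signs:
 assumes "realizes p" "3 <= n"
 obtains \<sigma> where "signs_on (piece 2) \<sigma>" "planar {..<n} (pos \<sigma>)" strict
proof -
 define \<sigma> :: "nat => nat" where "\<sigma> = (\<lambda>k. if 2 <= k & k < n then
   (if cross (p (pa k)) (p (pb k)) (p k) < 0 then 2 else 1) else 0)"
 have pl: "planar {..<n} p" and len: "\<And>k. k < n ==> lengths_ok p k"
  using assms by (auto simp: realizes_def lengths_ok_def)
 have d: "dist (p 0) (p 1) = la 1"
  using len[of 1] n2 by (simp add: lengths_ok_def base[unfolded One_nat_def])
 have pos01: "dist (pos \<sigma> 0) (pos \<sigma> 1) = la 1" "pos \<sigma> 0 ~= pos \<sigma> 1"
  using lengths[of 1] n2 by (auto simp: pos_simps pos_simps(2)[unfolded One_nat_def] dist_Pair_Pair)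
 obtain f where f: "rigid f" "f (pos \<sigma> 0) = p 0" "f (pos \<sigma> 1) = p 1"
  using rigid_exists[OF pos01(2)] pos01(1) d by metis
 have fp: "p k = f (pos \<sigma> k)" if "k < n" for k
  using that
 proof (induction k rule: less_induct)
  case (less k)
  consider "k = 0" | "k = 1" | "2 <= k" by linarith
  then show ?case
  proof cases
   case 3
   note b = parents'[OF 3 less.prems]
   note c = planar_cross[OF pl 3 less.prems]
   have "p k = apex (la k) (lb k) (\<sigma> k = 2) (p (pa k)) (p (pb k))"
   proof -
    have "(\<sigma> k = 2) = (cross (p (pa k)) (p (pb k)) (p k) < 0)" using 3 less.prems by (simp add: \<sigma>_def)
    moreover have "dist (p (pa k)) (p k) = la k" "dist (p (pb k)) (p k) = lb k"
     using len[OF less.prems] 3 less.prems by (simp_all add: lengths_ok_def)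
    ultimately show ?thesis using apex_unique(1)[OF c] by (simp only:)
   qed
   moreover have "p (pa k) = f (pos \<sigma> (pa k))" "p (pb k) = f (pos \<sigma> (pb k))"
    using less b by auto
   ultimately show ?thesis using rigid_apex[OF f(1)] pos_simps(3)[OF 3 less.prems] by simp
  qed (use f in simp_all)
 qed
 have "planar {..<n} (pos \<sigma>)" using planar_rigid[OF f(1), of "{..<n}" p "pos \<sigma>"] fp pl by simp
 moreover have strict
 proof (rule valid_strict)
  fix k assume k: "2 <= k" "k < n"
  have "sqdist (p (pa k)) (p (pb k)) = base_sqdist \<sigma> k"
   using fp parents'[OF k] k rigid_sqdist[OF f(1)] by (simp add: base_sqdist_def)
  then show "0 < discr (la k) (lb k) (base_sqdist \<sigma> k)"
   using apex_unique(2)[OF planar_cross[OF pl k]] len[OF k(2)] k by (simp add: lengths_ok_def)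
 qed
 moreover have "signs_on (piece 2) \<sigma>"
  unfolding piece_2[OF assms(2)] by (auto simp: signs_on_def \<sigma>_def)
 ultimately show ?thesis using that by blast
qed

lemma sound_realizes:
 assumes "sound 2 \<sigma>" "3 <= n"
 shows "realizes (pos \<sigma>)"
proof -
 have "pa 2 = 0" "pb 2 = 1" using parents[of 2] assms(2) base by auto
 then have "hull_piece 2 = {..<n}" using assms(2) by (auto simp: hull_piece_def piece_2)
 moreover have "lengths_ok (pos \<sigma>) k" if "k < n" for k
  using valid_lengths[OF _ that, of \<sigma>] assms by (auto simp: sound_def piece_2)
 ultimately show ?thesis using assms by (auto simp: realizes_def sound_def lengths_ok_def)
qed

theorem tables_decide:
 assumes "3 <= n" "L 0 = {\<lambda>_. 0}" "\<And>v. 2 <= v ==> v < n ==> table L v"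
 shows "(\<exists>p. realizes p) \<longleftrightarrow> L 2 ~= {}" "\<sigma> \<in> L 2 ==> realizes (pos \<sigma>)"
proof -
 show real: "realizes (pos \<sigma>)" if "\<sigma> \<in> L 2" for \<sigma>
  using assms(3)[of 2] that assms(1) by (auto simp: table_def intro: sound_realizes)
 show "(\<exists>p. realizes p) \<longleftrightarrow> L 2 ~= {}"
 proof
  assume "\<exists>p. realizes p"
  then obtain p where "realizes p" ..
  then obtain \<sigma> where "signs_on (piece 2) \<sigma>" "planar {..<n} (pos \<sigma>)" strict
   using realizes_signs assms(1) by blast
  then show "L 2 ~= {}" using tables_complete[of L \<sigma> 2] assms by auto
 qed (use real in blast)
qed

end

subsection \<open>Counting\<close>

text \<open>A set with at most \<open>N\<close> elements is listed by \<open>N\<close> entries over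
  an alphabet with one extra letter for padding.\<close>

lemma card_small_subsets:
 assumes "finite A"
 shows "card {S. S \<subseteq> A & card S <= N} <= (card A + 1) ^ N" "finite {S. S \<subseteq> A & card S <= N}"
proof -
 let ?B = "insert None (Some ` A)"
 let ?X = "{xs. set xs \<subseteq> ?B & length xs = N}"
 have fin: "finite ?B" using assms by simp
 have sub: "{S. S \<subseteq> A & card S <= N} \<subseteq> (\<lambda>xs. {x. Some x \<in> set xs}) ` ?X"
 proof
  fix S assume "S \<in> {S. S \<subseteq> A & card S <= N}"
  then have S: "S \<subseteq> A" "card S <= N" "finite S" using assms finite_subset by auto
  then obtain ys where ys: "set ys = S" "length ys = card S"
   using finite_distinct_list distinct_card by metis
  have "S = {x. Some x \<in> set (map Some ys @ replicate (N - card S) None)}"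
   using ys by auto
  moreover have "map Some ys @ replicate (N - card S) None \<in> ?X" using S ys by auto
  ultimately show "S \<in> (\<lambda>xs. {x. Some x \<in> set xs}) ` ?X" by blast
 qed
 have "finite ?X" using fin by (rule finite_lists_length_eq)
 then have "card {S. S \<subseteq> A & card S <= N} <= card ?X" using sub by (rule surj_card_le)
 also have "card ?X = card ?B ^ N" using fin by (rule card_lists_length_eq)
 also have "card ?B = card A + 1"
  using assms by (simp add: card_insert_if card_image)
 finally show "card {S. S \<subseteq> A & card S <= N} <= (card A + 1) ^ N" .
 show "finite {S. S \<subseteq> A & card S <= N}"
  using assms by (auto intro: rev_finite_subset[of "Pow A"])
qed

text \<open>A function is identified with its graph on the support, a set of at most
  \<open>N\<close> among \<open>2 * n\<close> pairs of vertex and sign.\<close>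

lemma card_sparse_functions:
 fixes F :: "(nat => nat) set"
 assumes "\<And>g k. g \<in> F ==> g k ~= 0 ==> k < n & g k <= 2" "\<And>g. g \<in> F ==> card {k. g k ~= 0} <= N"
 shows "finite F" "card F <= (2 * n + 1) ^ N"
proof -
 let ?G = "\<lambda>g :: nat => nat. {(k, g k) |k. g k ~= 0}"
 let ?A = "{..<n} \<times> {1, 2 :: nat}"
 have inj: "inj_on ?G F"
 proof (rule inj_onI, rule ext)
  fix g h k assume "?G g = ?G h"
  then have "(k, l) \<in> ?G g \<longleftrightarrow> (k, l) \<in> ?G h" for l by simp
  then have *: "g k = l & l ~= 0 \<longleftrightarrow> h k = l & l ~= 0" for l by auto
  show "g k = h k" using *[of "g k"] *[of "h k"] by (cases "g k = 0"; cases "h k = 0") auto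
 qed
 have img: "?G ` F \<subseteq> {S. S \<subseteq> ?A & card S <= N}"
 proof clarify
  fix g assume g: "g \<in> F"
  have "?G g = (\<lambda>k. (k, g k)) ` {k. g k ~= 0}" by auto
  then have "card (?G g) = card {k. g k ~= 0}" by (simp add: card_image inj_on_def)
  moreover have "(k, g k) \<in> ?A" if "g k ~= 0" for k using assms(1)[OF g that] that by auto
  ultimately show "?G g \<subseteq> ?A & card (?G g) <= N" using assms(2)[OF g] by auto
 qed
 have A: "finite ?A" "card ?A = 2 * n" by (simp_all add: card_cartesian_product)
 note S = card_small_subsets[OF A(1), of N]
 show "finite F" by (rule finite_imageD[OF finite_subset[OF img S(2)] inj])
 have "card F = card (?G ` F)" using inj by (simp add: card_image)
 also have "\<dots> <= card {S. S \<subseteq> ?A & card S <= N}" by (rule card_mono[OF S(2) img])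
 also have "\<dots> <= (2 * n + 1) ^ N" using S(1) by (simp only: A(2))
 finally show "card F <= (2 * n + 1) ^ N" .
qed

context parent_structure
begin

function depth :: "nat => nat" where
 "depth k = (if 2 <= k & pb k < k then Suc (depth (pb k)) else 0)"
 by pat_completeness auto
termination by (relation "Wellfounded.measure id") auto

declare depth.simps [simp del]

lemma depth_step: "2 <= k ==> k < n ==> depth k = Suc (depth (pb k))"
 by (subst depth.simps) (simp add: parents')

lemma depth_piece: "k \<in> piece v ==> depth v <= depth k & (pb k \<in> piece v --> depth v < depth k)
  & (pb k ~: piece v --> depth k = depth v)"
proof (induction k rule: less_induct)
 case (less k)
 then have k: "2 <= k" "k < n" "2 <= v" "v < n" using piece_bounds by auto
 show ?case
 proof (cases "pb k \<in> piece v")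
  case True
  then show ?thesis using less.IH[of "pb k"] parents'[OF k(1,2)] depth_step[OF k(1,2)] by auto
 next
  case False
  then show ?thesis using piece_parents(3)[OF less.prems] depth_step[OF k(1,2)] depth_step[OF k(3,4)] by auto
 qed
qed

text \<open>A base carries at most one visible triangle per sign, and a visible triangle offers two
  new bases. This gives the factor 4 per level, starting from 2 triangles on the base of the
  piece.\<close>

lemma card_visible_level:
 assumes \<sigma>: "signs_on (piece v) \<sigma>"
 defines "S \<equiv> \<lambda>i. {k. vis \<sigma> k & depth k = Suc i}"
 shows "finite (S i)" "card (S i) <= 2 * 4 ^ i"
proof -
 have in_piece: "k \<in> piece v" if "vis \<sigma> k" for k
  using vis_nonzero[OF that] signs_on_nonzero[OF \<sigma>] by blast
 have fin: "finite (S i)" for i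
  by (rule finite_subset[of _ "{..<n}"]) (use in_piece piece_bounds in \<open>auto simp: S_def\<close>)
 then show "finite (S i)" .
 have sib: "k = l" if "vis \<sigma> k" "vis \<sigma> l" "pa k = pa l" "pb k = pb l" "\<sigma> k = \<sigma> l" for k l
  using vis_iff[OF \<sigma> in_piece[OF that(1)]] vis_iff[OF \<sigma> in_piece[OF that(2)]] that
  by (metis linorder_neqE_nat)
 have two: "\<sigma> k \<in> {1, 2}" if "vis \<sigma> k" for k using signs_onD(1)[OF \<sigma> in_piece[OF that]] by auto
 \<comment> \<open>The uppermost level of the piece, where all triangles share its base. It can
   occur at any depth, since pieces hang at different depths of the tree.\<close>
 have top: "card (S i) <= 2" if t: "\<And>k. k \<in> S i ==> pb k ~: piece v" for i
 proof -
  have "inj_on \<sigma> (S i)"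
  proof (rule inj_onI)
   fix k l assume kl: "k \<in> S i" "l \<in> S i" "\<sigma> k = \<sigma> l"
   then have v: "vis \<sigma> k" "vis \<sigma> l" by (simp_all add: S_def)
   show "k = l"
    using sib[OF v] kl piece_parents(3)[OF in_piece[OF v(1)] t[OF kl(1)]]
     piece_parents(3)[OF in_piece[OF v(2)] t[OF kl(2)]] by simp
  qed
  moreover have "\<sigma> ` S i \<subseteq> {1, 2}" using two by (auto simp: S_def)
  ultimately have "card (S i) <= card {1, 2 :: nat}" by (intro card_inj_on_le) auto
  then show ?thesis by simp
 qed
 show "card (S i) <= 2 * 4 ^ i"
 proof (induction i)
  case 0
  have "pb k ~: piece v" if "k \<in> S 0" for k
  proof -
   have k: "k \<in> piece v" "depth k = 1" using that in_piece by (auto simp: S_def)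
   have "2 <= v" "v < n" using piece_bounds[OF k(1)] by auto
   then show ?thesis using depth_piece[OF k(1)] depth_step[of v] k(2) by auto
  qed
  then show ?case using top[of 0] by simp
 next
  case (Suc i)
  show ?case
  proof (cases "depth v = Suc (Suc i)")
   case True
   have "pb k ~: piece v" if "k \<in> S (Suc i)" for k
   proof -
    have k: "k \<in> piece v" "depth k = Suc (Suc i)" using that in_piece by (auto simp: S_def)
    then show ?thesis using depth_piece[OF k(1)] True by auto
   qed
   then have "card (S (Suc i)) <= 2" by (rule top)
   also have "\<dots> <= 2 * 4 ^ Suc i" using one_le_power[of "4 :: nat" "Suc i"] by simp
   finally show ?thesis .
  next
   case False
   \<comment> \<open>A visible vertex is determined by its parent, the choice of one of the two free
     sides, encoded as a truth value, and its sign.\<close>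
   let ?f = "\<lambda>k. (pb k, (pa k = pa (pb k), \<sigma> k))"
   have mem: "pb k \<in> piece v & vis \<sigma> (pb k) & depth (pb k) = Suc i & (pa k = pa (pb k) | pa k = pb (pb k))"
    if "k \<in> S (Suc i)" for k
   proof -
    have k: "vis \<sigma> k" "depth k = Suc (Suc i)" "k \<in> piece v" using that in_piece by (auto simp: S_def)
    then have b: "2 <= k" "k < n" using piece_bounds by auto
    have "pb k \<in> piece v" using depth_piece[OF k(3)] k(2) False by auto
    then show ?thesis using vis_iff[OF \<sigma> k(3)] k depth_step[OF b] parents[OF b] by auto
   qed
   have "inj_on ?f (S (Suc i))"
   proof (rule inj_onI)
    fix k l assume kl: "k \<in> S (Suc i)" "l \<in> S (Suc i)" "?f k = ?f l"
    then have "pa k = pa l" using mem[OF kl(1)] mem[OF kl(2)] by auto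
    then show "k = l" using sib[of k l] kl by (auto simp: S_def)
   qed
   moreover have "?f ` S (Suc i) \<subseteq> S i \<times> (UNIV \<times> {1, 2})"
    using mem two by (fastforce simp: S_def)
   moreover have "finite (S i \<times> ((UNIV :: bool set) \<times> {1, 2 :: nat}))" using fin by simp
   ultimately have "card (S (Suc i)) <= card (S i \<times> ((UNIV :: bool set) \<times> {1, 2 :: nat}))"
    by (intro card_inj_on_le)
   also have "\<dots> = 4 * card (S i)" by (simp add: card_cartesian_product)
   also have "\<dots> <= 2 * 4 ^ Suc i" using Suc.IH by simp
   finally show ?thesis .
  qed
 qed
qed

lemma card_visible:
 assumes \<sigma>: "signs_on (piece v) \<sigma>" and d: "\<And>k. k < n ==> depth k <= d"
 shows "card {k. vis \<sigma> k} <= 4 ^ d"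
proof -
 have in_piece: "k \<in> piece v" if "vis \<sigma> k" for k
  using vis_nonzero[OF that] signs_on_nonzero[OF \<sigma>] by blast
 have "{k. vis \<sigma> k} \<subseteq> (\<Union>i<d. {k. vis \<sigma> k & depth k = Suc i})"
 proof
  fix k assume "k \<in> {k. vis \<sigma> k}"
  then have "vis \<sigma> k" "2 <= k" "k < n" using in_piece piece_bounds by auto
  then show "k \<in> (\<Union>i<d. {k. vis \<sigma> k & depth k = Suc i})"
   using d[of k] depth_step[of k] by auto
 qed
 then have "card {k. vis \<sigma> k} <= card (\<Union>i<d. {k. vis \<sigma> k & depth k = Suc i})"
  using card_visible_level(1)[OF \<sigma>] by (intro card_mono) auto
 also have "\<dots> <= (\<Sum>i<d. card {k. vis \<sigma> k & depth k = Suc i})"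
  by (rule card_UN_le) simp
 also have "\<dots> <= (\<Sum>i<d. 2 * 4 ^ i)"
  using card_visible_level(2)[OF \<sigma>] by (intro sum_mono)
 also have "\<dots> <= 4 ^ d"
  by (induction d) auto
 finally show ?thesis .
qed

lemma card_keys:
 assumes \<sigma>: "\<And>\<sigma>. \<sigma> \<in> F ==> signs_on (piece v) \<sigma>" and d: "\<And>k. k < n ==> depth k <= d"
 shows "finite (key ` F)" "card (key ` F) <= (2 * n + 1) ^ (4 ^ d)"
proof -
 have 1: "k < n & g k <= 2" if g: "g \<in> key ` F" "g k ~= 0" for g k
 proof -
  obtain \<tau> where \<tau>: "g = key \<tau>" "\<tau> \<in> F" using g by blast
  then have "\<tau> k ~= 0" "g k = \<tau> k" using g by (auto simp: key_def split: if_splits)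
  then have "k \<in> piece v" using signs_on_nonzero[OF \<sigma>[OF \<tau>(2)]] by blast
  then show ?thesis
   using piece_bounds[of k v] signs_onD(1)[OF \<sigma>[OF \<tau>(2)] \<open>k \<in> piece v\<close>] \<open>g k = \<tau> k\<close> by auto
 qed
 have 2: "card {k. g k ~= 0} <= 4 ^ d" if g: "g \<in> key ` F" for g
 proof -
  obtain \<tau> where \<tau>: "g = key \<tau>" "\<tau> \<in> F" using g by blast
  then have "{k. g k ~= 0} = {k. vis \<tau> k}" using vis_nonzero by (auto simp: key_def)
  then show ?thesis using card_visible[OF \<sigma>[OF \<tau>(2)] d] by simp
 qed
 show "finite (key ` F)" "card (key ` F) <= (2 * n + 1) ^ (4 ^ d)"
  using card_sparse_functions[of "key ` F" n "4 ^ d"] 1 2 by blast+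
qed

end

subsection \<open>Heights of SPQ-trees\<close>

text \<open>A path in the rooted decomposition tree: each vertex spans a triangle with an edge of the
 triangle of its predecessor, the first one with \<open>{a, b}\<close>.\<close>

fun triangle_chain :: "'a set set => 'a => 'a => 'a list => bool" where
 "triangle_chain E a b [] \<longleftrightarrow> True"
| "triangle_chain E a b (k # ks) \<longleftrightarrow> k ~= a & k ~= b & {k, a} \<in> E & {k, b} \<in> E &
   (ks = [] | hd ks ~= b & triangle_chain E a k ks | hd ks ~= a & triangle_chain E b k ks)"

lemma triangle_chain_sym: "triangle_chain E a b ks \<longleftrightarrow> triangle_chain E b a ks"
 by (cases ks) auto

lemma series_parallel_poles:
 "series_parallel u v G T ==> two_tree_shape T ==>
  u \<in> fst G & v \<in> fst G & u ~= v & (\<forall>e\<in>snd G. e \<subseteq> fst G)"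
proof (induction rule: series_parallel.induct)
 case (parallel ts Gs u v)
 then have len: "0 < length ts" by auto
 have IH: "u \<in> fst (Gs ! i) & v \<in> fst (Gs ! i) & u ~= v & (\<forall>e\<in>snd (Gs ! i). e \<subseteq> fst (Gs ! i))"
  if "i < length ts" for i
  using parallel.IH that parallel.prems by auto
 have G0: "Gs ! 0 \<in> set Gs" using len parallel.hyps by simp
 have es: "e \<subseteq> \<Union> (fst ` set Gs)" if "H \<in> set Gs" "e \<in> snd H" for H e
  using that IH parallel.hyps(2) by (fastforce simp: in_set_conv_nth)
 have "u \<in> fst (Gs ! 0)" "v \<in> fst (Gs ! 0)" "u ~= v" using IH[OF len] by auto
 then have "u \<in> \<Union> (fst ` set Gs)" "v \<in> \<Union> (fst ` set Gs)" using G0 by blast+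
 moreover have "\<forall>e\<in>\<Union> (snd ` set Gs). e \<subseteq> \<Union> (fst ` set Gs)" using es by blast
 ultimately show ?case using \<open>u ~= v\<close> by simp
next
 case (series ts Gs ps)
 then have len: "length ts = 2" by simp
 then have lens: "length Gs = 2" "length ps = 3" using series.hyps by auto
 obtain t1 t2 where ts: "ts = [t1, t2]" using len by (auto simp: length_Suc_conv numeral_eq_Suc)
 obtain G1 G2 where Gs: "Gs = [G1, G2]" using lens by (auto simp: length_Suc_conv numeral_eq_Suc)
 obtain p q r where ps: "ps = [p, q, r]" using lens by (auto simp: length_Suc_conv numeral_eq_Suc)
 have "two_tree_shape t1" "two_tree_shape t2" using series.prems ts by auto
 then have "p \<in> fst G1 & q \<in> fst G1 & p ~= q & (\<forall>e\<in>snd G1. e \<subseteq> fst G1)"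
  "q \<in> fst G2 & r \<in> fst G2 & q ~= r & (\<forall>e\<in>snd G2. e \<subseteq> fst G2)"
  using series.IH[rule_format, of 0] series.IH[rule_format, of 1] by (auto simp: ts Gs ps)
 moreover have "fst G1 \<inter> fst G2 = {q}"
  using series.hyps(4)[rule_format, of 0 1] by (simp add: ts Gs ps)
 ultimately show ?case by (auto simp: Gs ps)
qed auto

lemma spq_children_height: "t \<in> set ts ==> height t < height (PNode ts)" "t \<in> set ts ==> height t < height (SNode ts)"
 by (auto simp: less_Suc_eq_le intro!: Max_ge)

lemma two_element_list: "length xs = 2 ==> xs = [xs ! 0, xs ! 1]"
 by (auto simp: length_Suc_conv numeral_eq_Suc)

lemma three_element_list: "length xs = 3 ==> xs = [xs ! 0, xs ! 1, xs ! 2]"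
 by (auto simp: length_Suc_conv numeral_eq_Suc)

text \<open>\<open>E\<close> is the edge set of the whole graph, and \<open>closed\<close> says that
  the inner vertices of \<open>G\<close> have no edges elsewhere. The components of a P-node share
  only the poles, so the common neighbour \<open>k\<close> of the poles is inside one S-node. Its
  halves are two levels down, and the neighbourhood of \<open>k\<close> splits between them.\<close>

lemma series_parallel_apex:
 assumes "series_parallel u v G T" "two_tree_shape T" "\<not> is_SNode T"
  and closed: "\<And>x y. x \<in> fst G - {u, v} ==> {x, y} \<in> E ==> {x, y} \<in> snd G"
  and k: "k \<in> fst G" "k ~= u" "k ~= v" "{k, u} \<in> E" "{k, v} \<in> E"
 obtains G1 G2 t1 t2 where
  "series_parallel u k G1 t1" "two_tree_shape t1" "\<not> is_SNode t1" "height t1 + 2 <= height T"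
  "series_parallel k v G2 t2" "two_tree_shape t2" "\<not> is_SNode t2" "height t2 + 2 <= height T"
  "\<forall>x\<in>fst G1 - {u, k}. \<forall>y. {x, y} \<in> E --> {x, y} \<in> snd G1"
  "\<forall>x\<in>fst G2 - {k, v}. \<forall>y. {x, y} \<in> E --> {x, y} \<in> snd G2"
  "\<forall>l. l ~: {u, v, k} & {l, k} \<in> E & {l, u} \<in> E --> l \<in> fst G1"
  "\<forall>l. l ~: {u, v, k} & {l, k} \<in> E & {l, v} \<in> E --> l \<in> fst G2"
proof -
 obtain ts Gs where T: "T = PNode ts" "G = (\<Union> (fst ` set Gs), \<Union> (snd ` set Gs))" "length Gs = length ts"
  "\<forall>i<length ts. series_parallel u v (Gs ! i) (ts ! i)"
  "\<forall>i j. i < j --> j < length ts --> fst (Gs ! i) \<inter> fst (Gs ! j) = {u, v} & snd (Gs ! i) \<inter> snd (Gs ! j) = {}"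
  using assms(1) by (rule series_parallel.cases) (use assms(3) k in auto)
 obtain i where i: "i < length ts" "k \<in> fst (Gs ! i)"
  using k(1) T(2,3) by (auto simp: in_set_conv_nth)
 have meet: "fst (Gs ! i) \<inter> fst (Gs ! j) = {u, v}" if "j < length ts" "j ~= i" for j
  using T(5) i that by (metis Int_commute linorder_neqE_nat)
 have sp: "series_parallel u v (Gs ! i) (ts ! i)" using T(4) i by blast
 have shape: "two_tree_shape (ts ! i)" "is_QNode (ts ! i) | is_SNode (ts ! i)"
  using assms(2) i by (auto simp: T(1))
 have edges: "e \<subseteq> fst (Gs ! j)" if "j < length ts" "e \<in> snd (Gs ! j)" for j e
 proof -
  have "two_tree_shape (ts ! j)" using assms(2) that by (simp add: T(1))
  from series_parallel_poles[OF T(4)[rule_format, OF that(1)] this] show ?thesis using that(2) by blast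
 qed
 have local: "{x, y} \<in> snd (Gs ! i)" if x: "x \<in> fst (Gs ! i)" "x ~= u" "x ~= v" "{x, y} \<in> E" for x y
 proof -
  have "Gs ! i \<in> set Gs" using i(1) T(3) by simp
  then have "x \<in> fst G" using x(1) unfolding T(2) by auto
  then have "{x, y} \<in> snd G" using closed x by blast
  then obtain j where j: "j < length ts" "{x, y} \<in> snd (Gs ! j)"
   using T(2,3) by (auto simp: in_set_conv_nth)
  then have "x \<in> fst (Gs ! j)" using edges by blast
  then have "j = i" using meet[of j] j x by blast
  then show ?thesis using j by simp
 qed
 obtain us Hs ps where S: "ts ! i = SNode us" "Gs ! i = (\<Union> (fst ` set Hs), \<Union> (snd ` set Hs))"
  "length Hs = length us" "length ps = length us + 1" "u = hd ps" "v = last ps"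
  "\<forall>i<length us. series_parallel (ps ! i) (ps ! (i + 1)) (Hs ! i) (us ! i)"
  "\<forall>i j. i < j --> j < length us --> fst (Hs ! i) \<inter> fst (Hs ! j) = (if j = i + 1 then {ps ! j} else {})"
  using sp by (rule series_parallel.cases) (use shape i k in auto)
 have two: "length us = 2" using shape(1) by (simp add: S(1))
 define t1 t2 G1 G2 w where "t1 = us ! 0" and "t2 = us ! 1" and "G1 = Hs ! 0" and "G2 = Hs ! 1" and "w = ps ! 1"
 have us: "us = [t1, t2]" unfolding t1_def t2_def by (rule two_element_list[OF two])
 have Hs: "Hs = [G1, G2]" unfolding G1_def G2_def by (rule two_element_list) (use S two in simp)
 have ps: "ps = [u, w, v]"
 proof -
  have e: "ps = [ps ! 0, ps ! 1, ps ! 2]" by (rule three_element_list) (use S two in simp)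
  have u: "u = ps ! 0" unfolding S(5) using arg_cong[OF e, of hd] by simp
  have v: "v = ps ! 2" unfolding S(6) using arg_cong[OF e, of last] by simp
  show ?thesis unfolding u v w_def by (rule e)
 qed
 have sp1: "series_parallel u w G1 t1" and sp2: "series_parallel w v G2 t2"
  using S(7)[rule_format, of 0] S(7)[rule_format, of 1] by (simp_all add: us Hs ps)
 have w: "fst G1 \<inter> fst G2 = {w}"
  using S(8)[rule_format, of 0 1] by (simp add: us Hs ps)
 have sh: "two_tree_shape t1" "two_tree_shape t2" "\<not> is_SNode t1" "\<not> is_SNode t2"
 proof -
  have h: "(is_QNode t1 | is_PNode t1) & two_tree_shape t1" "(is_QNode t2 | is_PNode t2) & two_tree_shape t2"
   using shape(1) unfolding S(1) us by simp_all
  then show "two_tree_shape t1" "two_tree_shape t2" by blast+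
  show "\<not> is_SNode t1" using h(1) by (cases t1) simp_all
  show "\<not> is_SNode t2" using h(2) by (cases t2) simp_all
 qed
 have ht: "height t1 + 2 <= height T" "height t2 + 2 <= height T"
 proof -
  have "height t1 < height (ts ! i)" "height t2 < height (ts ! i)"
   unfolding S(1) by (rule spq_children_height(2), simp add: us)+
  moreover have "height (ts ! i) < height T"
   unfolding T(1) by (rule spq_children_height(1)) (use i in simp)
  ultimately show "height t1 + 2 <= height T" "height t2 + 2 <= height T" by linarith+
 qed
 have p1: "u \<in> fst G1" "w \<in> fst G1" "u ~= w" "\<And>e. e \<in> snd G1 ==> e \<subseteq> fst G1"
  using series_parallel_poles[OF sp1 sh(1)] by auto
 have p2: "w \<in> fst G2" "v \<in> fst G2" "w ~= v" "\<And>e. e \<in> snd G2 ==> e \<subseteq> fst G2"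
  using series_parallel_poles[OF sp2 sh(2)] by auto
 have u2: "u ~: fst G2" using w p1(1,3) by blast
 have v1: "v ~: fst G1" using w p2(2) p2(3)[symmetric] by blast
 have V: "fst (Gs ! i) = fst G1 \<union> fst G2" and Ed: "snd (Gs ! i) = snd G1 \<union> snd G2"
  by (auto simp: S(2) Hs)
 have near_u: "x \<in> fst G1" if "x \<in> fst (Gs ! i)" "x ~= u" "x ~= v" "{x, u} \<in> E" for x
  using local[OF that] p1(4)[of "{x, u}"] p2(4)[of "{x, u}"] u2 unfolding Ed by blast
 have near_v: "x \<in> fst G2" if "x \<in> fst (Gs ! i)" "x ~= u" "x ~= v" "{x, v} \<in> E" for x
  using local[OF that] p1(4)[of "{x, v}"] p2(4)[of "{x, v}"] v1 unfolding Ed by blast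
 \<comment> \<open>A neighbour of \<open>u\<close> lies in the half containing \<open>u\<close> and
   a neighbour of \<open>v\<close> in the other one; the two halves share only
   \<open>w\<close>.\<close>
 have kw: "k = w" using near_u[OF i(2) k(2,3,4)] near_v[OF i(2) k(2,3,5)] w by blast
 have c1: "{x, y} \<in> snd G1" if "x \<in> fst G1 - {u, k}" "{x, y} \<in> E" for x y
  using local[of x y] that v1 p2(4)[of "{x, y}"] w unfolding V Ed kw by blast
 have c2: "{x, y} \<in> snd G2" if "x \<in> fst G2 - {k, v}" "{x, y} \<in> E" for x y
  using local[of x y] that u2 p1(4)[of "{x, y}"] w unfolding V Ed kw by blast
 have near_k: "l \<in> fst (Gs ! i)" if "{l, k} \<in> E" for l
  using local[of k l] i(2) k that edges[OF i(1), of "{k, l}"] insert_commute[of l k "{}"] by simp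
 show ?thesis
 proof (rule that[OF sp1[folded kw] sh(1,3) ht(1) sp2[folded kw] sh(2,4) ht(2)])
  show "\<forall>x\<in>fst G1 - {u, k}. \<forall>y. {x, y} \<in> E --> {x, y} \<in> snd G1"
   "\<forall>x\<in>fst G2 - {k, v}. \<forall>y. {x, y} \<in> E --> {x, y} \<in> snd G2"
   using c1 c2 by blast+
  show "\<forall>l. l ~: {u, v, k} & {l, k} \<in> E & {l, u} \<in> E --> l \<in> fst G1"
   "\<forall>l. l ~: {u, v, k} & {l, k} \<in> E & {l, v} \<in> E --> l \<in> fst G2"
   using near_k near_u near_v by blast+
 qed
qed

text \<open>Every vertex of the chain is the middle vertex of an S-node below the P-node whose poles
  are its base, and the next vertex lies in one of the halves. So each vertex accounts for a descent
  through a P-node and an S-node.\<close>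

lemma triangle_chain_height:
 assumes "series_parallel u v G T" "two_tree_shape T" "\<not> is_SNode T"
  and "\<And>x y. x \<in> fst G - {u, v} ==> {x, y} \<in> E ==> {x, y} \<in> snd G"
  and "triangle_chain E u v (k # ks)" "k \<in> fst G" "distinct (k # ks)" "u ~: set ks" "v ~: set ks"
 shows "2 * length (k # ks) <= height T"
 using assms
proof (induction ks arbitrary: k u v G T)
 case Nil
 then have "k ~= u" "k ~= v" "{k, u} \<in> E" "{k, v} \<in> E" by auto
 from series_parallel_apex[OF Nil(1-4,6) this] show ?case by (metis add_leE length_Cons list.size(3) mult.right_neutral One_nat_def)
next
 case (Cons l ks)
 then have k: "k ~= u" "k ~= v" "{k, u} \<in> E" "{k, v} \<in> E" by auto
 obtain G1 G2 t1 t2 where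
  g1: "series_parallel u k G1 t1" "two_tree_shape t1" "\<not> is_SNode t1" "height t1 + 2 <= height T" and
  g2: "series_parallel k v G2 t2" "two_tree_shape t2" "\<not> is_SNode t2" "height t2 + 2 <= height T" and
  c1: "\<forall>x\<in>fst G1 - {u, k}. \<forall>y. {x, y} \<in> E --> {x, y} \<in> snd G1" and
  c2: "\<forall>x\<in>fst G2 - {k, v}. \<forall>y. {x, y} \<in> E --> {x, y} \<in> snd G2" and
  n1: "\<forall>l. l ~: {u, v, k} & {l, k} \<in> E & {l, u} \<in> E --> l \<in> fst G1" and
  n2: "\<forall>l. l ~: {u, v, k} & {l, k} \<in> E & {l, v} \<in> E --> l \<in> fst G2"
  using series_parallel_apex[OF Cons.prems(1-4,6) k] .
 have l: "l ~= u" "l ~= v" "l ~= k" using Cons.prems by auto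
 have "triangle_chain E u k (l # ks) | triangle_chain E v k (l # ks)" using Cons.prems(5) by auto
 then show ?case
 proof
  assume ch: "triangle_chain E u k (l # ks)"
  then have "l \<in> fst G1" using n1 l by auto
  then have "2 * length (l # ks) <= height t1"
   using Cons.prems c1 by (intro Cons.IH[OF g1(1-3) _ ch]) auto
  then show ?thesis using g1(4) by simp
 next
  assume ch: "triangle_chain E v k (l # ks)"
  then have "l \<in> fst G2" using n2 l by auto
  then have "2 * length (l # ks) <= height t2"
   using Cons.prems ch c2 by (intro Cons.IH[OF g2(1-3)]) (auto simp: triangle_chain_sym[of E k])
  then show ?thesis using g2(4) by simp
 qed
qed

context parent_structure
begin

text \<open>The chain is built from the top: the child \<open>c\<close> of \<open>v\<close> towards
  \<open>k\<close> continues it. The strict order of the list is kept to obtain distinct vertices in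
  the height estimate.\<close>

lemma depth_chain:
 assumes E: "\<And>i j. child i j ==> {nm j, nm i} \<in> E" and nm: "inj_on nm {..<n}"
 shows "2 <= v ==> k \<in> sub v ==> \<exists>ks. ks ~= [] & hd ks = v & sorted_wrt (<) ks & set ks \<subseteq> {..<n} &
  triangle_chain E (nm (pa v)) (nm (pb v)) (map nm ks) & length ks + depth v = Suc (depth k)"
proof (induction "n - v" arbitrary: v rule: less_induct)
 case less
 have v: "2 <= v" "v < n" using less.prems sub_ge sub_bounds by fastforce+
 note b = parents'[OF v]
 have ne: "nm v ~= nm (pa v)" "nm v ~= nm (pb v)"
  using nm b v by (auto simp: inj_on_eq_iff)
 have e: "{nm v, nm (pa v)} \<in> E" "{nm v, nm (pb v)} \<in> E" using E v by (auto simp: child_def)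
 show ?case
 proof (cases "k = v")
  case True
  then show ?thesis using ne e v by (intro exI[of _ "[v]"]) auto
 next
  case False
  then obtain c where c: "2 <= c" "c < n" "pb c = v" "k \<in> sub c" using sub_child less.prems by blast
  have vc: "v < c" "pa c = pa v | pa c = pb v" using parents[OF c(1,2)] c(3) by auto
  obtain ks where ks: "ks ~= []" "hd ks = c" "sorted_wrt (<) ks" "set ks \<subseteq> {..<n}"
   "triangle_chain E (nm (pa c)) (nm (pb c)) (map nm ks)" "length ks + depth c = Suc (depth k)"
   using less.hyps[OF _ c(1,4)] c(2) vc(1) by (metis diff_less_mono2 order_less_trans)
  have "nm c ~= nm (pa v)" "nm c ~= nm (pb v)" using nm b v c vc by (auto simp: inj_on_eq_iff)
  then have "triangle_chain E (nm (pa v)) (nm (pb v)) (map nm (v # ks))"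
   using ks vc(2) ne e c(3) by (auto simp: hd_map)
  moreover have "sorted_wrt (<) (v # ks)"
   using ks vc(1) by (cases ks) auto
  moreover have "length (v # ks) + depth v = Suc (depth k)"
   using ks(6) depth_step[OF c(1,2)] c(3) by simp
  ultimately show ?thesis using ks v by (intro exI[of _ "v # ks"]) auto
 qed
qed

text \<open>The path of parents from the root edge to \<open>k\<close> is a triangle chain of length
  \<open>depth k\<close>. An SPQ-tree does not prescribe the order of the two poles, hence the
  disjunction.\<close>

lemma depth_height:
 assumes n: "3 <= n" and E: "\<And>i j. child i j ==> {nm j, nm i} \<in> E" and nm: "inj_on nm {..<n}"
  and T: "series_parallel (nm 0) (nm 1) (V, E) T | series_parallel (nm 1) (nm 0) (V, E) T"
  and shape: "two_tree_shape T" "is_PNode T" and V: "nm ` {..<n} \<subseteq> V" and "k < n"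
 shows "2 * depth k <= height T"
proof (cases "2 <= k")
 case False
 then have "depth k = 0" by (subst depth.simps) simp
 then show ?thesis by simp
next
 case True
 then have "k \<in> piece 2" using piece_2[OF n] \<open>k < n\<close> by simp
 then obtain t where t: "2 <= t" "t < n" "pa t = pa 2" "pb t = pb 2" "k \<in> sub t" by (auto elim!: pieceE)
 have "pa 2 = 0" "pb 2 = 1" using parents[of 2] n base by auto
 then have pt: "pa t = 0" "pb t = 1" using t by auto
 have d: "depth t = 1"
  using depth_step[OF t(1,2)] pt by (subst (asm) depth.simps[of "pb t"]) simp
 obtain ks where ks: "ks ~= []" "hd ks = t" "sorted_wrt (<) ks" "set ks \<subseteq> {..<n}"
  "triangle_chain E (nm 0) (nm 1) (map nm ks)" "length ks + depth t = Suc (depth k)"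
  using depth_chain[OF E nm t(1,5)] pt by auto
 obtain ls where ls: "ks = t # ls" using ks(1,2) by (cases ks) auto
 have gt: "x \<in> set ks ==> 2 <= x" for x using ks(3) t(1) unfolding ls by auto
 have out: "nm 0 ~: nm ` set ks" "nm 1 ~: nm ` set ks"
  using gt ks(4) nm n by (fastforce simp: inj_on_def)+
 have dist: "distinct (map nm ks)"
  using strict_sorted_iff ks(3,4) nm by (auto simp: distinct_map intro: inj_on_subset)
 have tV: "nm t \<in> V" using V t by auto
 have "\<not> is_SNode T" using shape(2) by (cases T) simp_all
 have out': "nm 0 ~: set (map nm ls)" "nm 1 ~: set (map nm ls)" using out ls by auto
 note chain = ks(5)[unfolded ls list.map]
 have "2 * length (map nm ks) <= height T"
  using T
 proof
  assume sp: "series_parallel (nm 0) (nm 1) (V, E) T"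
  show ?thesis
   unfolding ls list.map
   by (rule triangle_chain_height[OF sp shape(1) \<open>\<not> is_SNode T\<close> _ chain])
    (use dist out' tV ls in simp_all)
 next
  assume sp: "series_parallel (nm 1) (nm 0) (V, E) T"
  show ?thesis
   unfolding ls list.map
   by (rule triangle_chain_height[OF sp shape(1) \<open>\<not> is_SNode T\<close> _ chain[unfolded triangle_chain_sym[of E "nm 0" "nm 1"]]])
    (use dist out' tV ls in simp_all)
 qed
 then show ?thesis using ks(6) d by simp
qed

end

section \<open>Growing a 2-tree from an arbitrary edge\<close>

lemma two_tree_edges: "two_tree G ==> finite (fst G) & 3 <= card (fst G) & finite (snd G) &
  card (snd G) + 3 = 2 * card (fst G) & (\<forall>g\<in>snd G. \<exists>u w. g = {u, w} & u ~= w & u \<in> fst G & w \<in> fst G)"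
proof (induction rule: two_tree.induct)
 case (triangle a b c)
 then have "card {{a, b}, {b, c}, {a, c}} = 3" by (auto simp: card_insert_if doubleton_eq_iff)
 moreover have "card {a, b, c} = 3" using triangle by auto
 ultimately show ?case using triangle by auto
next
 case (extend V E u w v)
 then have V: "u \<in> V" "w \<in> V" "u ~= w" by (auto simp: doubleton_eq_iff)
 have "v ~: g" if "g \<in> E" for g using extend that by auto
 then have "{v, u} ~: E" "{v, w} ~: E" "{v, u} ~= {v, w}" using V extend(3) by (auto simp: doubleton_eq_iff)
 then have "card (E \<union> {{v, u}, {v, w}}) = card E + 2" using extend by simp
 moreover have "\<exists>x y. g = {x, y} & x ~= y & x \<in> insert v V & y \<in> insert v V" if g: "g \<in> E \<union> {{v, u}, {v, w}}" for g
 proof -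
  from g consider "g \<in> E" | "g = {v, u}" | "g = {v, w}" by blast
  then show ?thesis
  proof cases
   case 1
   then obtain x y where "g = {x, y}" "x ~= y" "x \<in> V" "y \<in> V" using extend by fastforce
   then show ?thesis by blast
  next
   case 2
   then show ?thesis using V extend(3) by (intro exI[of _ v] exI[of _ u]) auto
  next
   case 3
   then show ?thesis using V extend(3) by (intro exI[of _ v] exI[of _ w]) auto
  qed
 qed
 ultimately show ?case using extend by auto
qed

lemma two_tree_grow:
 "two_tree G ==> R \<subset> fst G ==> {a, b} \<in> snd G ==> a \<in> R ==> b \<in> R ==>
  \<exists>v x y. v \<in> fst G - R & x \<in> R & y \<in> R & {x, v} \<in> snd G & {y, v} \<in> snd G & {x, y} \<in> snd G"
proof (induction arbitrary: R a b rule: two_tree.induct)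
 case (triangle p q r)
 have e: "{p, q} \<in> {{p, q}, {q, r}, {p, r}}" "{q, r} \<in> {{p, q}, {q, r}, {p, r}}" "{p, r} \<in> {{p, q}, {q, r}, {p, r}}"
  by auto
 from triangle(3) consider "{a, b} = {p, q}" | "{a, b} = {q, r}" | "{a, b} = {p, r}" by auto
 then show ?case
 proof cases
  case 1
  then have "p \<in> R" "q \<in> R" "r ~: R" using triangle by (auto simp: doubleton_eq_iff)
  then show ?thesis using e by (intro exI[of _ r] exI[of _ p] exI[of _ q]) (auto simp: insert_commute)
 next
  case 2
  then have "q \<in> R" "r \<in> R" "p ~: R" using triangle by (auto simp: doubleton_eq_iff)
  then show ?thesis using e by (intro exI[of _ p] exI[of _ q] exI[of _ r]) (auto simp: insert_commute)
 next
  case 3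
  then have "p \<in> R" "r \<in> R" "q ~: R" using triangle by (auto simp: doubleton_eq_iff)
  then show ?thesis using e by (intro exI[of _ q] exI[of _ p] exI[of _ r]) (auto simp: insert_commute)
 qed
next
 case (extend V E u w v)
 have uw: "u \<in> V" "w \<in> V" "u ~= w"
  using two_tree_edges[OF extend(1)] extend(2) by (auto simp: doubleton_eq_iff)
 have vE: "v ~: g" if "g \<in> E" for g using two_tree_edges[OF extend(1)] extend(3) that by auto
 let ?E = "E \<union> {{v, u}, {v, w}}"
 have IH: ?case if "R - {v} \<subset> V" "{c, d} \<in> E" "c \<in> R" "d \<in> R" for c d
 proof -
  have "c ~= v" "d ~= v" using vE[OF that(2)] by auto
  then have "\<exists>z x y. z \<in> fst (V, E) - (R - {v}) & x \<in> R - {v} & y \<in> R - {v} &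
    {x, z} \<in> snd (V, E) & {y, z} \<in> snd (V, E) & {x, y} \<in> snd (V, E)"
   using that by (intro extend.IH[of "R - {v}" c d]) simp_all
  then obtain z x y where "z \<in> V - (R - {v})" "x \<in> R - {v}" "y \<in> R - {v}" "{x, z} \<in> E" "{y, z} \<in> E" "{x, y} \<in> E"
   unfolding fst_conv snd_conv by (elim exE conjE)
  then show ?thesis using extend(3) by (intro exI[of _ z] exI[of _ x] exI[of _ y]) auto
 qed
 show ?case
 proof (cases "v \<in> R")
  case False
  then have "R \<subseteq> V" using extend.prems by auto
  show ?thesis
  proof (cases "R = V")
   case True
   then show ?thesis using extend(2,3) uw
    by (intro exI[of _ v] exI[of _ u] exI[of _ w]) (auto simp: insert_commute)
  next
   case nV: False
   have "{a, b} \<in> E" using extend.prems False by (auto simp: doubleton_eq_iff)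
   then show ?thesis using IH[of a b] nV \<open>R \<subseteq> V\<close> False extend.prems by auto
  qed
 next
  case vR: True
  then have sub: "R - {v} \<subset> V" using extend.prems by auto
  show ?thesis
  proof (cases "{a, b} \<in> E | u \<in> R & w \<in> R")
   case True
   then show ?thesis using IH[OF sub, of a b] IH[OF sub, of u w] extend.prems extend(2) by blast
  next
   case False
   then have "u \<in> R | w \<in> R" using extend.prems by (auto simp: doubleton_eq_iff)
   then consider "u \<in> R" "w ~: R" | "w \<in> R" "u ~: R" using False by blast
   then show ?thesis
   proof cases
    case 1
    then show ?thesis using extend(2) uw vR extend(3)
     by (intro exI[of _ w] exI[of _ v] exI[of _ u]) auto
   next
    case 2
    then show ?thesis using extend(2) uw vR extend(3)
     by (intro exI[of _ u] exI[of _ v] exI[of _ w]) (auto simp: insert_commute)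
   qed
  qed
 qed
qed

section \<open>Realizations in the numbering of a construction order\<close>

lemma hull_doubleton: "convex hull (p ` {u, w}) = closed_segment (p u) (p w)"
 by (simp add: segment_convex_hull)

context parent_structure
begin

context
 fixes E :: "nat set set" and len :: "nat set => real" and nm :: "nat => nat"
 assumes n: "3 <= n" and bij: "bij_betw nm {..<n} {..<n}"
  and E: "E = {{nm i, nm j} |i j. child i j}"
  and len: "\<And>k. 1 <= k ==> k < n ==> la k = len {nm (pa k), nm k} & lb k = len {nm (pb k), nm k}"
begin

lemma nm_eq: "i < n ==> j < n ==> nm i = nm j \<longleftrightarrow> i = j"
 using bij by (auto simp: bij_betw_def dest: inj_onD)

lemma E_adj: "i < n ==> j < n ==> {nm i, nm j} \<in> E \<longleftrightarrow> adj i j"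
proof
 assume i: "i < n" "j < n"
 assume "{nm i, nm j} \<in> E"
 then obtain k l where c: "child k l" "{nm i, nm j} = {nm k, nm l}" by (auto simp: E)
 then have "k < n" "l < n" using child_bounds[of k l] by auto
 then have "{i, j} = {k, l}" using c(2) i nm_eq by (auto simp: doubleton_eq_iff)
 then show "adj i j" using c(1) by (auto simp: adj_def doubleton_eq_iff)
next
 assume "adj i j"
 then show "{nm i, nm j} \<in> E" by (auto simp: E adj_def insert_commute)
qed

lemma E_cases:
 assumes "g \<in> E"
 obtains i j where "i < n" "j < n" "adj i j" "g = {nm i, nm j}"
proof -
 obtain i j where "child i j" "g = {nm i, nm j}" using assms unfolding E by blast
 then show ?thesis using that[of i j] child_bounds[of i j] by (auto simp: adj_def)
qed

lemma vertex_cases: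
 assumes "v < n"
 obtains k where "k < n" "v = nm k"
proof -
 have "v \<in> nm ` {..<n}" using bij assms by (simp add: bij_betw_def)
 then show ?thesis using that by blast
qed

text \<open>The two notions of planarity differ in two points. Edges with a common end are treated
  by \<open>planar_edges\<close>. Injectivity holds because every vertex is on an edge: a coinciding
  vertex would be on that edge too, hence its other end, and edges have positive length.\<close>

lemma realization_iff: "planar_realization ({..<n}, E) len p \<longleftrightarrow> realizes (p \<circ> nm)"
proof
 assume r: "planar_realization ({..<n}, E) len p"
 then have inj: "inj_on p {..<n}"
  and V: "\<And>v g. v < n ==> g \<in> E ==> p v \<in> convex hull (p ` g) ==> v \<in> g"
  and D: "\<And>f g. f \<in> E ==> g \<in> E ==> f ~= g ==> convex hull (p ` f) \<inter> convex hull (p ` g) \<subseteq> p ` (f \<inter> g)"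
  and L: "\<And>u v. {u, v} \<in> E ==> dist (p u) (p v) = len {u, v}"
  unfolding planar_realization_def planar_drawing_def by auto
 have lt: "nm k < n" if "k < n" for k using bij that by (auto simp: bij_betw_def)
 show "realizes (p \<circ> nm)"
  unfolding realizes_def planar_def
 proof (intro conjI ballI impI allI)
  fix x i j assume a: "x \<in> {..<n}" "i \<in> {..<n}" "j \<in> {..<n}" "adj i j" "x ~= i" "x ~= j"
  then have "{nm i, nm j} \<in> E" "nm x ~: {nm i, nm j}" using E_adj nm_eq by auto
  then show "(p \<circ> nm) x ~: closed_segment ((p \<circ> nm) i) ((p \<circ> nm) j)"
   using V[of "nm x" "{nm i, nm j}"] lt a unfolding hull_doubleton by auto
 next
  fix i j k l assume a: "i \<in> {..<n}" "j \<in> {..<n}" "k \<in> {..<n}" "l \<in> {..<n}" "adj i j" "adj k l" "{i, j} \<inter> {k, l} = {}"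
  then have "{nm i, nm j} \<in> E" "{nm k, nm l} \<in> E" "{nm i, nm j} \<inter> {nm k, nm l} = {}"
   using E_adj nm_eq by auto
  moreover from this(3) have "{nm i, nm j} ~= {nm k, nm l}" by blast
  ultimately show "closed_segment ((p \<circ> nm) i) ((p \<circ> nm) j) \<inter> closed_segment ((p \<circ> nm) k) ((p \<circ> nm) l) = {}"
   using D[of "{nm i, nm j}" "{nm k, nm l}"] unfolding hull_doubleton by auto
 next
  fix k assume k: "1 <= k" "k < n"
  then have c: "child (pa k) k" "child (pb k) k" by (auto simp: child_def)
  then have "{nm (pa k), nm k} \<in> E" "{nm (pb k), nm k} \<in> E" by (auto simp: E)
  then show "dist ((p \<circ> nm) (pa k)) ((p \<circ> nm) k) = la k" "dist ((p \<circ> nm) (pb k)) ((p \<circ> nm) k) = lb k"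
   using L len[OF k] by auto
 qed
next
 assume r: "realizes (p \<circ> nm)"
 then have pl: "planar {..<n} (p \<circ> nm)"
  and L: "\<And>k. 1 <= k ==> k < n ==> dist (p (nm (pa k))) (p (nm k)) = la k & dist (p (nm (pb k))) (p (nm k)) = lb k"
  by (auto simp: realizes_def)
 have V: "p v \<in> convex hull (p ` g) ==> v \<in> g" if v: "v < n" and g: "g \<in> E" for v g
 proof -
  obtain k where k: "k < n" "v = nm k" by (rule vertex_cases[OF v])
  obtain i j where ij: "i < n" "j < n" "adj i j" "g = {nm i, nm j}" by (rule E_cases[OF g])
  assume "p v \<in> convex hull (p ` g)"
  then have "k = i | k = j"
   using planar_vertex[OF pl, of k i j] k(1) ij(1-3) unfolding k ij(4) hull_doubleton by auto
  then show "v \<in> g" using k ij by auto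
 qed
 have inj: "inj_on p {..<n}"
 proof (rule inj_onI)
  fix u v assume a: "u \<in> {..<n}" "v \<in> {..<n}" "p u = p v"
  have "\<exists>g\<in>E. x \<in> g" if x: "x < n" for x
  proof -
   obtain k where k: "k < n" "x = nm k" by (rule vertex_cases[OF x])
   have "child 0 1" using base n by (simp add: child_def)
   moreover have "child (pa k) k" if "1 <= k" using that k by (simp add: child_def)
   ultimately have "\<exists>i. adj k i & i < n" using k n child_bounds unfolding adj_def
    by (cases "k = 0") (force simp: adj_def)+
   then show ?thesis using E_adj k by blast
  qed
  then obtain g where g: "g \<in> E" "v \<in> g" using a by auto
  then have "p u \<in> convex hull (p ` g)" using a(3) hull_inc[of "p v" "p ` g" convex] by auto
  then have ug: "u \<in> g" using V a g by auto
  obtain i j where ij: "i < n" "j < n" "adj i j" "g = {nm i, nm j}" by (rule E_cases[OF g(1)])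
  show "u = v"
  proof (rule ccontr)
   assume "u ~= v"
   then have "p (nm i) = p (nm j)" using ug g(2) ij(4) a(3) by auto
   moreover have "0 < dist (p (nm x)) (p (nm y))" if "child x y" for x y
    using L[of y] lengths[of y] that by (auto simp: child_def)
   ultimately show False using ij(3) unfolding adj_def by (metis dist_self less_irrefl)
  qed
 qed
 have D: "convex hull (p ` f) \<inter> convex hull (p ` g) \<subseteq> p ` (f \<inter> g)" if fg: "f \<in> E" "g \<in> E" "f ~= g" for f g
 proof
  fix z assume z: "z \<in> convex hull (p ` f) \<inter> convex hull (p ` g)"
  obtain i j where ij: "i < n" "j < n" "adj i j" "f = {nm i, nm j}" by (rule E_cases[OF fg(1)])
  obtain k l where kl: "k < n" "l < n" "adj k l" "g = {nm k, nm l}" by (rule E_cases[OF fg(2)])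
  have "{i, j} ~= {k, l}" using fg(3) ij kl by (auto simp: doubleton_eq_iff)
  moreover have "z \<in> closed_segment ((p \<circ> nm) i) ((p \<circ> nm) j)" "z \<in> closed_segment ((p \<circ> nm) k) ((p \<circ> nm) l)"
   using z unfolding ij kl hull_doubleton by auto
  ultimately obtain x where "x \<in> {i, j} \<inter> {k, l}" "z = (p \<circ> nm) x"
   using planar_edges[OF pl, of i j k l z] ij kl by auto
  then show "z \<in> p ` (f \<inter> g)" using ij kl by auto
 qed
 have "dist (p u) (p v) = len {u, v}" if uv: "{u, v} \<in> E" for u v
 proof -
  obtain i k where c: "child i k" "{u, v} = {nm i, nm k}" using uv unfolding E by blast
  then have "1 <= k" "k < n" "i = pa k | i = pb k" by (auto simp: child_def)
  then have "dist (p (nm i)) (p (nm k)) = len {nm i, nm k}" using L len by auto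
  then show ?thesis using c(2) by (auto simp: doubleton_eq_iff dist_commute insert_commute)
 qed
 then show "planar_realization ({..<n}, E) len p"
  unfolding planar_realization_def planar_drawing_def using inj V D by auto
qed

lemma realization_ex: "(\<exists>p. planar_realization ({..<n}, E) len p) \<longleftrightarrow> (\<exists>q. realizes q)"
proof
 assume "\<exists>p. planar_realization ({..<n}, E) len p"
 then show "\<exists>q. realizes q" using realization_iff by blast
next
 assume "\<exists>q. realizes q"
 then obtain q where q: "realizes q" ..
 let ?p = "\<lambda>v. q (inv_into {..<n} nm v)"
 have eq: "(?p \<circ> nm) k = q k" if "k < n" for k using bij that by (simp add: bij_betw_def)
 have "pa k < n & pb k < n" if "1 <= k" "k < n" for k
  using child_bounds[of "pa k" k] child_bounds[of "pb k" k] that by (auto simp: child_def)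
 then have "realizes (?p \<circ> nm)"
  using q eq planar_cong[of "{..<n}" q "?p \<circ> nm"] unfolding realizes_def by (simp del: comp_apply)
 then show "\<exists>p. planar_realization ({..<n}, E) len p" using realization_iff by blast
qed

end

end

section \<open>A language of bounded loops and its compilation\<close>

datatype nexp =
  Const nat
 | Var nat
 | Plus nexp nexp
 | Minus nexp nexp
 | Arr nat nexp
 | Mem nexp
 | RLess rexp rexp
and rexp =
  RealConst int
 | RealVar nat
 | RPlus rexp rexp
 | RMinus rexp rexp
 | RTimes rexp rexp
 | RDivide rexp rexp
 | RRoot rexp
 | RealArr nat nexp
 | RealMem nexp

text \<open>There is no general loop: the number of rounds of \<open>For\<close> is known on entry,
  so that a time bound can be read off the syntax. Raw memory accesses exist for the sake of input
  and output, whose layout differs from that of the arrays.\<close>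

datatype com =
  Skip
 | SetVar nat nexp
 | SetReal nat rexp
 | SetArr nat nexp nexp
 | SetRealArr nat nexp rexp
 | SetRealMem nexp rexp
 | Seq com com
 | IfPos nexp com com
 | For nat nat com

record store =
 nv :: "nat => nat"
 rv :: "nat => real"
 nm :: "nat => nat"
 rm :: "nat => real"

text \<open>Up to 32 arrays per kind are interleaved in the memory.\<close>

abbreviation addr :: "nat => nat => nat" where
 "addr k i \<equiv> 32 * i + k"

primrec nval :: "nexp => store => nat" and rval :: "rexp => store => real" where
 "nval (Const k) s = k"
| "nval (Var x) s = nv s x"
| "nval (Plus a b) s = nval a s + nval b s"
| "nval (Minus a b) s = nval a s - nval b s"
| "nval (Arr k a) s = nm s (addr k (nval a s))"
| "nval (Mem a) s = nm s (nval a s)"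
| "nval (RLess a b) s = (if rval a s < rval b s then 1 else 0)"
| "rval (RealConst k) s = of_int k"
| "rval (RealVar x) s = rv s x"
| "rval (RPlus a b) s = rval a s + rval b s"
| "rval (RMinus a b) s = rval a s - rval b s"
| "rval (RTimes a b) s = rval a s * rval b s"
| "rval (RDivide a b) s = rval a s / rval b s"
| "rval (RRoot a) s = sqrt (rval a s)"
| "rval (RealArr k a) s = rm s (addr k (nval a s))"
| "rval (RealMem a) s = rm s (nval a s)"

primrec run :: "com => store => store" where
 "run Skip s = s"
| "run (SetVar x e) s = s\<lparr>nv := (nv s)(x := nval e s)\<rparr>"
| "run (SetReal x e) s = s\<lparr>rv := (rv s)(x := rval e s)\<rparr>"
| "run (SetArr k i e) s = s\<lparr>nm := (nm s)(addr k (nval i s) := nval e s)\<rparr>"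
| "run (SetRealArr k i e) s = s\<lparr>rm := (rm s)(addr k (nval i s) := rval e s)\<rparr>"
| "run (SetRealMem i e) s = s\<lparr>rm := (rm s)(nval i s := rval e s)\<rparr>"
| "run (Seq c d) s = run d (run c s)"
| "run (IfPos e c d) s = (if 0 < nval e s then run c s else run d s)"
| "run (For i x c) s =
   ((\<lambda>s. (run c s)\<lparr>nv := (nv (run c s))(i := Suc (nv (run c s) i))\<rparr>) ^^ nv s x)
    (s\<lparr>nv := (nv s)(i := 0)\<rparr>)"

primrec nmods :: "com => nat set" where
 "nmods Skip = {}"
| "nmods (SetVar x e) = {x}"
| "nmods (SetReal x e) = {}"
| "nmods (SetArr k i e) = {}"
| "nmods (SetRealArr k i e) = {}"
| "nmods (SetRealMem i e) = {}"
| "nmods (Seq c d) = nmods c \<union> nmods d"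
| "nmods (IfPos e c d) = nmods c \<union> nmods d"
| "nmods (For i x c) = insert i (nmods c)"

text \<open>As the body changes neither counter nor bound, the compiled loop, which compares the two
  in every round, agrees with \<open>run\<close>, which reads the bound once.\<close>

primrec well_formed :: "com => bool" where
 "well_formed Skip \<longleftrightarrow> True"
| "well_formed (SetVar x e) \<longleftrightarrow> True"
| "well_formed (SetReal x e) \<longleftrightarrow> True"
| "well_formed (SetArr k i e) \<longleftrightarrow> True"
| "well_formed (SetRealArr k i e) \<longleftrightarrow> True"
| "well_formed (SetRealMem i e) \<longleftrightarrow> True"
| "well_formed (Seq c d) \<longleftrightarrow> well_formed c & well_formed d"
| "well_formed (IfPos e c d) \<longleftrightarrow> well_formed c & well_formed d"
| "well_formed (For i x c) \<longleftrightarrow>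
   well_formed c & i ~= x & i ~: nmods c & x ~: nmods c"

primrec bounds :: "com => nat set" where
 "bounds Skip = {}"
| "bounds (SetVar x e) = {}"
| "bounds (SetReal x e) = {}"
| "bounds (SetArr k i e) = {}"
| "bounds (SetRealArr k i e) = {}"
| "bounds (SetRealMem i e) = {}"
| "bounds (Seq c d) = bounds c \<union> bounds d"
| "bounds (IfPos e c d) = bounds c \<union> bounds d"
| "bounds (For i x c) = insert x (bounds c)"

lemma nv_run: "x ~: nmods c ==> nv (run c s) x = nv s x"
proof (induction c arbitrary: s)
 case (For i y c)
 have "nv (((\<lambda>s. (run c s)\<lparr>nv := (nv (run c s))(i := Suc (nv (run c s) i))\<rparr>) ^^ n) t) x = nv t x" for n t
  by (induction n) (use For in auto)
 then show ?case using For by simp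
qed auto

lemma For_induct [consumes 1, case_names wf start iter]:
 assumes "well_formed (For i x c)"
  and "P 0 (s\<lparr>nv := (nv s)(i := 0)\<rparr>)"
  and "\<And>k t. k < nv s x ==> P k t ==> nv t i = k ==> nv t x = nv s x ==>
     P (Suc k) ((run c t)\<lparr>nv := (nv (run c t))(i := Suc k)\<rparr>)"
 shows "P (nv s x) (run (For i x c) s)"
proof -
 define F where "F = (\<lambda>s. (run c s)\<lparr>nv := (nv (run c s))(i := Suc (nv (run c s) i))\<rparr>)"
 define s' where "s' = s\<lparr>nv := (nv s)(i := 0)\<rparr>"
 have s': "P 0 s'" "nv s' i = 0" "nv s' x = nv s x"
  using assms by (auto simp: s'_def)
 have F: "P (Suc k) (F t) & nv (F t) i = Suc k & nv (F t) x = nv s x"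
  if "k < nv s x" "P k t" "nv t i = k" "nv t x = nv s x" for k t
  using assms(3)[OF that] assms(1) that by (auto simp: F_def nv_run)
 have "P k ((F ^^ k) s') & nv ((F ^^ k) s') i = k & nv ((F ^^ k) s') x = nv s x"
  if "k <= nv s x" for k
  using that
 proof (induction k)
  case (Suc k)
  then show ?case using F[of k "(F ^^ k) s'"] by simp
 qed (use s' in simp)
 from this[of "nv s x"] show ?thesis by (simp add: F_def s'_def)
qed

subsection \<open>Compilation\<close>

text \<open>Jump targets are absolute, so lengths have to be known before the code that uses
  them.\<close>

primrec nlen :: "nexp => nat" and rlen :: "rexp => nat" where
 "nlen (Const k) = 1"
| "nlen (Var x) = 2"
| "nlen (Plus a b) = nlen a + nlen b + 1"
| "nlen (Minus a b) = nlen a + nlen b + 1"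
| "nlen (Arr k a) = nlen a + 8"
| "nlen (Mem a) = nlen a + 1"
| "nlen (RLess a b) = rlen a + rlen b + 3"
| "rlen (RealConst k) = 1"
| "rlen (RealVar x) = 2"
| "rlen (RPlus a b) = rlen a + rlen b + 1"
| "rlen (RMinus a b) = rlen a + rlen b + 1"
| "rlen (RTimes a b) = rlen a + rlen b + 1"
| "rlen (RDivide a b) = rlen a + rlen b + 1"
| "rlen (RRoot a) = rlen a + 1"
| "rlen (RealArr k a) = nlen a + 8"
| "rlen (RealMem a) = nlen a + 1"

text \<open>Five doublings and one addition replace the multiplication in an array address, which
  the machine does not offer for natural numbers.\<close>

definition scale :: "nat => nat => nat => instr list" where
 "scale i j k = [NAdd i i i, NAdd i i i, NAdd i i i, NAdd i i i, NAdd i i i, NConst j k, NAdd i i j]"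

text \<open>Variables live in the even registers; the odd registers form a stack of temporaries.\<close>

abbreviation tmp :: "nat => nat" where
 "tmp t \<equiv> Suc (2 * t)"

text \<open>The machine has no move instruction, so a variable is copied by adding it to zero. The
  truth value of a comparison of reals is produced by writing 1 and jumping over the instruction
  that writes 0.\<close>

primrec ncomp :: "nexp => nat => nat => instr list"
 and rcomp :: "rexp => nat => nat => instr list" where
 "ncomp (Const k) t p = [NConst (tmp t) k]"
| "ncomp (Var x) t p = [NConst (tmp t) 0, NAdd (tmp t) (tmp t) (2 * x)]"
| "ncomp (Plus a b) t p = ncomp a t p @ ncomp b (Suc t) (p + nlen a) @ [NAdd (tmp t) (tmp t) (tmp (Suc t))]"
| "ncomp (Minus a b) t p = ncomp a t p @ ncomp b (Suc t) (p + nlen a) @ [NSub (tmp t) (tmp t) (tmp (Suc t))]"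
| "ncomp (Arr k a) t p = ncomp a t p @ scale (tmp t) (tmp (Suc t)) k @ [NLoad (tmp t) (tmp t)]"
| "ncomp (Mem a) t p = ncomp a t p @ [NLoad (tmp t) (tmp t)]"
| "ncomp (RLess a b) t p = rcomp a t p @ rcomp b (Suc t) (p + rlen a) @
   [NConst (tmp t) 1, RJumpLess (tmp t) (tmp (Suc t)) (p + rlen a + rlen b + 3), NConst (tmp t) 0]"
| "rcomp (RealConst k) t p = [RConst (tmp t) k]"
| "rcomp (RealVar x) t p = [RConst (tmp t) 0, RAdd (tmp t) (tmp t) (2 * x)]"
| "rcomp (RPlus a b) t p = rcomp a t p @ rcomp b (Suc t) (p + rlen a) @ [RAdd (tmp t) (tmp t) (tmp (Suc t))]"
| "rcomp (RMinus a b) t p = rcomp a t p @ rcomp b (Suc t) (p + rlen a) @ [RSub (tmp t) (tmp t) (tmp (Suc t))]"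
| "rcomp (RTimes a b) t p = rcomp a t p @ rcomp b (Suc t) (p + rlen a) @ [RMul (tmp t) (tmp t) (tmp (Suc t))]"
| "rcomp (RDivide a b) t p = rcomp a t p @ rcomp b (Suc t) (p + rlen a) @ [RDiv (tmp t) (tmp t) (tmp (Suc t))]"
| "rcomp (RRoot a) t p = rcomp a t p @ [RSqrt (tmp t) (tmp t)]"
| "rcomp (RealArr k a) t p = ncomp a t p @ scale (tmp t) (tmp (Suc t)) k @ [RLoad (tmp t) (tmp t)]"
| "rcomp (RealMem a) t p = ncomp a t p @ [RLoad (tmp t) (tmp t)]"

primrec clen :: "com => nat" where
 "clen Skip = 0"
| "clen (SetVar x e) = nlen e + 2"
| "clen (SetReal x e) = rlen e + 2"
| "clen (SetArr k i e) = nlen i + nlen e + 8"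
| "clen (SetRealArr k i e) = nlen i + rlen e + 8"
| "clen (SetRealMem i e) = nlen i + rlen e + 1"
| "clen (Seq c d) = clen c + clen d"
| "clen (IfPos e c d) = nlen e + clen d + clen c + 3"
| "clen (For i x c) = clen c + 6"

text \<open>Registers 1, 3 and 5 are \<open>tmp 0\<close>, \<open>tmp 1\<close> and
  \<open>tmp 2\<close>. Positivity of register 1 is tested by comparing a zero in register 3 with
  it; the branch for failure is placed right after the test.\<close>

primrec ccomp :: "com => nat => instr list" where
 "ccomp Skip p = []"
| "ccomp (SetVar x e) p = ncomp e 0 p @ [NConst (2 * x) 0, NAdd (2 * x) (2 * x) 1]"
| "ccomp (SetReal x e) p = rcomp e 0 p @ [RConst (2 * x) 0, RAdd (2 * x) (2 * x) 1]"
| "ccomp (SetArr k i e) p = ncomp i 0 p @ ncomp e 1 (p + nlen i) @ scale 1 5 k @ [NStore 1 3]"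
| "ccomp (SetRealArr k i e) p = ncomp i 0 p @ rcomp e 1 (p + nlen i) @ scale 1 5 k @ [RStore 1 3]"
| "ccomp (SetRealMem i e) p = ncomp i 0 p @ rcomp e 1 (p + nlen i) @ [RStore 1 3]"
| "ccomp (Seq c d) p = ccomp c p @ ccomp d (p + clen c)"
| "ccomp (IfPos e c d) p = ncomp e 0 p @ [NConst 3 0, NJumpLess 3 1 (p + nlen e + clen d + 3)] @
   ccomp d (p + nlen e + 2) @ [Jump (p + nlen e + clen d + clen c + 3)] @
   ccomp c (p + nlen e + clen d + 3)"
| "ccomp (For i x c) p = [NConst (2 * i) 0, NJumpLess (2 * i) (2 * x) (p + 3), Jump (p + clen c + 6)] @
   ccomp c (p + 3) @ [NConst 3 1, NAdd (2 * i) (2 * i) 3, Jump (p + 1)]"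

lemma length_expr_code [simp]: "length (ncomp a t p) = nlen a" "length (rcomp b t p) = rlen b"
 by (induction a and b arbitrary: t p and t p) (auto simp: scale_def)

lemma length_ccomp [simp]: "length (ccomp c p) = clen c"
 by (induction c arbitrary: p) (auto simp: scale_def)

definition reach :: "instr list => nat => config => config => bool" where
 "reach A t c c' \<longleftrightarrow> (\<exists>k\<le>t. (step A ^^ k) c = c')"

lemma reach_refl [simp]: "reach A t c c"
 unfolding reach_def by (rule exI[of _ 0]) auto

lemma reach_trans: "reach A t c d ==> reach A u d e ==> reach A (t + u) c e"
 unfolding reach_def
proof (elim exE conjE)
 fix k l assume "k <= t" "(step A ^^ k) c = d" "l <= u" "(step A ^^ l) d = e"
 then show "\<exists>m\<le>t + u. (step A ^^ m) c = e"
  by (intro exI[of _ "l + k"]) (auto simp: funpow_add)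
qed

lemma reach_mono: "reach A t c d ==> t <= u ==> reach A u c d"
 unfolding reach_def using le_trans by blast

primrec seg :: "instr list => nat => instr list => bool" where
 "seg A p [] \<longleftrightarrow> True"
| "seg A p (i # is) \<longleftrightarrow> p < length A & A ! p = i & seg A (Suc p) is"

lemma seg_append [simp]: "seg A p (xs @ ys) \<longleftrightarrow> seg A p xs & seg A (p + length xs) ys"
 by (induction xs arbitrary: p) auto

lemma seg_middle: "seg (xs @ ys @ zs) (length xs) ys"
proof (induction ys arbitrary: xs)
 case (Cons y ys)
 from Cons[of "xs @ [y]"] show ?case by (simp add: nth_append)
qed simp

lemma reach_step: "p < length A ==> A ! p = i ==> pc c = p ==> exec i c = d ==> reach A 1 c d"
 unfolding reach_def by (rule exI[of _ 1]) (auto simp: step_def halted_def)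

fun straight :: "instr => bool" where
 "straight (Jump l) \<longleftrightarrow> False"
| "straight (NJumpLess i j l) \<longleftrightarrow> False"
| "straight (RJumpLess i j l) \<longleftrightarrow> False"
| "straight i \<longleftrightarrow> True"

lemma pc_exec_straight: "straight i ==> pc (exec i c) = Suc (pc c)"
 by (cases i) (auto simp: set_nreg_def set_rreg_def)

lemma reach_straight:
 "seg A p is ==> pc c = p ==> \<forall>i\<in>set is. straight i ==> reach A (length is) c (fold exec is c)"
proof (induction "is" arbitrary: p c)
 case (Cons i "is")
 then have "reach A 1 c (exec i c)"
  by (intro reach_step) auto
 moreover have "reach A (length is) (exec i c) (fold exec is (exec i c))"
  using Cons by (intro Cons.IH[of "Suc p"]) (auto simp: pc_exec_straight)
 ultimately show ?case
  using reach_trans by fastforce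
qed simp

text \<open>At level \<open>t\<close> the temporaries from \<open>tmp t\<close> on may be
  overwritten. A left operand thus waits safely in \<open>tmp t\<close> while the right one is
  evaluated at level \<open>Suc t\<close>.\<close>

definition keeps :: "nat => config => config => bool" where
 "keeps t c d \<longleftrightarrow> nmem d = nmem c & rmem d = rmem c &
   (\<forall>i. even i | i < 2 * t --> nreg d i = nreg c i & rreg d i = rreg c i)"

lemma keeps_trans: "keeps t c d ==> keeps u d e ==> t <= u ==> keeps t c e"
 unfolding keeps_def by fastforce

definition store_of :: "config => store" where
 "store_of c = \<lparr>nv = \<lambda>i. nreg c (2 * i), rv = \<lambda>i. rreg c (2 * i), nm = nmem c, rm = rmem c\<rparr>"

lemma store_of_sel [simp]:
 "nv (store_of c) i = nreg c (2 * i)" "rv (store_of c) i = rreg c (2 * i)"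
 "nm (store_of c) = nmem c" "rm (store_of c) = rmem c"
 by (auto simp: store_of_def)

lemma keeps_store_of: "keeps t c d ==> store_of d = store_of c"
 by (auto simp: keeps_def store_of_def)

definition ndone :: "instr list => nexp => nat => config => config => bool" where
 "ndone A e t c d \<longleftrightarrow> reach A (nlen e) c d & keeps t c d & pc d = pc c + nlen e &
   nreg d (tmp t) = nval e (store_of c)"

definition rdone :: "instr list => rexp => nat => config => config => bool" where
 "rdone A e t c d \<longleftrightarrow> reach A (rlen e) c d & keeps t c d & pc d = pc c + rlen e &
   rreg d (tmp t) = rval e (store_of c)"

lemma two_operands:
 assumes "keeps t c d" "keeps (Suc t) d e"
 shows "keeps t c e" "store_of d = store_of c" "nreg e (tmp t) = nreg d (tmp t)"
  "rreg e (tmp t) = rreg d (tmp t)"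
 using assms by (auto simp: keeps_def store_of_def)

lemmas exec_simps = set_nreg_def set_rreg_def

lemma even_ne_tmp [simp]: "2 * x ~= tmp t" "tmp t ~= 2 * x"
 by presburger+

lemma fold_scale:
 assumes "i ~= j"
 shows "fold exec (scale i j k) c =
  c\<lparr>pc := pc c + 7, nreg := (nreg c)(j := k, i := addr k (nreg c i))\<rparr>"
 by (rule config.equality) (use assms in \<open>auto simp: scale_def exec_simps fun_eq_iff\<close>)

lemma straight_scale [simp]: "i \<in> set (scale k l m) ==> straight i"
 by (auto simp: scale_def)

lemma length_scale [simp]: "length (scale k l m) = 7"
 by (simp add: scale_def)

lemma expr_code_correct:
 "seg A (pc c) (ncomp a t (pc c)) ==> \<exists>d. ndone A a t c d"
 "seg A (pc c) (rcomp b t (pc c)) ==> \<exists>d. rdone A b t c d"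
proof (induction a and b arbitrary: t c and t c)
 case (Const k)
 show ?case
  using reach_straight[OF Const refl, unfolded length_expr_code]
  by (intro exI[of _ "fold exec (ncomp (Const k) t (pc c)) c"])
   (auto simp: ndone_def keeps_def exec_simps)
next
 case (Var x)
 show ?case
  using reach_straight[OF Var refl, unfolded length_expr_code]
  by (intro exI[of _ "fold exec (ncomp (Var x) t (pc c)) c"])
   (auto simp: ndone_def keeps_def exec_simps)
next
 case (Plus a b)
 obtain d where d: "ndone A a t c d"
  using Plus.IH(1)[where c=c and t=t] Plus.prems by auto
 obtain e where e: "ndone A b (Suc t) d e"
  using Plus.IH(2)[where c=d and t="Suc t"] Plus.prems d by (auto simp: ndone_def)
 note k = two_operands[of t c d e]
 have "reach A 1 e (exec (NAdd (tmp t) (tmp t) (tmp (Suc t))) e)"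
  using Plus.prems d e by (intro reach_step) (auto simp: ndone_def)
 then show ?case
  using d e k reach_trans[of A _ c d _ e] reach_trans[of A _ c e 1]
  by (intro exI[of _ "exec (NAdd (tmp t) (tmp t) (tmp (Suc t))) e"])
   (auto simp: ndone_def keeps_def exec_simps)
next
 case (Minus a b)
 obtain d where d: "ndone A a t c d"
  using Minus.IH(1)[where c=c and t=t] Minus.prems by auto
 obtain e where e: "ndone A b (Suc t) d e"
  using Minus.IH(2)[where c=d and t="Suc t"] Minus.prems d by (auto simp: ndone_def)
 note k = two_operands[of t c d e]
 have "reach A 1 e (exec (NSub (tmp t) (tmp t) (tmp (Suc t))) e)"
  using Minus.prems d e by (intro reach_step) (auto simp: ndone_def)
 then show ?case
  using d e k reach_trans[of A _ c d _ e] reach_trans[of A _ c e 1]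
  by (intro exI[of _ "exec (NSub (tmp t) (tmp t) (tmp (Suc t))) e"])
   (auto simp: ndone_def keeps_def exec_simps)
next
 case (Arr k a)
 obtain d where d: "ndone A a t c d"
  using Arr.IH(1)[where c=c and t=t] Arr.prems by auto
 let ?is = "scale (tmp t) (tmp (Suc t)) k @ [NLoad (tmp t) (tmp t)]"
 have "reach A (length ?is) d (fold exec ?is d)"
  by (rule reach_straight[of _ "pc d"]) (use Arr.prems d in \<open>auto simp: ndone_def\<close>)
 then show ?case
  using d reach_trans[of A _ c d 8]
  by (intro exI[of _ "fold exec ?is d"])
   (auto simp: ndone_def keeps_def exec_simps fold_scale)
next
 case (Mem a)
 obtain d where d: "ndone A a t c d"
  using Mem.IH(1)[where c=c and t=t] Mem.prems by auto
 let ?is = "[NLoad (tmp t) (tmp t)]"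
 have "reach A (length ?is) d (fold exec ?is d)"
  by (rule reach_straight[of _ "pc d"]) (use Mem.prems d in \<open>auto simp: ndone_def\<close>)
 then show ?case
  using d reach_trans[of A _ c d 1]
  by (intro exI[of _ "fold exec ?is d"])
   (auto simp: ndone_def keeps_def exec_simps)
next
 case (RLess a b)
 obtain d where d: "rdone A a t c d"
  using RLess.IH(1)[where c=c and t=t] RLess.prems by auto
 obtain e where e: "rdone A b (Suc t) d e"
  using RLess.IH(2)[where c=d and t="Suc t"] RLess.prems d by (auto simp: rdone_def)
 note k = two_operands[of t c d e]
 let ?l = "pc c + rlen a + rlen b + 3"
 let ?f = "exec (NConst (tmp t) 1) e"
 let ?g = "exec (RJumpLess (tmp t) (tmp (Suc t)) ?l) ?f"
 let ?h = "if rreg e (tmp t) < rreg e (tmp (Suc t)) then ?g else exec (NConst (tmp t) 0) ?g"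
 have f: "reach A 1 e ?f"
  using RLess.prems d e by (intro reach_step) (auto simp: rdone_def)
 have g: "reach A 1 ?f ?g"
  using RLess.prems d e by (intro reach_step) (auto simp: rdone_def exec_simps)
 have h: "reach A 1 ?g ?h"
 proof (cases "rreg e (tmp t) < rreg e (tmp (Suc t))")
  case False
  then show ?thesis
   using RLess.prems d e
   by (simp only: if_False, intro reach_step) (auto simp: rdone_def exec_simps)
 qed simp
 have "reach A (rlen a + rlen b + (1 + 1 + 1)) c ?h"
  using d e by (intro reach_trans[OF reach_trans[of A _ c d _ e] reach_trans[OF reach_trans[OF f g] h]])
   (auto simp: rdone_def)
 moreover have "keeps t e ?h" "pc ?h = pc e + 3"
  "nreg ?h (tmp t) = (if rreg e (tmp t) < rreg e (tmp (Suc t)) then 1 else 0)"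
  using d e by (auto simp: keeps_def exec_simps rdone_def)
 ultimately obtain h where h: "reach A (rlen a + rlen b + (1 + 1 + 1)) c h" "keeps t e h" "pc h = pc e + 3"
  "nreg h (tmp t) = (if rreg e (tmp t) < rreg e (tmp (Suc t)) then 1 else 0)"
  by blast
 then have "ndone A (RLess a b) t c h"
  using d e k keeps_trans[of t c e t h] by (auto simp: ndone_def rdone_def eval_nat_numeral)
 then show ?case ..
next
 case (RealConst k)
 show ?case
  using reach_straight[OF RealConst refl, unfolded length_expr_code]
  by (intro exI[of _ "fold exec (rcomp (RealConst k) t (pc c)) c"])
   (auto simp: rdone_def keeps_def exec_simps)
next
 case (RealVar x)
 show ?case
  using reach_straight[OF RealVar refl, unfolded length_expr_code]
  by (intro exI[of _ "fold exec (rcomp (RealVar x) t (pc c)) c"])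
   (auto simp: rdone_def keeps_def exec_simps)
next
 case (RPlus a b)
 obtain d where d: "rdone A a t c d"
  using RPlus.IH(1)[where c=c and t=t] RPlus.prems by auto
 obtain e where e: "rdone A b (Suc t) d e"
  using RPlus.IH(2)[where c=d and t="Suc t"] RPlus.prems d by (auto simp: rdone_def)
 note k = two_operands[of t c d e]
 have "reach A 1 e (exec (RAdd (tmp t) (tmp t) (tmp (Suc t))) e)"
  using RPlus.prems d e by (intro reach_step) (auto simp: rdone_def)
 then show ?case
  using d e k reach_trans[of A _ c d _ e] reach_trans[of A _ c e 1]
  by (intro exI[of _ "exec (RAdd (tmp t) (tmp t) (tmp (Suc t))) e"])
   (auto simp: rdone_def keeps_def exec_simps)
next
 case (RMinus a b)
 obtain d where d: "rdone A a t c d"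
  using RMinus.IH(1)[where c=c and t=t] RMinus.prems by auto
 obtain e where e: "rdone A b (Suc t) d e"
  using RMinus.IH(2)[where c=d and t="Suc t"] RMinus.prems d by (auto simp: rdone_def)
 note k = two_operands[of t c d e]
 have "reach A 1 e (exec (RSub (tmp t) (tmp t) (tmp (Suc t))) e)"
  using RMinus.prems d e by (intro reach_step) (auto simp: rdone_def)
 then show ?case
  using d e k reach_trans[of A _ c d _ e] reach_trans[of A _ c e 1]
  by (intro exI[of _ "exec (RSub (tmp t) (tmp t) (tmp (Suc t))) e"])
   (auto simp: rdone_def keeps_def exec_simps)
next
 case (RTimes a b)
 obtain d where d: "rdone A a t c d"
  using RTimes.IH(1)[where c=c and t=t] RTimes.prems by auto
 obtain e where e: "rdone A b (Suc t) d e"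
  using RTimes.IH(2)[where c=d and t="Suc t"] RTimes.prems d by (auto simp: rdone_def)
 note k = two_operands[of t c d e]
 have "reach A 1 e (exec (RMul (tmp t) (tmp t) (tmp (Suc t))) e)"
  using RTimes.prems d e by (intro reach_step) (auto simp: rdone_def)
 then show ?case
  using d e k reach_trans[of A _ c d _ e] reach_trans[of A _ c e 1]
  by (intro exI[of _ "exec (RMul (tmp t) (tmp t) (tmp (Suc t))) e"])
   (auto simp: rdone_def keeps_def exec_simps)
next
 case (RDivide a b)
 obtain d where d: "rdone A a t c d"
  using RDivide.IH(1)[where c=c and t=t] RDivide.prems by auto
 obtain e where e: "rdone A b (Suc t) d e"
  using RDivide.IH(2)[where c=d and t="Suc t"] RDivide.prems d by (auto simp: rdone_def)
 note k = two_operands[of t c d e]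
 have "reach A 1 e (exec (RDiv (tmp t) (tmp t) (tmp (Suc t))) e)"
  using RDivide.prems d e by (intro reach_step) (auto simp: rdone_def)
 then show ?case
  using d e k reach_trans[of A _ c d _ e] reach_trans[of A _ c e 1]
  by (intro exI[of _ "exec (RDiv (tmp t) (tmp t) (tmp (Suc t))) e"])
   (auto simp: rdone_def keeps_def exec_simps)
next
 case (RRoot a)
 obtain d where d: "rdone A a t c d"
  using RRoot.IH(1)[where c=c and t=t] RRoot.prems by auto
 let ?is = "[RSqrt (tmp t) (tmp t)]"
 have "reach A (length ?is) d (fold exec ?is d)"
  by (rule reach_straight[of _ "pc d"]) (use RRoot.prems d in \<open>auto simp: rdone_def\<close>)
 then show ?case
  using d reach_trans[of A _ c d 1]
  by (intro exI[of _ "fold exec ?is d"])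
   (auto simp: rdone_def keeps_def exec_simps)
next
 case (RealArr k a)
 obtain d where d: "ndone A a t c d"
  using RealArr.IH(1)[where c=c and t=t] RealArr.prems by auto
 let ?is = "scale (tmp t) (tmp (Suc t)) k @ [RLoad (tmp t) (tmp t)]"
 have "reach A (length ?is) d (fold exec ?is d)"
  by (rule reach_straight[of _ "pc d"]) (use RealArr.prems d in \<open>auto simp: ndone_def\<close>)
 then show ?case
  using d reach_trans[of A _ c d 8]
  by (intro exI[of _ "fold exec ?is d"])
   (auto simp: ndone_def rdone_def keeps_def exec_simps fold_scale)
next
 case (RealMem a)
 obtain d where d: "ndone A a t c d"
  using RealMem.IH(1)[where c=c and t=t] RealMem.prems by auto
 let ?is = "[RLoad (tmp t) (tmp t)]"
 have "reach A (length ?is) d (fold exec ?is d)"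
  by (rule reach_straight[of _ "pc d"]) (use RealMem.prems d in \<open>auto simp: ndone_def\<close>)
 then show ?case
  using d reach_trans[of A _ c d 1]
  by (intro exI[of _ "fold exec ?is d"])
   (auto simp: ndone_def rdone_def keeps_def exec_simps)
qed

text \<open>\<open>M\<close> stands for a common bound on all loop bounds. Adding up both branches
  of a conditional is coarse, but keeps the bound independent of the store and polynomial in
  \<open>M\<close>.\<close>

primrec time :: "com => nat => nat" where
 "time Skip M = 0"
| "time (SetVar x e) M = nlen e + 2"
| "time (SetReal x e) M = rlen e + 2"
| "time (SetArr k i e) M = nlen i + nlen e + 8"
| "time (SetRealArr k i e) M = nlen i + rlen e + 8"
| "time (SetRealMem i e) M = nlen i + rlen e + 1"
| "time (Seq c d) M = time c M + time d M"
| "time (IfPos e c d) M = nlen e + 3 + time c M + time d M"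
| "time (For i x c) M = M * (time c M + 4) + 3"

lemma poly_bound_add:
 assumes "\<forall>M. f M <= C * (M + 1) ^ d" "\<forall>M. g M <= D * (M + 1) ^ e"
 shows "f M + g M <= (C + D) * (M + 1 :: nat) ^ (d + e)"
proof -
 have "C * (M + 1) ^ d <= C * (M + 1) ^ (d + e)" "D * (M + 1) ^ e <= D * (M + 1) ^ (d + e)"
  by (intro mult_le_mono le_refl power_increasing; simp)+
 moreover have "f M <= C * (M + 1) ^ d" "g M <= D * (M + 1) ^ e"
  using assms by blast+
 ultimately show ?thesis by (simp only: add_mult_distrib)
qed

lemma time_poly: "\<exists>C d. \<forall>M. time c M <= C * (M + 1) ^ d"
proof (induction c)
 case (Seq c1 c2)
 then obtain C d D e where "\<forall>M. time c1 M <= C * (M + 1) ^ d" "\<forall>M. time c2 M <= D * (M + 1) ^ e"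
  by blast
 from poly_bound_add[OF this] show ?case by auto
next
 case (IfPos b c1 c2)
 then obtain C d D e where "\<forall>M. time c1 M <= C * (M + 1) ^ d" "\<forall>M. time c2 M <= D * (M + 1) ^ e"
  by blast
 from poly_bound_add[OF this]
 have 1: "\<forall>M. time c1 M + time c2 M <= (C + D) * (M + 1) ^ (d + e)"
  by blast
 have 2: "\<forall>M. nlen b + 3 <= (nlen b + 3) * (M + 1) ^ 0"
  by simp
 from poly_bound_add[OF 1 2] show ?case
  by (intro exI[of _ "C + D + (nlen b + 3)"] exI[of _ "d + e + 0"] allI) (simp add: add_ac)
next
 case (For i x c)
 then obtain C d where C: "\<And>M. time c M <= C * (M + 1) ^ d"
  by blast
 have "M * (time c M + 4) + 3 <= (C + 7) * (M + 1) ^ (d + 1)" for M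
 proof -
  have "4 * 1 <= 4 * (M + 1) ^ d" by (intro mult_le_mono) auto
  then have "time c M + 4 <= (C + 4) * (M + 1) ^ d"
   using C[of M] unfolding add_mult_distrib by linarith
  then have "M * (time c M + 4) <= (M + 1) * ((C + 4) * (M + 1) ^ d)"
   by (intro mult_le_mono) auto
  moreover have "3 * 1 <= 3 * (M + 1) ^ (d + 1)"
   by (intro mult_le_mono one_le_power) auto
  ultimately show ?thesis by (simp add: algebra_simps)
 qed
 then show ?case by (intro exI[of _ "C + 7"] exI[of _ "d + 1"]) simp
qed (unfold time.simps, (rule exI, rule exI[of _ 0], simp only: power_0 mult_1_right, rule allI, rule order_refl)+)

lemma store_of_exec_temporary [simp]:
 "store_of (exec (NConst 3 k) c) = store_of c"
 "store_of (exec (Jump l) c) = store_of c"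
 "store_of (exec (NJumpLess i j l) c) = store_of c"
proof -
 have "2 * i ~= 3" for i :: nat by presburger
 then show "store_of (exec (NConst 3 k) c) = store_of c"
  by (auto simp: store_of_def exec_simps)
qed (auto simp: store_of_def)

lemma store_of_increment:
 "store_of (exec (NAdd (2 * i) (2 * i) 3) (exec (NConst 3 1) c)) =
  (store_of c)\<lparr>nv := (nv (store_of c))(i := Suc (nv (store_of c) i))\<rparr>"
proof -
 have "2 * i ~= 3" for i :: nat by presburger
 then show ?thesis by (auto simp: store_of_def exec_simps fun_eq_iff)
qed

definition cdone :: "instr list => com => nat => config => config => bool" where
 "cdone A c M a b \<longleftrightarrow> reach A (time c M) a b & pc b = pc a + clen c &
   store_of b = run c (store_of a)"

text \<open>Since no loop bound is ever modified, its value at the start is also its value whenever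
  the loop is entered, even for inner loops in late rounds. Bounding these initial values by
  \<open>M\<close> is therefore enough.\<close>

lemma com_code_correct:
 assumes "well_formed c" "seg A (pc a) (ccomp c (pc a))" "bounds c \<inter> nmods c = {}"
  and "\<forall>x\<in>bounds c. nv (store_of a) x <= M"
 shows "\<exists>b. cdone A c M a b"
 using assms
proof (induction c arbitrary: a)
 case Skip
 then show ?case by (intro exI[of _ a]) (auto simp: cdone_def)
next
 case (SetVar x e)
 then obtain b where b: "ndone A e 0 a b"
  using expr_code_correct(1)[of A a e 0] by auto
 let ?is = "[NConst (2 * x) 0, NAdd (2 * x) (2 * x) 1]"
 have "reach A (length ?is) b (fold exec ?is b)"
  by (rule reach_straight[of _ "pc b"]) (use SetVar.prems b in \<open>auto simp: ndone_def\<close>)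
 then have "reach A (nlen e + 2) a (fold exec ?is b)"
  using b by (intro reach_trans[of A _ a b]) (auto simp: ndone_def numeral_2_eq_2)
 moreover have "2 * y ~= Suc 0" for y :: nat by presburger
 ultimately show ?case
  using b keeps_store_of[of 0 a b]
  by (intro exI[of _ "fold exec ?is b"])
   (auto simp: cdone_def ndone_def exec_simps store_of_def fun_eq_iff)
next
 case (SetReal x e)
 then obtain b where b: "rdone A e 0 a b"
  using expr_code_correct(2)[of A a e 0] by auto
 let ?is = "[RConst (2 * x) 0, RAdd (2 * x) (2 * x) 1]"
 have "reach A (length ?is) b (fold exec ?is b)"
  by (rule reach_straight[of _ "pc b"]) (use SetReal.prems b in \<open>auto simp: rdone_def\<close>)
 then have "reach A (rlen e + 2) a (fold exec ?is b)"
  using b by (intro reach_trans[of A _ a b]) (auto simp: rdone_def numeral_2_eq_2)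
 moreover have "2 * y ~= Suc 0" for y :: nat by presburger
 ultimately show ?case
  using b keeps_store_of[of 0 a b]
  by (intro exI[of _ "fold exec ?is b"])
   (auto simp: cdone_def rdone_def exec_simps store_of_def fun_eq_iff)
next
 case (SetArr k i e)
 then obtain b where b: "ndone A i 0 a b"
  using expr_code_correct(1)[of A a i 0] by auto
 then obtain d where d: "ndone A e 1 b d"
  using SetArr.prems expr_code_correct(1)[of A b e 1] by (auto simp: ndone_def)
 have k: "keeps 0 a d" "store_of b = store_of a" "nreg d 1 = nreg b 1"
  using b d two_operands[of 0 a b d] by (auto simp: ndone_def)
 let ?is = "scale 1 5 k @ [NStore 1 3]"
 have "reach A (length ?is) d (fold exec ?is d)"
  by (rule reach_straight[of _ "pc d"]) (use SetArr.prems b d in \<open>auto simp: ndone_def add_ac\<close>)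
 then have "reach A (nlen i + nlen e + 8) a (fold exec ?is d)"
  using b d by (intro reach_trans[OF reach_trans, of A _ a b _ d]) (auto simp: ndone_def)
 moreover have "store_of (fold exec ?is d) =
   (store_of d)\<lparr>nm := (nm (store_of d))(addr k (nreg d 1) := nreg d 3)\<rparr>"
 proof -
  have "2 * y ~= Suc 0" "2 * y ~= 5" for y :: nat by presburger+
  then show ?thesis by (simp add: store_of_def exec_simps fold_scale fun_eq_iff)
 qed
 moreover have "pc (fold exec ?is d) = pc d + 8"
  by (simp add: fold_scale)
 ultimately show ?case
  using b d k keeps_store_of[OF k(1)]
  by (intro exI[of _ "fold exec ?is d"])
   (simp add: cdone_def ndone_def rdone_def del: store_of_sel fold.simps fold_append exec.simps)
next
 case (SetRealArr k i e)
 then obtain b where b: "ndone A i 0 a b"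
  using expr_code_correct(1)[of A a i 0] by auto
 then obtain d where d: "rdone A e 1 b d"
  using SetRealArr.prems expr_code_correct(2)[of A b e 1] by (auto simp: ndone_def)
 have k: "keeps 0 a d" "store_of b = store_of a" "nreg d 1 = nreg b 1"
  using b d two_operands[of 0 a b d] by (auto simp: ndone_def rdone_def)
 let ?is = "scale 1 5 k @ [RStore 1 3]"
 have "reach A (length ?is) d (fold exec ?is d)"
  by (rule reach_straight[of _ "pc d"]) (use SetRealArr.prems b d in \<open>auto simp: ndone_def rdone_def add_ac\<close>)
 then have "reach A (nlen i + rlen e + 8) a (fold exec ?is d)"
  using b d by (intro reach_trans[OF reach_trans, of A _ a b _ d]) (auto simp: ndone_def rdone_def)
 moreover have "store_of (fold exec ?is d) =
   (store_of d)\<lparr>rm := (rm (store_of d))(addr k (nreg d 1) := rreg d 3)\<rparr>"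
 proof -
  have "2 * y ~= Suc 0" "2 * y ~= 5" for y :: nat by presburger+
  then show ?thesis by (simp add: store_of_def exec_simps fold_scale fun_eq_iff)
 qed
 moreover have "pc (fold exec ?is d) = pc d + 8"
  by (simp add: fold_scale)
 ultimately show ?case
  using b d k keeps_store_of[OF k(1)]
  by (intro exI[of _ "fold exec ?is d"])
   (simp add: cdone_def ndone_def rdone_def del: store_of_sel fold.simps fold_append exec.simps)
next
 case (SetRealMem i e)
 then obtain b where b: "ndone A i 0 a b"
  using expr_code_correct(1)[of A a i 0] by auto
 then obtain d where d: "rdone A e 1 b d"
  using SetRealMem.prems expr_code_correct(2)[of A b e 1] by (auto simp: ndone_def)
 have k: "keeps 0 a d" "store_of b = store_of a" "nreg d 1 = nreg b 1"
  using b d two_operands[of 0 a b d] by (auto simp: ndone_def rdone_def)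
 have "reach A 1 d (exec (RStore 1 3) d)"
  by (rule reach_step[OF _ _ refl]) (use SetRealMem.prems b d in \<open>auto simp: ndone_def rdone_def add_ac\<close>)
 then have "reach A (nlen i + rlen e + 1) a (exec (RStore 1 3) d)"
  using b d by (intro reach_trans[OF reach_trans, of A _ a b _ d]) (auto simp: ndone_def rdone_def)
 moreover have "store_of (exec (RStore 1 3) d) =
   (store_of d)\<lparr>rm := (rm (store_of d))(nreg d 1 := rreg d 3)\<rparr>"
  by (simp add: store_of_def)
 moreover have "pc (exec (RStore 1 3) d) = pc d + 1"
  by simp
 ultimately show ?case
  using b d k keeps_store_of[OF k(1)]
  by (intro exI[of _ "exec (RStore 1 3) d"])
   (simp add: cdone_def ndone_def rdone_def del: store_of_sel exec.simps)
next
 case (Seq c d)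
 then have "\<exists>b. cdone A c M a b"
  by (intro Seq.IH(1)) auto
 then obtain b where b: "cdone A c M a b" ..
 moreover have "nv (store_of b) x = nv (store_of a) x" if "x \<in> bounds d" for x
  using b Seq.prems(3) that nv_run[of x c] by (auto simp: cdone_def simp del: store_of_sel)
 ultimately have "\<exists>e. cdone A d M b e"
  using Seq.prems by (intro Seq.IH(2)) (auto simp: cdone_def simp del: store_of_sel)
 then obtain e where e: "cdone A d M b e" ..
 with b have "reach A (time c M + time d M) a e"
  unfolding cdone_def by (blast intro: reach_trans)
 then show ?case
  using b e by (intro exI[of _ e]) (simp add: cdone_def)
next
 case (IfPos e c d)
 let ?p = "pc a"
 let ?l = "?p + nlen e + clen d + 3"
 obtain b where b: "ndone A e 0 a b"
  using IfPos.prems expr_code_correct(1)[of A a e 0] by auto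
 let ?f = "exec (NConst 3 0) b"
 let ?g = "exec (NJumpLess 3 1 ?l) ?f"
 have code: "seg A (?p + nlen e + 2) (ccomp d (?p + nlen e + 2))" "seg A ?l (ccomp c ?l)"
  "?p + nlen e + 2 + clen d < length A"
  "A ! (?p + nlen e + 2 + clen d) = Jump (?p + nlen e + clen d + clen c + 3)"
  using IfPos.prems(2) by (auto simp: eval_nat_numeral add_ac)
 have "reach A (1 + 1) b ?g"
  using IfPos.prems b by (intro reach_trans[OF reach_step reach_step]) (auto simp: ndone_def exec_simps)
 then have "reach A (nlen e + (1 + 1)) a ?g"
  using b by (intro reach_trans[of A _ a b]) (auto simp: ndone_def)
 moreover have "store_of ?g = store_of a"
  using b keeps_store_of[of 0 a b] by (simp only: store_of_exec_temporary ndone_def)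
 moreover have "pc ?g = (if 0 < nval e (store_of a) then ?l else ?p + nlen e + 2)"
  using b by (auto simp: ndone_def exec_simps)
 ultimately obtain g where g: "reach A (nlen e + 2) a g" "store_of g = store_of a"
  "pc g = (if 0 < nval e (store_of a) then ?l else ?p + nlen e + 2)"
  by (metis one_add_one)
 show ?case
 proof (cases "0 < nval e (store_of a)")
  case True
  then have "\<exists>h. cdone A c M g h"
   using IfPos.prems g code by (intro IfPos.IH(1)) (auto simp del: store_of_sel)
  then obtain h where h: "cdone A c M g h" ..
  then have "reach A (time c M) g h" by (simp add: cdone_def)
  from reach_trans[OF g(1) this] have "reach A (time (IfPos e c d) M) a h"
   by (rule reach_mono) simp
  then show ?thesis
   using True g h by (intro exI[of _ h]) (auto simp: cdone_def simp del: store_of_sel time.simps)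
 next
  case False
  then have "\<exists>h. cdone A d M g h"
   using IfPos.prems g code by (intro IfPos.IH(2)) (auto simp del: store_of_sel)
  then obtain h where h: "cdone A d M g h" ..
  let ?i = "exec (Jump (?p + nlen e + clen d + clen c + 3)) h"
  have "reach A 1 h ?i"
   by (rule reach_step[OF code(3,4) _ refl]) (use h g False in \<open>auto simp: cdone_def\<close>)
  moreover have "reach A (time d M) g h" using h by (simp add: cdone_def)
  ultimately have "reach A (nlen e + 2 + time d M + 1) a ?i"
   using g(1) by (blast intro: reach_trans)
  then have "reach A (time (IfPos e c d) M) a ?i"
   by (rule reach_mono) simp
  moreover have "store_of ?i = store_of h" "pc ?i = ?p + nlen e + clen d + clen c + 3"
   by (simp_all add: store_of_def)
  ultimately show ?thesis
   using False g h
   by (intro exI[of _ ?i]) (auto simp: cdone_def simp del: store_of_sel exec.simps time.simps)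
 qed
next
 case (For i x c)
 let ?p = "pc a"
 define N where "N = nv (store_of a) x"
 define F where "F = (\<lambda>s. (run c s)\<lparr>nv := (nv (run c s))(i := Suc (nv (run c s) i))\<rparr>)"
 define s where "s = (store_of a)\<lparr>nv := (nv (store_of a))(i := 0)\<rparr>"
 have code: "seg A (?p + 3) (ccomp c (?p + 3))" "?p + clen c + 5 < length A"
  "A ! ?p = NConst (2 * i) 0" "A ! (?p + 1) = NJumpLess (2 * i) (2 * x) (?p + 3)"
  "A ! (?p + 2) = Jump (?p + clen c + 6)" "A ! (?p + clen c + 3) = NConst 3 1"
  "A ! (?p + clen c + 4) = NAdd (2 * i) (2 * i) 3" "A ! (?p + clen c + 5) = Jump (?p + 1)"
  using For.prems(2) by (auto simp: eval_nat_numeral add_ac)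
 have F: "nv (F t) i = Suc (nv t i)" "\<forall>y. y ~= i & y ~: nmods c --> nv (F t) y = nv t y" for t
  using For.prems by (auto simp: F_def nv_run)
 have Fj: "nv ((F ^^ j) s) i = j & (\<forall>y. y ~= i & y ~: nmods c --> nv ((F ^^ j) s) y = nv (store_of a) y)" for j
  by (induction j) (use F in \<open>auto simp: s_def\<close>)
 \<comment> \<open>Each round costs its body and four instructions: the test, and the constant,
   addition and jump that close the round. The leading 1 is for clearing the counter.\<close>
 have loop: "\<exists>b. reach A (1 + j * (time c M + 4)) a b & pc b = ?p + 1 & store_of b = (F ^^ j) s"
  if "j <= N" for j
  using that
 proof (induction j)
  case 0
  have "reach A 1 a (exec (NConst (2 * i) 0) a)"
   using code by (intro reach_step[OF _ _ refl]) auto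
  then show ?case
   by (intro exI[of _ "exec (NConst (2 * i) 0) a"]) (auto simp: s_def store_of_def exec_simps fun_eq_iff)
 next
  case (Suc j)
  then obtain b where b: "reach A (1 + j * (time c M + 4)) a b" "pc b = ?p + 1" "store_of b = (F ^^ j) s"
   by auto
  have lt: "nreg b (2 * i) < nreg b (2 * x)"
   using Suc.prems Fj[of j] For.prems b(3)[symmetric] by (auto simp: N_def)
  let ?c = "exec (NJumpLess (2 * i) (2 * x) (?p + 3)) b"
  have "reach A 1 b ?c"
   by (rule reach_step[OF _ code(4) b(2) refl]) (use code(2) in simp)
  moreover have "pc ?c = ?p + 3" using lt by simp
  moreover have "store_of ?c = (F ^^ j) s" using b(3) by (simp only: store_of_exec_temporary)
  ultimately obtain g where c: "reach A 1 b g" "pc g = ?p + 3" "store_of g = (F ^^ j) s"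
   by (rule that)
  have "nv (store_of g) y <= M" if "y \<in> bounds c" for y
   using Fj[of j] For.prems(3,4) that unfolding c(3) by (auto simp del: store_of_sel)
  then have "\<exists>d. cdone A c M g d"
   using For.prems(1,3) c code(1) by (intro For.IH) (auto simp del: store_of_sel)
  then obtain d where d: "cdone A c M g d" ..
  let ?e = "exec (NConst 3 1) d"
  let ?f = "exec (NAdd (2 * i) (2 * i) 3) ?e"
  let ?g = "exec (Jump (?p + 1)) ?f"
  have pd: "pc d = ?p + clen c + 3" using d c(2) by (auto simp: cdone_def)
  have "reach A 1 d ?e"
   by (rule reach_step[OF _ code(6) pd refl]) (use code(2) in simp)
  moreover have "reach A 1 ?e ?f"
   by (rule reach_step[OF _ code(7) _ refl]) (use code(2) pd in \<open>simp_all add: exec_simps\<close>)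
  moreover have "reach A 1 ?f ?g"
   by (rule reach_step[OF code(2,8) _ refl]) (use pd in \<open>simp add: exec_simps\<close>)
  moreover have "reach A (time c M) g d" using d by (simp add: cdone_def)
  ultimately have "reach A (1 + j * (time c M + 4) + 1 + time c M + 1 + 1 + 1) a ?g"
   using b(1) c(1) by (blast intro: reach_trans)
  moreover have "store_of ?g = (F ^^ Suc j) s"
   using d c(3) by (simp only: store_of_exec_temporary store_of_increment) (simp add: cdone_def F_def)
  moreover have "pc ?g = ?p + 1" by simp
  moreover have "1 + j * (time c M + 4) + 1 + time c M + 1 + 1 + 1 = 1 + Suc j * (time c M + 4)"
   by simp
  ultimately show ?case
   by metis
 qed
 from loop[OF order_refl] obtain b where
  b: "reach A (1 + N * (time c M + 4)) a b" "pc b = ?p + 1" "store_of b = (F ^^ N) s"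
  by (elim exE conjE)
 have ge: "\<not> nreg b (2 * i) < nreg b (2 * x)"
  using Fj[of N] For.prems b(3)[symmetric] by (auto simp: N_def)
 let ?c = "exec (NJumpLess (2 * i) (2 * x) (?p + 3)) b"
 let ?d = "exec (Jump (?p + clen c + 6)) ?c"
 have "reach A 1 b ?c"
  by (rule reach_step[OF _ code(4) b(2) refl]) (use code(2) in simp)
 moreover have "reach A 1 ?c ?d"
  by (rule reach_step[OF _ code(5) _ refl]) (use code(2) b(2) ge in simp_all)
 ultimately have "reach A (1 + N * (time c M + 4) + 1 + 1) a ?d"
  using b(1) by (blast intro: reach_trans)
 moreover have "1 + N * (time c M + 4) + 1 + 1 <= time (For i x c) M"
 proof -
  have "N <= M" using For.prems(4) by (simp add: N_def)
  then have "N * (time c M + 4) <= M * (time c M + 4)" by (rule mult_le_mono1)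
  then show ?thesis by simp
 qed
 ultimately have "reach A (time (For i x c) M) a ?d"
  by (rule reach_mono)
 moreover have "store_of ?d = run (For i x c) (store_of a)"
  using b(3) by (simp only: store_of_exec_temporary) (simp add: F_def s_def N_def)
 moreover have "pc ?d = pc a + clen (For i x c)"
  by simp
 ultimately show ?case
  unfolding cdone_def by (intro exI[of _ ?d] conjI)
qed

text \<open>The only loop without a fixed bound, left when variable \<open>x\<close> becomes
  positive. Five commands are kept apart because each must leave its own loop bounds alone:
  \<open>c0\<close> and \<open>c2\<close> set the bounds on which \<open>c1\<close> and
  \<open>c3\<close> rely. The two opening instructions rescue the second input number from register
  1, a temporary, to register 2, which is variable 1.\<close>

definition loop_program :: "com => com => com => com => nat => com => instr list" where
 "loop_program c0 c1 c2 c3 x c4 =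
   (let p2 = 2 + clen c0 + clen c1; p4 = p2 + clen c2 + clen c3 in
   [NConst 3 0, NAdd 2 1 3] @ ccomp c0 2 @ ccomp c1 (2 + clen c0) @
   ccomp c2 p2 @ ccomp c3 (p2 + clen c2) @
   [NConst 3 0, NJumpLess 3 (2 * x) (p4 + 3), Jump p2] @ ccomp c4 (p4 + 3))"

abbreviation separated :: "com => bool" where
 "separated c \<equiv> well_formed c & bounds c \<inter> nmods c = {}"

definition start_store :: "config => store" where
 "start_store a = (store_of a)\<lparr>nv := (nv (store_of a))(1 := nreg a 1)\<rparr>"

lemma seg_self: "seg (xs @ ys) (length xs) ys"
 using seg_middle[of xs ys "[]"] by simp

lemma loop_program_correct:
 fixes c0 c1 c2 c3 c4 x
 defines "A \<equiv> loop_program c0 c1 c2 c3 x c4" and "G \<equiv> \<lambda>s. run c3 (run c2 s)"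
 assumes sep: "separated c0" "separated c1" "separated c2" "separated c3" "separated c4"
  and "pc a = 0" "bounds c0 = {}" "bounds c2 = {}"
  and bound1: "\<forall>y\<in>bounds c1. nv (run c0 (start_store a)) y <= M"
  and s1: "s1 = run c1 (run c0 (start_store a))"
  and bound3: "\<And>j. j <= K ==> \<forall>y\<in>bounds c3. nv (run c2 ((G ^^ j) s1)) y <= M"
  and bound4: "\<forall>y\<in>bounds c4. nv ((G ^^ Suc K) s1) y <= M"
  and continue: "\<And>j. j < K ==> nv ((G ^^ Suc j) s1) x = 0"
  and stop: "0 < nv ((G ^^ Suc K) s1) x"
 shows "\<exists>b. reach A (2 + time c0 M + time c1 M + Suc K * (time c2 M + time c3 M + 3) + time c4 M) a b &
   halted A b & store_of b = run c4 ((G ^^ Suc K) s1)"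
proof -
 define p1 p2 p3 p4 where "p1 = 2 + clen c0" and "p2 = p1 + clen c1" and "p3 = p2 + clen c2"
  and "p4 = p3 + clen c3"
 have A: "A = [NConst 3 0, NAdd 2 1 3] @ ccomp c0 2 @ ccomp c1 p1 @ ccomp c2 p2 @ ccomp c3 p3 @
   [NConst 3 0, NJumpLess 3 (2 * x) (p4 + 3), Jump p2] @ ccomp c4 (p4 + 3)"
  by (simp add: A_def loop_program_def p1_def p2_def p3_def p4_def Let_def add_ac)
 have "seg A 0 A"
  using seg_self[of "[]" A] by simp
 then have code: "seg A 2 (ccomp c0 2)" "seg A p1 (ccomp c1 p1)" "seg A p2 (ccomp c2 p2)"
  "seg A p3 (ccomp c3 p3)" "seg A p4 [NConst 3 0, NJumpLess 3 (2 * x) (p4 + 3), Jump p2]"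
  "seg A (p4 + 3) (ccomp c4 (p4 + 3))" "seg A 0 [NConst 3 0, NAdd 2 1 3]"
  unfolding A seg_append by (simp_all add: p1_def p2_def p3_def p4_def eval_nat_numeral add_ac del: seg.simps)
 have len: "length A = p4 + 3 + clen c4"
  by (simp add: A p1_def p2_def p3_def p4_def)
 have code4: "p4 + 2 < length A" "A ! p4 = NConst 3 0" "A ! (p4 + 1) = NJumpLess 3 (2 * x) (p4 + 3)"
  "A ! (p4 + 2) = Jump p2"
  using code(5) by (auto simp: eval_nat_numeral)
 define a0 where "a0 = fold exec [NConst 3 0, NAdd 2 1 3] a"
 have "reach A 2 a a0"
  using reach_straight[OF code(7), of a] \<open>pc a = 0\<close> by (simp add: a0_def eval_nat_numeral)
 moreover have "pc a0 = 2" "store_of a0 = start_store a"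
 proof -
  have "2 * i ~= 3" "2 * i = 2 \<longleftrightarrow> i = 1" for i :: nat by presburger+
  then show "store_of a0 = start_store a"
   by (auto simp: a0_def store_of_def start_store_def exec_simps fun_eq_iff)
 qed (simp add: a0_def exec_simps \<open>pc a = 0\<close>)
 moreover have "\<exists>b. cdone A c0 M a0 b"
  using sep calculation code \<open>bounds c0 = {}\<close> by (intro com_code_correct) simp_all
 ultimately obtain a1 where a1: "reach A 2 a a0" "reach A (time c0 M) a0 a1" "pc a1 = p1"
  "store_of a1 = run c0 (start_store a)"
  by (auto simp: cdone_def p1_def)
 then have "\<exists>b. cdone A c1 M a1 b"
  using sep code bound1 by (intro com_code_correct) (simp_all del: store_of_sel)
 then obtain a2 where a2: "reach A (time c1 M) a1 a2" "pc a2 = p2" "store_of a2 = s1"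
  using a1 by (auto simp: cdone_def p2_def s1)
 have a2': "reach A (2 + time c0 M + time c1 M) a a2"
  using reach_trans[OF reach_trans[OF a1(1,2)] a2(1)] .
 let ?t = "time c2 M + time c3 M"
 have iter: "\<exists>d. reach A ?t b d & pc d = p4 & store_of d = (G ^^ Suc j) s1"
  if b: "pc b = p2" "store_of b = (G ^^ j) s1" and "j <= K" for b j
 proof -
  have "\<exists>d. cdone A c2 M b d"
   using sep code b \<open>bounds c2 = {}\<close> by (intro com_code_correct) simp_all
  then obtain d where d: "reach A (time c2 M) b d" "pc d = p3" "store_of d = run c2 ((G ^^ j) s1)"
   using b by (auto simp: cdone_def p3_def)
  then have "\<exists>e. cdone A c3 M d e"
   using sep code bound3[OF \<open>j <= K\<close>] by (intro com_code_correct) (simp_all del: store_of_sel)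
  then obtain e where "reach A (time c3 M) d e" "pc e = p4" "store_of e = (G ^^ Suc j) s1"
   using d by (auto simp: cdone_def p4_def G_def)
  then show ?thesis using reach_trans[OF d(1)] by blast
 qed
 have test: "\<exists>d. reach A 3 b d & store_of d = store_of b &
   pc d = (if 0 < nv (store_of b) x then p4 + 3 else p2)" if "pc b = p4" for b
 proof -
  let ?c = "exec (NConst 3 0) b"
  let ?d = "exec (NJumpLess 3 (2 * x) (p4 + 3)) ?c"
  have c: "reach A 1 b ?c"
   by (rule reach_step[OF _ code4(2) that refl]) (use code4(1) in simp)
  have d: "reach A 1 ?c ?d"
   by (rule reach_step[OF _ code4(3) _ refl]) (use code4(1) that in \<open>simp_all add: exec_simps\<close>)
  have ne: "2 * x ~= 3" by presburger
  show ?thesis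
  proof (cases "0 < nv (store_of b) x")
   case True
   have "reach A 3 b ?d"
    using reach_trans[OF c d] by (rule reach_mono) simp
   moreover have "pc ?d = p4 + 3" using True ne by (simp add: exec_simps)
   ultimately show ?thesis using True
    by (intro exI[of _ ?d] conjI) (simp_all only: store_of_exec_temporary if_True)
  next
   case False
   let ?e = "exec (Jump p2) ?d"
   have "reach A 1 ?d ?e"
    by (rule reach_step[OF code4(1,4) _ refl]) (use False ne that in \<open>simp add: exec_simps\<close>)
   from reach_trans[OF reach_trans[OF c d] this] have "reach A 3 b ?e"
    by (rule reach_mono) simp
   moreover have "pc ?e = p2" by simp
   ultimately show ?thesis using False
    by (intro exI[of _ ?e] conjI) (simp_all only: store_of_exec_temporary if_False)
  qed
 qed
 have "\<exists>b. reach A (2 + time c0 M + time c1 M + j * (?t + 3)) a b & pc b = p2 & store_of b = (G ^^ j) s1"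
  if "j <= K" for j
  using that
 proof (induction j)
  case 0
  then show ?case using a2 a2' by auto
 next
  case (Suc j)
  then obtain b where b: "reach A (2 + time c0 M + time c1 M + j * (?t + 3)) a b" "pc b = p2"
   "store_of b = (G ^^ j) s1"
   by auto
  then obtain d where d: "reach A ?t b d" "pc d = p4" "store_of d = (G ^^ Suc j) s1"
   using iter Suc.prems Suc_leD by blast
  obtain e where e: "reach A 3 d e" "store_of e = store_of d"
   "pc e = (if 0 < nv (store_of d) x then p4 + 3 else p2)"
   using test[OF d(2)] by blast
  have "nv (store_of d) x = 0"
   unfolding d(3) using continue Suc.prems by simp
  with e have "pc e = p2" by (simp del: store_of_sel)
  moreover have "reach A (2 + time c0 M + time c1 M + Suc j * (?t + 3)) a e"
   using reach_trans[OF reach_trans[OF b(1) d(1)] e(1)] by (rule reach_mono) simp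
  ultimately show ?case using d e by metis
 qed
 from this[OF order_refl] obtain b where b: "reach A (2 + time c0 M + time c1 M + K * (?t + 3)) a b" "pc b = p2"
  "store_of b = (G ^^ K) s1"
  by blast
 then obtain d where d: "reach A ?t b d" "pc d = p4" "store_of d = (G ^^ Suc K) s1"
  using iter order_refl by blast
 obtain e where e: "reach A 3 d e" "store_of e = store_of d"
  "pc e = (if 0 < nv (store_of d) x then p4 + 3 else p2)"
  using test[OF d(2)] by blast
 have pe: "pc e = p4 + 3" using e(3) stop unfolding d(3) by simp
 then have "\<exists>f. cdone A c4 M e f"
  using sep code bound4 e(2) d(3) by (intro com_code_correct) (simp_all del: store_of_sel funpow.simps)
 then obtain f where f: "cdone A c4 M e f" ..
 then have "reach A (time c4 M) e f" by (simp add: cdone_def)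
 from reach_trans[OF reach_trans[OF reach_trans[OF b(1) d(1)] e(1)] this]
 have "reach A (2 + time c0 M + time c1 M + Suc K * (time c2 M + time c3 M + 3) + time c4 M) a f"
  by (rule reach_mono) simp
 moreover have "halted A f"
  using f pe by (simp add: cdone_def halted_def len)
 moreover have "store_of f = run c4 ((G ^^ Suc K) s1)"
  using f e(2) d(3) by (simp add: cdone_def del: store_of_sel funpow.simps)
 ultimately show ?thesis by blast
qed

lemma reach_halts:
 assumes "reach A t a b" "halted A b" "t <= u"
 shows "halts_within A a u b"
proof -
 obtain k where "k <= t" and k: "(step A ^^ k) a = b"
  using assms(1) unfolding reach_def by blast
 with assms(3) have "k <= u" by simp
 have "(step A ^^ j) b = b" for j
  by (induction j) (use assms(2) in \<open>auto simp: step_def\<close>)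
 then have "(step A ^^ ((u - k) + k)) a = b"
  using k by (simp only: funpow_add o_apply)
 then show ?thesis
  using \<open>k <= u\<close> assms(2) by (simp add: halts_within_def)
qed

section \<open>Stores as families of arrays, and frame rules\<close>

definition na :: "store => nat => nat => nat" where "na s k i = nm s (addr k i)"
definition ra :: "store => nat => nat => real" where "ra s k i = rm s (addr k i)"
definition set_nv :: "nat => nat => store => store" where
 "set_nv x v s = s\<lparr>nv := (nv s)(x := v)\<rparr>"
definition set_rv :: "nat => real => store => store" where
 "set_rv x v s = s\<lparr>rv := (rv s)(x := v)\<rparr>"
definition set_na :: "nat => nat => nat => store => store" where
 "set_na k i v s = s\<lparr>nm := (nm s)(addr k i := v)\<rparr>"
definition set_ra :: "nat => nat => real => store => store" where
 "set_ra k i v s = s\<lparr>rm := (rm s)(addr k i := v)\<rparr>"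

lemma addr_inject: "k < 32 ==> l < 32 ==> addr k i = addr l j \<longleftrightarrow> k = l & i = j"
 by presburger

lemma nv_sets [simp]:
 "nv (set_nv x v s) y = (if y = x then v else nv s y)" "nv (set_rv x r s) = nv s"
 "nv (set_na k i v s) = nv s" "nv (set_ra k i r s) = nv s"
 by (simp_all add: set_nv_def set_rv_def set_na_def set_ra_def)

lemma rv_sets [simp]:
 "rv (set_rv x r s) y = (if y = x then r else rv s y)" "rv (set_nv x v s) = rv s"
 "rv (set_na k i v s) = rv s" "rv (set_ra k i r s) = rv s"
 by (simp_all add: set_nv_def set_rv_def set_na_def set_ra_def)

lemma na_sets [simp]:
 "na (set_nv x v s) = na s" "na (set_rv x r s) = na s" "na (set_ra k i r s) = na s"
 "k < 32 ==> l < 32 ==> na (set_na k i v s) l j = (if l = k & j = i then v else na s l j)"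
 by (auto simp: set_nv_def set_rv_def set_na_def set_ra_def na_def fun_eq_iff addr_inject)

lemma ra_sets [simp]:
 "ra (set_nv x v s) = ra s" "ra (set_rv x r s) = ra s" "ra (set_na k i v s) = ra s"
 "k < 32 ==> l < 32 ==> ra (set_ra k i r s) l j = (if l = k & j = i then r else ra s l j)"
 by (auto simp: set_nv_def set_rv_def set_na_def set_ra_def ra_def fun_eq_iff addr_inject)

lemma nval_Arr [simp]: "nval (Arr k a) s = na s k (nval a s)"
 by (simp add: na_def)

lemma rval_RealArr [simp]: "rval (RealArr k a) s = ra s k (nval a s)"
 by (simp add: ra_def)

lemma run_sets [simp]:
 "run (SetVar x e) s = set_nv x (nval e s) s"
 "run (SetReal x d) s = set_rv x (rval d s) s"
 "run (SetArr k i e) s = set_na k (nval i s) (nval e s) s"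
 "run (SetRealArr k i d) s = set_ra k (nval i s) (rval d s) s"
 by (simp_all add: set_nv_def set_rv_def set_na_def set_ra_def)

lemmas raw_simps = nval.simps(5) rval.simps(8) run.simps(2,3,4,5,9)
declare nval.simps(5) [simp del] rval.simps(8) [simp del] run.simps(2-5,9) [simp del]

text \<open>A constant of its own, so that the arithmetic of tests is rewritten to propositional
  logic without case distinctions on every comparison.\<close>

definition truth :: "bool => nat" where "truth P = (if P then 1 else 0)"

lemma truth_simps [simp]:
 "truth P + truth Q - Suc 0 = truth (P & Q)" "Suc 0 - truth P = truth (\<not> P)" "0 < truth P \<longleftrightarrow> P"
 "truth P = Suc 0 \<longleftrightarrow> P" "truth P = 0 \<longleftrightarrow> \<not> P" "truth True = Suc 0" "truth False = 0"
 by (simp_all add: truth_def)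

text \<open>Tests are built from truncated subtraction and yield 0 or 1; conjunction presupposes
  operands of this kind.\<close>

definition EqE :: "nexp => nexp => nexp" where
 "EqE a b = Minus (Const 1) (Plus (Minus a b) (Minus b a))"
definition LtE :: "nexp => nexp => nexp" where
 "LtE a b = Minus (Const 1) (Minus (Const 1) (Minus b a))"
definition NotE :: "nexp => nexp" where "NotE a = Minus (Const 1) a"
definition AndE :: "nexp => nexp => nexp" where "AndE a b = Minus (Plus a b) (Const 1)"

lemma nval_tests [simp]:
 "nval (EqE a b) s = truth (nval a s = nval b s)" "nval (LtE a b) s = truth (nval a s < nval b s)"
 "nval (NotE a) s = 1 - nval a s" "nval (AndE a b) s = nval a s + nval b s - 1"
 "nval (RLess d e) s = truth (rval d s < rval e s)"
 by (auto simp: EqE_def LtE_def NotE_def AndE_def truth_def)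

declare nval.simps(7) [simp del]

primrec rmods :: "com => nat set" where
 "rmods Skip = {}"
| "rmods (SetVar x e) = {}"
| "rmods (SetReal x e) = {x}"
| "rmods (SetArr k i e) = {}"
| "rmods (SetRealArr k i e) = {}"
| "rmods (SetRealMem i e) = {}"
| "rmods (Seq c d) = rmods c \<union> rmods d"
| "rmods (IfPos e c d) = rmods c \<union> rmods d"
| "rmods (For i x c) = rmods c"

primrec namods :: "com => nat set" where
 "namods Skip = {}"
| "namods (SetVar x e) = {}"
| "namods (SetReal x e) = {}"
| "namods (SetArr k i e) = {k}"
| "namods (SetRealArr k i e) = {}"
| "namods (SetRealMem i e) = {}"
| "namods (Seq c d) = namods c \<union> namods d"
| "namods (IfPos e c d) = namods c \<union> namods d"
| "namods (For i x c) = namods c"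

text \<open>The index 32 for writes to raw memory is out of the range of arrays. Commands with such
  writes are thereby rejected by \<open>checked\<close>, as their effect on the arrays is not
  tracked.\<close>

primrec ramods :: "com => nat set" where
 "ramods Skip = {}"
| "ramods (SetVar x e) = {}"
| "ramods (SetReal x e) = {}"
| "ramods (SetArr k i e) = {}"
| "ramods (SetRealArr k i e) = {k}"
| "ramods (SetRealMem i e) = {32}"
| "ramods (Seq c d) = ramods c \<union> ramods d"
| "ramods (IfPos e c d) = ramods c \<union> ramods d"
| "ramods (For i x c) = ramods c"

definition checked :: "com => bool" where
 "checked c \<longleftrightarrow> well_formed c & (\<forall>k\<in>namods c. k < 32) & (\<forall>k\<in>ramods c. k < 32)"

definition same :: "com => store => store => bool" where
 "same c s t \<longleftrightarrow> (\<forall>y. y ~: nmods c --> nv t y = nv s y) & (\<forall>y. y ~: rmods c --> rv t y = rv s y) &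
   (\<forall>k. k < 32 --> k ~: namods c --> na t k = na s k) & (\<forall>k. k < 32 --> k ~: ramods c --> ra t k = ra s k)"

lemma sameD:
 "same c s t ==> y ~: nmods c ==> nv t y = nv s y" "same c s t ==> y ~: rmods c ==> rv t y = rv s y"
 "same c s t ==> k < 32 ==> k ~: namods c ==> na t k = na s k"
 "same c s t ==> k < 32 ==> k ~: ramods c ==> ra t k = ra s k"
 by (auto simp: same_def)

lemma same_refl [simp]: "same c s s"
 by (simp add: same_def)

lemma run_For:
 "run (For i x c) s = ((\<lambda>s. set_nv i (Suc (nv (run c s) i)) (run c s)) ^^ nv s x) (set_nv i 0 s)"
 by (simp add: raw_simps set_nv_def)

lemma same_trans: "same c s t ==> same d t u ==> nmods c \<subseteq> nmods e ==> rmods c \<subseteq> rmods e ==>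
  namods c \<subseteq> namods e ==> ramods c \<subseteq> ramods e ==> nmods d \<subseteq> nmods e ==> rmods d \<subseteq> rmods e ==>
  namods d \<subseteq> namods e ==> ramods d \<subseteq> ramods e ==> same e s u"
 unfolding same_def by (metis subsetD)

lemma same_run: "checked c ==> same c s (run c s)"
proof (induction c arbitrary: s)
 case (SetArr k i e)
 then show ?case by (auto simp: same_def checked_def fun_eq_iff)
next
 case (SetRealArr k i e)
 then show ?case by (auto simp: same_def checked_def fun_eq_iff)
next
 case (Seq c d)
 then have "same c s (run c s)" "same d (run c s) (run d (run c s))" by (auto simp: checked_def)
 then show ?case by (auto intro: same_trans)
next
 case (IfPos e c d)
 then have "same c s (run c s)" "same d s (run d s)" by (auto simp: checked_def)
 then show ?case by (auto simp: same_def)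
next
 case (For i x c)
 then have IH: "same c s (run c s)" for s by (auto simp: checked_def)
 have "same (For i x c) s (((\<lambda>s. set_nv i (Suc (nv (run c s) i)) (run c s)) ^^ k) (set_nv i 0 s))" for k
 proof (induction k)
  case 0
  then show ?case by (simp add: same_def)
 next
  case (Suc k)
  let ?t = "((\<lambda>s. set_nv i (Suc (nv (run c s) i)) (run c s)) ^^ k) (set_nv i 0 s)"
  show ?case using Suc IH[of ?t] by (simp add: same_def)
 qed
 then show ?case by (simp only: run_For)
qed (auto simp: same_def checked_def)

text \<open>The frame condition \<open>same\<close> is available in every round, so an invariant has
  to mention only what the loop changes.\<close>

lemma For_rule:
 assumes c: "checked (For i x c)"
  and start: "P 0 (set_nv i 0 s)"
  and iter: "\<And>k t. k < nv s x ==> P k t ==> nv t i = k ==> same (For i x c) s t ==>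
     P (Suc k) (set_nv i (Suc k) (run c t))"
 shows "P (nv s x) (run (For i x c) s)"
proof -
 define F where "F = (\<lambda>s. set_nv i (Suc (nv (run c s) i)) (run c s))"
 have wf: "well_formed (For i x c)" and cc: "checked c" using c by (auto simp: checked_def)
 have "P k ((F ^^ k) (set_nv i 0 s)) & nv ((F ^^ k) (set_nv i 0 s)) i = k &
   same (For i x c) s ((F ^^ k) (set_nv i 0 s))" if "k <= nv s x" for k
  using that
 proof (induction k)
  case 0
  then show ?case using start by (simp add: same_def)
 next
  case (Suc k)
  let ?t = "(F ^^ k) (set_nv i 0 s)"
  have t: "P k ?t" "nv ?t i = k" "same (For i x c) s ?t" using Suc by auto
  have i: "nv (run c ?t) i = k" using wf t(2) nv_run[of i c ?t] by simp
  have "F u = set_nv i (Suc (nv (run c u) i)) (run c u)" for u by (simp add: F_def)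
  then have Ft: "F ?t = set_nv i (Suc k) (run c ?t)" by (simp only: i)
  have "P (Suc k) (F ?t)" using iter[OF _ t(1,2,3)] Suc.prems unfolding Ft by simp
  moreover have "same (For i x c) s (F ?t)"
   using t(3) same_run[OF cc, of ?t] unfolding Ft by (simp add: same_def)
  moreover have "nv (F ?t) i = Suc k" by (simp add: Ft)
  ultimately show ?case by simp
 qed
 from this[of "nv s x"] show ?thesis by (simp add: run_For F_def)
qed

text \<open>The pattern of the universal tests in the program: a flag raised before a loop is
  cleared by any offending index.\<close>

lemma For_flag:
 assumes c: "checked (For i x c)" and fi: "f ~= i"
  and body: "\<And>k t. k < nv s x ==> nv t i = k ==> same (For i x c) s t ==>
   nv (run c t) f = (if bad k then 0 else nv t f)"
 shows "nv (run (For i x c) s) f = (if \<exists>k<nv s x. bad k then 0 else nv s f)"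
proof (rule For_rule[OF c, where P = "\<lambda>k t. nv t f = (if \<exists>j<k. bad j then 0 else nv s f)"])
 fix k t
 assume "k < nv s x" "nv t f = (if \<exists>j<k. bad j then 0 else nv s f)" "nv t i = k" "same (For i x c) s t"
 then show "nv (set_nv i (Suc k) (run c t)) f = (if \<exists>j<Suc k. bad j then 0 else nv s f)"
  using body[of k t] fi by (auto simp: less_Suc_eq)
qed (use fi in simp)

subsection \<open>The program\<close>

abbreviation (input) "num_vertices \<equiv> 0 :: nat"
abbreviation (input) "num_edges \<equiv> 19 :: nat"
abbreviation (input) "num_sides \<equiv> 2 :: nat"
abbreviation (input) "two \<equiv> 3 :: nat"
abbreviation (input) "limit \<equiv> 4 :: nat"
abbreviation (input) "halt \<equiv> 5 :: nat"
abbreviation (input) "answer \<equiv> 6 :: nat"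
abbreviation (input) "base_edge \<equiv> 7 :: nat"
abbreviation (input) "cur \<equiv> 8 :: nat"
abbreviation (input) "ok \<equiv> 9 :: nat"
abbreviation (input) "entries \<equiv> 10 :: nat"
abbreviation (input) "overflow \<equiv> 11 :: nat"

text \<open>The machine cannot multiply natural numbers, so the start \<open>e * n\<close> of row \<open>e\<close> of a two-dimensional
 table is read from the array \<open>offset\<close>.\<close>

abbreviation (input) "offset \<equiv> 15 :: nat"
abbreviation (input) "reached \<equiv> 3 :: nat"
abbreviation (input) "name \<equiv> 4 :: nat"
abbreviation (input) "apa \<equiv> 5 :: nat"
abbreviation (input) "apb \<equiv> 6 :: nat"
abbreviation (input) "side1 \<equiv> 7 :: nat"
abbreviation (input) "side2 \<equiv> 8 :: nat"
abbreviation (input) "cand \<equiv> 9 :: nat"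
abbreviation (input) "akey \<equiv> 10 :: nat"
abbreviation (input) "present \<equiv> 11 :: nat"
abbreviation (input) "label \<equiv> 12 :: nat"
abbreviation (input) "signs \<equiv> 13 :: nat"
abbreviation (input) "keys \<equiv> 14 :: nat"

abbreviation (input) "ala \<equiv> 2 :: nat"
abbreviation (input) "alb \<equiv> 3 :: nat"
abbreviation (input) "px \<equiv> 4 :: nat"
abbreviation (input) "py \<equiv> 5 :: nat"
abbreviation (input) "disc \<equiv> 6 :: nat"
abbreviation (input) "outx \<equiv> 7 :: nat"
abbreviation (input) "outy \<equiv> 8 :: nat"

abbreviation (input) "R0 \<equiv> RealVar 0" abbreviation (input) "R1 \<equiv> RealVar 1" abbreviation (input) "R2 \<equiv> RealVar 2"
abbreviation (input) "R3 \<equiv> RealVar 3" abbreviation (input) "R4 \<equiv> RealVar 4" abbreviation (input) "R5 \<equiv> RealVar 5"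
abbreviation (input) "R6 \<equiv> RealVar 6" abbreviation (input) "R7 \<equiv> RealVar 7"

notation Seq (infixr ";;" 60)

text \<open>Straight-line evaluation of \<open>apex\<close>: the real variables 0 and 1 hold the
  first end of the base, 2 and 3 the vector to the second, 4 its squared length, 5 the
  \<open>foot\<close>, 6 the \<open>discr\<close> and 7 the signed altitude. The discriminant is
  stored for a later test; until then the formulas are computed with the total division and
  root.\<close>

definition place_step :: com where
 "place_step =
   SetReal 0 (RealArr px (Arr apa (Var 20)));;
   SetReal 1 (RealArr py (Arr apa (Var 20)));;
   SetReal 2 (RMinus (RealArr px (Arr apb (Var 20))) R0);;
   SetReal 3 (RMinus (RealArr py (Arr apb (Var 20))) R1);;
   SetReal 4 (RPlus (RTimes R2 R2) (RTimes R3 R3));;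
   SetReal 6 (RealArr ala (Var 20));;
   SetReal 7 (RealArr alb (Var 20));;
   SetReal 5 (RDivide (RPlus (RMinus (RTimes R6 R6) (RTimes R7 R7)) R4) (RTimes (RealConst 2) R4));;
   SetReal 6 (RMinus (RDivide (RTimes R6 R6) R4) (RTimes R5 R5));;
   SetReal 7 (RRoot R6);;
   IfPos (EqE (Arr cand (Var 20)) (Const 2)) (SetReal 7 (RMinus (RealConst 0) R7)) Skip;;
   SetRealArr disc (Var 20) R6;;
   SetRealArr px (Var 20) (RMinus (RPlus R0 (RTimes R5 R2)) (RTimes R7 R3));;
   SetRealArr py (Var 20) (RPlus (RPlus R1 (RTimes R5 R3)) (RTimes R7 R2))"

definition place :: com where
 "place = For 20 num_vertices
   (IfPos (EqE (Var 20) (Const 0))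
    (SetRealArr px (Const 0) (RealConst 0);; SetRealArr py (Const 0) (RealConst 0))
   (IfPos (EqE (Var 20) (Const 1))
    (SetRealArr px (Const 1) (RealArr ala (Const 1));; SetRealArr py (Const 1) (RealConst 0))
    place_step))"

lemma place_correct:
 fixes s
 defines "n \<equiv> nv s num_vertices" and "pa \<equiv> na s apa" and "pb \<equiv> na s apb" and "la \<equiv> ra s ala" and "lb \<equiv> ra s alb"
 defines "pos \<equiv> position pa pb la lb (na s cand)"
 assumes par: "\<And>k. 2 <= k ==> k < n ==> pa k < k & pb k < k"
 shows "k < n ==> ra (run place s) px k = fst (pos k) & ra (run place s) py k = snd (pos k)"
  and "2 <= k ==> k < n ==> ra (run place s) disc k = discr (la k) (lb k) (sqdist (pos (pa k)) (pos (pb k)))"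
proof -
 let ?P = "\<lambda>m t. \<forall>k<m. ra t px k = fst (pos k) & ra t py k = snd (pos k) &
   (2 <= k --> ra t disc k = discr (la k) (lb k) (sqdist (pos (pa k)) (pos (pb k))))"
 have "?P (nv s num_vertices) (run place s)"
  unfolding place_def
 proof (rule For_rule[where P = ?P])
  fix k t
  assume k: "k < nv s num_vertices" and P: "?P k t" and i: "nv t 20 = k"
   and sm: "same (For 20 num_vertices
   (IfPos (EqE (Var 20) (Const 0))
    (SetRealArr px (Const 0) (RealConst 0);; SetRealArr py (Const 0) (RealConst 0))
   (IfPos (EqE (Var 20) (Const 1))
    (SetRealArr px (Const 1) (RealArr ala (Const 1));; SetRealArr py (Const 1) (RealConst 0))
    place_step))) s t"
  have f: "na t apa = pa" "na t apb = pb" "na t cand = na s cand" "ra t ala = la" "ra t alb = lb"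
   using sameD(3,4)[OF sm] by (simp_all add: pa_def pb_def la_def lb_def place_step_def)
  let ?c = "IfPos (EqE (Var 20) (Const 0))
    (SetRealArr px (Const 0) (RealConst 0);; SetRealArr py (Const 0) (RealConst 0))
   (IfPos (EqE (Var 20) (Const 1))
    (SetRealArr px (Const 1) (RealArr ala (Const 1));; SetRealArr py (Const 1) (RealConst 0))
    place_step)"
  have pos01: "pos 0 = (0, 0)" "pos (Suc 0) = (la (Suc 0), 0)"
   unfolding pos_def by (subst position.simps, simp)+
  show "?P (Suc k) (set_nv 20 (Suc k) (run ?c t))"
  proof (cases "k < 2")
   case True
   then have "k = 0 | k = Suc 0" by auto
   then show ?thesis using P by (auto simp: i f pos01 less_Suc_eq)
  next
   case False
   then have k2: "2 <= k" "k < n" using k by (auto simp: n_def)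
   note b = par[OF k2]
   have posk: "pos k = apex (la k) (lb k) (na s cand k = 2) (pos (pa k)) (pos (pb k))"
    using k2 b unfolding pos_def by (subst position.simps) simp
   have ab: "ra t px (pa k) = fst (pos (pa k))" "ra t py (pa k) = snd (pos (pa k))"
    "ra t px (pb k) = fst (pos (pb k))" "ra t py (pb k) = snd (pos (pb k))" using P b by auto
   have "run ?c t = run place_step t" using False i by simp
   moreover have "ra (run place_step t) px k = fst (pos k) & ra (run place_step t) py k = snd (pos k) &
     ra (run place_step t) disc k = discr (la k) (lb k) (sqdist (pos (pa k)) (pos (pb k)))"
    by (simp add: place_step_def i f ab posk apex_def Let_def discr_def foot_def sqdist_def)
   moreover have "ra (run place_step t) l j = ra t l j" if "j < k" "l \<in> {px, py, disc}" for l j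
    using that by (auto simp: place_step_def i)
   ultimately show ?thesis using P by (auto simp: less_Suc_eq)
  qed
 qed (auto simp: checked_def place_step_def)
 then show "k < n ==> ra (run place s) px k = fst (pos k) & ra (run place s) py k = snd (pos k)"
  "2 <= k ==> k < n ==> ra (run place s) disc k = discr (la k) (lb k) (sqdist (pos (pa k)) (pos (pb k)))"
  by (auto simp: n_def)
qed

text \<open>Variable 31 is lowered if an earlier sibling has the same sign, or if the parent is
  drawn but hidden, which shows in its key being 0. A vertex that is not drawn gets key 0 through
  its own sign.\<close>

definition key_step :: com where
 "key_step = SetVar 31 (Const 1);;
   For 26 num_vertices
    (IfPos (AndE (LtE (Var 26) (Var 25)) (AndE (EqE (Arr apa (Var 26)) (Arr apa (Var 25)))
     (AndE (EqE (Arr apb (Var 26)) (Arr apb (Var 25))) (EqE (Arr cand (Var 26)) (Arr cand (Var 25))))))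
    (SetVar 31 (Const 0)) Skip);;
   IfPos (Arr cand (Arr apb (Var 25)))
    (IfPos (EqE (Arr akey (Arr apb (Var 25))) (Const 0)) (SetVar 31 (Const 0)) Skip) Skip;;
   IfPos (Var 31) (SetArr akey (Var 25) (Arr cand (Var 25))) (SetArr akey (Var 25) (Const 0))"

definition compute_key :: com where
 "compute_key = For 25 num_vertices key_step"

lemma compute_key_correct:
 fixes s
 defines "n \<equiv> nv s num_vertices" and "pa \<equiv> na s apa" and "pb \<equiv> na s apb" and "\<sigma> \<equiv> na s cand"
 assumes par: "\<And>k. 2 <= k ==> k < n ==> pb k < k" and small: "\<And>k. k < 2 ==> \<sigma> k = 0 & pb k = 0"
 shows "k < n ==> na (run compute_key s) akey k = (if visible pa pb \<sigma> k then \<sigma> k else 0)"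
proof -
 let ?P = "\<lambda>m t. \<forall>k<m. na t akey k = (if visible pa pb \<sigma> k then \<sigma> k else 0)"
 have vis_nz: "visible pa pb \<sigma> k ==> \<sigma> k ~= 0" for k by (subst (asm) visible.simps) simp
 have "?P (nv s num_vertices) (run compute_key s)"
  unfolding compute_key_def
 proof (rule For_rule[where P = ?P])
  fix k t
  assume k: "k < nv s num_vertices" and P: "?P k t" and i: "nv t 25 = k" and sm: "same (For 25 num_vertices key_step) s t"
  have f: "na t apa = pa" "na t apb = pb" "na t cand = \<sigma>" "nv t num_vertices = n"
   using sameD[OF sm] by (simp_all add: pa_def pb_def \<sigma>_def n_def key_step_def)
  define t1 where "t1 = set_nv 31 1 t"
  define lp where "lp = For 26 num_vertices
    (IfPos (AndE (LtE (Var 26) (Var 25)) (AndE (EqE (Arr apa (Var 26)) (Arr apa (Var 25)))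
     (AndE (EqE (Arr apb (Var 26)) (Arr apb (Var 25))) (EqE (Arr cand (Var 26)) (Arr cand (Var 25))))))
    (SetVar 31 (Const 0)) Skip)"
  define t2 where "t2 = run lp t1"
  have fl: "nv t2 31 = (if \<exists>j<nv t1 num_vertices. j < k & pa j = pa k & pb j = pb k & \<sigma> j = \<sigma> k then 0 else nv t1 31)"
   unfolding t2_def lp_def
  proof (rule For_flag)
   fix j u assume u: "nv u 26 = j" and su: "same (For 26 num_vertices
    (IfPos (AndE (LtE (Var 26) (Var 25)) (AndE (EqE (Arr apa (Var 26)) (Arr apa (Var 25)))
     (AndE (EqE (Arr apb (Var 26)) (Arr apb (Var 25))) (EqE (Arr cand (Var 26)) (Arr cand (Var 25))))))
    (SetVar 31 (Const 0)) Skip)) t1 u"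
   have "na u apa = pa" "na u apb = pb" "na u cand = \<sigma>" "nv u 25 = k"
    using sameD[OF su] by (simp_all add: f i t1_def)
   then show "nv (run (IfPos (AndE (LtE (Var 26) (Var 25)) (AndE (EqE (Arr apa (Var 26)) (Arr apa (Var 25)))
     (AndE (EqE (Arr apb (Var 26)) (Arr apb (Var 25))) (EqE (Arr cand (Var 26)) (Arr cand (Var 25))))))
    (SetVar 31 (Const 0)) Skip) u) 31 = (if j < k & pa j = pa k & pb j = pb k & \<sigma> j = \<sigma> k then 0 else nv u 31)"
    using u by simp
  qed (auto simp: checked_def)
  have sm2: "same lp t1 t2" unfolding t2_def by (rule same_run) (simp add: lp_def checked_def)
  have g: "na t2 apa = pa" "na t2 apb = pb" "na t2 cand = \<sigma>" "nv t2 25 = k" "na t2 akey = na t akey"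
   using sameD[OF sm2] by (simp_all add: f i t1_def lp_def)
  have flag: "nv t2 31 = truth (\<not> (\<exists>j<k. pa j = pa k & pb j = pb k & \<sigma> j = \<sigma> k))"
   unfolding fl using k by (auto simp: t1_def truth_def f n_def)
  have ks: "run key_step t = run (IfPos (Arr cand (Arr apb (Var 25)))
    (IfPos (EqE (Arr akey (Arr apb (Var 25))) (Const 0)) (SetVar 31 (Const 0)) Skip) Skip;;
   IfPos (Var 31) (SetArr akey (Var 25) (Arr cand (Var 25))) (SetArr akey (Var 25) (Const 0))) t2"
   by (simp add: key_step_def t2_def lp_def t1_def)
  have "na (run key_step t) akey j = (if j = k then (if visible pa pb \<sigma> k then \<sigma> k else 0) else na t akey j)" for j
  proof (cases "2 <= k")
   case True
   then have b: "pb k < k" using par k by (simp add: n_def)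
   then have "na t akey (pb k) = (if visible pa pb \<sigma> (pb k) then \<sigma> (pb k) else 0)" using P by blast
   then show ?thesis
    unfolding ks using b vis_nz[of "pb k"] visible.simps[of pa pb \<sigma> k] by (auto simp: g flag)
  next
   case False
   then have "\<sigma> k = 0" "pb k = 0" "\<sigma> 0 = 0" using small[of k] small[of 0] by auto
   then show ?thesis unfolding ks by (simp add: g)
  qed
  then show "?P (Suc k) (set_nv 25 (Suc k) (run key_step t))" using P by (auto simp: less_Suc_eq)
 qed (auto simp: checked_def key_step_def)
 then show "k < n ==> na (run compute_key s) akey k = (if visible pa pb \<sigma> k then \<sigma> k else 0)"
  by (simp add: n_def)
qed

definition cross_expr :: "nexp => nexp => nexp => rexp" where
 "cross_expr p q x = RMinus
   (RTimes (RMinus (RealArr px q) (RealArr px p)) (RMinus (RealArr py x) (RealArr py p)))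
   (RTimes (RMinus (RealArr py q) (RealArr py p)) (RMinus (RealArr px x) (RealArr px p)))"

definition dot_expr :: "nexp => nexp => nexp => rexp" where
 "dot_expr p q z = RPlus
   (RTimes (RMinus (RealArr px p) (RealArr px z)) (RMinus (RealArr px q) (RealArr px z)))
   (RTimes (RMinus (RealArr py p) (RealArr py z)) (RMinus (RealArr py q) (RealArr py z)))"

definition point_at :: "store => nat => point" where
 "point_at s k = (ra s px k, ra s py k)"

lemma rval_cross_expr [simp]:
 "rval (cross_expr p q x) s = cross (point_at s (nval p s)) (point_at s (nval q s)) (point_at s (nval x s))"
 by (simp add: cross_expr_def cross_def point_at_def)

lemma rval_dot_expr [simp]:
 "rval (dot_expr p q z) s =
   (fst (point_at s (nval p s)) - fst (point_at s (nval z s))) * (fst (point_at s (nval q s)) - fst (point_at s (nval z s))) +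
   (snd (point_at s (nval p s)) - snd (point_at s (nval z s))) * (snd (point_at s (nval q s)) - snd (point_at s (nval z s)))"
 by (simp add: dot_expr_def point_at_def)

text \<open>Vertex 0 contributes two degenerate sides from itself to itself to the lists; the
  comparison of the ends sorts them out.\<close>

definition side_present :: "nat => nexp" where
 "side_present i = AndE (LtE (Arr side1 (Var i)) (Arr side2 (Var i)))
   (AndE (EqE (Arr present (Arr side1 (Var i))) (Const 1)) (EqE (Arr present (Arr side2 (Var i))) (Const 1)))"

text \<open>The condition of \<open>on_segment_iff\<close>, with vanishing expressed by two negated
  strict comparisons, the only kind of comparison that reals admit on the machine.\<close>

definition vertex_test :: com where
 "vertex_test = IfPos (AndE (side_present 22) (AndE (EqE (Arr present (Var 23)) (Const 1))
    (AndE (NotE (EqE (Var 23) (Arr side1 (Var 22)))) (AndE (NotE (EqE (Var 23) (Arr side2 (Var 22))))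
    (AndE (NotE (RLess (cross_expr (Arr side1 (Var 22)) (Arr side2 (Var 22)) (Var 23)) (RealConst 0)))
    (AndE (NotE (RLess (RealConst 0) (cross_expr (Arr side1 (Var 22)) (Arr side2 (Var 22)) (Var 23))))
    (NotE (RLess (RealConst 0) (dot_expr (Arr side1 (Var 22)) (Arr side2 (Var 22)) (Var 23))))))))))
   (SetVar ok (Const 0)) Skip"

text \<open>Applied to all pairs of drawn sides without exception: for sides with a common end one
  of the factors is zero, so the strict inequalities fail.\<close>

definition edge_test :: com where
 "edge_test = IfPos (AndE (side_present 22) (AndE (side_present 23)
    (AndE (RLess (RTimes (cross_expr (Arr side1 (Var 22)) (Arr side2 (Var 22)) (Arr side1 (Var 23)))
        (cross_expr (Arr side1 (Var 22)) (Arr side2 (Var 22)) (Arr side2 (Var 23)))) (RealConst 0))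
       (RLess (RTimes (cross_expr (Arr side1 (Var 23)) (Arr side2 (Var 23)) (Arr side1 (Var 22)))
        (cross_expr (Arr side1 (Var 23)) (Arr side2 (Var 23)) (Arr side2 (Var 22)))) (RealConst 0)))))
   (SetVar ok (Const 0)) Skip"

definition mark_step :: com where
 "mark_step = SetArr present (Var 21) (Const 0);;
   IfPos (EqE (Var 21) (Arr apa (Var cur))) (SetArr present (Var 21) (Const 1)) Skip;;
   IfPos (EqE (Var 21) (Arr apb (Var cur))) (SetArr present (Var 21) (Const 1)) Skip;;
   IfPos (Arr cand (Var 21)) (SetArr present (Var 21) (Const 1);;
    IfPos (RLess (RealConst 0) (RealArr disc (Var 21))) Skip (SetVar ok (Const 0))) Skip"

definition check :: com where
 "check = SetVar ok (Const 1);; For 21 num_vertices mark_step;;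
   For 22 num_sides (For 23 num_vertices vertex_test);;
   For 22 num_sides (For 23 num_sides edge_test)"

lemma check_correct:
 fixes s
 defines "n \<equiv> nv s num_vertices" and "N \<equiv> nv s num_sides" and "v \<equiv> nv s cur" and "\<sigma> \<equiv> na s cand"
  and "e1 \<equiv> na s side1" and "e2 \<equiv> na s side2" and "p \<equiv> point_at s"
 defines "inn \<equiv> \<lambda>k. \<sigma> k ~= 0 | k = na s apa v | k = na s apb v"
 defines "side \<equiv> \<lambda>i. i < N & e1 i < e2 i & inn (e1 i) & inn (e2 i)"
 assumes bnd: "\<And>i. i < N ==> e1 i < n & e2 i < n"
 shows "nv (run check s) ok = truth ((\<forall>k<n. \<sigma> k ~= 0 --> 0 < ra s disc k) &
   (\<forall>i x. side i --> x < n --> inn x --> x ~= e1 i --> x ~= e2 i --> p x ~: closed_segment (p (e1 i)) (p (e2 i))) &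
   (\<forall>i j. side i --> side j --> \<not> (cross (p (e1 i)) (p (e2 i)) (p (e1 j)) * cross (p (e1 i)) (p (e2 i)) (p (e2 j)) < 0 &
    cross (p (e1 j)) (p (e2 j)) (p (e1 i)) * cross (p (e1 j)) (p (e2 j)) (p (e2 i)) < 0)))"
proof -
 define s1 where "s1 = run (SetVar ok (Const 1);; For 21 num_vertices mark_step) s"
 have P1: "(\<forall>k<n. na s1 present k = truth (inn k)) & nv s1 ok = truth (\<forall>k<n. \<sigma> k ~= 0 --> 0 < ra s disc k)"
 proof -
  let ?P = "\<lambda>m t. (\<forall>k<m. na t present k = truth (inn k)) & nv t ok = truth (\<forall>k<m. \<sigma> k ~= 0 --> 0 < ra s disc k)"
  have "?P (nv (set_nv ok 1 s) num_vertices) (run (For 21 num_vertices mark_step) (set_nv ok 1 s))"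
  proof (rule For_rule[where P = ?P])
   fix k t
   assume P: "?P k t" and i: "nv t 21 = k" and sm: "same (For 21 num_vertices mark_step) (set_nv ok 1 s) t"
   have f: "na t apa = na s apa" "na t apb = na s apb" "na t cand = \<sigma>" "nv t cur = v" "ra t disc = ra s disc"
    using sameD[OF sm] by (simp_all add: v_def \<sigma>_def mark_step_def)
   have "na (run mark_step t) present j = (if j = k then truth (inn k) else na t present j)" for j
    by (cases "\<sigma> k = 0"; cases "0 < ra s disc k"; cases "k = na s apa v"; cases "k = na s apb v")
     (simp_all add: mark_step_def i f inn_def)
   moreover have "nv (run mark_step t) ok = (if \<sigma> k ~= 0 & \<not> 0 < ra s disc k then 0 else nv t ok)"
    by (cases "\<sigma> k = 0"; cases "0 < ra s disc k"; cases "k = na s apa v"; cases "k = na s apb v")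
     (simp_all add: mark_step_def i f)
   ultimately show "?P (Suc k) (set_nv 21 (Suc k) (run mark_step t))"
    using P by (simp add: less_Suc_eq truth_def) blast
  qed (auto simp: checked_def mark_step_def)
  then show ?thesis by (simp add: s1_def n_def)
 qed
 have sm1: "same (SetVar ok (Const 1);; For 21 num_vertices mark_step) s s1"
  unfolding s1_def by (rule same_run) (simp add: checked_def mark_step_def)
 have f1: "na s1 side1 = e1" "na s1 side2 = e2" "nv s1 num_vertices = n" "nv s1 num_sides = N"
  "ra s1 px = ra s px" "ra s1 py = ra s py"
  using sameD[OF sm1] by (simp_all add: e1_def e2_def n_def N_def mark_step_def)
 have pt: "point_at t = p" if "ra t px = ra s px" "ra t py = ra s py" for t
  using that by (auto simp: p_def point_at_def fun_eq_iff)
 have sp: "nval (side_present i) t = truth (side (nv t i))"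
  if "nv t i < N" "na t side1 = e1" "na t side2 = e2" "na t present = na s1 present" for t i
  using that bnd[OF that(1)] P1 by (simp add: side_present_def side_def)
 define badv where "badv = (\<lambda>i x. side i & inn x & x ~= e1 i & x ~= e2 i & p x \<in> closed_segment (p (e1 i)) (p (e2 i)))"
 define s2 where "s2 = run (For 22 num_sides (For 23 num_vertices vertex_test)) s1"
 have P2: "nv s2 ok = (if \<exists>i<nv s1 num_sides. \<exists>x<n. badv i x then 0 else nv s1 ok)"
  unfolding s2_def
 proof (rule For_flag)
  fix i t assume i: "i < nv s1 num_sides" "nv t 22 = i" and sm: "same (For 22 num_sides (For 23 num_vertices vertex_test)) s1 t"
  have ft: "na t side1 = e1" "na t side2 = e2" "nv t num_vertices = n" "na t present = na s1 present"
   "ra t px = ra s px" "ra t py = ra s py"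
   using sameD[OF sm] by (simp_all add: f1 vertex_test_def)
  have "nv (run (For 23 num_vertices vertex_test) t) ok = (if \<exists>x<nv t num_vertices. badv i x then 0 else nv t ok)"
  proof (rule For_flag)
   fix x u assume x: "x < nv t num_vertices" "nv u 23 = x" and su: "same (For 23 num_vertices vertex_test) t u"
   have fu: "na u side1 = e1" "na u side2 = e2" "na u present = na s1 present" "nv u 22 = i"
    "ra u px = ra s px" "ra u py = ra s py"
    using sameD[OF su] by (simp_all add: ft i vertex_test_def)
   have iN: "i < N" using i by (simp add: f1)
   have "na s1 present x = truth (inn x)" using P1 x by (simp add: ft)
   moreover have "badv i x \<longleftrightarrow> side i & inn x & x ~= e1 i & x ~= e2 i &
     \<not> cross (p (e1 i)) (p (e2 i)) (p x) < 0 & \<not> 0 < cross (p (e1 i)) (p (e2 i)) (p x) &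
     \<not> 0 < (fst (p (e1 i)) - fst (p x)) * (fst (p (e2 i)) - fst (p x)) +
       (snd (p (e1 i)) - snd (p x)) * (snd (p (e2 i)) - snd (p x))"
   proof -
    have "C = 0 & D <= 0 \<longleftrightarrow> \<not> C < 0 & \<not> 0 < C & \<not> 0 < D" for C D :: real by linarith
    then show ?thesis unfolding badv_def on_segment_iff by blast
   qed
   ultimately show "nv (run vertex_test u) ok = (if badv i x then 0 else nv u ok)"
    by (simp add: vertex_test_def sp[of u 22] fu iN x pt)
  qed (auto simp: checked_def vertex_test_def)
  then show "nv (run (For 23 num_vertices vertex_test) t) ok = (if \<exists>x<n. badv i x then 0 else nv t ok)"
   by (simp add: ft)
 qed (auto simp: checked_def vertex_test_def)
 have sm2: "same (For 22 num_sides (For 23 num_vertices vertex_test)) s1 s2"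
  unfolding s2_def by (rule same_run) (simp add: checked_def vertex_test_def)
 have f2: "na s2 side1 = e1" "na s2 side2 = e2" "nv s2 num_sides = N" "na s2 present = na s1 present"
  "ra s2 px = ra s px" "ra s2 py = ra s py"
  using sameD[OF sm2] by (simp_all add: f1 vertex_test_def)
 define bade where "bade = (\<lambda>i j. side i & side j &
   cross (p (e1 i)) (p (e2 i)) (p (e1 j)) * cross (p (e1 i)) (p (e2 i)) (p (e2 j)) < 0 &
   cross (p (e1 j)) (p (e2 j)) (p (e1 i)) * cross (p (e1 j)) (p (e2 j)) (p (e2 i)) < 0)"
 have P3: "nv (run (For 22 num_sides (For 23 num_sides edge_test)) s2) ok =
   (if \<exists>i<nv s2 num_sides. \<exists>j<N. bade i j then 0 else nv s2 ok)"
 proof (rule For_flag)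
  fix i t assume i: "i < nv s2 num_sides" "nv t 22 = i" and sm: "same (For 22 num_sides (For 23 num_sides edge_test)) s2 t"
  have ft: "na t side1 = e1" "na t side2 = e2" "nv t num_sides = N" "na t present = na s1 present"
   "ra t px = ra s px" "ra t py = ra s py"
   using sameD[OF sm] by (simp_all add: f2 edge_test_def)
  have "nv (run (For 23 num_sides edge_test) t) ok = (if \<exists>j<nv t num_sides. bade i j then 0 else nv t ok)"
  proof (rule For_flag)
   fix j u assume x: "j < nv t num_sides" "nv u 23 = j" and su: "same (For 23 num_sides edge_test) t u"
   have fu: "na u side1 = e1" "na u side2 = e2" "na u present = na s1 present" "nv u 22 = i"
    "ra u px = ra s px" "ra u py = ra s py"
    using sameD[OF su] by (simp_all add: ft i edge_test_def)
   have "i < N" "j < N" using i x by (simp_all add: f2 ft)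
   then show "nv (run edge_test u) ok = (if bade i j then 0 else nv u ok)"
    by (simp add: edge_test_def sp[of u 22] sp[of u 23] fu x pt bade_def)
  qed (auto simp: checked_def edge_test_def)
  then show "nv (run (For 23 num_sides edge_test) t) ok = (if \<exists>j<N. bade i j then 0 else nv t ok)"
   by (simp add: ft)
 qed (auto simp: checked_def edge_test_def)
 have rc: "run check s = run (For 22 num_sides (For 23 num_sides edge_test)) s2"
  by (simp add: check_def s2_def s1_def)
 have "nv s1 ok = truth (\<forall>k<n. \<sigma> k ~= 0 --> 0 < ra s disc k)" using P1 by blast
 then have "nv (run check s) ok = (if \<exists>i<N. \<exists>j<N. bade i j then 0 else
   if \<exists>i<N. \<exists>x<n. badv i x then 0 else truth (\<forall>k<n. \<sigma> k ~= 0 --> 0 < ra s disc k))"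
  by (simp only: rc P3 f2(3) P2 f1(4))
 also have "\<dots> = truth ((\<forall>k<n. \<sigma> k ~= 0 --> 0 < ra s disc k) &
   (\<forall>i<N. \<forall>x<n. \<not> badv i x) & (\<forall>i<N. \<forall>j<N. \<not> bade i j))"
  by (auto simp: truth_def)
 also have "\<dots> = truth ((\<forall>k<n. \<sigma> k ~= 0 --> 0 < ra s disc k) &
   (\<forall>i x. side i --> x < n --> inn x --> x ~= e1 i --> x ~= e2 i --> p x ~: closed_segment (p (e1 i)) (p (e2 i))) &
   (\<forall>i j. side i --> side j --> \<not> (cross (p (e1 i)) (p (e2 i)) (p (e1 j)) * cross (p (e1 i)) (p (e2 i)) (p (e2 j)) < 0 &
    cross (p (e1 j)) (p (e2 j)) (p (e1 i)) * cross (p (e1 j)) (p (e2 j)) (p (e2 i)) < 0)))"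
 proof -
  have N: "side i ==> i < N" for i by (simp add: side_def)
  have "(\<forall>i<N. \<forall>x<n. \<not> badv i x) \<longleftrightarrow>
   (\<forall>i x. side i --> x < n --> inn x --> x ~= e1 i --> x ~= e2 i --> p x ~: closed_segment (p (e1 i)) (p (e2 i)))"
   unfolding badv_def using N by blast
  moreover have "(\<forall>i<N. \<forall>j<N. \<not> bade i j) \<longleftrightarrow> (\<forall>i j. side i --> side j -->
    \<not> (cross (p (e1 i)) (p (e2 i)) (p (e1 j)) * cross (p (e1 i)) (p (e2 i)) (p (e2 j)) < 0 &
    cross (p (e1 j)) (p (e2 j)) (p (e1 i)) * cross (p (e1 j)) (p (e2 j)) (p (e2 i)) < 0))"
   unfolding bade_def using N by blast
  ultimately show ?thesis by (simp only:)
 qed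
 finally show ?thesis .
qed

abbreviation (input) "Vn \<equiv> Var num_vertices"

definition guard :: "nat => nexp => nexp => com" where
 "guard x a b = IfPos (AndE (LtE (Var cur) (Var 32)) (AndE (EqE (Arr apa (Var 32)) a) (EqE (Arr apb (Var 32)) b)))
   (SetVar x (Var 32)) Skip"

lemma run_guard:
 "nv (run (guard x a b) s) y = (if y = x & nv s cur < nv s 32 & na s apa (nv s 32) = nval a s &
   na s apb (nv s 32) = nval b s then nv s 32 else nv s y)"
 "na (run (guard x a b) s) = na s"
 by (auto simp: guard_def)

text \<open>The scan runs downwards from the last vertex, so that the last hit is the least
  one.\<close>

definition find_children :: com where
 "find_children = SetVar 12 (Const 0);; SetVar 13 (Const 0);; SetVar 14 (Const 0);;
   For 27 num_vertices (
    SetVar 32 (Minus (Minus Vn (Const 1)) (Var 27));;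
    guard 12 (Arr apa (Var cur)) (Arr apb (Var cur));; guard 13 (Arr apa (Var cur)) (Var cur);;
    guard 14 (Arr apb (Var cur)) (Var cur))"

text \<open>Variables 15, 16 and 17 select one entry for each sub-piece and 18 the sign of the
  current vertex. A missing child is served by entry 0, which holds the zero vector.\<close>

definition load :: com where
 "load = For 27 num_vertices (SetArr cand (Var 27)
    (Plus (Plus (Arr signs (Plus (Arr offset (Var 15)) (Var 27))) (Arr signs (Plus (Arr offset (Var 16)) (Var 27))))
     (Arr signs (Plus (Arr offset (Var 17)) (Var 27)))));;
   SetArr cand (Var cur) (Plus (Var 18) (Const 1))"

text \<open>The loop runs up to \<open>limit\<close> and not to \<open>entries\<close>, because the
  latter changes while tables are filled and loop bounds have to stay fixed during a round.\<close>

definition find_duplicate :: com where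
 "find_duplicate = SetVar 33 (Const 1);; For 28 limit
   (IfPos (AndE (LtE (Var 28) (Var entries)) (EqE (Arr label (Var 28)) (Var cur)))
    (SetVar 34 (Const 1);;
    For 27 num_vertices (IfPos (EqE (Arr keys (Plus (Arr offset (Var 28)) (Var 27))) (Arr akey (Var 27))) Skip (SetVar 34 (Const 0)));;
    IfPos (Var 34) (SetVar 33 (Const 0)) Skip) Skip)"

definition save :: com where
 "save = For 27 num_vertices
    (SetArr signs (Plus (Arr offset (Var entries)) (Var 27)) (Arr cand (Var 27));;
    SetArr keys (Plus (Arr offset (Var entries)) (Var 27)) (Arr akey (Var 27)));;
   SetArr label (Var entries) (Var cur);; SetVar entries (Plus (Var entries) (Const 1))"

definition merge :: com where
 "merge = IfPos (AndE (LtE (Var 15) (Var entries)) (AndE (LtE (Var 16) (Var entries)) (AndE (LtE (Var 17) (Var entries))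
    (AndE (EqE (Arr label (Var 15)) (Var 12)) (AndE (EqE (Arr label (Var 16)) (Var 13)) (EqE (Arr label (Var 17)) (Var 14)))))))
   (load;; place;; check;; IfPos (Var ok)
    (compute_key;; find_duplicate;; IfPos (Var 33) (IfPos (LtE (Var entries) (Var limit)) save (SetVar overflow (Const 1))) Skip)
    Skip) Skip"

text \<open>All triples of entries are tried and most are rejected by their labels. A cube of the
  cap is affordable and saves any index structure.\<close>

definition process :: com where
 "process = find_children;;
   For 15 limit (For 16 limit (For 17 limit (For 18 two merge)))"

lemmas part_defs = place_def place_step_def check_def mark_step_def vertex_test_def edge_test_def
 compute_key_def key_step_def find_children_def guard_def load_def find_duplicate_def save_def

lemma checked_parts: "checked place" "checked check" "checked compute_key" "checked find_children" "checked load"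
 "checked find_duplicate" "checked save" "checked merge"
 by (auto simp: checked_def part_defs merge_def)

lemma pairs_reindex:
 assumes "\<And>x. A x & B x \<longleftrightarrow> H x"
 shows "(\<forall>i x. S i --> A x --> B x --> W (e i) (f i) x) \<longleftrightarrow>
  (\<forall>i j x. (\<exists>m. S m & e m = i & f m = j) --> H x --> W i j x)"
 unfolding assms[symmetric] by blast

section \<open>Correctness of the table construction\<close>

context parent_structure
begin

definition static :: "store => bool" where
 "static s \<longleftrightarrow> nv s num_vertices = n & nv s num_sides = 2 * n & nv s two = 2 &
   na s apa = pa & na s apb = pb & ra s ala = la & ra s alb = lb &
   (\<forall>k<n. na s side1 k = pa k & na s side2 k = k & na s side1 (n + k) = pb k & na s side2 (n + k) = k) &
   (\<forall>e<nv s limit. na s offset e = e * n)"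

lemma static_same:
 assumes "static s" "same c s t" "nmods c \<inter> {num_vertices, num_sides, two, limit} = {}"
  "namods c \<inter> {apa, apb, side1, side2, offset} = {}" "ramods c \<inter> {ala, alb} = {}"
 shows "static t"
 using assms(1,3-5) sameD[OF assms(2)] unfolding static_def by simp

definition vec :: "store => nat => nat => nat" where
 "vec s e k = (if k < n then na s signs (e * n + k) else 0)"

lemma vec_set_nv [simp]: "vec (set_nv x k s) = vec s"
 by (simp add: vec_def fun_eq_iff)

text \<open>Beyond the vertices the arrays contain arbitrary values, whereas sign vectors and keys
  are compared as functions on all natural numbers.\<close>

definition cut :: "(nat => nat) => nat => nat" where
 "cut \<sigma> k = (if k < n then \<sigma> k else 0)"

lemma pos_cut: "k < n ==> pos (cut \<sigma>) k = pos \<sigma> k"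
proof (induction k rule: less_induct)
 case (less k)
 consider "k = 0" | "k = 1" | "2 <= k" by linarith
 then show ?case
 proof cases
  case 3
  then show ?thesis using less parents'[OF 3 less.prems] by (simp add: pos_simps cut_def)
 qed (simp_all add: pos_simps pos_simps(2)[unfolded One_nat_def])
qed

lemma vis_cut: "k < n ==> vis (cut \<sigma>) k = vis \<sigma> k"
proof (induction k rule: less_induct)
 case (less k)
 have "pb k < k ==> vis (cut \<sigma>) (pb k) = vis \<sigma> (pb k)" using less by simp
 then show ?case
  using less.prems by (subst (1 2) visible.simps) (auto simp: cut_def)
qed

text \<open>The right-hand side is what the program can check: sides with the earlier end first, and
  signs instead of intersections. The sign test is exact for disjoint sides because the vertex
  clause supplies the hypotheses of \<open>segments_cross_iff\<close>, and it never fires for sides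
  with a common end.\<close>

lemma planar_test:
 assumes "S \<subseteq> {..<n}"
 shows "planar S p \<longleftrightarrow>
  (\<forall>i j x. child i j --> i \<in> S --> j \<in> S --> x \<in> S --> x ~= i --> x ~= j --> p x ~: closed_segment (p i) (p j)) &
  (\<forall>i j k l. child i j --> child k l --> i \<in> S --> j \<in> S --> k \<in> S --> l \<in> S -->
   \<not> (cross (p i) (p j) (p k) * cross (p i) (p j) (p l) < 0 & cross (p k) (p l) (p i) * cross (p k) (p l) (p j) < 0))"
  (is "_ \<longleftrightarrow> ?V & ?E")
proof
 assume pl: "planar S p"
 have V: ?V
  using planar_vertex[OF pl] by (auto simp: adj_def)
 moreover have ?E
 proof (intro allI impI)
  fix i j k l assume a: "child i j" "child k l" "i \<in> S" "j \<in> S" "k \<in> S" "l \<in> S"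
  show "\<not> (cross (p i) (p j) (p k) * cross (p i) (p j) (p l) < 0 & cross (p k) (p l) (p i) * cross (p k) (p l) (p j) < 0)"
  proof (cases "{i, j} \<inter> {k, l} = {}")
   case True
   then have "closed_segment (p i) (p j) \<inter> closed_segment (p k) (p l) = {}"
    using planar_disjoint[OF pl, of i j k l] a by (auto simp: adj_def)
   moreover have "p k ~: closed_segment (p i) (p j)" "p l ~: closed_segment (p i) (p j)"
    "p i ~: closed_segment (p k) (p l)" "p j ~: closed_segment (p k) (p l)"
    using V a True by auto
   ultimately show ?thesis using segments_cross_iff by blast
  next
   case False
   then consider "i = k" | "i = l" | "j = k" | "j = l" by blast
   then show ?thesis by cases simp_all
  qed
 qed
 ultimately show "?V & ?E" ..
next
 assume VE: "?V & ?E"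
 have v: "p x ~: closed_segment (p i) (p j)" if "adj i j" "i \<in> S" "j \<in> S" "x \<in> S" "x ~= i" "x ~= j" for i j x
 proof -
  from that(1) consider "child i j" | "child j i" by (auto simp: adj_def)
  then show ?thesis
  proof cases
   case 1
   then show ?thesis using VE that by blast
  next
   case 2
   then have "p x ~: closed_segment (p j) (p i)" using VE that by blast
   then show ?thesis by (simp add: closed_segment_commute)
  qed
 qed
 have d: "closed_segment (p i) (p j) \<inter> closed_segment (p k) (p l) = {}"
  if a: "child i j" "child k l" "i \<in> S" "j \<in> S" "k \<in> S" "l \<in> S" "{i, j} \<inter> {k, l} = {}" for i j k l
 proof -
  have "p k ~: closed_segment (p i) (p j)" "p l ~: closed_segment (p i) (p j)"
   "p i ~: closed_segment (p k) (p l)" "p j ~: closed_segment (p k) (p l)"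
   using v[of i j] v[of k l] a by (auto simp: adj_def)
  moreover have "\<not> (cross (p i) (p j) (p k) * cross (p i) (p j) (p l) < 0 & cross (p k) (p l) (p i) * cross (p k) (p l) (p j) < 0)"
   using VE a by blast
  ultimately show ?thesis using segments_cross_iff by blast
 qed
 show "planar S p"
  unfolding planar_def
 proof (intro conjI ballI impI)
  fix i j k l assume a: "i \<in> S" "j \<in> S" "k \<in> S" "l \<in> S" "adj i j" "adj k l" "{i, j} \<inter> {k, l} = {}"
  then consider "child i j" "child k l" | "child j i" "child k l" | "child i j" "child l k" | "child j i" "child l k"
   by (auto simp: adj_def)
  then show "closed_segment (p i) (p j) \<inter> closed_segment (p k) (p l) = {}"
  proof cases
   case 1
   then show ?thesis using d[of i j k l] a by blast
  next
   case 2
   then show ?thesis using d[of j i k l] a by (simp add: closed_segment_commute insert_commute)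
  next
   case 3
   then show ?thesis using d[of i j l k] a by (simp add: closed_segment_commute insert_commute)
  next
   case 4
   then show ?thesis using d[of j i l k] a by (simp add: closed_segment_commute insert_commute)
  qed
 qed (use v in blast)
qed

lemma check_sound:
 assumes st: "static s" and v: "nv s cur = v" "2 <= v" "v < n" and \<sigma>: "signs_on (piece v) (cut (na s cand))"
 shows "nv (run check (run place s)) ok = truth (sound v (cut (na s cand)))"
proof -
 let ?\<sigma> = "na s cand"
 let ?\<tau> = "cut ?\<sigma>"
 define s1 where "s1 = run place s"
 have sm: "same place s s1" unfolding s1_def by (rule same_run[OF checked_parts(1)])
 have st1: "static s1" by (rule static_same[OF st sm]) (auto simp: part_defs)
 have f: "na s1 cand = ?\<sigma>" "nv s1 cur = v" using sameD[OF sm] v by (simp_all add: part_defs)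
 have s: "nv s num_vertices = n" "na s apa = pa" "na s apb = pb" "ra s ala = la" "ra s alb = lb"
  using st by (simp_all add: static_def)
 have pl: "k < n ==> point_at s1 k = pos ?\<sigma> k" for k
  using place_correct(1)[of s k] parents' by (simp add: s s1_def point_at_def)
 have dc: "2 <= k ==> k < n ==> ra s1 disc k = discr (la k) (lb k) (base_sqdist ?\<tau> k)" for k
 proof -
  assume k: "2 <= k" "k < n"
  then have "pa k < n" "pb k < n" using parents'[OF k] by auto
  then show ?thesis
   using place_correct(2)[of s k] parents' k by (simp add: s s1_def base_sqdist_def pos_cut)
 qed
 have s1: "nv s1 num_vertices = n" "nv s1 num_sides = 2 * n" "na s1 apa = pa" "na s1 apb = pb"
  "\<And>k. k < n ==> na s1 side1 k = pa k & na s1 side2 k = k & na s1 side1 (n + k) = pb k & na s1 side2 (n + k) = k"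
  using st1 by (simp_all add: static_def)
 have pk: "pa k < n & pb k < n" if "k < n" for k
 proof -
  consider "k = 0" | "k = 1" | "2 <= k" by linarith
  then show ?thesis
  proof cases
   case 3
   then show ?thesis using parents'[OF 3 that] that by simp
  qed (use n2 base in simp_all)
 qed
 have side_cases: "\<exists>k<n. i = k | i = n + k" if "i < 2 * n" for i
  using that by (cases "i < n") (auto intro: exI[of _ "i - n"])
 have bnd: "na s1 side1 i < nv s1 num_vertices & na s1 side2 i < nv s1 num_vertices" if "i < nv s1 num_sides" for i
 proof -
  obtain k where k: "k < n" "i = k | i = n + k" using side_cases[of i] \<open>i < nv s1 num_sides\<close> s1(2) by auto
  show ?thesis using s1(5)[OF k(1)] pk[OF k(1)] k unfolding s1(1) by auto
 qed
 have inn: "(?\<sigma> k ~= 0 | k = pa v | k = pb v) \<longleftrightarrow> k \<in> hull_piece v" if "k < n" for k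
  using signs_on_nonzero[OF \<sigma>, of k] that by (auto simp: hull_piece_def cut_def)
 have ch: "child i j \<longleftrightarrow> (\<exists>m<2 * n. na s1 side1 m = i & na s1 side2 m = j & i < j)" for i j
 proof
  assume c: "child i j"
  then have j: "j < n" "i < j" "i = pa j | i = pb j" using child_bounds by (auto simp: child_def)
  then show "\<exists>m<2 * n. na s1 side1 m = i & na s1 side2 m = j & i < j"
   using s1(5)[OF j(1)] by (auto intro: exI[of _ j] exI[of _ "n + j"])
 next
  assume "\<exists>m<2 * n. na s1 side1 m = i & na s1 side2 m = j & i < j"
  then obtain m k where "na s1 side1 m = i" "na s1 side2 m = j" "i < j" "k < n" "m = k | m = n + k"
   using side_cases by blast
  then show "child i j" using s1(5)[of k] by (auto simp: child_def)
 qed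
 have hull: "hull_piece v \<subseteq> {..<n}"
  using piece_bounds pk[OF v(3)] by (auto simp: hull_piece_def)
 define inn' where "inn' k = (?\<sigma> k ~= 0 | k = pa v | k = pb v)" for k
 define sd where "sd i = (i < 2 * n & na s1 side1 i < na s1 side2 i & inn' (na s1 side1 i) & inn' (na s1 side2 i))" for i
 let ?e1 = "na s1 side1" and ?e2 = "na s1 side2" and ?p = "point_at s1"
 have sdc: "(\<exists>m. sd m & ?e1 m = i & ?e2 m = j) \<longleftrightarrow> child i j & i \<in> hull_piece v & j \<in> hull_piece v" for i j
 proof
  assume "\<exists>m. sd m & ?e1 m = i & ?e2 m = j"
  then obtain m where m: "m < 2 * n" "?e1 m < ?e2 m" "inn' (?e1 m)" "inn' (?e2 m)" "?e1 m = i" "?e2 m = j"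
   by (auto simp: sd_def)
  then have "child i j" unfolding ch by blast
  moreover have "i < n" "j < n" using child_bounds[OF calculation] by auto
  ultimately show "child i j & i \<in> hull_piece v & j \<in> hull_piece v"
   using m inn unfolding inn'_def by blast
 next
  assume a: "child i j & i \<in> hull_piece v & j \<in> hull_piece v"
  then obtain m where m: "m < 2 * n" "?e1 m = i" "?e2 m = j" "i < j" unfolding ch by blast
  have "i < n" "j < n" using a child_bounds[of i j] by auto
  then have "inn' i" "inn' j" using a inn unfolding inn'_def by blast+
  then show "\<exists>m. sd m & ?e1 m = i & ?e2 m = j" using m by (auto simp: sd_def)
 qed
 have "nv (run check s1) ok = truth ((\<forall>k<n. ?\<sigma> k ~= 0 --> 0 < ra s1 disc k) &
   (\<forall>i x. sd i --> x < n --> inn' x --> x ~= ?e1 i --> x ~= ?e2 i --> ?p x ~: closed_segment (?p (?e1 i)) (?p (?e2 i))) &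
   (\<forall>i j. sd i --> sd j --> \<not> (cross (?p (?e1 i)) (?p (?e2 i)) (?p (?e1 j)) * cross (?p (?e1 i)) (?p (?e2 i)) (?p (?e2 j)) < 0 &
    cross (?p (?e1 j)) (?p (?e2 j)) (?p (?e1 i)) * cross (?p (?e1 j)) (?p (?e2 j)) (?p (?e2 i)) < 0)))"
  using check_correct[of s1, OF bnd] unfolding f s1(1-4) inn'_def sd_def by simp
 moreover have "(\<forall>k<n. ?\<sigma> k ~= 0 --> 0 < ra s1 disc k) \<longleftrightarrow> (\<forall>k\<in>piece v. 0 < discr (la k) (lb k) (base_sqdist ?\<tau> k))"
 proof -
  have "k < n & ?\<sigma> k ~= 0 \<longleftrightarrow> k \<in> piece v" for k
   using signs_on_nonzero[OF \<sigma>, of k] by (cases "k < n") (auto simp: cut_def)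
  then show ?thesis using dc piece_bounds by metis
 qed
 moreover have "(\<forall>i x. sd i --> x < n --> inn' x --> x ~= ?e1 i --> x ~= ?e2 i --> ?p x ~: closed_segment (?p (?e1 i)) (?p (?e2 i)))
   & (\<forall>i j. sd i --> sd j --> \<not> (cross (?p (?e1 i)) (?p (?e2 i)) (?p (?e1 j)) * cross (?p (?e1 i)) (?p (?e2 i)) (?p (?e2 j)) < 0 &
    cross (?p (?e1 j)) (?p (?e2 j)) (?p (?e1 i)) * cross (?p (?e1 j)) (?p (?e2 j)) (?p (?e2 i)) < 0))
   \<longleftrightarrow> planar (hull_piece v) ?p"
 proof -
  have x: "x < n & inn' x \<longleftrightarrow> x \<in> hull_piece v" for x using inn[of x] hull unfolding inn'_def by blast
  let ?W = "\<lambda>i j x. x ~= i --> x ~= j --> ?p x ~: closed_segment (?p i) (?p j)"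
  let ?X = "\<lambda>i j k l. \<not> (cross (?p i) (?p j) (?p k) * cross (?p i) (?p j) (?p l) < 0 & cross (?p k) (?p l) (?p i) * cross (?p k) (?p l) (?p j) < 0)"
  let ?s = "\<lambda>i j. \<exists>m. sd m & ?e1 m = i & ?e2 m = j"
  let ?h = "hull_piece v"
  have "(\<forall>i x. sd i --> x < n --> inn' x --> ?W (?e1 i) (?e2 i) x) \<longleftrightarrow> (\<forall>i j x. ?s i j --> x \<in> ?h --> ?W i j x)"
   by (rule pairs_reindex[where H = "\<lambda>x. x \<in> ?h" and W = ?W]) (rule x)
  also have "\<dots> \<longleftrightarrow> (\<forall>i j x. child i j --> i \<in> ?h --> j \<in> ?h --> x \<in> ?h --> ?W i j x)"
   unfolding sdc by fast
  finally have 1: "(\<forall>i x. sd i --> x < n --> inn' x --> ?W (?e1 i) (?e2 i) x) \<longleftrightarrow>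
   (\<forall>i j x. child i j --> i \<in> ?h --> j \<in> ?h --> x \<in> ?h --> ?W i j x)" .
  have "(\<forall>i j. sd i --> sd j --> ?X (?e1 i) (?e2 i) (?e1 j) (?e2 j)) \<longleftrightarrow> (\<forall>i j k l. ?s i j --> ?s k l --> ?X i j k l)"
   by fast
  also have "\<dots> \<longleftrightarrow> (\<forall>i j k l. child i j --> child k l --> i \<in> ?h --> j \<in> ?h --> k \<in> ?h --> l \<in> ?h --> ?X i j k l)"
   unfolding sdc by fast
  finally have 2: "(\<forall>i j. sd i --> sd j --> ?X (?e1 i) (?e2 i) (?e1 j) (?e2 j)) \<longleftrightarrow>
   (\<forall>i j k l. child i j --> child k l --> i \<in> ?h --> j \<in> ?h --> k \<in> ?h --> l \<in> ?h --> ?X i j k l)" .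
  show ?thesis unfolding planar_test[OF hull] 1 2 by (rule refl)
 qed
 moreover have "planar (hull_piece v) ?p \<longleftrightarrow> planar (hull_piece v) (pos ?\<tau>)"
  using planar_cong[of "hull_piece v" ?p "pos ?\<tau>"] planar_cong[of "hull_piece v" "pos ?\<tau>" ?p] pl hull
  by (metis lessThan_iff pos_cut subsetD)
 ultimately show ?thesis by (auto simp: sound_def s1_def truth_def)
qed

definition first_from :: "(nat => bool) => nat => nat => bool" where
 "first_from Q lo x \<longleftrightarrow> (x = 0 & (\<forall>w. lo <= w --> w < n --> \<not> Q w)) |
   (lo <= x & x < n & Q x & (\<forall>w. lo <= w --> w < x --> \<not> Q w))"

lemma first_from_step:
 assumes x: "first_from Q (Suc l) x" and "l < n"
 shows "first_from Q l (if Q l then l else x)"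
proof (cases "Q l")
 case True
 then show ?thesis using assms(2) by (auto simp: first_from_def)
next
 case False
 have l: "w = l | Suc l <= w" if "l <= w" for w using that by auto
 from x consider "x = 0" "\<forall>w. Suc l <= w --> w < n --> \<not> Q w"
  | "Suc l <= x" "x < n" "Q x" "\<forall>w. Suc l <= w --> w < x --> \<not> Q w"
  unfolding first_from_def by blast
 then show ?thesis
 proof cases
  case 1
  then have "\<forall>w. l <= w --> w < n --> \<not> Q w" using l False by blast
  then show ?thesis using False 1 by (simp add: first_from_def)
 next
  case 2
  then have "\<forall>w. l <= w --> w < x --> \<not> Q w" using l False by blast
  then show ?thesis using False 2 by (simp add: first_from_def)
 qed
qed

lemma first_from_child:
 assumes "first_from (\<lambda>w. v < w & pa w = x & pb w = y) 0 u"
 shows "u = first_child x y v"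
proof -
 let ?Q = "\<lambda>w. v < w & pa w = x & pb w = y"
 from assms consider "u = 0" "\<forall>w<n. \<not> ?Q w" | "u < n" "?Q u" "\<forall>w<u. \<not> ?Q w"
  unfolding first_from_def by blast
 then show ?thesis
 proof cases
  case 1
  then show ?thesis by (cases rule: first_child_cases[of x y v]) auto
 next
  case 2
  show ?thesis
  proof (cases rule: first_child_cases[of x y v])
   case (2 w)
   have "w <= u" using 2(6) \<open>u < n\<close> \<open>?Q u\<close> by blast
   moreover have "\<not> w < u" using 2 \<open>\<forall>w<u. \<not> ?Q w\<close> by blast
   ultimately show ?thesis using 2(1) by simp
  qed (use 2 in blast)
 qed
qed

lemma find_children_correct:
 assumes st: "static s" and v: "nv s cur = v" "v < n"
 shows "nv (run find_children s) 12 = first_child (pa v) (pb v) v"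
  "nv (run find_children s) 13 = first_child (pa v) v v"
  "nv (run find_children s) 14 = first_child (pb v) v v"
proof -
 let ?Q1 = "\<lambda>w. v < w & pa w = pa v & pb w = pb v"
 let ?Q2 = "\<lambda>w. v < w & pa w = pa v & pb w = v"
 let ?Q3 = "\<lambda>w. v < w & pa w = pb v & pb w = v"
 let ?P = "\<lambda>m t. first_from ?Q1 (n - m) (nv t 12) & first_from ?Q2 (n - m) (nv t 13) & first_from ?Q3 (n - m) (nv t 14)"
 define t0 where "t0 = set_nv 14 0 (set_nv 13 0 (set_nv 12 0 s))"
 have t0: "nv t0 num_vertices = n" "nv t0 cur = v" "na t0 apa = pa" "na t0 apb = pb"
  using st v by (simp_all add: static_def t0_def)
 define rest where "rest = guard 12 (Arr apa (Var cur)) (Arr apb (Var cur));; guard 13 (Arr apa (Var cur)) (Var cur);;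
    guard 14 (Arr apb (Var cur)) (Var cur)"
 define body where "body = SetVar 32 (Minus (Minus Vn (Const 1)) (Var 27));; rest"
 have body: "find_children = SetVar 12 (Const 0);; SetVar 13 (Const 0);; SetVar 14 (Const 0);; For 27 num_vertices body"
  unfolding find_children_def body_def rest_def ..
 have "?P (nv t0 num_vertices) (run (For 27 num_vertices body) t0)"
 proof (rule For_rule[where P = ?P])
  show "checked (For 27 num_vertices body)" by (auto simp: checked_def body_def rest_def guard_def)
  show "?P 0 (set_nv 27 0 t0)" by (simp add: t0_def first_from_def)
  fix k t
  assume k: "k < nv t0 num_vertices" and P: "?P k t" and i: "nv t 27 = k" and sm: "same (For 27 num_vertices body) t0 t"
  have f: "na t apa = pa" "na t apb = pb" "nv t cur = v" "nv t num_vertices = n"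
   using sameD[OF sm] by (simp_all add: t0 body_def rest_def guard_def)
  have kn: "n - k = Suc (n - Suc k)" "n - Suc k < n" using k by (simp_all add: t0)
  let ?w = "n - Suc k"
  define w where "w = ?w"
  define u where "u = set_nv 32 w t"
  have "nval (Minus (Minus Vn (Const 1)) (Var 27)) t = w" by (simp add: f i w_def)
  then have "run body t = run rest u"
   by (simp only: body_def run.simps(7) run_sets(1) u_def)
  then have "nv (run body t) 12 = (if ?Q1 w then w else nv t 12)"
   "nv (run body t) 13 = (if ?Q2 w then w else nv t 13)"
   "nv (run body t) 14 = (if ?Q3 w then w else nv t 14)"
   by (simp_all add: rest_def run_guard u_def f)
  then have "nv (run body t) 12 = (if ?Q1 ?w then ?w else nv t 12)"
   "nv (run body t) 13 = (if ?Q2 ?w then ?w else nv t 13)"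
   "nv (run body t) 14 = (if ?Q3 ?w then ?w else nv t 14)"
   unfolding w_def .
  moreover have "first_from ?Q1 (n - Suc k) (if ?Q1 ?w then ?w else nv t 12)"
   using P by (intro first_from_step[OF _ kn(2)]) (simp only: kn(1))
  moreover have "first_from ?Q2 (n - Suc k) (if ?Q2 ?w then ?w else nv t 13)"
   using P by (intro first_from_step[OF _ kn(2)]) (simp only: kn(1))
  moreover have "first_from ?Q3 (n - Suc k) (if ?Q3 ?w then ?w else nv t 14)"
   using P by (intro first_from_step[OF _ kn(2)]) (simp only: kn(1))
  ultimately show "?P (Suc k) (set_nv 27 (Suc k) (run body t))" by simp
 qed
 moreover have "run find_children s = run (For 27 num_vertices body) t0" by (simp add: body t0_def)
 ultimately have "?P n (run find_children s)" by (simp only: t0(1))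
 then show "nv (run find_children s) 12 = first_child (pa v) (pb v) v"
  "nv (run find_children s) 13 = first_child (pa v) v v"
  "nv (run find_children s) 14 = first_child (pb v) v v"
  using first_from_child by simp_all
qed

lemma load_correct:
 assumes st: "static s" and v: "nv s cur < n" and e: "nv s 15 < nv s limit" "nv s 16 < nv s limit" "nv s 17 < nv s limit"
 shows "cut (na (run load s) cand) = cut (join (nv s cur) (Suc (nv s 18)) (vec s (nv s 15)) (vec s (nv s 16)) (vec s (nv s 17)))"
proof -
 define body where "body = SetArr cand (Var 27)
    (Plus (Plus (Arr signs (Plus (Arr offset (Var 15)) (Var 27))) (Arr signs (Plus (Arr offset (Var 16)) (Var 27))))
     (Arr signs (Plus (Arr offset (Var 17)) (Var 27))))"
 let ?X = "\<lambda>k. vec s (nv s 15) k + vec s (nv s 16) k + vec s (nv s 17) k"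
 have s: "nv s num_vertices = n" using st by (simp add: static_def)
 have "\<forall>k<nv s num_vertices. na (run (For 27 num_vertices body) s) cand k = ?X k"
 proof (rule For_rule[where P = "\<lambda>m t. \<forall>k<m. na t cand k = ?X k"])
  fix k t assume k: "k < nv s num_vertices" and P: "\<forall>j<k. na t cand j = ?X j" and i: "nv t 27 = k" and sm: "same (For 27 num_vertices body) s t"
  have f: "na t signs = na s signs" "na t offset = na s offset" "nv t 15 = nv s 15" "nv t 16 = nv s 16" "nv t 17 = nv s 17"
   using sameD[OF sm] by (simp_all add: body_def)
  show "\<forall>j<Suc k. na (set_nv 27 (Suc k) (run body t)) cand j = ?X j"
   using P st e k s by (auto simp: body_def f i less_Suc_eq vec_def static_def)
 qed (auto simp: checked_def body_def)
 moreover have "nv (run (For 27 num_vertices body) s) cur = nv s cur" "nv (run (For 27 num_vertices body) s) 18 = nv s 18"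
  by (subst nv_run; simp add: body_def)+
 ultimately show ?thesis
  using s v by (auto simp: load_def body_def[symmetric] cut_def join_def fun_eq_iff)
qed

lemma find_duplicate_correct:
 assumes st: "static s" and cap: "nv s entries <= nv s limit"
 shows "nv (run find_duplicate s) 33 = truth (\<not> (\<exists>e<nv s entries. na s label e = nv s cur &
  (\<forall>k<n. na s keys (e * n + k) = na s akey k)))"
proof -
 define inner where "inner = IfPos (EqE (Arr keys (Plus (Arr offset (Var 28)) (Var 27))) (Arr akey (Var 27))) Skip (SetVar 34 (Const 0))"
 define body where "body = IfPos (AndE (LtE (Var 28) (Var entries)) (EqE (Arr label (Var 28)) (Var cur)))
    (SetVar 34 (Const 1);; For 27 num_vertices inner;; IfPos (Var 34) (SetVar 33 (Const 0)) Skip) Skip"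
 define t0 where "t0 = set_nv 33 (Suc 0) s"
 define bad where "bad = (\<lambda>e. e < nv s entries & na s label e = nv s cur & (\<forall>k<n. na s keys (e * n + k) = na s akey k))"
 have s: "nv s num_vertices = n" using st by (simp add: static_def)
 have "nv (run (For 28 limit body) t0) 33 = (if \<exists>e<nv t0 limit. bad e then 0 else nv t0 33)"
 proof (rule For_flag)
  show "checked (For 28 limit body)" by (auto simp: checked_def body_def inner_def)
  fix e t assume e: "e < nv t0 limit" and i: "nv t 28 = e" and sm: "same (For 28 limit body) t0 t"
  have f: "na t keys = na s keys" "na t offset = na s offset" "na t akey = na s akey" "na t label = na s label"
   "nv t entries = nv s entries" "nv t cur = nv s cur" "nv t num_vertices = n"
   using sameD[OF sm] by (simp_all add: body_def inner_def t0_def s)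
  define t1 where "t1 = set_nv 34 (Suc 0) t"
  have off: "na s offset e = e * n" using st e by (simp add: static_def t0_def)
  have "nv (run (For 27 num_vertices inner) t1) 34 =
    (if \<exists>k<nv t1 num_vertices. na s keys (e * n + k) ~= na s akey k then 0 else nv t1 34)"
  proof (rule For_flag)
   fix k u assume "nv u 27 = k" and su: "same (For 27 num_vertices inner) t1 u"
   moreover have "na u keys = na s keys" "na u offset = na s offset" "na u akey = na s akey" "nv u 28 = e"
    using sameD[OF su] by (simp_all add: inner_def t1_def f i)
   ultimately show "nv (run inner u) 34 = (if na s keys (e * n + k) ~= na s akey k then 0 else nv u 34)"
    by (simp add: inner_def off)
  qed (auto simp: checked_def inner_def)
  then have "nv (run (For 27 num_vertices inner) t1) 34 = truth (\<forall>k<n. na s keys (e * n + k) = na s akey k)"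
   by (simp add: t1_def f truth_def)
  moreover have "nv (run (For 27 num_vertices inner) t1) 33 = nv t 33"
   by (subst nv_run) (simp_all add: inner_def t1_def)
  ultimately show "nv (run body t) 33 = (if bad e then 0 else nv t 33)"
   by (auto simp: body_def f i bad_def t1_def[symmetric])
 qed simp
 moreover have fd: "find_duplicate = SetVar 33 (Const 1);; For 28 limit body"
  unfolding find_duplicate_def body_def inner_def by (rule refl)
 have "run find_duplicate s = run (For 28 limit body) t0" unfolding fd by (simp add: t0_def)
 moreover have "(\<exists>e<nv t0 limit. bad e) \<longleftrightarrow> (\<exists>e<nv s entries. na s label e = nv s cur &
  (\<forall>k<n. na s keys (e * n + k) = na s akey k))"
 proof -
  have "nv t0 limit = nv s limit" by (simp add: t0_def)
  then show ?thesis unfolding bad_def using cap by (metis order_less_le_trans)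
 qed
 moreover have "nv t0 33 = 1" by (simp add: t0_def)
 ultimately show ?thesis by (auto simp: truth_def)
qed

lemma row_inject:
 assumes "k < n" "l < n"
 shows "e * n + k = f * n + l \<longleftrightarrow> e = f & k = l"
proof
 assume h: "e * n + k = f * n + l"
 have "(e * n + k) div n = e" "(f * n + l) div n = f" using assms by auto
 with h have "e = f" by metis
 with h show "e = f & k = l" by simp
qed simp

lemma save_correct:
 assumes st: "static s" and cap: "nv s entries < nv s limit"
 defines "c \<equiv> nv s entries" and "t \<equiv> run save s"
 shows "nv t entries = Suc c" "na t label c = nv s cur" "vec t c = cut (na s cand)"
  "\<And>k. k < n ==> na t keys (c * n + k) = na s akey k"
  "\<And>e. e ~= c ==> na t label e = na s label e & vec t e = vec s e & (\<forall>k<n. na t keys (e * n + k) = na s keys (e * n + k))"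
proof -
 define body where "body = SetArr signs (Plus (Arr offset (Var entries)) (Var 27)) (Arr cand (Var 27));;
    SetArr keys (Plus (Arr offset (Var entries)) (Var 27)) (Arr akey (Var 27))"
 have s: "nv s num_vertices = n" "na s offset c = c * n" using st cap by (simp_all add: static_def c_def)
 let ?P = "\<lambda>m u. (\<forall>j. na u signs j = (if \<exists>k<m. j = c * n + k then na s cand (j - c * n) else na s signs j)) &
   (\<forall>j. na u keys j = (if \<exists>k<m. j = c * n + k then na s akey (j - c * n) else na s keys j))"
 define u where "u = run (For 27 num_vertices body) s"
 have "?P (nv s num_vertices) u"
  unfolding u_def
 proof (rule For_rule[where P = ?P])
  fix k t assume P: "?P k t" and i: "nv t 27 = k" and sm: "same (For 27 num_vertices body) s t"
  have f: "na t cand = na s cand" "na t akey = na s akey" "na t offset = na s offset" "nv t entries = c"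
   using sameD[OF sm] by (simp_all add: body_def c_def)
  have "na (run body t) signs j = (if j = c * n + k then na s cand k else na t signs j)"
   "na (run body t) keys j = (if j = c * n + k then na s akey k else na t keys j)" for j
   by (simp_all add: body_def f i s)
  then show "?P (Suc k) (set_nv 27 (Suc k) (run body t))" using P by (auto simp: less_Suc_eq)
 qed (auto simp: checked_def body_def)
 then have P: "na u signs j = (if \<exists>k<n. j = c * n + k then na s cand (j - c * n) else na s signs j)"
  "na u keys j = (if \<exists>k<n. j = c * n + k then na s akey (j - c * n) else na s keys j)" for j
  by (simp_all add: s)
 have sm: "same (For 27 num_vertices body) s u" unfolding u_def by (rule same_run) (simp add: checked_def body_def)
 have f: "na u label = na s label" "nv u entries = c" "nv u cur = nv s cur"
  using sameD[OF sm] by (simp_all add: body_def c_def)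
 have t: "t = set_nv entries (Suc c) (set_na label c (nv s cur) u)"
  by (simp add: t_def save_def body_def[symmetric] u_def[symmetric] f)
 show "nv t entries = Suc c" "na t label c = nv s cur" by (simp_all add: t)
 show "vec t c = cut (na s cand)" by (auto simp: vec_def cut_def t P fun_eq_iff)
 show "\<And>k. k < n ==> na t keys (c * n + k) = na s akey k" by (auto simp: t P)
 fix e assume e: "e ~= c"
 then have ne: "\<not> (\<exists>l<n. e * n + k = c * n + l)" if "k < n" for k using row_inject that by blast
 have "vec t e k = vec s e k" for k using ne[of k] by (cases "k < n") (auto simp: vec_def t P)
 moreover have "na t keys (e * n + k) = na s keys (e * n + k)" if "k < n" for k using ne[OF that] by (auto simp: t P)
 ultimately show "na t label e = na s label e & vec t e = vec s e & (\<forall>k<n. na t keys (e * n + k) = na s keys (e * n + k))"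
  using e by (auto simp: t f fun_eq_iff)
qed

text \<open>Label 0 belongs to the entry of the empty piece. The last clause, distinct keys among
  entries with one label, is what limits the number of entries.\<close>

definition entries_ok :: "store => bool" where
 "entries_ok s \<longleftrightarrow> nv s entries <= nv s limit &
   (\<forall>e<nv s entries. na s label e = 0 & vec s e = (\<lambda>_. 0) |
    2 <= na s label e & na s label e < n & signs_on (piece (na s label e)) (vec s e) & sound (na s label e) (vec s e) &
    (\<forall>k<n. na s keys (e * n + k) = key (vec s e) k)) &
   (\<forall>e<nv s entries. \<forall>f<nv s entries. na s label e = na s label f --> key (vec s e) = key (vec s f) --> e = f)"

definition extends :: "nat => store => store => bool" where
 "extends v s t \<longleftrightarrow> nv s entries <= nv t entries &
   (\<forall>e<nv s entries. na t label e = na s label e & vec t e = vec s e) &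
   (\<forall>e. nv s entries <= e --> e < nv t entries --> na t label e = v)"

text \<open>Unsound vectors count as represented, so that the property can be claimed for every
  combination the loops have tried.\<close>

definition represented :: "nat => (nat => nat) => store => bool" where
 "represented v \<tau> s \<longleftrightarrow> (sound v \<tau> --> (\<exists>e<nv s entries. na s label e = v & key (vec s e) = key \<tau>))"

lemma extends_refl [simp]: "extends v s s" by (simp add: extends_def)

lemma extends_trans:
 assumes st: "extends v s t" and tu: "extends v t u"
 shows "extends v s u"
 unfolding extends_def
proof (intro conjI allI impI)
 have le: "nv s entries <= nv t entries" "nv t entries <= nv u entries"
  using st tu by (simp_all add: extends_def)
 then show "nv s entries <= nv u entries" by simp
 show "na u label e = na s label e" "vec u e = vec s e" if "e < nv s entries" for e
  using that le st tu by (auto simp: extends_def)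
 show "na u label e = v" if "nv s entries <= e" "e < nv u entries" for e
  using that st tu by (cases "e < nv t entries") (auto simp: extends_def)
qed

lemma represented_extends:
 assumes "represented v \<tau> s" "extends u s t"
 shows "represented v \<tau> t"
 unfolding represented_def
proof
 assume "sound v \<tau>"
 then obtain e where e: "e < nv s entries" "na s label e = v" "key (vec s e) = key \<tau>"
  using assms(1) by (auto simp: represented_def)
 then show "\<exists>e<nv t entries. na t label e = v & key (vec t e) = key \<tau>"
  using assms(2) by (intro exI[of _ e]) (auto simp: extends_def)
qed

lemma key_cut: "k < n ==> key (cut \<sigma>) k = (if vis \<sigma> k then \<sigma> k else 0)"
 by (simp add: key_def vis_cut) (simp add: cut_def)

lemma key_eq_below:
 assumes "signs_on (piece u) \<sigma>" "signs_on (piece v) \<tau>"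
 shows "key \<sigma> = key \<tau> \<longleftrightarrow> (\<forall>k<n. key \<sigma> k = key \<tau> k)"
proof -
 have "key \<rho> k = 0" if "signs_on (piece w) \<rho>" "\<not> k < n" for \<rho> k w
  using that signs_on_nonzero[OF that(1), of k] piece_bounds[of k w] by (auto simp: key_def)
 then show ?thesis using assms by (metis ext)
qed

lemma entry_cases:
 assumes "entries_ok s" "e < nv s entries"
 shows "signs_on (piece (na s label e)) (vec s e)"
proof (cases "na s label e = 0 & vec s e = (\<lambda>_. 0)")
 case True
 then show ?thesis by (simp add: signs_on_def)
next
 case False
 then show ?thesis using assms unfolding entries_ok_def by blast
qed

lemma same_vec: "same c s t ==> signs ~: namods c ==> vec t e = vec s e"
 using sameD(3)[of c s t signs] by (auto simp: vec_def fun_eq_iff)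

lemma same_entries_ok:
 assumes "same c s t" "entries_ok s" "namods c \<inter> {signs, keys, label} = {}" "nmods c \<inter> {entries, limit} = {}"
 shows "entries_ok t" "extends v s t"
proof -
 have eq: "na t label = na s label" "na t keys = na s keys" "nv t entries = nv s entries" "nv t limit = nv s limit"
  using sameD[OF assms(1)] assms(3,4) by auto
 moreover have "vec t e = vec s e" for e using same_vec[OF assms(1)] assms(3) by simp
 ultimately show "entries_ok t" "extends v s t"
  using assms(2) by (simp_all add: entries_ok_def extends_def)
qed

lemma join_signs:
 assumes v: "2 <= v" "v < n" and s: "s = 1 | s = 2"
  and X: "signs_on (piece (first_child (pa v) (pb v) v)) X"
  and Y: "signs_on (piece (first_child (pa v) v v)) Y" and Z: "signs_on (piece (first_child (pb v) v v)) Z"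
 shows "signs_on (piece v) (join v s X Y Z)"
 unfolding signs_on_def
proof
 fix k
 note D = piece_decompose[OF v]
 show "if k \<in> piece v then join v s X Y Z k = 1 | join v s X Y Z k = 2 else join v s X Y Z k = 0"
  using D s signs_onD[OF X, of k] signs_onD[OF Y, of k] signs_onD[OF Z, of k]
  unfolding join_def by (cases "k = v"; cases "k \<in> piece (first_child (pa v) (pb v) v)";
   cases "k \<in> piece (first_child (pa v) v v)"; cases "k \<in> piece (first_child (pb v) v v)") auto
qed

definition ready :: "nat => store => bool" where
 "ready v s \<longleftrightarrow> static s & entries_ok s & nv s cur = v & nv s 12 = first_child (pa v) (pb v) v &
   nv s 13 = first_child (pa v) v v & nv s 14 = first_child (pb v) v v"

lemma merge_same: "same merge s (run merge s)"
 by (rule same_run[OF checked_parts(8)])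

text \<open>A tried combination is unsound, or its key is already present, or it is stored, or the
  table is full. The conclusions are proved together because each needs this case
  distinction.\<close>

lemma merge_correct:
 assumes r: "ready v s" and v: "2 <= v" "v < n" and sg: "nv s 18 < 2"
 defines "t \<equiv> run merge s"
 defines "\<tau> \<equiv> join v (Suc (nv s 18)) (vec s (nv s 15)) (vec s (nv s 16)) (vec s (nv s 17))"
 shows "entries_ok t" "extends v s t"
  "nv t overflow ~= 0 ==> nv s overflow ~= 0 | nv s entries = nv s limit"
  "nv t overflow = 0 ==> nv s 15 < nv s entries ==> nv s 16 < nv s entries ==> nv s 17 < nv s entries ==>
   na s label (nv s 15) = nv s 12 ==> na s label (nv s 16) = nv s 13 ==> na s label (nv s 17) = nv s 14 ==>
   represented v \<tau> t"
  "nv t overflow = 0 ==> nv s overflow = 0"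
proof -
 have st: "static s" and ok: "entries_ok s" and cu: "nv s cur = v" using r by (auto simp: ready_def)
 let ?C = "nv s 15 < nv s entries & nv s 16 < nv s entries & nv s 17 < nv s entries &
   na s label (nv s 15) = nv s 12 & na s label (nv s 16) = nv s 13 & na s label (nv s 17) = nv s 14"
 define rest where "rest = load;; place;; check;; IfPos (Var ok)
    (compute_key;; find_duplicate;; IfPos (Var 33) (IfPos (LtE (Var entries) (Var limit)) save (SetVar overflow (Const 1))) Skip)
    Skip"
 define cond where "cond = AndE (LtE (Var 15) (Var entries)) (AndE (LtE (Var 16) (Var entries)) (AndE (LtE (Var 17) (Var entries))
    (AndE (EqE (Arr label (Var 15)) (Var 12)) (AndE (EqE (Arr label (Var 16)) (Var 13)) (EqE (Arr label (Var 17)) (Var 14))))))"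
 have mg: "merge = IfPos cond rest Skip" unfolding merge_def rest_def cond_def by (rule refl)
 have "nval cond s = truth ?C" by (simp add: cond_def)
 then have tt: "t = (if ?C then run rest s else s)" unfolding t_def mg by simp
 have "entries_ok t & extends v s t & (nv t overflow ~= 0 --> nv s overflow ~= 0 | nv s entries = nv s limit) &
   (nv t overflow = 0 --> nv s overflow = 0 & (?C --> represented v \<tau> t))"
 proof (cases ?C)
  case False
  have "t = s" unfolding tt using False by (rule if_not_P)
  show ?thesis unfolding \<open>t = s\<close> using ok False extends_refl by blast
 next
  case True
  define s1 where "s1 = run load s"
  define s2 where "s2 = run check (run place s1)"
  have lim: "nv s entries <= nv s limit" using ok by (simp add: entries_ok_def)
  have X: "signs_on (piece (nv s 12)) (vec s (nv s 15))" "signs_on (piece (nv s 13)) (vec s (nv s 16))"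
   "signs_on (piece (nv s 14)) (vec s (nv s 17))"
   using entry_cases[OF ok, of "nv s 15"] entry_cases[OF ok, of "nv s 16"] entry_cases[OF ok, of "nv s 17"] True by auto
  have \<tau>: "signs_on (piece v) \<tau>"
   unfolding \<tau>_def using r sg X by (intro join_signs[OF v]) (auto simp: ready_def)
  have cut\<tau>: "cut \<tau> = \<tau>"
  proof
   fix k show "cut \<tau> k = \<tau> k"
    using signs_on_nonzero[OF \<tau>, of k] piece_bounds[of k v] by (auto simp: cut_def)
  qed
  have c1: "cut (na s1 cand) = \<tau>"
   using load_correct[OF st, unfolded cu, OF v(2)] True lim cut\<tau> by (simp add: s1_def \<tau>_def)
  have sm1: "same load s s1" unfolding s1_def by (rule same_run[OF checked_parts(5)])
  have st1: "static s1" by (rule static_same[OF st sm1]) (auto simp: part_defs)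
  have "nv s1 cur = v" using sameD(1)[OF sm1, of cur] cu by (simp add: part_defs)
  then have okv: "nv s2 ok = truth (sound v \<tau>)"
   using check_sound[OF st1 _ v] \<tau> c1 by (simp add: s2_def)
  have "same place s1 (run place s1)" by (rule same_run[OF checked_parts(1)])
  moreover have "same check (run place s1) s2" unfolding s2_def by (rule same_run[OF checked_parts(2)])
  ultimately have sm2: "same (load;; place;; check) s s2"
   using sm1 unfolding same_def by (simp add: part_defs)
  have cand2: "na s2 cand = na s1 cand"
   using sameD(3)[OF \<open>same place s1 (run place s1)\<close>, of cand] sameD(3)[OF \<open>same check (run place s1) s2\<close>, of cand]
   by (simp add: part_defs)
  have f2: "nv s2 overflow = nv s overflow" "nv s2 entries = nv s entries" "nv s2 limit = nv s limit" "nv s2 cur = v"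
   "na s2 label = na s label"
   using sameD[OF sm2] cu by (simp_all add: part_defs)
  have st2: "static s2" by (rule static_same[OF st sm2]) (auto simp: part_defs)
  have ok2: "entries_ok s2" and ex2: "extends v s s2"
   by (rule same_entries_ok[OF sm2 ok]; auto simp: part_defs)+
  have t: "t = run (IfPos (Var ok)
    (compute_key;; find_duplicate;; IfPos (Var 33) (IfPos (LtE (Var entries) (Var limit)) save (SetVar overflow (Const 1))) Skip)
    Skip) s2"
   unfolding tt if_P[OF True] by (simp add: rest_def s2_def s1_def)
  show ?thesis
  proof (cases "sound v \<tau>")
   case False
   then have "t = s2" by (simp add: t okv)
   then show ?thesis using ok2 ex2 f2 False by (simp add: represented_def)
  next
   case sd: True
   define s3 where "s3 = run find_duplicate (run compute_key s2)"
   have smk: "same compute_key s2 (run compute_key s2)" by (rule same_run[OF checked_parts(3)])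
   have smd: "same find_duplicate (run compute_key s2) s3" unfolding s3_def by (rule same_run[OF checked_parts(6)])
   have sm3: "same (compute_key;; find_duplicate) s2 s3"
    using smk smd unfolding same_def by (simp add: part_defs)
   have st3: "static s3" by (rule static_same[OF st2 sm3]) (auto simp: part_defs)
   have stk: "static (run compute_key s2)" by (rule static_same[OF st2 smk]) (auto simp: part_defs)
   have ok3: "entries_ok s3" and ex3: "extends v s2 s3"
    by (rule same_entries_ok[OF sm3 ok2]; auto simp: part_defs)+
   have f3: "nv s3 overflow = nv s overflow" "nv s3 entries = nv s entries" "nv s3 limit = nv s limit" "nv s3 cur = v"
    "na s3 label = na s label" "na s3 cand = na s1 cand" "na s3 keys = na s2 keys"
    using sameD[OF sm3] f2 cand2 by (simp_all add: part_defs)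
   have fk: "nv (run compute_key s2) entries = nv s entries" "nv (run compute_key s2) limit = nv s limit"
    "nv (run compute_key s2) cur = v" "na (run compute_key s2) label = na s label" "na (run compute_key s2) keys = na s2 keys"
    using sameD[OF smk] f2 by (simp_all add: part_defs)
   \<comment> \<open>Vertices 0 and 1 belong to no piece. Their sign 0 stops the recursion of
     visibility at the root edge.\<close>
   have small: "na s2 cand k = 0 & pb k = 0" if "k < 2" for k
   proof -
    have "cut (na s2 cand) k = 0"
     using signs_on_nonzero[OF \<tau>, of k] piece_bounds[of k v] that c1 cand2 by auto
    moreover have "k < n" using that n2 by simp
    moreover have "k = 0 | k = 1" using that by auto
    ultimately show ?thesis using base by (auto simp: cut_def)
   qed
   have kk: "na (run compute_key s2) akey k = key \<tau> k" if "k < n" for k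
   proof -
    have "na (run compute_key s2) akey k = (if vis (na s2 cand) k then na s2 cand k else 0)"
     using compute_key_correct[of s2 k] st2 parents' small that by (simp add: static_def)
    then show ?thesis using key_cut[OF that, of "na s2 cand"] c1 cand2 by simp
   qed
   have k3: "na s3 akey k = key \<tau> k" if "k < n" for k
    using sameD(3)[OF smd, of akey] kk[OF that] by (simp add: part_defs)
   have v3: "vec s3 e = vec s e" if "e < nv s entries" for e
    using ex2 ex3 that f2 by (simp add: extends_def)
   have dup: "nv s3 33 = truth (\<not> (\<exists>e<nv s entries. na s label e = v & key (vec s e) = key \<tau>))"
   proof -
    have "(\<forall>k<n. na s2 keys (e * n + k) = key \<tau> k) \<longleftrightarrow> key (vec s e) = key \<tau>"
     if e: "e < nv s entries" "na s label e = v" for e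
    proof -
     have "signs_on (piece v) (vec s2 e) & (\<forall>k<n. na s2 keys (e * n + k) = key (vec s2 e) k)"
      using ok2 e f2 v unfolding entries_ok_def by fastforce
     then show ?thesis using key_eq_below[OF _ \<tau>, of v "vec s2 e"] ex2 e by (auto simp: extends_def)
    qed
    moreover have "nv s3 33 = truth (\<not> (\<exists>e<nv s entries. na s label e = v & (\<forall>k<n. na s2 keys (e * n + k) = key \<tau> k)))"
     using find_duplicate_correct[OF stk] lim kk by (simp add: s3_def fk cong: conj_cong)
    ultimately show ?thesis by (simp cong: conj_cong)
   qed
   have t3: "t = run (IfPos (Var 33) (IfPos (LtE (Var entries) (Var limit)) save (SetVar overflow (Const 1))) Skip) s3"
    using sd by (simp add: t okv s3_def)
   have ex: "extends v s s3" using extends_trans[OF ex2 ex3] .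
   show ?thesis
   proof (cases "\<exists>e<nv s entries. na s label e = v & key (vec s e) = key \<tau>")
    case True
    then have "t = s3" by (simp add: t3 dup)
    moreover have "represented v \<tau> s3" using True v3 f3 by (auto simp: represented_def)
    ultimately show ?thesis using ok3 ex f3 by simp
   next
    case new: False
    show ?thesis
    proof (cases "nv s entries < nv s limit")
     case False
     then have "t = set_nv overflow 1 s3" using new by (simp add: t3 dup f3)
     moreover have "entries_ok (set_nv overflow 1 s3)" "extends v s (set_nv overflow 1 s3)"
      using ok3 ex by (simp_all add: entries_ok_def extends_def)
     ultimately show ?thesis using False lim by simp
    next
     case room: True
     then have ts: "t = run save s3" using new by (simp add: t3 dup f3)
     have "nv s3 entries < nv s3 limit" using room f3 by simp
     note sv = save_correct[OF st3 this, folded ts, unfolded f3(2,4,5,6) c1]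
     have sms: "same save s3 t" unfolding ts by (rule same_run[OF checked_parts(7)])
     have ft: "nv t overflow = nv s overflow" "nv t limit = nv s limit"
      using sameD(1)[OF sms] f3 by (simp_all add: part_defs)
     let ?c = "nv s entries"
     have ext: "extends v s3 t"
      using sv by (auto simp: extends_def f3 less_Suc_eq)
     have old: "na t label e = na s label e & vec t e = vec s e & (\<forall>k<n. na t keys (e * n + k) = na s3 keys (e * n + k))"
      if "e < ?c" for e
      using sv(5)[of e] that v3[OF that] by auto
     have "entries_ok t"
      unfolding entries_ok_def
     proof (intro conjI allI impI)
      show "nv t entries <= nv t limit" using room by (simp add: sv(1) ft)
     next
      fix e assume e: "e < nv t entries"
      show "na t label e = 0 & vec t e = (\<lambda>_. 0) |
       2 <= na t label e & na t label e < n & signs_on (piece (na t label e)) (vec t e) & sound (na t label e) (vec t e) &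
       (\<forall>k<n. na t keys (e * n + k) = key (vec t e) k)"
      proof (cases "e = ?c")
       case True
       then show ?thesis using v sd \<tau> k3 sv(2,3,4) by simp
      next
       case False
       then have "e < ?c" using e sv(1) by simp
       then show ?thesis using ok3 old[of e] v3[of e] unfolding entries_ok_def f3 by auto
      qed
     next
      fix e f assume ef: "e < nv t entries" "f < nv t entries" "na t label e = na t label f" "key (vec t e) = key (vec t f)"
      have c: "na t label ?c = v" "vec t ?c = \<tau>" using sv(2,3) by auto
      have fresh: "\<not> (na t label g = v & key (vec t g) = key \<tau>)" if "g < ?c" for g
       using new old[OF that] that by auto
      consider "e = ?c" "f = ?c" | "e = ?c" "f < ?c" | "e < ?c" "f = ?c" | "e < ?c" "f < ?c"
       using ef sv(1) by (auto simp: less_Suc_eq)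
      then show "e = f"
      proof cases
       case 2
       then show ?thesis using fresh[of f] ef c by simp
      next
       case 3
       then show ?thesis using fresh[of e] ef c by simp
      next
       case 4
       then show ?thesis using ok old[of e] old[of f] ef unfolding entries_ok_def by auto
      qed simp
     qed
     moreover have "represented v \<tau> t"
      unfolding represented_def using sv(1-3) by (intro impI exI[of _ ?c]) simp
     ultimately show ?thesis using extends_trans[OF ex ext] ft by simp
    qed
   qed
  qed
 qed
 then show "entries_ok t" "extends v s t"
  "nv t overflow ~= 0 ==> nv s overflow ~= 0 | nv s entries = nv s limit"
  "nv t overflow = 0 ==> nv s 15 < nv s entries ==> nv s 16 < nv s entries ==> nv s 17 < nv s entries ==>
   na s label (nv s 15) = nv s 12 ==> na s label (nv s 16) = nv s 13 ==> na s label (nv s 17) = nv s 14 ==>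
   represented v \<tau> t"
  "nv t overflow = 0 ==> nv s overflow = 0"
  by blast+
qed

text \<open>A transitive summary of the effect of \<open>merge\<close>, fit to pass through nested
  loops. That overflow entails a full table persists under further growth, since the number of
  entries never exceeds the cap.\<close>

definition grows :: "nat => store => store => bool" where
 "grows v s t \<longleftrightarrow> ready v t & extends v s t & nv t limit = nv s limit &
   (nv t overflow ~= 0 --> nv s overflow ~= 0 | nv t entries = nv t limit) &
   (nv t overflow = 0 --> nv s overflow = 0)"

lemma grows_trans:
 assumes st: "grows v s t" and tu: "grows v t u"
 shows "grows v s u"
proof -
 have "nv t entries <= nv u entries" "nv u entries <= nv u limit" "nv u limit = nv t limit"
  using tu by (auto simp: grows_def extends_def ready_def entries_ok_def)
 then have "nv u entries = nv u limit" if "nv t entries = nv t limit" using that by simp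
 then show ?thesis using st tu extends_trans[of v s t u] unfolding grows_def by auto
qed

lemma ready_counter:
 assumes "i \<in> {15, 16, 17, 18}"
 shows "ready v (set_nv i k s) \<longleftrightarrow> ready v s"
proof -
 have i: "i ~: {num_vertices, num_sides, two, limit, cur, entries, 12, 13, 14}" using assms by auto
 then have "static (set_nv i k s) \<longleftrightarrow> static s" "entries_ok (set_nv i k s) \<longleftrightarrow> entries_ok s"
  by (simp_all add: static_def entries_ok_def)
 then show ?thesis using i by (simp add: ready_def)
qed

lemma grows_counter:
 assumes "ready v s" "i \<in> {15, 16, 17, 18}"
 shows "grows v s (set_nv i k s)"
 using assms(2) ready_counter[OF assms(2), of v k s] assms(1)
 by (auto simp: grows_def extends_def)

text \<open>Round \<open>k\<close> establishes \<open>Q k\<close>; stability under growth carries it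
  through the later rounds and the increments of the counter.\<close>

lemma For_grows:
 assumes c: "checked (For i x c)" and i: "i \<in> {15, 16, 17, 18}" and r: "ready v s"
  and body: "\<And>k u. k < nv s x ==> nv u i = k ==> same (For i x c) s u ==> grows v s u ==> grows v u (run c u) & Q k (run c u)"
  and stable: "\<And>k u w. Q k u ==> grows v u w ==> Q k w"
 shows "grows v s (run (For i x c) s) & (\<forall>k<nv s x. Q k (run (For i x c) s))"
proof (rule For_rule[OF c, where P = "\<lambda>m t. grows v s t & (\<forall>k<m. Q k t)"])
 show "grows v s (set_nv i 0 s) & (\<forall>k<0. Q k (set_nv i 0 s))" using grows_counter[OF r i] by simp
 fix k u assume k: "k < nv s x" and P: "grows v s u & (\<forall>j<k. Q j u)" and u: "nv u i = k" "same (For i x c) s u"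
 have b: "grows v u (run c u)" "Q k (run c u)" using body[OF k u] P by auto
 have "ready v (run c u)" using b by (simp add: grows_def)
 note g = grows_counter[OF this i, of "Suc k"]
 have "Q j (set_nv i (Suc k) (run c u))" if j: "j < Suc k" for j
 proof (cases "j = k")
  case True
  then show ?thesis using stable[OF b(2) g] by simp
 next
  case False
  then have "Q j u" using P j by simp
  then show ?thesis using stable[OF stable[OF _ b(1)] g] by blast
 qed
 then show "grows v s (set_nv i (Suc k) (run c u)) & (\<forall>j<Suc k. Q j (set_nv i (Suc k) (run c u)))"
  using grows_trans[OF grows_trans[OF _ b(1)] g] P by blast
qed

lemma merge_grows:
 assumes r: "ready v s" and v: "2 <= v" "v < n" and sg: "nv s 18 < 2"
 shows "grows v s (run merge s)"
proof -
 have f: "nv (run merge s) x = nv s x" if "x \<in> {cur, 12, 13, 14, limit}" for x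
 proof -
  have "nmods merge \<inter> {cur, 12, 13, 14, limit} = {}" by (simp add: merge_def part_defs)
  then show ?thesis using sameD(1)[OF merge_same, of x] that by blast
 qed
 have "static s" using r by (simp add: ready_def)
 then have "static (run merge s)"
  by (rule static_same[OF _ merge_same]; simp add: merge_def part_defs)
 then have rt: "ready v (run merge s)"
  using r merge_correct(1)[OF r v sg] by (simp add: ready_def f)
 have "nv (run merge s) entries = nv (run merge s) limit" if "nv s entries = nv s limit"
  using that rt merge_correct(2)[OF r v sg] f[of limit] by (auto simp: ready_def entries_ok_def extends_def)
 then show ?thesis
  using rt merge_correct(2,3,5)[OF r v sg] f[of limit] by (auto simp: grows_def)
qed

lemma process_correct:
 assumes st: "static s" and ok: "entries_ok s" and cu: "nv s cur = v" and v: "2 <= v" "v < n"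
 defines "t \<equiv> run process s"
 shows "static t" "entries_ok t" "extends v s t"
  "nv t overflow ~= 0 ==> nv s overflow ~= 0 | nv t entries = nv s limit"
  "nv t overflow = 0 ==> nv s overflow = 0"
  "nv t overflow = 0 ==> e1 < nv s entries ==> e2 < nv s entries ==> e3 < nv s entries ==>
   na s label e1 = first_child (pa v) (pb v) v ==> na s label e2 = first_child (pa v) v v ==>
   na s label e3 = first_child (pb v) v v ==> g < 2 ==>
   represented v (join v (Suc g) (vec s e1) (vec s e2) (vec s e3)) t"
proof -
 define s1 where "s1 = run find_children s"
 have sm: "same find_children s s1" unfolding s1_def by (rule same_run[OF checked_parts(4)])
 have ok1: "entries_ok s1" and ex1: "extends v s s1"
  by (rule same_entries_ok[OF sm ok]; auto simp: part_defs)+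
 have f1: "nv s1 overflow = nv s overflow" "nv s1 entries = nv s entries" "nv s1 limit = nv s limit" "nv s1 cur = v"
  "na s1 label = na s label"
  using sameD[OF sm] cu by (simp_all add: part_defs)
 have st1: "static s1" by (rule static_same[OF st sm]) (auto simp: part_defs)
 have r1: "ready v s1"
  using find_children_correct[OF st cu v(2)] st1 ok1 f1 by (simp add: ready_def s1_def)
 let ?C = "\<lambda>e1 e2 e3. e1 < nv s entries & e2 < nv s entries & e3 < nv s entries &
   na s label e1 = first_child (pa v) (pb v) v & na s label e2 = first_child (pa v) v v & na s label e3 = first_child (pb v) v v"
 \<comment> \<open>\<open>Q\<close> refers to the vectors of the initial store \<open>s\<close>.
   Entries are only appended during the loops, so these vectors remain where they were.\<close>
 define Q where "Q = (\<lambda>e1 e2 e3 g w. nv w overflow = 0 --> ?C e1 e2 e3 -->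
   represented v (join v (Suc g) (vec s e1) (vec s e2) (vec s e3)) w)"
 have stable: "Q e1 e2 e3 g w" if "Q e1 e2 e3 g u" "grows v u w" for e1 e2 e3 g u w
  using that represented_extends[of v _ u v w] by (auto simp: Q_def grows_def)
 have ck: "checked (For 18 two merge)" "checked (For 17 limit (For 18 two merge))"
  "checked (For 16 limit (For 17 limit (For 18 two merge)))"
  "checked (For 15 limit (For 16 limit (For 17 limit (For 18 two merge))))"
  by (auto simp: checked_def merge_def part_defs)
 \<comment> \<open>The four loops are treated from the inside out, each one contributing a further
   quantifier in front of \<open>Q\<close>.\<close>
 have l4: "grows v w (run (For 18 two merge) w) & (\<forall>g<2. Q e1 e2 e3 g (run (For 18 two merge) w))"
  if g: "grows v s1 w" and c: "nv w 15 = e1" "nv w 16 = e2" "nv w 17 = e3" for w e1 e2 e3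
 proof -
  have rw: "ready v w" using g by (simp add: grows_def)
  then have two: "nv w two = 2" by (simp add: ready_def static_def)
  have "grows v w (run (For 18 two merge) w) & (\<forall>g<nv w two. Q e1 e2 e3 g (run (For 18 two merge) w))"
  proof (rule For_grows[OF ck(1) _ rw])
   fix k u assume k: "k < nv w two" "nv u 18 = k" and sm: "same (For 18 two merge) w u" and gu: "grows v w u"
   have ru: "ready v u" using gu by (simp add: grows_def)
   have f: "nv u 15 = e1" "nv u 16 = e2" "nv u 17 = e3"
    using sameD(1)[OF sm] c by (auto simp: merge_def part_defs)
   have k2: "nv u 18 < 2" using k two by simp
   have ex: "extends v s u"
    using extends_trans[OF ex1] extends_trans[of v s1 w u] g gu by (auto simp: grows_def)
   have "Q e1 e2 e3 k (run merge u)"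
    unfolding Q_def
   proof (intro impI)
    assume ov: "nv (run merge u) overflow = 0" and C: "?C e1 e2 e3"
    have o: "e < nv u entries" "na u label e = na s label e" "vec u e = vec s e" if "e < nv s entries" for e
     using ex that by (auto simp: extends_def)
    note m = merge_correct(4)[OF ru v k2 ov, unfolded f k(2)]
    have "nv u 12 = first_child (pa v) (pb v) v" "nv u 13 = first_child (pa v) v v" "nv u 14 = first_child (pb v) v v"
     using ru by (simp_all add: ready_def)
    then show "represented v (join v (Suc k) (vec s e1) (vec s e2) (vec s e3)) (run merge u)"
     using m C o[of e1] o[of e2] o[of e3] by simp
   qed
   then show "grows v u (run merge u) & Q e1 e2 e3 k (run merge u)" using merge_grows[OF ru v k2] by simp
  qed (use stable in auto)
  then show ?thesis unfolding two .
 qed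
 let ?c4 = "For 18 two merge"
 have l3: "grows v w (run (For 17 limit ?c4) w) & (\<forall>e3<nv s limit. \<forall>g<2. Q e1 e2 e3 g (run (For 17 limit ?c4) w))"
  if g: "grows v s1 w" and c: "nv w 15 = e1" "nv w 16 = e2" for w e1 e2
 proof -
  have rw: "ready v w" and lim: "nv w limit = nv s limit" using g f1 by (auto simp: grows_def)
  have "grows v w (run (For 17 limit ?c4) w) & (\<forall>e3<nv w limit. \<forall>g<2. Q e1 e2 e3 g (run (For 17 limit ?c4) w))"
  proof (rule For_grows[OF ck(2) _ rw])
   fix k u assume k: "k < nv w limit" "nv u 17 = k" and sm: "same (For 17 limit ?c4) w u" and gu: "grows v w u"
   have "nv u 15 = e1" "nv u 16 = e2" using sameD(1)[OF sm] c by (auto simp: merge_def part_defs)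
   then show "grows v u (run ?c4 u) & (\<forall>g<2. Q e1 e2 k g (run ?c4 u))"
    using l4[OF grows_trans[OF g gu]] k by blast
  qed (use stable in blast)+
  then show ?thesis unfolding lim .
 qed
 let ?c3 = "For 17 limit ?c4"
 have l2: "grows v w (run (For 16 limit ?c3) w) & (\<forall>e2<nv s limit. \<forall>e3<nv s limit. \<forall>g<2. Q e1 e2 e3 g (run (For 16 limit ?c3) w))"
  if g: "grows v s1 w" and c: "nv w 15 = e1" for w e1
 proof -
  have rw: "ready v w" and lim: "nv w limit = nv s limit" using g f1 by (auto simp: grows_def)
  have "grows v w (run (For 16 limit ?c3) w) &
   (\<forall>e2<nv w limit. \<forall>e3<nv s limit. \<forall>g<2. Q e1 e2 e3 g (run (For 16 limit ?c3) w))"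
  proof (rule For_grows[OF ck(3) _ rw])
   fix k u assume k: "k < nv w limit" "nv u 16 = k" and sm: "same (For 16 limit ?c3) w u" and gu: "grows v w u"
   have "nv u 15 = e1" using sameD(1)[OF sm] c by (auto simp: merge_def part_defs)
   then show "grows v u (run ?c3 u) & (\<forall>e3<nv s limit. \<forall>g<2. Q e1 k e3 g (run ?c3 u))"
    using l3[OF grows_trans[OF g gu]] k by blast
  qed (use stable in blast)+
  then show ?thesis unfolding lim .
 qed
 let ?c2 = "For 16 limit ?c3"
 have t: "t = run (For 15 limit ?c2) s1" by (simp add: t_def process_def s1_def)
 have refl: "grows v s1 s1" using r1 by (simp add: grows_def)
 have "grows v s1 t & (\<forall>e1<nv s1 limit. \<forall>e2<nv s limit. \<forall>e3<nv s limit. \<forall>g<2. Q e1 e2 e3 g t)"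
  unfolding t
 proof (rule For_grows[OF ck(4) _ r1])
  fix k u assume k: "k < nv s1 limit" "nv u 15 = k" and sm: "same (For 15 limit ?c2) s1 u" and gu: "grows v s1 u"
  show "grows v u (run ?c2 u) & (\<forall>e2<nv s limit. \<forall>e3<nv s limit. \<forall>g<2. Q k e2 e3 g (run ?c2 u))"
   using l2[OF gu k(2)] by blast
 qed (use stable in blast)+
 then have g: "grows v s1 t" and all: "\<forall>e1<nv s limit. \<forall>e2<nv s limit. \<forall>e3<nv s limit. \<forall>g<2. Q e1 e2 e3 g t"
  unfolding f1 by auto
 show "static t" "entries_ok t" using g by (auto simp: grows_def ready_def)
 show "extends v s t" using g extends_trans[OF ex1] by (simp add: grows_def)
 show "nv t overflow ~= 0 ==> nv s overflow ~= 0 | nv t entries = nv s limit"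
  "nv t overflow = 0 ==> nv s overflow = 0"
  using g f1 by (auto simp: grows_def)
 have lim: "e < nv s limit" if "e < nv s entries" for e using ok that by (simp add: entries_ok_def)
 show "nv t overflow = 0 ==> e1 < nv s entries ==> e2 < nv s entries ==> e3 < nv s entries ==>
   na s label e1 = first_child (pa v) (pb v) v ==> na s label e2 = first_child (pa v) v v ==>
   na s label e3 = first_child (pb v) v v ==> g < 2 ==>
   represented v (join v (Suc g) (vec s e1) (vec s e2) (vec s e3)) t"
  using all[rule_format, OF lim lim lim, of e1 e2 e3 g] unfolding Q_def by blast
qed

end

lemma set_other [simp]:
 "k < 32 ==> l < 32 ==> l ~= k ==> na (set_na k i v s) l = na s l"
 "k < 32 ==> l < 32 ==> l ~= k ==> ra (set_ra k i r s) l = ra s l"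
 by (simp_all add: fun_eq_iff)

section \<open>One pass over all pieces for a fixed root and cap\<close>

definition sweep :: com where
 "sweep = For 35 num_vertices (SetVar cur (Minus (Minus Vn (Const 1)) (Var 35));;
   IfPos (LtE (Const 1) (Var cur)) process Skip)"

definition start :: com where
 "start = SetVar entries (Const 1);; SetVar overflow (Const 0);; SetArr label (Const 0) (Const 0);;
   For 27 num_vertices (SetArr signs (Var 27) (Const 0))"

definition fetch :: com where
 "fetch = SetVar answer (Const 1);;
   For 27 num_vertices (SetArr cand (Var 27) (Arr signs (Plus (Arr offset (Var 35)) (Var 27))));; place;;
   For 27 num_vertices (SetRealArr outx (Arr name (Var 27)) (RealArr px (Var 27));;
    SetRealArr outy (Arr name (Var 27)) (RealArr py (Var 27)))"

text \<open>There is no early exit from a loop, so every entry for the whole graph is fetched and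
  the last one wins; each of them gives a realization.\<close>

definition finish :: com where
 "finish = SetVar halt (Const 1);; SetVar answer (Const 0);;
   For 35 limit (IfPos (AndE (LtE (Var 35) (Var entries)) (EqE (Arr label (Var 35)) (Const 2))) fetch Skip)"

definition solve :: com where
 "solve = start;; sweep;; IfPos (Var overflow) Skip finish"

lemmas solve_defs = part_defs merge_def process_def sweep_def start_def fetch_def finish_def

lemma checked_solve_parts: "checked process" "checked sweep" "checked start" "checked finish" "checked solve" "checked fetch"
 by (auto simp: checked_def solve_def solve_defs)

context parent_structure
begin

definition closed :: "nat => store => bool" where
 "closed v s \<longleftrightarrow> (\<forall>e1<nv s entries. \<forall>e2<nv s entries. \<forall>e3<nv s entries. \<forall>g<2.
   na s label e1 = first_child (pa v) (pb v) v --> na s label e2 = first_child (pa v) v v -->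
   na s label e3 = first_child (pb v) v v -->
   represented v (join v (Suc g) (vec s e1) (vec s e2) (vec s e3)) s)"

text \<open>Pieces with index at least \<open>m\<close> are complete. After an overflow this is
  given up, and only the fact that the table is full is retained.\<close>

definition swept :: "nat => nat => store => bool" where
 "swept B m s \<longleftrightarrow> static s & entries_ok s & 1 <= nv s entries & nv s limit = B & (nv s overflow ~= 0 --> nv s entries = B) &
   (\<forall>e<nv s entries. na s label e = 0 \<longleftrightarrow> e = 0) & (\<forall>e<nv s entries. na s label e = 0 | m <= na s label e) &
   (nv s overflow = 0 --> (\<forall>v. 2 <= v --> m <= v --> v < n --> closed v s))"

lemma first_child_above: "first_child x y v = 0 | v < first_child x y v"
 by (cases rule: first_child_cases[of x y v]) auto

text \<open>The children of \<open>v\<close> have label 0 or a label above \<open>v\<close>. New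
  entries with a nonzero label up to \<open>v\<close> therefore create no new combinations for
  \<open>v\<close>.\<close>

lemma closed_extends:
 assumes c: "closed v s" and e: "extends u s t" and u: "u ~= 0" "u <= v"
 shows "closed v t"
 unfolding closed_def
proof (intro allI impI)
 fix e1 e2 e3 g :: nat
 assume h: "e1 < nv t entries" "e2 < nv t entries" "e3 < nv t entries" "g < 2"
  "na t label e1 = first_child (pa v) (pb v) v" "na t label e2 = first_child (pa v) v v"
  "na t label e3 = first_child (pb v) v v"
 have old: "f < nv s entries & na t label f = na s label f & vec t f = vec s f"
  if "f < nv t entries" "na t label f = first_child x y v" for f x y
 proof -
  have "na t label f ~= u" using that(2) first_child_above[of x y v] u by auto
  then show ?thesis using e that(1) unfolding extends_def by (meson not_le)
 qed
 note o = old[OF h(1,5)] old[OF h(2,6)] old[OF h(3,7)]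
 have "represented v (join v (Suc g) (vec s e1) (vec s e2) (vec s e3)) s"
  using c h o unfolding closed_def by simp
 then show "represented v (join v (Suc g) (vec t e1) (vec t e2) (vec t e3)) t"
  using represented_extends[OF _ e] o by simp
qed

lemma process_swept:
 assumes s: "swept B (Suc v) s" and cu: "nv s cur = v" and v: "2 <= v" "v < n"
 shows "swept B v (run process s)"
proof -
 let ?t = "run process s"
 have st: "static s" and ok: "entries_ok s" using s by (simp_all add: swept_def)
 note P = process_correct[OF st ok cu v]
 have lim: "nv ?t limit = nv s limit"
  using sameD(1)[OF same_run[OF checked_solve_parts(1)], of limit s] by (simp add: solve_defs)
 have ex: "extends v s ?t" using P(3) .
 then have le: "nv s entries <= nv ?t entries" by (simp add: extends_def)
 have full: "nv ?t entries = B" if "nv ?t overflow ~= 0"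
 proof -
  have "nv ?t entries <= nv ?t limit" using P(2) by (simp add: entries_ok_def)
  moreover have "nv s overflow ~= 0 ==> nv s entries = B" "nv s limit = B" using s by (auto simp: swept_def)
  ultimately show ?thesis using P(4)[OF that] le lim by auto
 qed
 have lab: "na ?t label e = (if e < nv s entries then na s label e else v)" if "e < nv ?t entries" for e
  using ex that by (simp add: extends_def)
 have s1: "1 <= nv s entries" using s by (simp add: swept_def)
 have l0: "na ?t label e = 0 \<longleftrightarrow> e = 0" if "e < nv ?t entries" for e
  using lab[OF that] s v s1 by (auto simp: swept_def)
 have l1: "na ?t label e = 0 | v <= na ?t label e" if "e < nv ?t entries" for e
  using lab[OF that] s by (auto simp: swept_def dest: Suc_leD)
 have cl: "closed w ?t" if ov: "nv ?t overflow = 0" and w: "2 <= w" "v <= w" "w < n" for w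
 proof (cases "w = v")
  case True
  show ?thesis
   unfolding closed_def True
  proof (intro allI impI)
   fix e1 e2 e3 g :: nat
   assume h: "e1 < nv ?t entries" "e2 < nv ?t entries" "e3 < nv ?t entries" "g < 2"
    "na ?t label e1 = first_child (pa v) (pb v) v" "na ?t label e2 = first_child (pa v) v v"
    "na ?t label e3 = first_child (pb v) v v"
   have old: "f < nv s entries & na ?t label f = na s label f & vec ?t f = vec s f"
    if "f < nv ?t entries" "na ?t label f = first_child x y v" for f x y
   proof -
    have "na ?t label f ~= v" using that(2) first_child_above[of x y v] v by auto
    then have "f < nv s entries" using lab[OF that(1)] by (auto split: if_splits)
    then show ?thesis using ex by (simp add: extends_def)
   qed
   note o = old[OF h(1,5)] old[OF h(2,6)] old[OF h(3,7)]
   show "represented v (join v (Suc g) (vec ?t e1) (vec ?t e2) (vec ?t e3)) ?t"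
    using P(6)[OF ov, of e1 e2 e3 g] o h by simp
  qed
 next
  case False
  then have "closed w s" using s w P(5)[OF ov] by (simp add: swept_def)
  then show ?thesis using closed_extends[OF _ ex] v w by simp
 qed
 have "nv ?t limit = B" using s lim by (simp add: swept_def)
 then show ?thesis
  unfolding swept_def using P(1,2) full l0 l1 cl le s1 by auto
qed

lemma sweep_correct:
 assumes s: "swept B n s" and n: "3 <= n"
 shows "swept B 0 (run sweep s)"
proof -
 define body where "body = SetVar cur (Minus (Minus Vn (Const 1)) (Var 35));; IfPos (LtE (Const 1) (Var cur)) process Skip"
 have nn: "nv s num_vertices = n" using s by (simp add: swept_def static_def)
 have keep: "swept B m (set_nv x k t) \<longleftrightarrow> swept B m t" if "x = 35 | x = cur" for x k m t
 proof -
  have x: "x ~: {num_vertices, num_sides, two, limit, entries, overflow}" using that by auto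
  have 1: "nv (set_nv x k t) limit = nv t limit" "nv (set_nv x k t) entries = nv t entries"
   "nv (set_nv x k t) overflow = nv t overflow" "static (set_nv x k t) = static t"
   using x by (simp_all add: static_def)
  have 2: "entries_ok (set_nv x k t) = entries_ok t"
   unfolding entries_ok_def 1 na_sets(1) vec_set_nv by (rule refl)
  have 3: "represented v \<tau> (set_nv x k t) = represented v \<tau> t" for v \<tau>
   unfolding represented_def 1 na_sets(1) vec_set_nv by (rule refl)
  have 4: "closed v (set_nv x k t) = closed v t" for v
   unfolding closed_def 1 3 na_sets(1) vec_set_nv by (rule refl)
  show ?thesis unfolding swept_def 1 2 4 na_sets(1) by (rule refl)
 qed
 have less: "swept B m' t" if "swept B m t" "m' <= m" "\<And>v. 2 <= v ==> m' <= v ==> m <= v" for m m' t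
  unfolding swept_def
 proof (intro conjI)
  show "\<forall>e<nv t entries. na t label e = 0 | m' <= na t label e" using that(1,2) by (auto simp: swept_def)
  show "nv t overflow = 0 --> (\<forall>v. 2 <= v --> m' <= v --> v < n --> closed v t)"
   using that(1,3) by (simp add: swept_def)
 qed (use that(1) in \<open>simp_all add: swept_def\<close>)
 have "swept B (n - nv s num_vertices) (run (For 35 num_vertices body) s)"
 proof (rule For_rule[where P = "\<lambda>k t. swept B (n - k) t"])
  show "checked (For 35 num_vertices body)" by (auto simp: checked_def body_def solve_defs)
  show "swept B (n - 0) (set_nv 35 0 s)" using s keep by simp
  fix k t assume k: "k < nv s num_vertices" and P: "swept B (n - k) t" and i: "nv t 35 = k"
  have tn: "nv t num_vertices = n" using P by (simp add: swept_def static_def)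
  define v where "v = n - Suc k"
  have kv: "n - k = Suc v" "v < n" using k nn by (auto simp: v_def)
  define u where "u = set_nv cur v t"
  have cv: "nval (Minus (Minus Vn (Const 1)) (Var 35)) t = v" by (simp add: tn i v_def)
  have b: "run body t = run (IfPos (LtE (Const 1) (Var cur)) process Skip) u"
   by (simp only: body_def run.simps(7) run_sets(1) cv u_def)
  have u: "swept B (Suc v) u" "nv u cur = v" using P keep kv by (simp_all add: u_def)
  have "swept B v (run body t)"
  proof (cases "2 <= v")
   case True
   then show ?thesis using process_swept[OF u True kv(2)] by (simp add: b u(2))
  next
   case False
   then have "run body t = u" by (simp add: b u(2))
   moreover have "swept B v u" by (rule less[OF u(1)]) (use False in simp_all)
   ultimately show ?thesis by simp
  qed
  then show "swept B (n - Suc k) (set_nv 35 (Suc k) (run body t))" using keep by (simp add: v_def)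
 qed
 moreover have sd: "sweep = For 35 num_vertices body" unfolding sweep_def body_def by (rule refl)
 ultimately show ?thesis unfolding sd nn by simp
qed

lemma start_correct:
 assumes st: "static s" and B: "nv s limit = B" "1 <= B"
 shows "swept B n (run start s)"
proof -
 define s1 where "s1 = set_na label 0 0 (set_nv overflow 0 (set_nv entries (Suc 0) s))"
 let ?body = "SetArr signs (Var 27) (Const 0)"
 define t where "t = run (For 27 num_vertices ?body) s1"
 have nn: "nv s1 num_vertices = n" using st by (simp add: static_def s1_def)
 have sm: "same (For 27 num_vertices ?body) s1 t" unfolding t_def by (rule same_run) (simp add: checked_def)
 have "\<forall>k<nv s1 num_vertices. na t signs k = 0"
  unfolding t_def
 proof (rule For_rule[where P = "\<lambda>m t. \<forall>k<m. na t signs k = 0"])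
  fix k t assume "\<forall>j<k. na t signs j = 0" "nv t 27 = k"
  then show "\<forall>j<Suc k. na (set_nv 27 (Suc k) (run ?body t)) signs j = 0" by simp
 qed (auto simp: checked_def)
 then have v0: "vec t 0 = (\<lambda>_. 0)" by (auto simp: vec_def nn)
 have s1: "static s1" using st by (simp add: static_def s1_def)
 have st1: "static t" by (rule static_same[OF s1 sm]) simp_all
 have f: "nv t entries = Suc 0" "nv t overflow = 0" "nv t limit = B" "na t label 0 = 0"
  using sameD[OF sm] B by (simp_all add: s1_def)
 have "entries_ok t" using f v0 B by (simp add: entries_ok_def)
 then have "swept B n t" using f st1 by (auto simp: swept_def)
 moreover have "run start s = t" by (simp add: start_def t_def s1_def)
 ultimately show ?thesis by simp
qed

text \<open>The labels range over fewer than \<open>n + 1\<close> values, and entries with a common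
  label have distinct keys, which \<open>card_keys\<close> counts.\<close>

lemma entries_bound:
 assumes ok: "entries_ok s" and d: "\<And>k. k < n ==> depth k <= d"
 shows "nv s entries <= n * (2 * n + 1) ^ (4 ^ d)"
proof -
 let ?S = "\<lambda>u. {e. e < nv s entries & na s label e = u}"
 have lab: "na s label e < n" if "e < nv s entries" for e
  using ok that n2 unfolding entries_ok_def by fastforce
 have "card (?S u) <= (2 * n + 1) ^ (4 ^ d)" for u
 proof -
  have sg: "signs_on (piece u) \<sigma>" if "\<sigma> \<in> vec s ` ?S u" for \<sigma> using that entry_cases[OF ok] by auto
  have "inj_on (\<lambda>e. key (vec s e)) (?S u)"
   using ok unfolding entries_ok_def by (intro inj_onI) auto
  then have "card (?S u) = card ((\<lambda>e. key (vec s e)) ` ?S u)" by (rule card_image[symmetric])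
  also have "(\<lambda>e. key (vec s e)) ` ?S u = key ` vec s ` ?S u" by (simp add: image_image)
  also have "card \<dots> <= (2 * n + 1) ^ (4 ^ d)" by (rule card_keys(2)[OF sg d])
  finally show ?thesis .
 qed
 then have "(\<Sum>u<n. card (?S u)) <= n * (2 * n + 1) ^ (4 ^ d)"
  using sum_mono[of "{..<n}" "\<lambda>u. card (?S u)" "\<lambda>_. (2 * n + 1) ^ (4 ^ d)"] by simp
 moreover have "card (\<Union>u<n. ?S u) <= (\<Sum>u<n. card (?S u))" by (rule card_UN_le) simp
 moreover have "(\<Union>u<n. ?S u) = {..<nv s entries}" using lab by auto
 ultimately show ?thesis by simp
qed

lemma swept_tables:
 assumes s: "swept B 0 s" and ov: "nv s overflow = 0" and n: "3 <= n"
 shows "(\<exists>p. realizes p) \<longleftrightarrow> (\<exists>e<nv s entries. na s label e = 2)"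
  "e < nv s entries ==> na s label e = 2 ==> realizes (pos (vec s e))"
proof -
 define L where "L v = vec s ` {e. e < nv s entries & na s label e = v}" for v
 have ok: "entries_ok s" using s by (simp add: swept_def)
 have "{e. e < nv s entries & na s label e = 0} = {0}"
  using s by (auto simp: swept_def)
 moreover have "vec s 0 = (\<lambda>_. 0)"
 proof -
  have "0 < nv s entries" "na s label 0 = 0" using s by (auto simp: swept_def)
  then show ?thesis using ok unfolding entries_ok_def by fastforce
 qed
 ultimately have L0: "L 0 = {\<lambda>_. 0}" by (simp add: L_def)
 have L: "table L v" if v: "2 <= v" "v < n" for v
  unfolding table_def
 proof (intro conjI ballI impI)
  fix \<sigma> assume "\<sigma> \<in> L v"
  then obtain e where e: "e < nv s entries" "na s label e = v" "\<sigma> = vec s e" by (auto simp: L_def)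
  then show "signs_on (piece v) \<sigma>" "sound v \<sigma>" using ok v unfolding entries_ok_def by fastforce+
 next
  fix X Y Z g
  assume h: "X \<in> L (first_child (pa v) (pb v) v)" "Y \<in> L (first_child (pa v) v v)" "Z \<in> L (first_child (pb v) v v)"
   "g \<in> {1, 2}" "sound v (join v g X Y Z)"
  obtain e1 where e1: "e1 < nv s entries" "na s label e1 = first_child (pa v) (pb v) v" "X = vec s e1"
   using h(1) unfolding L_def by blast
  obtain e2 where e2: "e2 < nv s entries" "na s label e2 = first_child (pa v) v v" "Y = vec s e2"
   using h(2) unfolding L_def by blast
  obtain e3 where e3: "e3 < nv s entries" "na s label e3 = first_child (pb v) v v" "Z = vec s e3"
   using h(3) unfolding L_def by blast
  obtain g' where g': "g' < 2" "g = Suc g'" using h(4) by (auto intro: that[of 0] that[of 1])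
  have "closed v s" using s ov v by (simp add: swept_def)
  then have "represented v (join v g X Y Z) s"
   using e1 e2 e3 g' unfolding closed_def by simp
  then obtain e where "e < nv s entries" "na s label e = v" "key (vec s e) = key (join v g X Y Z)"
   using h(5) unfolding represented_def by blast
  then show "\<exists>\<tau>\<in>L v. key \<tau> = key (join v g X Y Z)" unfolding L_def by blast
 qed
 note D = tables_decide[OF n L0 L]
 show "(\<exists>p. realizes p) \<longleftrightarrow> (\<exists>e<nv s entries. na s label e = 2)"
  using D(1) by (auto simp: L_def)
 show "e < nv s entries ==> na s label e = 2 ==> realizes (pos (vec s e))"
  using D(2) by (auto simp: L_def)
qed

lemma realizes_cong:
 assumes "realizes p" "\<And>k. k < n ==> r k = p k"
 shows "realizes r"
proof -
 have "pa k < n & pb k < n" if "1 <= k" "k < n" for k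
  using child_bounds[of "pa k" k] child_bounds[of "pb k" k] that by (auto simp: child_def)
 then show ?thesis
  using assms planar_cong[of "{..<n}" p r] unfolding realizes_def by simp
qed

definition answered :: "store => bool" where
 "answered s \<longleftrightarrow> (if \<exists>p. realizes p then nv s answer = 1 & realizes (\<lambda>k. (ra s outx (na s name k), ra s outy (na s name k)))
   else nv s answer = 0)"

lemma fetch_correct:
 assumes st: "static s" and e: "nv s 35 < nv s limit" and nm: "inj_on (na s name) {..<n}" and k: "k < n"
 defines "t \<equiv> run fetch s"
 shows "(ra t outx (na s name k), ra t outy (na s name k)) = pos (vec s (nv s 35)) k"
proof -
 define b1 where "b1 = SetArr cand (Var 27) (Arr signs (Plus (Arr offset (Var 35)) (Var 27)))"
 define b2 where "b2 = SetRealArr outx (Arr name (Var 27)) (RealArr px (Var 27));;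
    SetRealArr outy (Arr name (Var 27)) (RealArr py (Var 27))"
 define s1 where "s1 = set_nv answer (Suc 0) s"
 define s2 where "s2 = run (For 27 num_vertices b1) s1"
 define s3 where "s3 = run place s2"
 have t: "t = run (For 27 num_vertices b2) s3"
  by (simp add: t_def fetch_def b1_def b2_def s3_def s2_def s1_def)
 have st1: "static s1" using st by (simp add: static_def s1_def)
 have nn: "nv s1 num_vertices = n" using st1 by (simp add: static_def)
 have sm2: "same (For 27 num_vertices b1) s1 s2" unfolding s2_def by (rule same_run) (simp add: checked_def b1_def)
 have st2: "static s2" by (rule static_same[OF st1 sm2]) (simp_all add: b1_def)
 have off: "na s offset (nv s 35) = nv s 35 * n" using st e by (simp add: static_def)
 have "\<forall>k<nv s1 num_vertices. na s2 cand k = vec s (nv s 35) k"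
  unfolding s2_def
 proof (rule For_rule[where P = "\<lambda>m t. \<forall>k<m. na t cand k = vec s (nv s 35) k"])
  fix k t assume k: "k < nv s1 num_vertices" and P: "\<forall>j<k. na t cand j = vec s (nv s 35) j" and i: "nv t 27 = k"
   and sm: "same (For 27 num_vertices b1) s1 t"
  have "na t signs = na s signs" "na t offset = na s offset" "nv t 35 = nv s 35"
   using sameD[OF sm] by (simp_all add: b1_def s1_def)
  then show "\<forall>j<Suc k. na (set_nv 27 (Suc k) (run b1 t)) cand j = vec s (nv s 35) j"
   using P k off by (auto simp: b1_def i less_Suc_eq vec_def nn)
 qed (simp_all add: checked_def b1_def)
 then have "cut (na s2 cand) = vec s (nv s 35)" by (auto simp: cut_def vec_def nn fun_eq_iff)
 then have pos: "pos (na s2 cand) k = pos (vec s (nv s 35)) k" if "k < n" for k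
  using pos_cut[OF that] by metis
 have sm3: "same place s2 s3" unfolding s3_def by (rule same_run[OF checked_parts(1)])
 have st3: "static s3" by (rule static_same[OF st2 sm3]) (auto simp: part_defs)
 have n3: "nv s3 num_vertices = n" using st3 by (simp add: static_def)
 have pt: "ra s3 px k = fst (pos (vec s (nv s 35)) k) & ra s3 py k = snd (pos (vec s (nv s 35)) k)" if "k < n" for k
  using place_correct(1)[of s2 k] parents' st2 pos[OF that] that by (simp add: static_def s3_def)
 have nm3: "na s3 name = na s name"
  using sameD(3)[OF sm3, of name] sameD(3)[OF sm2, of name] by (simp add: part_defs b1_def s1_def)
 have "\<forall>k<nv s3 num_vertices. ra t outx (na s name k) = ra s3 px k & ra t outy (na s name k) = ra s3 py k"
  unfolding t
 proof (rule For_rule[where P = "\<lambda>m t. \<forall>k<m. ra t outx (na s name k) = ra s3 px k & ra t outy (na s name k) = ra s3 py k"])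
  fix k t assume k: "k < nv s3 num_vertices" and i: "nv t 27 = k" and sm: "same (For 27 num_vertices b2) s3 t"
   and P: "\<forall>j<k. ra t outx (na s name j) = ra s3 px j & ra t outy (na s name j) = ra s3 py j"
  have f: "na t name = na s name" "ra t px = ra s3 px" "ra t py = ra s3 py" using sameD[OF sm] nm3 by (simp_all add: b2_def)
  have "na s name j ~= na s name k" if "j < k" for j using nm that k n3 by (auto dest: inj_onD)
  then show "\<forall>j<Suc k. ra (set_nv 27 (Suc k) (run b2 t)) outx (na s name j) = ra s3 px j &
    ra (set_nv 27 (Suc k) (run b2 t)) outy (na s name j) = ra s3 py j"
   using P by (auto simp: b2_def f i less_Suc_eq)
 qed (simp_all add: checked_def b2_def)
 then show ?thesis using pt[OF k] k n3 by simp
qed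

lemma fetch_answer: "nv (run fetch s) answer = 1"
proof -
 define rest where "rest = For 27 num_vertices (SetArr cand (Var 27) (Arr signs (Plus (Arr offset (Var 35)) (Var 27))));; place;;
   For 27 num_vertices (SetRealArr outx (Arr name (Var 27)) (RealArr px (Var 27));;
    SetRealArr outy (Arr name (Var 27)) (RealArr py (Var 27)))"
 have f: "fetch = SetVar answer (Const 1);; rest" unfolding fetch_def rest_def by (rule refl)
 have "checked rest" "answer ~: nmods rest" by (auto simp: rest_def checked_def part_defs)
 then show ?thesis unfolding f using sameD(1)[OF same_run, of rest answer] by simp
qed

lemma finish_correct:
 assumes s: "swept B 0 s" and ov: "nv s overflow = 0" and n: "3 <= n" and nm: "inj_on (na s name) {..<n}"
 shows "answered (run finish s)" "nv (run finish s) halt = 1"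
proof -
 define body where "body = IfPos (AndE (LtE (Var 35) (Var entries)) (EqE (Arr label (Var 35)) (Const 2))) fetch Skip"
 define s1 where "s1 = set_nv answer 0 (set_nv halt (Suc 0) s)"
 have t: "run finish s = run (For 35 limit body) s1" by (simp add: finish_def body_def s1_def)
 have ck: "checked (For 35 limit body)" by (auto simp: checked_def body_def solve_defs)
 have st1: "static s1" using s by (simp add: swept_def static_def s1_def)
 let ?good = "\<lambda>e. e < nv s entries & na s label e = 2"
 let ?q = "\<lambda>t k. (ra t outx (na s name k), ra t outy (na s name k))"
 have P: "nv (run (For 35 limit body) s1) answer = truth (\<exists>e<nv s1 limit. ?good e) &
   ((\<exists>e<nv s1 limit. ?good e) --> realizes (?q (run (For 35 limit body) s1)))"
 proof (rule For_rule[OF ck, where P = "\<lambda>m t. nv t answer = truth (\<exists>e<m. ?good e) & ((\<exists>e<m. ?good e) --> realizes (?q t))"])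
  fix k t assume k: "k < nv s1 limit" and i: "nv t 35 = k" and sm: "same (For 35 limit body) s1 t"
   and P: "nv t answer = truth (\<exists>e<k. ?good e) & ((\<exists>e<k. ?good e) --> realizes (?q t))"
  have f: "na t label = na s label" "nv t entries = nv s entries" "nv t limit = nv s limit" "na t name = na s name" "na t signs = na s signs"
   using sameD[OF sm] by (simp_all add: body_def solve_defs s1_def)
  have stt: "static t" by (rule static_same[OF st1 sm]; simp add: body_def solve_defs)
  have vt: "vec t e = vec s e" for e by (simp add: vec_def f fun_eq_iff)
  show "nv (set_nv 35 (Suc k) (run body t)) answer = truth (\<exists>e<Suc k. ?good e) &
    ((\<exists>e<Suc k. ?good e) --> realizes (?q (set_nv 35 (Suc k) (run body t))))"
  proof (cases "?good k")
   case True
   then have b: "run body t = run fetch t" by (simp add: body_def f i)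
   have g: "\<exists>e<Suc k. ?good e" using True by blast
   have "nv (run fetch t) answer = 1"
    by (rule fetch_answer)
   moreover have "realizes (?q (run fetch t))"
   proof (rule realizes_cong[OF swept_tables(2)[OF s ov n]])
    show "k < nv s entries" "na s label k = 2" using True by auto
    show "?q (run fetch t) j = pos (vec s k) j" if "j < n" for j
     using fetch_correct[OF stt _ _ that] i nm k vt by (simp add: f s1_def)
   qed
   ultimately show ?thesis using g by (simp add: b truth_def)
  next
   case False
   then have "run body t = t" by (auto simp: body_def f i)
   moreover have "(\<exists>e<Suc k. ?good e) \<longleftrightarrow> (\<exists>e<k. ?good e)" using False less_Suc_eq by auto
   ultimately show ?thesis using P by simp
  qed
 qed (simp add: s1_def truth_def)
 have "nv s entries <= nv s limit" using s by (simp add: swept_def entries_ok_def)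
 then have "(\<exists>e<nv s1 limit. ?good e) \<longleftrightarrow> (\<exists>e<nv s entries. na s label e = 2)"
  by (auto simp: s1_def intro: less_le_trans)
 then have ex: "(\<exists>e<nv s1 limit. ?good e) \<longleftrightarrow> (\<exists>p. realizes p)"
  using swept_tables(1)[OF s ov n] by simp
 have sm: "same (For 35 limit body) s1 (run finish s)" unfolding t by (rule same_run[OF ck])
 have f: "na (run finish s) name = na s name" "nv (run finish s) halt = 1"
  using sameD[OF sm] by (simp_all add: body_def solve_defs s1_def)
 show "nv (run finish s) halt = 1" by (fact f(2))
 show "answered (run finish s)"
  using P[folded t] unfolding ex answered_def f(1) by (auto simp: truth_def)
qed

text \<open>In the second case the table overflowed and so has exactly \<open>B\<close> entries, to
  which \<open>entries_bound\<close> applies. Failure is thus turned into an upper bound for the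
  cap, for any bound \<open>d\<close> on the depths.\<close>

lemma solve_correct:
 assumes st: "static s" and B: "nv s limit = B" "1 <= B" and n: "3 <= n" and nm: "inj_on (na s name) {..<n}" and h: "nv s halt = 0"
  and d: "\<And>k. k < n ==> depth k <= d"
 shows "nv (run solve s) halt = 1 & answered (run solve s) | nv (run solve s) halt = 0 & B <= n * (2 * n + 1) ^ (4 ^ d)"
proof -
 define s2 where "s2 = run sweep (run start s)"
 have sw: "swept B 0 s2" unfolding s2_def by (rule sweep_correct[OF start_correct[OF st B] n])
 have sm: "same start s (run start s)" "same sweep (run start s) s2"
  unfolding s2_def by (rule same_run; simp add: checked_solve_parts)+
 have "nv s2 halt = 0" "na s2 name = na s name"
  using sameD(1)[OF sm(1), of halt] sameD(1)[OF sm(2), of halt] sameD(3)[OF sm(1), of name] sameD(3)[OF sm(2), of name] h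
  by (simp_all add: solve_defs)
 then have f: "nv s2 halt = 0" "inj_on (na s2 name) {..<n}" using nm by simp_all
 show ?thesis
 proof (cases "nv s2 overflow = 0")
  case True
  then have "run solve s = run finish s2" by (simp add: solve_def s2_def)
  then show ?thesis using finish_correct[OF sw True n f(2)] by simp
 next
  case False
  then have "run solve s = s2" by (simp add: solve_def s2_def)
  moreover have "nv s2 entries = B" "entries_ok s2" using sw False by (simp_all add: swept_def)
  ultimately show ?thesis using entries_bound[OF _ d, of s2] f by simp
 qed
qed

end

section \<open>Finding a construction order for a given root\<close>

abbreviation (input) "num_arcs \<equiv> 29 :: nat"
abbreviation (input) "found \<equiv> 37 :: nat"
abbreviation (input) "best1 \<equiv> 41 :: nat"
abbreviation (input) "best2 \<equiv> 42 :: nat"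
abbreviation (input) "largest \<equiv> 43 :: nat"
abbreviation (input) "src \<equiv> 0 :: nat"
abbreviation (input) "dst \<equiv> 2 :: nat"
abbreviation (input) "wt \<equiv> 9 :: nat"

text \<open>Two arcs lead from placed vertices to a common new vertex, and a third one joins their
  sources. Requiring the first source to be placed before the second decides which of them becomes
  \<open>pa\<close>.\<close>

definition consider_arcs :: com where
 "consider_arcs = IfPos (AndE (EqE (Arr dst (Var 38)) (Arr dst (Var 39))) (AndE (EqE (Arr reached (Arr dst (Var 38))) (Const 0))
    (AndE (LtE (Const 0) (Arr reached (Arr src (Var 38)))) (AndE (LtE (Arr reached (Arr src (Var 38))) (Arr reached (Arr src (Var 39))))
    (AndE (EqE (Arr src (Var 40)) (Arr src (Var 38))) (AndE (EqE (Arr dst (Var 40)) (Arr src (Var 39)))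
    (LtE (Const 0) (Plus (NotE (Var found)) (RLess (RealVar 8) (RPlus (RealArr wt (Var 38)) (RealArr wt (Var 39))))))))))))
   (SetVar found (Const 1);; SetReal 8 (RPlus (RealArr wt (Var 38)) (RealArr wt (Var 39)));;
   SetVar best1 (Var 38);; SetVar best2 (Var 39)) Skip"

definition search :: com where
 "search = SetVar found (Const 0);; For 38 num_arcs (For 39 num_arcs (For 40 num_arcs consider_arcs))"

text \<open>\<open>reached\<close> holds the construction number plus one, with 0 for vertices not
  yet placed; hence the corrections by one.\<close>

definition pick :: com where
 "pick = search;;
   SetArr name (Var 36) (Arr dst (Var best1));;
   SetArr apa (Var 36) (Minus (Arr reached (Arr src (Var best1))) (Const 1));;
   SetArr apb (Var 36) (Minus (Arr reached (Arr src (Var best2))) (Const 1));;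
   SetRealArr ala (Var 36) (RealArr wt (Var best1));; SetRealArr alb (Var 36) (RealArr wt (Var best2));;
   SetArr reached (Arr dst (Var best1)) (Plus (Var 36) (Const 1))"

definition root :: com where
 "root = For 27 num_vertices (SetArr reached (Var 27) (Const 0));;
   SetArr reached (Arr src (Var base_edge)) (Const 1);; SetArr reached (Arr dst (Var base_edge)) (Const 2);;
   SetArr name (Const 0) (Arr src (Var base_edge));; SetArr name (Const 1) (Arr dst (Var base_edge));;
   SetArr apa (Const 0) (Const 0);; SetArr apb (Const 0) (Const 0);; SetArr apa (Const 1) (Const 0);; SetArr apb (Const 1) (Const 0);;
   SetRealArr ala (Const 1) (RealArr wt (Var base_edge));; SetRealArr alb (Const 1) (RealArr wt (Var base_edge))"

definition sides :: com where
 "sides = For 27 num_vertices (SetArr side1 (Var 27) (Arr apa (Var 27));; SetArr side2 (Var 27) (Var 27);;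
   SetArr side1 (Plus Vn (Var 27)) (Arr apb (Var 27));; SetArr side2 (Plus Vn (Var 27)) (Var 27))"

definition order :: com where
 "order = root;; For 36 num_vertices (IfPos (LtE (Const 1) (Var 36)) pick Skip);; sides"

definition attempt :: com where
 "attempt = SetVar largest (Const 1);;
   For 38 num_arcs (IfPos (RLess (RealArr wt (Var base_edge)) (RealArr wt (Var 38))) (SetVar largest (Const 0)) Skip);;
   IfPos (Var largest) (order;; solve) Skip"

definition offsets :: com where
 "offsets = SetVar 31 (Const 0);; For 27 limit (SetArr offset (Var 27) (Var 31);; SetVar 31 (Plus (Var 31) Vn))"

definition round :: com where
 "round = offsets;; For base_edge num_arcs (IfPos (Var halt) Skip attempt)"

lemmas order_defs = consider_arcs_def search_def pick_def root_def sides_def order_def attempt_def offsets_def round_def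

lemma checked_order_parts: "checked search" "checked pick" "checked root" "checked sides" "checked order" "checked offsets" "checked consider_arcs"
 "checked attempt" "checked round"
 by (auto simp: checked_def order_defs solve_def solve_defs)

text \<open>Every edge occurs as two arcs, so edges can be looked up in either orientation and any
  end of the root edge may become vertex 0.\<close>

locale arc_graph =
 fixes n :: nat and E :: "nat set set" and len :: "nat set => real" and N :: nat and sr ds :: "nat => nat" and w :: "nat => real"
 assumes two_tree: "two_tree ({..<n}, E)" and pos: "\<And>g. g \<in> E ==> 0 < len g"
  and arc: "\<And>i. i < N ==> {sr i, ds i} \<in> E & w i = len {sr i, ds i}"
  and arc_ex: "\<And>u v. {u, v} \<in> E ==> \<exists>i<N. sr i = u & ds i = v"
begin

definition loaded :: "store => bool" where
 "loaded s \<longleftrightarrow> nv s num_vertices = n & nv s num_arcs = N & nv s num_sides = 2 * n & nv s two = 2 &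
   na s src = sr & na s dst = ds & ra s wt = w"

lemma loaded_same:
 assumes "loaded s" "same c s t" "nmods c \<inter> {num_vertices, num_arcs, num_sides, two} = {}" "namods c \<inter> {src, dst} = {}" "ramods c \<inter> {wt} = {}"
 shows "loaded t"
 using assms(1,3-5) sameD[OF assms(2)] unfolding loaded_def by simp

lemma n3: "3 <= n" and card_E: "card E + 3 = 2 * n" and finite_E: "finite E"
 using two_tree_edges[OF two_tree] by simp_all

lemma E_vertices: "{u, v} \<in> E ==> u < n & v < n & u ~= v"
proof -
 assume "{u, v} \<in> E"
 then obtain x y where "{u, v} = {x, y}" "x ~= y" "x < n" "y < n"
  using two_tree_edges[OF two_tree] by auto
 then show ?thesis by (auto simp: doubleton_eq_iff)
qed

definition fits :: "(nat => nat) => nat => nat => nat => bool" where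
 "fits \<rho> f g h \<longleftrightarrow> ds f = ds g & \<rho> (ds f) = 0 & 0 < \<rho> (sr f) & \<rho> (sr f) < \<rho> (sr g) & sr h = sr f & ds h = sr g"

definition best :: "(nat => nat) => (nat \<times> nat \<times> nat) set => store => bool" where
 "best \<rho> A t \<longleftrightarrow> nv t found = 0 & (\<forall>(f, g, h)\<in>A. \<not> fits \<rho> f g h) |
   nv t found = 1 & (\<exists>h<N. nv t best1 < N & nv t best2 < N & fits \<rho> (nv t best1) (nv t best2) h) &
   rv t 8 = w (nv t best1) + w (nv t best2) & (\<forall>(f, g, h)\<in>A. fits \<rho> f g h --> w f + w g <= rv t 8)"

lemma best_counter: "x \<in> {38, 39, 40} ==> best \<rho> A (set_nv x k t) \<longleftrightarrow> best \<rho> A t"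
 by (auto simp: best_def)

lemma consider_arcs_correct:
 assumes b: "best \<rho> A t" and l: "loaded t" "na t reached = \<rho>" and i: "nv t 38 = f" "nv t 39 = g" "nv t 40 = h" "f < N" "g < N" "h < N"
 shows "best \<rho> (insert (f, g, h) A) (run consider_arcs t)"
proof -
 have a: "na t src = sr" "na t dst = ds" "ra t wt = w" using l by (simp_all add: loaded_def)
 let ?u = "set_nv best2 g (set_nv best1 f (set_rv 8 (w f + w g) (set_nv found (Suc 0) t)))"
 define tst where "tst = (AndE (EqE (Arr dst (Var 38)) (Arr dst (Var 39))) (AndE (EqE (Arr reached (Arr dst (Var 38))) (Const 0))
    (AndE (LtE (Const 0) (Arr reached (Arr src (Var 38)))) (AndE (LtE (Arr reached (Arr src (Var 38))) (Arr reached (Arr src (Var 39))))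
    (AndE (EqE (Arr src (Var 40)) (Arr src (Var 38))) (AndE (EqE (Arr dst (Var 40)) (Arr src (Var 39)))
    (LtE (Const 0) (Plus (NotE (Var found)) (RLess (RealVar 8) (RPlus (RealArr wt (Var 38)) (RealArr wt (Var 39))))))))))))"
 define upd where "upd = (SetVar found (Const 1);; SetReal 8 (RPlus (RealArr wt (Var 38)) (RealArr wt (Var 39)));;
   SetVar best1 (Var 38);; SetVar best2 (Var 39))"
 have ca: "consider_arcs = IfPos tst upd Skip" unfolding consider_arcs_def tst_def upd_def by (rule refl)
 have "nval tst t = truth (fits \<rho> f g h & (nv t found = 0 | rv t 8 < w f + w g))"
  by (simp add: tst_def a l i fits_def conj_assoc)
 moreover have "run upd t = ?u" by (simp add: upd_def a i)
 ultimately have "run consider_arcs t = (if fits \<rho> f g h & (nv t found = 0 | rv t 8 < w f + w g) then ?u else t)"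
  unfolding ca by auto
 moreover have "best \<rho> (insert (f, g, h) A) ?u" if "fits \<rho> f g h" "nv t found = 0 | rv t 8 < w f + w g"
 proof -
  have "w f' + w g' <= w f + w g" if "(f', g', h') \<in> A" "fits \<rho> f' g' h'" for f' g' h'
   using b that \<open>nv t found = 0 | rv t 8 < w f + w g\<close> unfolding best_def by fastforce
  then show ?thesis using that(1) i unfolding best_def by auto
 qed
 moreover have "best \<rho> (insert (f, g, h) A) t" if "\<not> (fits \<rho> f g h & (nv t found = 0 | rv t 8 < w f + w g))"
  using b that unfolding best_def by auto
 ultimately show ?thesis
  by (cases "fits \<rho> f g h & (nv t found = 0 | rv t 8 < w f + w g)") simp_all
qed

lemma search_correct:
 assumes l: "loaded s" and \<rho>: "na s reached = \<rho>"
 shows "best \<rho> ({..<N} \<times> {..<N} \<times> {..<N}) (run search s)"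
proof -
 let ?c1 = "For 40 num_arcs consider_arcs"
 let ?c2 = "For 39 num_arcs ?c1"
 let ?c3 = "For 38 num_arcs ?c2"
 have ck: "checked ?c1" "checked ?c2" "checked ?c3" by (auto simp: checked_def consider_arcs_def)
 have fr: "loaded u & na u reached = \<rho>" if "loaded t" "na t reached = \<rho>" "same c t u" "c \<in> {?c1, ?c2, ?c3}" for t u c
 proof -
  have m: "nmods c \<inter> {num_vertices, num_arcs, num_sides, two} = {}" "namods c = {}" "ramods c = {}"
   using that(4) by (auto simp: consider_arcs_def)
  then show ?thesis using loaded_same[OF that(1,3)] sameD(3)[OF that(3), of reached] that(2) by simp
 qed
 have 1: "best \<rho> (A \<union> {f} \<times> {g} \<times> {..<N}) (run ?c1 t)"
  if b: "best \<rho> A t" and lt: "loaded t" "na t reached = \<rho>" and i: "nv t 38 = f" "nv t 39 = g" "f < N" "g < N" for A t f g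
 proof -
  have N: "nv t num_arcs = N" using lt by (simp add: loaded_def)
  have "best \<rho> (A \<union> {f} \<times> {g} \<times> {..<nv t num_arcs}) (run ?c1 t)"
  proof (rule For_rule[OF ck(1), where P = "\<lambda>k u. best \<rho> (A \<union> {f} \<times> {g} \<times> {..<k}) u"])
   fix k u assume k: "k < nv t num_arcs" and P: "best \<rho> (A \<union> {f} \<times> {g} \<times> {..<k}) u" and u: "nv u 40 = k" and sm: "same ?c1 t u"
   have "nv u 38 = f" "nv u 39 = g" using sameD(1)[OF sm] i by (simp_all add: consider_arcs_def)
   then have "best \<rho> (insert (f, g, k) (A \<union> {f} \<times> {g} \<times> {..<k})) (run consider_arcs u)"
    using fr[OF lt sm] u k N i by (intro consider_arcs_correct[OF P]) auto
   moreover have "insert (f, g, k) (A \<union> {f} \<times> {g} \<times> {..<k}) = A \<union> {f} \<times> {g} \<times> {..<Suc k}" by auto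
   ultimately show "best \<rho> (A \<union> {f} \<times> {g} \<times> {..<Suc k}) (set_nv 40 (Suc k) (run consider_arcs u))"
    using best_counter[of 40] by simp
  qed (use b best_counter in simp)
  then show ?thesis by (simp add: N)
 qed
 have 2: "best \<rho> (A \<union> {f} \<times> {..<N} \<times> {..<N}) (run ?c2 t)"
  if b: "best \<rho> A t" and lt: "loaded t" "na t reached = \<rho>" and i: "nv t 38 = f" "f < N" for A t f
 proof -
  have N: "nv t num_arcs = N" using lt by (simp add: loaded_def)
  have "best \<rho> (A \<union> {f} \<times> {..<nv t num_arcs} \<times> {..<N}) (run ?c2 t)"
  proof (rule For_rule[OF ck(2), where P = "\<lambda>k u. best \<rho> (A \<union> {f} \<times> {..<k} \<times> {..<N}) u"])
   fix k u assume k: "k < nv t num_arcs" and P: "best \<rho> (A \<union> {f} \<times> {..<k} \<times> {..<N}) u" and u: "nv u 39 = k" and sm: "same ?c2 t u"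
   have "nv u 38 = f" using sameD(1)[OF sm] i by (simp add: consider_arcs_def)
   then have "best \<rho> ((A \<union> {f} \<times> {..<k} \<times> {..<N}) \<union> {f} \<times> {k} \<times> {..<N}) (run ?c1 u)"
    using fr[OF lt sm] u k N i by (intro 1[OF P]) auto
   moreover have "(A \<union> {f} \<times> {..<k} \<times> {..<N}) \<union> {f} \<times> {k} \<times> {..<N} = A \<union> {f} \<times> {..<Suc k} \<times> {..<N}" by auto
   ultimately show "best \<rho> (A \<union> {f} \<times> {..<Suc k} \<times> {..<N}) (set_nv 39 (Suc k) (run ?c1 u))"
    using best_counter[of 39] by simp
  qed (use b best_counter in simp)
  then show ?thesis by (simp add: N)
 qed
 define s0 where "s0 = set_nv found 0 s"
 have l0: "loaded s0" "na s0 reached = \<rho>" using l \<rho> by (simp_all add: loaded_def s0_def)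
 then have N: "nv s0 num_arcs = N" by (simp add: loaded_def)
 have "best \<rho> ({..<nv s0 num_arcs} \<times> {..<N} \<times> {..<N}) (run ?c3 s0)"
 proof (rule For_rule[OF ck(3), where P = "\<lambda>k u. best \<rho> ({..<k} \<times> {..<N} \<times> {..<N}) u"])
  show "best \<rho> ({..<0} \<times> {..<N} \<times> {..<N}) (set_nv 38 0 s0)" by (simp add: best_def s0_def)
  fix k u assume k: "k < nv s0 num_arcs" and P: "best \<rho> ({..<k} \<times> {..<N} \<times> {..<N}) u" and u: "nv u 38 = k" and sm: "same ?c3 s0 u"
  have "best \<rho> (({..<k} \<times> {..<N} \<times> {..<N}) \<union> {k} \<times> {..<N} \<times> {..<N}) (run ?c2 u)"
   using fr[OF l0 sm] u k N by (intro 2[OF P]) auto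
  moreover have "({..<k} \<times> {..<N} \<times> {..<N}) \<union> {k} \<times> {..<N} \<times> {..<N} = {..<Suc k} \<times> {..<N} \<times> {..<N}" by auto
  ultimately show "best \<rho> ({..<Suc k} \<times> {..<N} \<times> {..<N}) (set_nv 38 (Suc k) (run ?c2 u))"
   using best_counter[of 38] by simp
 qed
 then show ?thesis by (simp add: search_def s0_def[symmetric] N)
qed

text \<open>The last clause records the greedy choice of vertex \<open>i\<close>: no vertex unplaced
  at that time had a greater sum of sides over an earlier edge. Meanwhile such a vertex may have
  been placed, so being unplaced then reads as \<open>reached\<close> being 0 or above
  \<open>i\<close>.\<close>

definition stacked :: "store => nat => bool" where
 "stacked t i \<longleftrightarrow> na t apa i < na t apb i & na t apb i < i &
   {na t name (na t apa i), na t name i} \<in> E & {na t name (na t apb i), na t name i} \<in> E &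
   {na t name (na t apa i), na t name (na t apb i)} \<in> E &
   ra t ala i = len {na t name (na t apa i), na t name i} & ra t alb i = len {na t name (na t apb i), na t name i} &
   (\<forall>v<n. \<forall>x y. na t reached v = 0 | i < na t reached v --> x < y --> y < i -->
    {na t name x, v} \<in> E --> {na t name y, v} \<in> E --> {na t name x, na t name y} \<in> E -->
    len {na t name x, v} + len {na t name y, v} <= ra t ala i + ra t alb i)"

definition ordered :: "nat => nat => store => bool" where
 "ordered r k t \<longleftrightarrow> loaded t & 2 <= k &
   (\<forall>i<k. na t name i < n & na t reached (na t name i) = Suc i) &
   (\<forall>v<n. na t reached v ~= 0 --> na t reached v <= k & na t name (na t reached v - 1) = v) &
   na t name 0 = sr r & na t name (Suc 0) = ds r & na t apa 0 = 0 & na t apb 0 = 0 & na t apa (Suc 0) = 0 & na t apb (Suc 0) = 0 &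
   ra t ala (Suc 0) = w r & ra t alb (Suc 0) = w r & (\<forall>i. 2 <= i --> i < k --> stacked t i)"

lemma ordered_inj:
 assumes "ordered r k t"
 shows "inj_on (na t name) {..<k}"
proof (rule inj_onI)
 fix i j assume "i \<in> {..<k}" "j \<in> {..<k}" "na t name i = na t name j"
 then have "Suc i = Suc j" using assms unfolding ordered_def by (metis lessThan_iff)
 then show "i = j" by simp
qed

lemma pick_correct:
 assumes o: "ordered r k s" and k: "k < n" "nv s 36 = k" and r: "r < N"
 shows "ordered r (Suc k) (run pick s)"
proof -
 define \<rho> where "\<rho> = na s reached"
 let ?nm = "na s name"
 have l: "loaded s" and k2: "2 <= k" using o by (simp_all add: ordered_def)
 have nm: "\<And>i. i < k ==> ?nm i < n & \<rho> (?nm i) = Suc i" using o by (simp add: ordered_def \<rho>_def)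
 have re: "\<And>v. v < n ==> \<rho> v ~= 0 ==> \<rho> v <= k & ?nm (\<rho> v - 1) = v" using o by (simp add: ordered_def \<rho>_def)
 define u where "u = run search s"
 have sm: "same search s u" unfolding u_def by (rule same_run[OF checked_order_parts(1)])
 have lu: "loaded u" by (rule loaded_same[OF l sm]) (auto simp: search_def consider_arcs_def)
 have fu: "na u name = ?nm" "na u reached = \<rho>" "na u apa = na s apa" "na u apb = na s apb" "ra u ala = ra s ala" "ra u alb = ra s alb"
  "nv u 36 = k" "na u src = sr" "na u dst = ds" "ra u wt = w"
  using sameD[OF sm] k lu by (simp_all add: search_def consider_arcs_def \<rho>_def loaded_def)
 have b: "best \<rho> ({..<N} \<times> {..<N} \<times> {..<N}) u"
  unfolding u_def by (rule search_correct[OF l]) (simp add: \<rho>_def)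
 have fitting: "\<exists>f g h. f < N & g < N & h < N & fits \<rho> f g h & ds f = v & sr f = ?nm x & sr g = ?nm y"
  if e: "x < y" "y < k" "\<rho> v = 0" "{?nm x, v} \<in> E" "{?nm y, v} \<in> E" "{?nm x, ?nm y} \<in> E" for v x y
 proof -
  obtain f where f: "f < N" "sr f = ?nm x" "ds f = v" using arc_ex[OF e(4)] by blast
  obtain g where g: "g < N" "sr g = ?nm y" "ds g = v" using arc_ex[OF e(5)] by blast
  obtain h where h: "h < N" "sr h = ?nm x" "ds h = ?nm y" using arc_ex[OF e(6)] by blast
  have "fits \<rho> f g h" using f g h e nm[of x] nm[of y] by (simp add: fits_def)
  then show ?thesis using f g h by blast
 qed
 \<comment> \<open>As long as vertices are missing, \<open>two_tree_grow\<close> provides a triangle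
   on a placed edge, so the search cannot come back empty.\<close>
 have "\<exists>f g h. f < N & g < N & h < N & fits \<rho> f g h"
 proof -
  let ?R = "?nm ` {..<k}"
  have "?R \<subset> {..<n}"
  proof
   show "?R \<subseteq> {..<n}" using nm by auto
   have "card ?R <= k" using card_image_le[of "{..<k}" ?nm] by simp
   then show "?R ~= {..<n}" using k by auto
  qed
  moreover have "{?nm 0, ?nm 1} \<in> E" using o arc[OF r] by (simp add: ordered_def)
  moreover have "?nm 0 \<in> ?R" "?nm 1 \<in> ?R" using k2 by auto
  ultimately have "\<exists>v x y. v \<in> fst ({..<n}, E) - ?R & x \<in> ?R & y \<in> ?R &
    {x, v} \<in> snd ({..<n}, E) & {y, v} \<in> snd ({..<n}, E) & {x, y} \<in> snd ({..<n}, E)"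
   by (intro two_tree_grow[OF two_tree, of ?R "?nm 0" "?nm 1"]) simp_all
  then obtain v x y where v: "v \<in> {..<n} - ?R" "x \<in> ?R" "y \<in> ?R" "{x, v} \<in> E" "{y, v} \<in> E" "{x, y} \<in> E"
   unfolding fst_conv snd_conv by (elim exE conjE)
  then obtain i j where ij: "i < k" "j < k" "x = ?nm i" "y = ?nm j" by auto
  have "\<rho> v = 0"
  proof (rule ccontr)
   assume "\<rho> v ~= 0"
   then have "v = ?nm (\<rho> v - 1)" "\<rho> v - 1 < k" using re[of v] v(1) by auto
   then show False using v(1) by blast
  qed
  moreover have "i ~= j" using E_vertices[OF v(6)] ij by auto
  ultimately show ?thesis
   using fitting[of i j v] fitting[of j i v] v ij by (cases "i < j") (auto simp: insert_commute)
 qed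
 then have ex: "\<not> (\<forall>(f, g, h)\<in>{..<N} \<times> {..<N} \<times> {..<N}. \<not> fits \<rho> f g h)" by blast
 define f where "f = nv u best1"
 define g where "g = nv u best2"
 from b ex have B: "\<exists>h<N. f < N & g < N & fits \<rho> f g h" "\<And>f' g' h'. f' < N ==> g' < N ==> h' < N ==> fits \<rho> f' g' h' ==> w f' + w g' <= w f + w g"
  unfolding best_def f_def g_def by (fastforce, fastforce)
 then obtain h where h: "h < N" "f < N" "g < N" "fits \<rho> f g h" by blast
 define v where "v = ds f"
 define a where "a = \<rho> (sr f) - 1"
 define c where "c = \<rho> (sr g) - 1"
 have F: "ds g = v" "\<rho> v = 0" "0 < \<rho> (sr f)" "\<rho> (sr f) < \<rho> (sr g)" "sr h = sr f" "ds h = sr g"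
  using h(4) by (auto simp: fits_def v_def)
 have vn: "v < n" "sr f < n" "sr g < n" using arc[OF h(2)] arc[OF h(3)] E_vertices unfolding v_def by blast+
 have ac: "a < c" "c < k" "?nm a = sr f" "?nm c = sr g"
  using re[OF vn(2)] re[OF vn(3)] F by (auto simp: a_def c_def)
 have t: "run pick s = set_na reached v (Suc k) (set_ra alb k (w g) (set_ra ala k (w f)
   (set_na apb k c (set_na apa k a (set_na name k v u)))))"
  by (simp add: pick_def u_def[symmetric] fu f_def[symmetric] g_def[symmetric] v_def a_def c_def)
 let ?t = "run pick s"
 have T: "na ?t name i = (if i = k then v else ?nm i)" "na ?t reached x = (if x = v then Suc k else \<rho> x)"
  "na ?t apa i = (if i = k then a else na s apa i)" "na ?t apb i = (if i = k then c else na s apb i)"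
  "ra ?t ala i = (if i = k then w f else ra s ala i)" "ra ?t alb i = (if i = k then w g else ra s alb i)" for i x
  by (simp_all add: t fu)
 have lt: "loaded ?t" using lu by (simp add: t loaded_def)
 have nv: "?nm i ~= v" if "i < k" for i using nm[OF that] F(2) by auto
 have st: "stacked ?t i" if i: "2 <= i" "i < Suc k" for i
 proof (cases "i = k")
  case True
  have "{sr f, v} \<in> E" "{sr g, v} \<in> E" "{sr f, sr g} \<in> E" "w f = len {sr f, v}" "w g = len {sr g, v}"
   using arc[OF h(1)] arc[OF h(2)] arc[OF h(3)] F by (simp_all add: v_def)
  moreover have "len {?nm x, z} + len {?nm y, z} <= w f + w g"
   if z: "z < n" "z = v | \<rho> z = 0 | k < \<rho> z" "x < y" "y < k" "{?nm x, z} \<in> E" "{?nm y, z} \<in> E" "{?nm x, ?nm y} \<in> E" for x y z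
  proof -
   have "\<rho> z = 0" using z(2) re[OF z(1)] F(2) by auto
   from fitting[OF z(3,4) this z(5-7)] obtain f' g' h' where
    "f' < N" "g' < N" "h' < N" "fits \<rho> f' g' h'" "ds f' = z" "sr f' = ?nm x" "sr g' = ?nm y" by blast
   moreover from this have "ds g' = z" by (simp add: fits_def)
   ultimately show ?thesis using B(2)[of f' g' h'] arc[of f'] arc[of g'] by simp
  qed
  ultimately show ?thesis
   using ac True by (auto simp: stacked_def T split: if_splits)
 next
  case False
  then have ik: "i < k" using i by simp
  then have s: "stacked s i" using o i by (simp add: ordered_def)
  then have lt: "na s apa i < k" "na s apb i < k" "i < k" "na s apa i ~= k" "na s apb i ~= k" using ik by (auto simp: stacked_def)
  have "len {?nm x, z} + len {?nm y, z} <= ra s ala i + ra s alb i"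
   if z: "z < n" "na ?t reached z = 0 | i < na ?t reached z" "x < y" "y < i" "{?nm x, z} \<in> E" "{?nm y, z} \<in> E" "{?nm x, ?nm y} \<in> E" for x y z
  proof -
   have "\<rho> z = 0 | i < \<rho> z" using z(2) F(2) by (auto simp: T split: if_splits)
   then show ?thesis using s z unfolding stacked_def \<rho>_def by blast
  qed
  moreover have "x < i ==> na ?t name x = ?nm x" for x using ik by (simp add: T)
  ultimately show ?thesis
   using s lt unfolding stacked_def by (auto simp: T(1,3-6))
 qed
 show ?thesis
  unfolding ordered_def
 proof (intro conjI allI impI lt st)
  show "na ?t name i < n" "na ?t reached (na ?t name i) = Suc i" if "i < Suc k" for i
   using that nm[of i] nv[of i] vn(1) by (auto simp: T less_Suc_eq)
  show "na ?t reached x <= Suc k" "na ?t name (na ?t reached x - 1) = x" if "x < n" "na ?t reached x ~= 0" for x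
  proof -
   have "\<rho> x - 1 ~= k" if "\<rho> x ~= 0" using re[OF \<open>x < n\<close> that] k2 by auto
   then show "na ?t reached x <= Suc k" "na ?t name (na ?t reached x - 1) = x"
    using that re[OF that(1)] by (auto simp: T split: if_splits)
  qed
 qed (use o k2 in \<open>auto simp: ordered_def T\<close>)
qed

end

text \<open>The children of a P-node share its poles, and one child of the root is the Q-node of
  \<open>e\<close>; so the poles are the ends of \<open>e\<close> in some order.\<close>

lemma spq_poles:
 assumes "spq_tree_of G e T"
 obtains u v where "series_parallel u v G T" "{u, v} = e" "is_PNode T" "two_tree_shape T"
proof -
 obtain u v ts where sp: "series_parallel u v G T" "two_tree_shape T" "T = PNode ts" "QNode e \<in> set ts"
  using assms by (auto simp: spq_tree_of_def)
 obtain Gs where Gs: "\<forall>i<length ts. series_parallel u v (Gs ! i) (ts ! i)"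
  using sp(1) unfolding sp(3) by (cases rule: series_parallel.cases) auto
 obtain i where "i < length ts" "ts ! i = QNode e" using sp(4) by (auto simp: in_set_conv_nth)
 then have "series_parallel u v (Gs ! i) (QNode e)" using Gs by metis
 then have "{u, v} = e" by (cases rule: series_parallel.cases) auto
 then show ?thesis using that[OF sp(1)] sp(2,3) by simp
qed

context arc_graph
begin

lemma ordered_counter:
 assumes "x ~: {num_vertices, num_arcs, num_sides, two}"
 shows "ordered r k (set_nv x m t) = ordered r k t"
proof -
 have "loaded (set_nv x m t) = loaded t" using assms by (simp add: loaded_def)
 moreover have "stacked (set_nv x m t) i = stacked t i" for i unfolding stacked_def na_sets(1) ra_sets(1) by (rule refl)
 ultimately show ?thesis unfolding ordered_def na_sets(1) ra_sets(1) by (simp only:)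
qed

lemma root_correct:
 assumes l: "loaded s" and r: "nv s base_edge = r" "r < N"
 shows "ordered r 2 (run root s)"
proof -
 let ?b = "SetArr reached (Var 27) (Const 0)"
 define u where "u = run (For 27 num_vertices ?b) s"
 have sm: "same (For 27 num_vertices ?b) s u" unfolding u_def by (rule same_run) (simp add: checked_def)
 have lu: "loaded u" by (rule loaded_same[OF l sm]) simp_all
 have "\<forall>v<nv s num_vertices. na u reached v = 0"
  unfolding u_def
 proof (rule For_rule[where P = "\<lambda>m t. \<forall>v<m. na t reached v = 0"])
  fix k t assume "\<forall>v<k. na t reached v = 0" "nv t 27 = k"
  then show "\<forall>v<Suc k. na (set_nv 27 (Suc k) (run ?b t)) reached v = 0" by simp
 qed (simp_all add: checked_def)
 then have zero: "na u reached v = 0" if "v < n" for v using that l by (simp add: loaded_def)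
 have f: "nv u base_edge = r" "na u src = sr" "na u dst = ds" "ra u wt = w"
  using sameD(1)[OF sm, of base_edge] r lu by (simp_all add: loaded_def)
 let ?t = "run root s"
 have t: "?t = set_ra alb (Suc 0) (w r) (set_ra ala (Suc 0) (w r) (set_na apb (Suc 0) 0 (set_na apa (Suc 0) 0 (set_na apb 0 0 (set_na apa 0 0
   (set_na name (Suc 0) (ds r) (set_na name 0 (sr r) (set_na reached (ds r) 2 (set_na reached (sr r) (Suc 0) u)))))))))"
  by (simp add: root_def u_def[symmetric] f)
 have v: "sr r < n" "ds r < n" "sr r ~= ds r" using arc[OF r(2)] E_vertices by blast+
 have T: "na ?t name 0 = sr r" "na ?t name (Suc 0) = ds r"
  "na ?t reached x = (if x = ds r then 2 else if x = sr r then Suc 0 else na u reached x)"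
  "na ?t apa 0 = 0" "na ?t apb 0 = 0" "na ?t apa (Suc 0) = 0" "na ?t apb (Suc 0) = 0" "ra ?t ala (Suc 0) = w r" "ra ?t alb (Suc 0) = w r" for x
  by (simp_all add: t)
 have "loaded ?t" using lu by (simp add: t loaded_def)
 moreover have "na ?t name i < n & na ?t reached (na ?t name i) = Suc i" if "i < 2" for i
 proof -
  have "i = 0 | i = Suc 0" using that by auto
  then show ?thesis using v T by auto
 qed
 moreover have "na ?t reached x <= 2 & na ?t name (na ?t reached x - 1) = x" if "x < n" "na ?t reached x ~= 0" for x
  using that zero[of x] T by (auto split: if_splits)
 ultimately show ?thesis unfolding ordered_def using T by simp
qed

lemma ordered_order:
 assumes l: "loaded s" and r: "nv s base_edge = r" "r < N"
 shows "ordered r n (run (For 36 num_vertices (IfPos (LtE (Const 1) (Var 36)) pick Skip)) (run root s))"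
proof -
 define s1 where "s1 = run root s"
 define body where "body = IfPos (LtE (Const 1) (Var 36)) pick Skip"
 have o: "ordered r 2 s1" unfolding s1_def by (rule root_correct[OF l r])
 then have nn: "nv s1 num_vertices = n" by (simp add: ordered_def loaded_def)
 \<comment> \<open>Rounds 0 and 1 are idle because the root edge is already placed, which explains
   the maximum with 2.\<close>
 have "ordered r (max 2 (nv s1 num_vertices)) (run (For 36 num_vertices body) s1)"
 proof (rule For_rule[where P = "\<lambda>k t. ordered r (max 2 k) t"])
  show "checked (For 36 num_vertices body)" by (auto simp: checked_def body_def order_defs)
  show "ordered r (max 2 0) (set_nv 36 0 s1)" using o ordered_counter[of 36 r 2 0 s1] by simp
  fix k t assume k: "k < nv s1 num_vertices" and P: "ordered r (max 2 k) t" and i: "nv t 36 = k"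
  have "ordered r (max 2 (Suc k)) (run body t)"
  proof (cases "1 < k")
   case True
   then have "max 2 k = k" "max 2 (Suc k) = Suc k" by auto
   then show ?thesis using pick_correct[of r k t] P k i r nn True by (simp add: body_def)
  next
   case False
   then have m: "max 2 k = 2" "max 2 (Suc k) = 2" by auto
   have "run body t = t" using False i by (simp add: body_def)
   then show ?thesis using P by (simp only: m)
  qed
  then show "ordered r (max 2 (Suc k)) (set_nv 36 (Suc k) (run body t))" using ordered_counter[of 36] by simp
 qed
 moreover have "max 2 n = n" using n3 by simp
 ultimately show ?thesis by (simp only: nn body_def[symmetric] s1_def[symmetric])
qed

text \<open>The search does not record that the base of \<open>k\<close> is a side of the triangle
  of \<open>pb k\<close>; this comes from counting. The sides of all triangles make up
  \<open>2 * n - 3\<close> distinct edges, that is all of \<open>E\<close>, so the base is among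
  them and is listed at its later end. The order of siblings follows from the greedy choice, since
  \<open>k\<close> was still available when \<open>j\<close> was chosen.\<close>

lemma ordered_structure:
 assumes o: "ordered r n t" and r: "r < N" "\<And>i. i < N ==> w i <= w r"
 defines "pa \<equiv> na t apa" and "pb \<equiv> na t apb" and "la \<equiv> ra t ala" and "lb \<equiv> ra t alb" and "nam \<equiv> na t name"
 shows "parent_structure n pa pb la lb" "bij_betw nam {..<n} {..<n}"
  "E = {{nam i, nam j} |i j. parent_structure.child n pa pb i j}"
  "\<And>k. 1 <= k ==> k < n ==> la k = len {nam (pa k), nam k} & lb k = len {nam (pb k), nam k}"
proof -
 have nam_n: "nam i < n" and re: "na t reached (nam i) = Suc i" if "i < n" for i
  using o that by (auto simp: ordered_def nam_def)
 have base: "nam 0 = sr r" "nam (Suc 0) = ds r" "pa 0 = 0" "pb 0 = 0" "pa (Suc 0) = 0" "pb (Suc 0) = 0" "la (Suc 0) = w r" "lb (Suc 0) = w r"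
  using o by (simp_all add: ordered_def nam_def pa_def pb_def la_def lb_def)
 have st: "pa i < pb i" "pb i < i" "{nam (pa i), nam i} \<in> E" "{nam (pb i), nam i} \<in> E" "{nam (pa i), nam (pb i)} \<in> E"
  "la i = len {nam (pa i), nam i}" "lb i = len {nam (pb i), nam i}"
  and greedy: "\<And>v x y. v < n ==> i < na t reached v ==> x < y ==> y < i ==> {nam x, v} \<in> E ==> {nam y, v} \<in> E ==>
    {nam x, nam y} \<in> E ==> len {nam x, v} + len {nam y, v} <= la i + lb i" if "2 <= i" "i < n" for i
 proof -
  have "stacked t i" using o that by (simp add: ordered_def)
  then show "pa i < pb i" "pb i < i" "{nam (pa i), nam i} \<in> E" "{nam (pb i), nam i} \<in> E" "{nam (pa i), nam (pb i)} \<in> E"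
   "la i = len {nam (pa i), nam i}" "lb i = len {nam (pb i), nam i}"
   by (simp_all add: stacked_def nam_def pa_def pb_def la_def lb_def)
  fix v x y
  assume "v < n" "i < na t reached v" "x < y" "y < i" "{nam x, v} \<in> E" "{nam y, v} \<in> E" "{nam x, nam y} \<in> E"
  then show "len {nam x, v} + len {nam y, v} <= la i + lb i"
   using \<open>stacked t i\<close> unfolding stacked_def nam_def la_def lb_def by blast
 qed
 have inj: "inj_on nam {..<n}" unfolding nam_def by (rule ordered_inj[OF o])
 have "nam ` {..<n} = {..<n}"
  by (rule card_subset_eq) (use nam_n inj in \<open>auto simp: card_image\<close>)
 then show bij: "bij_betw nam {..<n} {..<n}" using inj by (simp add: bij_betw_def)
 have arc_r: "{nam 0, nam (Suc 0)} \<in> E" "w r = len {nam 0, nam (Suc 0)}" using arc[OF r(1)] by (simp_all add: base)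
 have edge: "{nam (pa k), nam k} \<in> E & {nam (pb k), nam k} \<in> E & la k = len {nam (pa k), nam k} & lb k = len {nam (pb k), nam k} & pa k < k & pb k < k"
  if "1 <= k" "k < n" for k
 proof (cases "k = 1")
  case True
  then show ?thesis using arc_r by (simp add: base)
 next
  case False
  then have "2 <= k" using that by simp
  then show ?thesis using st[of k] that by simp
 qed
 then show "\<And>k. 1 <= k ==> k < n ==> la k = len {nam (pa k), nam k} & lb k = len {nam (pb k), nam k}" by blast
 \<comment> \<open>Vertex 1 contributes a single pair, both its parents being 0; this gives
   \<open>n - 1\<close> and \<open>n - 2\<close> pairs.\<close>
 let ?P1 = "(\<lambda>k. (pa k, k)) ` {1..<n}"
 let ?P2 = "(\<lambda>k. (pb k, k)) ` {2..<n}"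
 let ?h = "\<lambda>(i, k). {nam i, nam k}"
 have "card ?P1 = n - 1" "card ?P2 = n - 2" by (simp_all add: card_image inj_on_def)
 moreover have "?P1 \<inter> ?P2 = {}" using st(1) by fastforce
 ultimately have cP: "card (?P1 \<union> ?P2) + 3 = 2 * n" using n3 by (simp add: card_Un_disjoint)
 have Plt: "i < k & k < n" if "(i, k) \<in> ?P1 \<union> ?P2" for i k using that edge[of k] by auto
 have pair: "i = i' & k = k'" if e: "{nam i, nam k} = {nam i', nam k'}" "i < k" "k < n" "i' < k'" "k' < n" for i k i' k'
 proof -
  have q: "nam x = nam y \<longleftrightarrow> x = y" if "x < n" "y < n" for x y using inj that by (auto dest: inj_onD)
  have "{i, k} = {i', k'}"
   using e q[of i i'] q[of i k'] q[of k i'] q[of k k'] by (auto simp: doubleton_eq_iff)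
  then show ?thesis using e by (auto simp: doubleton_eq_iff)
 qed
 have "inj_on ?h (?P1 \<union> ?P2)"
 proof (rule inj_onI)
  fix x y assume a: "x \<in> ?P1 \<union> ?P2" "y \<in> ?P1 \<union> ?P2" "?h x = ?h y"
  obtain i k i' k' where xy: "x = (i, k)" "y = (i', k')" by (cases x; cases y)
  show "x = y" using pair[of i k i' k'] Plt[of i k] Plt[of i' k'] a unfolding xy by simp
 qed
 then have "card (?h ` (?P1 \<union> ?P2)) = card E" using cP card_E by (simp add: card_image)
 moreover have "?h ` (?P1 \<union> ?P2) \<subseteq> E" using edge by auto
 ultimately have EP: "?h ` (?P1 \<union> ?P2) = E" using finite_E by (intro card_subset_eq) auto
 show ps: "parent_structure n pa pb la lb"
 proof
  show "2 <= n" using n3 by simp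
  show "pa 0 = 0" "pb 0 = 0" "pa 1 = 0" "pb 1 = 0" "lb 1 = la 1" by (simp_all add: base)
  show "pa k < pb k & pb k < k & (pa k = pa (pb k) | pa k = pb (pb k))" if k: "2 <= k" "k < n" for k
  proof -
   note s = st(1,2,5)[OF k]
   have "{nam (pa k), nam (pb k)} \<in> ?h ` (?P1 \<union> ?P2)" using s EP by simp
   then obtain i j where ij: "(i, j) \<in> ?P1 \<union> ?P2" "{nam (pa k), nam (pb k)} = {nam i, nam j}" by auto
   have "pa k = i & pb k = j" by (rule pair[OF ij(2)]) (use s k Plt[OF ij(1)] in simp_all)
   then show ?thesis using ij(1) s by auto
  qed
  show "la k + lb k <= la j + lb j" if jk: "2 <= j" "j < k" "k < n" "pa j = pa k" "pb j = pb k" for j k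
  proof -
   have k: "2 <= k" and j: "j < n" using jk by auto
   note s = st[OF k jk(3)] and sj = st(1,2)[OF jk(1) j]
   show ?thesis
    using greedy[OF jk(1) j nam_n[OF jk(3)], of "pa k" "pb k"] re[OF jk(3)] jk s sj by simp
  qed
  show "0 < la k & 0 < lb k & la k <= la 1 & lb k <= la 1" if k: "1 <= k" "k < n" for k
  proof -
   have "len {u, v} <= w r" if "{u, v} \<in> E" for u v
    using arc_ex[OF that] arc r(2) by metis
   then show ?thesis using edge[OF k] pos by (simp add: base)
  qed
 qed
 interpret parent_structure n pa pb la lb by (rule ps)
 show "E = {{nam i, nam j} |i j. child i j}"
 proof
  show "E \<subseteq> {{nam i, nam j} |i j. child i j}"
  proof
   fix g assume "g \<in> E"
   then obtain i k where g: "(i, k) \<in> ?P1 \<union> ?P2" "g = {nam i, nam k}" unfolding EP[symmetric] by blast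
   then have "child i k" by (auto simp: child_def)
   then show "g \<in> {{nam i, nam j} |i j. child i j}" using g(2) by blast
  qed
  show "{{nam i, nam j} |i j. child i j} \<subseteq> E" using edge by (auto simp: child_def)
 qed
qed

definition good :: "store => bool" where
 "good t \<longleftrightarrow> (if \<exists>p. planar_realization ({..<n}, E) len p
   then nv t answer = 1 & planar_realization ({..<n}, E) len (\<lambda>v. (ra t outx v, ra t outy v)) else nv t answer = 0)"

text \<open>What an unsuccessful attempt with root arc \<open>r\<close> proves. It speaks about all
  SPQ-trees, as the algorithm sees none, and is vacuous for arcs that are not longest, which the
  program skips.\<close>

definition refuted :: "nat => nat => bool" where
 "refuted B r \<longleftrightarrow> ((\<forall>i<N. w i <= w r) --> (\<forall>T. spq_tree_of ({..<n}, E) {sr r, ds r} T -->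
   B <= n * (2 * n + 1) ^ (4 ^ (height T div 2))))"

lemma sides_correct:
 assumes l: "loaded s" and k: "k < n"
 defines "t \<equiv> run sides s"
 shows "na t side1 k = na s apa k" "na t side2 k = k" "na t side1 (n + k) = na s apb k" "na t side2 (n + k) = k"
proof -
 define body where "body = SetArr side1 (Var 27) (Arr apa (Var 27));; SetArr side2 (Var 27) (Var 27);;
   SetArr side1 (Plus Vn (Var 27)) (Arr apb (Var 27));; SetArr side2 (Plus Vn (Var 27)) (Var 27)"
 have sd: "sides = For 27 num_vertices body" unfolding sides_def body_def by (rule refl)
 have nn: "nv s num_vertices = n" using l by (simp add: loaded_def)
 let ?P = "\<lambda>m t. \<forall>k<m. na t side1 k = na s apa k & na t side2 k = k & na t side1 (n + k) = na s apb k & na t side2 (n + k) = k"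
 have "?P (nv s num_vertices) t"
  unfolding t_def sd
 proof (rule For_rule[where P = ?P])
  fix j u assume j: "j < nv s num_vertices" and P: "?P j u" and i: "nv u 27 = j" and sm: "same (For 27 num_vertices body) s u"
  have f: "na u apa = na s apa" "na u apb = na s apb" "nv u num_vertices = n" using sameD[OF sm] nn by (simp_all add: body_def)
  have "i ~= j & i ~= n + j" if "i < j" for i using that by simp
  then show "?P (Suc j) (set_nv 27 (Suc j) (run body u))"
   using P j nn by (auto simp: body_def f i less_Suc_eq)
 qed (simp_all add: checked_def body_def)
 then show "na t side1 k = na s apa k" "na t side2 k = k" "na t side1 (n + k) = na s apb k" "na t side2 (n + k) = k"
  using k nn by auto
qed

lemma order_solve_correct:
 assumes l: "loaded s" and r: "nv s base_edge = r" "r < N" "\<And>i. i < N ==> w i <= w r"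
  and h: "nv s halt = 0" and B: "nv s limit = B" "1 <= B" and off: "\<forall>e<B. na s offset e = e * n"
 defines "t \<equiv> run solve (run order s)"
 shows "nv t halt = 1 & good t | nv t halt = 0 & refuted B r"
proof -
 define s1 where "s1 = run (For 36 num_vertices (IfPos (LtE (Const 1) (Var 36)) pick Skip)) (run root s)"
 define s2 where "s2 = run sides s1"
 have o: "ordered r n s1" unfolding s1_def by (rule ordered_order[OF l r(1,2)])
 have s2: "run order s = s2" by (simp add: order_def s1_def s2_def)
 have sm: "same sides s1 s2" unfolding s2_def by (rule same_run[OF checked_order_parts(4)])
 have f: "na s2 name = na s1 name" "na s2 apa = na s1 apa" "na s2 apb = na s1 apb" "ra s2 ala = ra s1 ala" "ra s2 alb = ra s1 alb"
  using sameD[OF sm] by (simp_all add: sides_def)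
 have l1: "loaded s1" using o by (simp add: ordered_def)
 have l2: "loaded s2" by (rule loaded_same[OF l1 sm]) (simp_all add: sides_def)
 have smo: "same order s s2" unfolding s2[symmetric] by (rule same_run[OF checked_order_parts(5)])
 have m: "limit ~: nmods order" "halt ~: nmods order" "offset ~: namods order" by (auto simp: order_defs)
 have g: "nv s2 limit = B" "nv s2 halt = 0" "na s2 offset = na s offset"
  using sameD(1)[OF smo m(1)] sameD(1)[OF smo m(2)] sameD(3)[OF smo _ m(3)] B h by simp_all
 note S = ordered_structure[OF o r(2,3), folded f]
 interpret parent_structure n "na s2 apa" "na s2 apb" "ra s2 ala" "ra s2 alb" by (rule S(1))
 have sf: "na s2 side1 k = na s2 apa k & na s2 side2 k = k & na s2 side1 (n + k) = na s2 apb k & na s2 side2 (n + k) = k"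
  if "k < n" for k using sides_correct[OF l1 that] by (simp add: s2_def[symmetric] f)
 have st: "static s2"
  unfolding static_def using l2 g off sf unfolding loaded_def by metis
 have inj: "inj_on (na s2 name) {..<n}" using S(2) by (simp add: bij_betw_def)
 have t: "t = run solve s2" by (simp add: t_def s2)
 have smt: "same solve s2 t" unfolding t by (rule same_run[OF checked_solve_parts(5)])
 have "name ~: namods solve" by (auto simp: solve_def solve_defs)
 then have nmt: "na t name = na s2 name" using sameD(3)[OF smt, of name] by simp
 note sc = solve_correct[OF st g(1) B(2) n3 inj g(2), folded t]
 \<comment> \<open>\<open>solve_correct\<close> is used twice: with the maximal depth to separate
   success from failure, and, after a failure, with half the height of a given SPQ-tree to bound the
   cap.\<close>
 obtain d0 where "\<And>k. k < n ==> depth k <= d0"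
 proof
  show "depth k <= Max (depth ` {..<n})" if "k < n" for k using that by (intro Max_ge) auto
 qed
 note c0 = sc[OF this]
 show ?thesis
 proof (cases "nv t halt = 0")
  case True
  have "refuted B r"
   unfolding refuted_def
  proof (intro impI allI)
   fix T assume T: "spq_tree_of ({..<n}, E) {sr r, ds r} T"
   obtain u v where uv: "series_parallel u v ({..<n}, E) T" "{u, v} = {sr r, ds r}" "is_PNode T" "two_tree_shape T"
    by (rule spq_poles[OF T])
   have nm: "na s2 name 0 = sr r" "na s2 name 1 = ds r" using o by (simp_all add: f ordered_def)
   have sp: "series_parallel (na s2 name 0) (na s2 name 1) ({..<n}, E) T | series_parallel (na s2 name 1) (na s2 name 0) ({..<n}, E) T"
    unfolding nm using uv(1,2) by (auto simp: doubleton_eq_iff)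
   have Ec: "{na s2 name j, na s2 name i} \<in> E" if "child i j" for i j
   proof -
    have "{na s2 name i, na s2 name j} \<in> {{na s2 name i, na s2 name j} |i j. child i j}" using that by blast
    then have "{na s2 name i, na s2 name j} \<in> E" by (simp only: S(3)[symmetric])
    then show ?thesis by (simp only: insert_commute)
   qed
   have "depth k <= height T div 2" if "k < n" for k
    using depth_height[OF n3 Ec inj sp uv(4,3) _ that] S(2) by (simp add: bij_betw_def)
   from sc[OF this] show "B <= n * (2 * n + 1) ^ (4 ^ (height T div 2))" using True by simp
  qed
  then show ?thesis using True by simp
 next
  case False
  then have "nv t halt = 1" and a: "answered t" using c0 by auto
  have eq: "(\<lambda>v. (ra t outx v, ra t outy v)) \<circ> na s2 name = (\<lambda>k. (ra t outx (na s2 name k), ra t outy (na s2 name k)))"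
   by (simp add: fun_eq_iff)
  have "good t"
   using a realization_ex[OF n3 S(2-4)] realization_iff[OF n3 S(2-4), of "\<lambda>v. (ra t outx v, ra t outy v)"]
   unfolding good_def answered_def nmt eq by simp
  then show ?thesis using \<open>nv t halt = 1\<close> by simp
 qed
qed

lemma attempt_correct:
 assumes l: "loaded s" and r: "nv s base_edge = r" "r < N"
  and h: "nv s halt = 0" and B: "nv s limit = B" "1 <= B" and off: "\<forall>e<B. na s offset e = e * n"
 defines "t \<equiv> run attempt s"
 shows "nv t halt = 1 & good t | nv t halt = 0 & refuted B r"
proof -
 define body where "body = IfPos (RLess (RealArr wt (Var base_edge)) (RealArr wt (Var 38))) (SetVar largest (Const 0)) Skip"
 define s0 where "s0 = set_nv largest (Suc 0) s"
 define s1 where "s1 = run (For 38 num_arcs body) s0"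
 have l0: "loaded s0" using l by (simp add: s0_def loaded_def)
 have ck: "checked (For 38 num_arcs body)" by (auto simp: checked_def body_def)
 have sm: "same (For 38 num_arcs body) s0 s1" unfolding s1_def by (rule same_run[OF ck])
 have l1: "loaded s1" by (rule loaded_same[OF l0 sm]) (simp_all add: body_def)
 have f: "nv s1 base_edge = r" "nv s1 halt = 0" "nv s1 limit = B" "na s1 offset = na s offset"
  using sameD[OF sm] r h B by (simp_all add: body_def s0_def)
 have "nv s1 largest = (if \<exists>i<nv s0 num_arcs. w r < w i then 0 else nv s0 largest)"
  unfolding s1_def
 proof (rule For_flag[OF ck])
  fix k u assume "nv u 38 = k" and su: "same (For 38 num_arcs body) s0 u"
  moreover have "loaded u" by (rule loaded_same[OF l0 su]) (simp_all add: body_def)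
  moreover have "nv u base_edge = r" using sameD(1)[OF su, of base_edge] r by (simp add: body_def s0_def)
  ultimately show "nv (run body u) largest = (if w r < w k then 0 else nv u largest)"
   by (simp add: body_def loaded_def)
 qed simp
 then have lg: "nv s1 largest = truth (\<forall>i<N. w i <= w r)"
  using l0 by (auto simp: loaded_def s0_def truth_def not_le[symmetric])
 have at: "attempt = SetVar largest (Const 1);; For 38 num_arcs body;; IfPos (Var largest) (order;; solve) Skip"
  unfolding attempt_def body_def by (rule refl)
 have t: "t = run (IfPos (Var largest) (order;; solve) Skip) s1"
  unfolding t_def at by (simp add: s1_def s0_def)
 show ?thesis
 proof (cases "\<forall>i<N. w i <= w r")
  case True
  then have "t = run solve (run order s1)" by (simp add: t lg)
  then show ?thesis
   using order_solve_correct[OF l1 f(1) r(2) _ f(2,3) B(2)] True off f(4) by simp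
 next
  case False
  then have "nv s1 largest = 0" unfolding lg truth_def by (rule if_not_P)
  then have "t = s1" by (simp add: t)
  moreover have "refuted B r" unfolding refuted_def using False by blast
  ultimately show ?thesis using f(2) by simp
 qed
qed

text \<open>After a success the remaining roots are skipped, so the answer survives; without success
  every root arc has been refuted for the current cap.\<close>

lemma round_correct:
 assumes l: "loaded s" and h: "nv s halt = 0" and B: "nv s limit = B" "1 <= B"
 defines "t \<equiv> run round s"
 shows "loaded t" "nv t limit = B" "nv t halt = 1 & good t | nv t halt = 0 & (\<forall>r<N. refuted B r)"
proof -
 have sm: "same round s t" unfolding t_def by (rule same_run[OF checked_order_parts(9)])
 have m: "nmods round \<inter> {num_vertices, num_arcs, num_sides, two} = {}" "namods round \<inter> {src, dst} = {}" "ramods round \<inter> {wt} = {}"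
  "limit ~: nmods round"
  by (auto simp: order_defs solve_def solve_defs)
 show "loaded t" by (rule loaded_same[OF l sm m(1-3)])
 show "nv t limit = B" using sameD(1)[OF sm m(4)] B by simp
 define ob where "ob = SetArr offset (Var 27) (Var 31);; SetVar 31 (Plus (Var 31) Vn)"
 define s0 where "s0 = set_nv 31 0 s"
 define s1 where "s1 = run (For 27 limit ob) s0"
 have s1: "run offsets s = s1" by (simp add: offsets_def s1_def s0_def ob_def)
 have ck: "checked (For 27 limit ob)" by (simp add: checked_def ob_def)
 have l0: "loaded s0" using l by (simp add: s0_def loaded_def)
 have sm1: "same (For 27 limit ob) s0 s1" unfolding s1_def by (rule same_run[OF ck])
 have l1: "loaded s1" by (rule loaded_same[OF l0 sm1]) (simp_all add: ob_def)
 have "nv s1 31 = nv s0 limit * n & (\<forall>e<nv s0 limit. na s1 offset e = e * n)"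
  unfolding s1_def
 proof (rule For_rule[OF ck, where P = "\<lambda>k u. nv u 31 = k * n & (\<forall>e<k. na u offset e = e * n)"])
  fix k u assume P: "nv u 31 = k * n & (\<forall>e<k. na u offset e = e * n)" and i: "nv u 27 = k" and su: "same (For 27 limit ob) s0 u"
  have "loaded u" by (rule loaded_same[OF l0 su]) (simp_all add: ob_def)
  then show "nv (set_nv 27 (Suc k) (run ob u)) 31 = Suc k * n & (\<forall>e<Suc k. na (set_nv 27 (Suc k) (run ob u)) offset e = e * n)"
   using P i by (auto simp: ob_def loaded_def less_Suc_eq)
 qed (simp add: s0_def)
 then have off: "\<forall>e<B. na s1 offset e = e * n" using B by (simp add: s0_def)
 have f1: "nv s1 halt = 0" "nv s1 limit = B" "nv s1 num_arcs = N"
  using sameD[OF sm1] h B l1 by (simp_all add: ob_def s0_def loaded_def)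
 define body where "body = IfPos (Var halt) Skip attempt"
 have rd: "round = offsets;; For base_edge num_arcs body" unfolding round_def body_def by (rule refl)
 have t: "t = run (For base_edge num_arcs body) s1" unfolding t_def rd by (simp add: s1)
 have ck2: "checked (For base_edge num_arcs body)"
  unfolding body_def by (auto simp: checked_def order_defs solve_def solve_defs)
 have mb: "nmods (For base_edge num_arcs body) \<inter> {num_vertices, num_arcs, num_sides, two} = {}"
  "namods (For base_edge num_arcs body) \<inter> {src, dst} = {}" "ramods (For base_edge num_arcs body) \<inter> {wt} = {}"
  "limit ~: nmods (For base_edge num_arcs body)" "offset ~: namods (For base_edge num_arcs body)"
  by (auto simp: body_def order_defs solve_def solve_defs)
 have "nv t halt = 1 & good t | nv t halt = 0 & (\<forall>r<nv s1 num_arcs. refuted B r)"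
  unfolding t
 proof (rule For_rule[OF ck2, where P = "\<lambda>k u. nv u halt = 1 & good u | nv u halt = 0 & (\<forall>r<k. refuted B r)"])
  show "nv (set_nv base_edge 0 s1) halt = 1 & good (set_nv base_edge 0 s1) | nv (set_nv base_edge 0 s1) halt = 0 & (\<forall>r<0. refuted B r)"
   using f1 by simp
  fix k u assume k: "k < nv s1 num_arcs" and P: "nv u halt = 1 & good u | nv u halt = 0 & (\<forall>r<k. refuted B r)"
   and i: "nv u base_edge = k" and su: "same (For base_edge num_arcs body) s1 u"
  have lu: "loaded u" by (rule loaded_same[OF l1 su mb(1-3)])
  have fu: "nv u limit = B" "na u offset = na s1 offset"
   using sameD(1)[OF su mb(4)] sameD(3)[OF su _ mb(5)] f1 by simp_all
  have gs: "good (set_nv base_edge m x) = good x" for m x by (simp add: good_def)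
  have "nv (run body u) halt = 1 & good (run body u) | nv (run body u) halt = 0 & (\<forall>r<Suc k. refuted B r)"
  proof (cases "nv u halt = 0")
   case True
   then have b: "run body u = run attempt u" by (simp add: body_def)
   have "\<forall>r<k. refuted B r" using P True by simp
   then show ?thesis
    using attempt_correct[OF lu i _ True fu(1) B(2)] k f1 off fu(2) unfolding b by (auto simp: less_Suc_eq)
  next
   case False
   then have "run body u = u" by (simp add: body_def)
   then show ?thesis using P False by simp
  qed
  then show "nv (set_nv base_edge (Suc k) (run body u)) halt = 1 & good (set_nv base_edge (Suc k) (run body u)) |
    nv (set_nv base_edge (Suc k) (run body u)) halt = 0 & (\<forall>r<Suc k. refuted B r)"
   using gs by simp
 qed
 then show "nv t halt = 1 & good t | nv t halt = 0 & (\<forall>r<N. refuted B r)" by (simp only: f1)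
qed

end

section \<open>Input, output and the complete program\<close>

abbreviation (input) "copied_vertices \<equiv> 30 :: nat"

text \<open>Variable 0 lives in the output register and is overwritten by the answer. A copy of the
  number of vertices is kept as the bound of the output loop.\<close>

definition initialize :: com where
 "initialize = SetVar num_edges (Var 1);; SetVar num_sides (Plus Vn Vn);; SetVar two (Const 2);;
   SetVar num_arcs (Plus (Var num_edges) (Var num_edges));; SetVar copied_vertices Vn;;
   SetVar halt (Const 0);; SetVar answer (Const 0);; SetVar limit (Const 0)"

text \<open>Cell \<open>j\<close> moves to address \<open>32 * j\<close>, which is at least
  \<open>j\<close>. Going downwards, no cell is overwritten before it has been read.\<close>

definition read_ends :: com where
 "read_ends = For 27 num_arcs (SetVar 31 (Minus (Minus (Var num_arcs) (Const 1)) (Var 27));; SetArr src (Var 31) (Mem (Var 31)))"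

text \<open>The length of edge \<open>e\<close> goes to its two arcs \<open>2 * e\<close> and
  \<open>2 * e + 1\<close>, at addresses \<open>64 * e + 9\<close> and \<open>64 * e + 41\<close>;
  both are above \<open>e\<close>, so the scan runs downwards again.\<close>

definition read_lengths :: com where
 "read_lengths = For 27 num_edges (SetVar 31 (Minus (Minus (Var num_edges) (Const 1)) (Var 27));;
   SetRealArr wt (Plus (Var 31) (Var 31)) (RealMem (Var 31));;
   SetRealArr wt (Plus (Plus (Var 31) (Var 31)) (Const 1)) (RealMem (Var 31)))"

definition reverse_arcs :: com where
 "reverse_arcs = For 27 num_edges (SetArr dst (Plus (Var 27) (Var 27)) (Arr src (Plus (Plus (Var 27) (Var 27)) (Const 1)));;
   SetArr dst (Plus (Plus (Var 27) (Var 27)) (Const 1)) (Arr src (Plus (Var 27) (Var 27))))"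

definition read_input :: com where
 "read_input = read_ends;; read_lengths;; reverse_arcs"

definition increment :: com where
 "increment = SetVar limit (Plus (Var limit) (Const 1))"

text \<open>The output cells \<open>2 * v\<close> and \<open>2 * v + 1\<close> lie below the array
  cells still to be read, so this copy runs upwards.\<close>

definition write_back :: com where
 "write_back = For 27 copied_vertices (SetRealMem (Plus (Var 27) (Var 27)) (RealArr outx (Var 27));;
   SetRealMem (Plus (Plus (Var 27) (Var 27)) (Const 1)) (RealArr outy (Var 27)))"

definition write_output :: com where
 "write_output = write_back;; SetVar num_vertices (Var answer)"

lemmas io_defs = initialize_def read_ends_def read_lengths_def reverse_arcs_def read_input_def increment_def write_back_def write_output_def

lemma nm_sets [simp]: "nm (set_nv x v s) = nm s" "nm (set_na k i v s) = (nm s)(addr k i := v)" "nm (set_ra k i r s) = nm s"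
 "rm (set_nv x v s) = rm s" "rm (set_na k i v s) = rm s" "rm (set_ra k i r s) = (rm s)(addr k i := r)"
 by (simp_all add: set_nv_def set_na_def set_ra_def)

lemma read_ends_correct:
 assumes j: "j < nv s num_arcs"
 shows "na (run read_ends s) src j = nm s j"
proof -
 define body where "body = SetVar 31 (Minus (Minus (Var num_arcs) (Const 1)) (Var 27));; SetArr src (Var 31) (Mem (Var 31))"
 have rd: "read_ends = For 27 num_arcs body" unfolding read_ends_def body_def by (rule refl)
 define N where "N = nv s num_arcs"
 let ?P = "\<lambda>k t. (\<forall>j<N. N - k <= j --> nm t (32 * j) = nm s j) & (\<forall>j<N - k. nm t j = nm s j)"
 have "?P (nv s num_arcs) (run (For 27 num_arcs body) s)"
 proof (rule For_rule[where P = ?P])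
  fix k t assume k: "k < nv s num_arcs" and P: "?P k t" and i: "nv t 27 = k" and sm: "same (For 27 num_arcs body) s t"
  have N: "nv t num_arcs = N" using sameD(1)[OF sm, of num_arcs] by (simp add: body_def N_def)
  define v where "v = N - Suc k"
  have v: "N - k = Suc v" "v < N" using k by (auto simp: v_def N_def)
  have cv: "nval (Minus (Minus (Var num_arcs) (Const 1)) (Var 27)) t = v" by (simp add: N i v_def)
  define u where "u = set_nv 31 v t"
  have b: "run body t = run (SetArr src (Var 31) (Mem (Var 31))) u"
   by (simp only: body_def run.simps(7) run_sets(1) cv u_def)
  have nt: "nm (run body t) x = (if x = 32 * v then nm t v else nm t x)" for x unfolding b by (simp add: u_def)
  have "nm (run body t) (32 * j) = nm s j" if "j < N" "v <= j" for j
   using P v that by (cases "j = v") (auto simp: nt)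
  moreover have "nm (run body t) j = nm s j" if "j < v" for j
   using P v that by (auto simp: nt)
  ultimately show "?P (Suc k) (set_nv 27 (Suc k) (run body t))" by (simp add: v_def[symmetric])
 qed (simp_all add: checked_def body_def N_def)
 then show ?thesis using j unfolding rd N_def by (simp add: na_def)
qed

lemma read_lengths_correct:
 assumes e: "e < nv s num_edges"
 shows "ra (run read_lengths s) wt (2 * e) = rm s e" "ra (run read_lengths s) wt (Suc (2 * e)) = rm s e"
proof -
 define body where "body = SetVar 31 (Minus (Minus (Var num_edges) (Const 1)) (Var 27));;
   SetRealArr wt (Plus (Var 31) (Var 31)) (RealMem (Var 31));;
   SetRealArr wt (Plus (Plus (Var 31) (Var 31)) (Const 1)) (RealMem (Var 31))"
 have rd: "read_lengths = For 27 num_edges body" unfolding read_lengths_def body_def by (rule refl)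
 define N where "N = nv s num_edges"
 let ?P = "\<lambda>k t. (\<forall>j<N. N - k <= j --> rm t (64 * j + 9) = rm s j & rm t (64 * j + 41) = rm s j) & (\<forall>j<N - k. rm t j = rm s j)"
 have "?P (nv s num_edges) (run (For 27 num_edges body) s)"
 proof (rule For_rule[where P = ?P])
  fix k t assume k: "k < nv s num_edges" and P: "?P k t" and i: "nv t 27 = k" and sm: "same (For 27 num_edges body) s t"
  have N: "nv t num_edges = N" using sameD(1)[OF sm, of num_edges] by (simp add: body_def N_def)
  define v where "v = N - Suc k"
  have v: "N - k = Suc v" "v < N" using k by (auto simp: v_def N_def)
  have cv: "nval (Minus (Minus (Var num_edges) (Const 1)) (Var 27)) t = v" by (simp add: N i v_def)
  define u where "u = set_nv 31 v t"
  have b: "run body t = run (SetRealArr wt (Plus (Var 31) (Var 31)) (RealMem (Var 31));;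
   SetRealArr wt (Plus (Plus (Var 31) (Var 31)) (Const 1)) (RealMem (Var 31))) u"
   by (simp only: body_def run.simps(7) run_sets(1) cv u_def)
  have nt: "rm (run body t) x = (if x = 64 * v + 9 | x = 64 * v + 41 then rm t v else rm t x)" for x
   unfolding b by (auto simp: u_def)
  have "rm (run body t) (64 * j + 9) = rm s j & rm (run body t) (64 * j + 41) = rm s j" if "j < N" "v <= j" for j
  proof (cases "j = v")
   case True
   then show ?thesis using P v by (simp add: nt)
  next
   case False
   then have "64 * j + 9 ~= 64 * v + 41" "64 * j + 41 ~= 64 * v + 9" by presburger+
   then show ?thesis using P v that False by (simp add: nt)
  qed
  moreover have "rm (run body t) j = rm s j" if "j < v" for j
   using P v that by (auto simp: nt)
  ultimately show "?P (Suc k) (set_nv 27 (Suc k) (run body t))" by (simp add: v_def[symmetric])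
 qed (simp_all add: checked_def body_def N_def)
 then have "rm (run read_lengths s) (64 * e + 9) = rm s e & rm (run read_lengths s) (64 * e + 41) = rm s e"
  using e unfolding rd N_def by simp
 then show "ra (run read_lengths s) wt (2 * e) = rm s e" "ra (run read_lengths s) wt (Suc (2 * e)) = rm s e"
  by (simp_all add: ra_def algebra_simps)
qed

lemma reverse_arcs_correct:
 assumes e: "e < nv s num_edges"
 shows "na (run reverse_arcs s) dst (2 * e) = na s src (Suc (2 * e))" "na (run reverse_arcs s) dst (Suc (2 * e)) = na s src (2 * e)"
proof -
 define body where "body = SetArr dst (Plus (Var 27) (Var 27)) (Arr src (Plus (Plus (Var 27) (Var 27)) (Const 1)));;
   SetArr dst (Plus (Plus (Var 27) (Var 27)) (Const 1)) (Arr src (Plus (Var 27) (Var 27)))"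
 have rd: "reverse_arcs = For 27 num_edges body" unfolding reverse_arcs_def body_def by (rule refl)
 let ?P = "\<lambda>k t. \<forall>e<k. na t dst (2 * e) = na s src (Suc (2 * e)) & na t dst (Suc (2 * e)) = na s src (2 * e)"
 have "?P (nv s num_edges) (run reverse_arcs s)"
  unfolding rd
 proof (rule For_rule[where P = ?P])
  fix k t assume P: "?P k t" and i: "nv t 27 = k" and sm: "same (For 27 num_edges body) s t"
  have f: "na t src = na s src" using sameD(3)[OF sm, of src] by (simp add: body_def)
  have "na (run body t) dst x = (if x = Suc (2 * k) then na s src (2 * k) else if x = 2 * k then na s src (Suc (2 * k)) else na t dst x)" for x
   by (simp add: body_def f i mult_2)
  moreover have "2 * e ~= Suc (2 * k)" "Suc (2 * e) ~= 2 * k" for e by presburger+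
  ultimately show "?P (Suc k) (set_nv 27 (Suc k) (run body t))" using P by (auto simp: less_Suc_eq)
 qed (simp_all add: checked_def body_def)
 then show "na (run reverse_arcs s) dst (2 * e) = na s src (Suc (2 * e))" "na (run reverse_arcs s) dst (Suc (2 * e)) = na s src (2 * e)"
  using e by auto
qed

lemma write_back_correct:
 assumes v: "v < nv s copied_vertices"
 shows "rm (run write_back s) (2 * v) = ra s outx v" "rm (run write_back s) (Suc (2 * v)) = ra s outy v"
proof -
 define body where "body = SetRealMem (Plus (Var 27) (Var 27)) (RealArr outx (Var 27));;
   SetRealMem (Plus (Plus (Var 27) (Var 27)) (Const 1)) (RealArr outy (Var 27))"
 have rd: "write_back = For 27 copied_vertices body" unfolding write_back_def body_def by (rule refl)
 let ?P = "\<lambda>k t. (\<forall>v<k. rm t (2 * v) = ra s outx v & rm t (Suc (2 * v)) = ra s outy v) & (\<forall>v\<ge>k. ra t outx v = ra s outx v & ra t outy v = ra s outy v)"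
 \<comment> \<open>Writes to raw memory are not \<open>checked\<close>, so the loop is handled by
   \<open>For_induct\<close>, with an invariant that protects the unread part of the arrays.\<close>
 have "well_formed (For 27 copied_vertices body)" by (simp add: body_def)
 then have "?P (nv s copied_vertices) (run (For 27 copied_vertices body) s)"
 proof (rule For_induct[where P = ?P])
  show "?P 0 (s\<lparr>nv := (nv s)(27 := 0)\<rparr>)" by (simp add: ra_def)
  fix k t assume P: "?P k t" and i: "nv t 27 = k"
  have r: "rm (run body t) x = (if x = Suc (2 * k) then ra t outy k else if x = 2 * k then ra t outx k else rm t x)" for x
   by (simp add: body_def i ra_def mult_2)
  have "2 * u ~= Suc (2 * k)" "Suc (2 * u) ~= 2 * k" for u by presburger+
  then have 1: "rm (run body t) (2 * u) = ra s outx u & rm (run body t) (Suc (2 * u)) = ra s outy u" if "u < Suc k" for u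
   using P that by (auto simp: r less_Suc_eq)
  have 2: "ra (run body t) outx u = ra s outx u & ra (run body t) outy u = ra s outy u" if "Suc k <= u" for u
  proof -
   have "32 * u + 7 ~= Suc (2 * k)" "32 * u + 7 ~= 2 * k" "32 * u + 8 ~= Suc (2 * k)" "32 * u + 8 ~= 2 * k" using that by linarith+
   moreover have "ra t outx u = ra s outx u" "ra t outy u = ra s outy u" using P that by auto
   ultimately show ?thesis unfolding ra_def r by simp
  qed
  show "?P (Suc k) ((run body t)\<lparr>nv := (nv (run body t))(27 := Suc k)\<rparr>)"
   using 1 2 by (simp add: ra_def)
 qed
 then show "rm (run write_back s) (2 * v) = ra s outx v" "rm (run write_back s) (Suc (2 * v)) = ra s outy v"
  using v unfolding rd by auto
qed

lemma mem_pairs: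
 "e < length es ==> mem_of_list (concat (map (\<lambda>(u, v). [u, v]) es)) (2 * e) = fst (es ! e) &
  mem_of_list (concat (map (\<lambda>(u, v). [u, v]) es)) (Suc (2 * e)) = snd (es ! e)"
proof (induction es arbitrary: e)
 case (Cons p es)
 have len: "length (concat (map (\<lambda>(u, v). [u, v]) xs)) = 2 * length xs" for xs :: "('a \<times> 'a) list"
  by (induction xs) auto
 show ?case
 proof (cases e)
  case 0
  then show ?thesis by (cases p) (simp add: mem_of_list_def)
 next
  case (Suc d)
  then show ?thesis using Cons.IH[of d] Cons.prems by (cases p) (simp add: mem_of_list_def len)
 qed
qed simp

lemma input_correct:
 assumes tt: "two_tree ({..<n}, E)" and pos: "\<forall>g\<in>E. 0 < len g" and es: "edge_list E es"
 defines "s \<equiv> run read_input (run initialize (start_store (input_config n es len)))"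
 shows "arc_graph n E len (2 * length es) (na s src) (na s dst) (ra s wt)"
  "arc_graph.loaded n (2 * length es) (na s src) (na s dst) (ra s wt) s"
  "nv s halt = 0" "nv s limit = 0" "nv s copied_vertices = n"
  "nv (run initialize (start_store (input_config n es len))) num_arcs = 2 * length es"
  "nv (run initialize (start_store (input_config n es len))) num_edges = length es"
proof -
 let ?a = "input_config n es len"
 define m where "m = length es"
 define s0 where "s0 = start_store ?a"
 define s1 where "s1 = run initialize s0"
 define s2 where "s2 = run read_ends s1"
 define s3 where "s3 = run read_lengths s2"
 have s: "s = run reverse_arcs s3" by (simp add: s_def read_input_def s3_def s2_def s1_def s0_def)
 have i0: "nv s0 0 = n" "nv s0 (Suc 0) = m" by (simp_all add: s0_def start_store_def input_config_def mem_of_list_def m_def)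
 have f1: "nv s1 num_vertices = n" "nv s1 num_edges = m" "nv s1 num_sides = 2 * n" "nv s1 two = 2" "nv s1 num_arcs = 2 * m"
  "nv s1 copied_vertices = n" "nv s1 halt = 0" "nv s1 limit = 0"
  by (simp_all add: s1_def initialize_def i0)
 show "nv (run initialize (start_store ?a)) num_arcs = 2 * length es" "nv (run initialize (start_store ?a)) num_edges = length es"
  using f1 by (simp_all add: s1_def s0_def m_def)
 have mem1: "nm s1 = nmem ?a" "rm s1 = rmem ?a"
  by (simp_all add: s1_def initialize_def s0_def start_store_def)
 have ck: "checked read_ends" "checked read_lengths" "checked reverse_arcs" by (auto simp: checked_def io_defs)
 have sm: "same read_ends s1 s2" "same read_lengths s2 s3" "same reverse_arcs s3 s"
  unfolding s2_def s3_def s by (rule same_run[OF ck(1)] same_run[OF ck(2)] same_run[OF ck(3)])+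
 have fix_nv: "nv s x = nv s1 x & nv s3 x = nv s1 x & nv s2 x = nv s1 x" if "x ~: {27, 31}" for x
  using sameD(1)[OF sm(1), of x] sameD(1)[OF sm(2), of x] sameD(1)[OF sm(3), of x] that by (auto simp: io_defs)
 show "nv s halt = 0" "nv s limit = 0" "nv s copied_vertices = n" using fix_nv f1 by auto
 \<comment> \<open>The frame relation \<open>same\<close> speaks about arrays, not about raw cells.
   That the real memory is untouched as a whole is obtained from invariance under the two kinds of
   update that occur.\<close>
 have rm2: "rm s2 = rm s1"
 proof -
  have "P s2" if "P s1" "\<And>x v u. P u ==> P (set_nv x v u)" "\<And>i v u. P u ==> P (set_na src i v u)" for P
   unfolding s2_def read_ends_def
   by (rule For_rule[where P = "\<lambda>_. P"]) (use that in \<open>simp_all add: checked_def\<close>)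
  from this[of "\<lambda>u. rm u = rm s1"] show ?thesis by simp
 qed
 have src_s: "na s src = na s2 src" using sameD(3)[OF sm(2), of src] sameD(3)[OF sm(3), of src] by (simp add: io_defs)
 have wt_s: "ra s wt = ra s3 wt" using sameD(4)[OF sm(3), of wt] by (simp add: io_defs)
 have A: "na s src (2 * e) = fst (es ! e)" "na s src (Suc (2 * e)) = snd (es ! e)"
  "na s dst (2 * e) = snd (es ! e)" "na s dst (Suc (2 * e)) = fst (es ! e)"
  "ra s wt (2 * e) = len {fst (es ! e), snd (es ! e)}" "ra s wt (Suc (2 * e)) = len {fst (es ! e), snd (es ! e)}" if e: "e < m" for e
 proof -
  have nm: "nmem ?a (2 * e) = fst (es ! e)" "nmem ?a (Suc (2 * e)) = snd (es ! e)"
   using mem_pairs[of e es] e by (simp_all add: input_config_def m_def)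
  have "rmem ?a e = len {fst (es ! e), snd (es ! e)}"
   using e by (simp add: input_config_def mem_of_list_def m_def case_prod_beta)
  then show "ra s wt (2 * e) = len {fst (es ! e), snd (es ! e)}" "ra s wt (Suc (2 * e)) = len {fst (es ! e), snd (es ! e)}"
   using read_lengths_correct[of e s2] e fix_nv[of num_edges] f1 by (simp_all add: wt_s s3_def[symmetric] rm2 mem1)
  show S: "na s src (2 * e) = fst (es ! e)" "na s src (Suc (2 * e)) = snd (es ! e)"
   using read_ends_correct[of "2 * e" s1] read_ends_correct[of "Suc (2 * e)" s1] e f1 nm
   by (simp_all add: src_s s2_def[symmetric] mem1)
  have "na s3 src = na s src" using sameD(3)[OF sm(3), of src] by (simp add: io_defs)
  then show "na s dst (2 * e) = snd (es ! e)" "na s dst (Suc (2 * e)) = fst (es ! e)"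
   using reverse_arcs_correct[of e s3] e fix_nv[of num_edges] f1 S by (simp_all add: s)
 qed
 have sete: "E = (\<lambda>e. {fst (es ! e), snd (es ! e)}) ` {..<m}"
 proof -
  have "E = (\<lambda>(u, v). {u, v}) ` set es" using es by (simp add: edge_list_def)
  also have "set es = (\<lambda>e. es ! e) ` {..<m}" by (auto simp: set_conv_nth m_def)
  finally show ?thesis by (simp add: image_image case_prod_beta)
 qed
 have arc: "{na s src i, na s dst i} \<in> E & ra s wt i = len {na s src i, na s dst i}" if i: "i < 2 * m" for i
 proof -
  define e where "e = i div 2"
  have e: "e < m" "i = 2 * e | i = Suc (2 * e)" using i by (auto simp: e_def)
  have "{fst (es ! e), snd (es ! e)} \<in> E" using sete e by auto
  then show ?thesis using e(2) A[OF e(1)] by (auto simp: insert_commute)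
 qed
 show ag: "arc_graph n E len (2 * length es) (na s src) (na s dst) (ra s wt)"
 proof
  show "two_tree ({..<n}, E)" by (rule tt)
  show "0 < len g" if "g \<in> E" for g using pos that by blast
  show "{na s src i, na s dst i} \<in> E & ra s wt i = len {na s src i, na s dst i}" if "i < 2 * length es" for i
   using arc that by (simp add: m_def)
  show "\<exists>i<2 * length es. na s src i = u & na s dst i = v" if uv: "{u, v} \<in> E" for u v
  proof -
   obtain e where e: "e < m" "{u, v} = {fst (es ! e), snd (es ! e)}" using uv unfolding sete by auto
   then consider "u = fst (es ! e)" "v = snd (es ! e)" | "v = fst (es ! e)" "u = snd (es ! e)" by (auto simp: doubleton_eq_iff)
   then show ?thesis
   proof cases
    case 1
    then show ?thesis using A[OF e(1)] e(1) by (intro exI[of _ "2 * e"]) (simp add: m_def)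
   next
    case 2
    then show ?thesis using A[OF e(1)] e(1) by (intro exI[of _ "Suc (2 * e)"]) (simp add: m_def)
   qed
  qed
 qed
 interpret arc_graph n E len "2 * length es" "na s src" "na s dst" "ra s wt" by (rule ag)
 show "loaded s" using fix_nv f1 by (simp add: loaded_def m_def)
qed

text \<open>The exponent of the theorem comes from \<open>4 ^ (h div 2) <= 2 ^ h\<close>. The rest
  absorbs constants into powers of \<open>n\<close>, for which \<open>3 <= n\<close> gives
  \<open>2 * n + 1 <= n ^ 2\<close>.\<close>

lemma size_bound:
 fixes n h C d :: nat
 assumes n: "3 <= n" and bd: "bd = n * (2 * n + 1) ^ (4 ^ (h div 2))"
 shows "(2 * C + 5) * (4 * n + bd + 1 + 1) ^ (d + 1) <= n ^ ((2 * C + 5 + 6 * (d + 1)) * 2 ^ h)"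
proof -
 have "3 * n <= n * n" using n by simp
 then have "2 * n + 1 <= n ^ 2" using n unfolding power2_eq_square by linarith
 then have "(2 * n + 1) ^ (4 ^ (h div 2)) <= (n ^ 2) ^ (4 ^ (h div 2))" by (rule power_mono) simp
 also have "\<dots> = n ^ (2 * 4 ^ (h div 2))" by (simp add: power_mult)
 also have "\<dots> <= n ^ (2 * 2 ^ h)"
 proof (rule power_increasing)
  have "(4 :: nat) ^ (h div 2) = 2 ^ (2 * (h div 2))" by (simp add: power_mult)
  also have "\<dots> <= 2 ^ h" by (rule power_increasing) simp_all
  finally show "2 * 4 ^ (h div 2) <= 2 * (2 :: nat) ^ h" by simp
 qed (use n in simp)
 finally have "bd <= n * n ^ (2 * 2 ^ h)" unfolding bd by simp
 also have "\<dots> <= n ^ (3 + 2 * 2 ^ h)"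
  using n power_increasing[of "1 + 2 * 2 ^ h" "3 + 2 * 2 ^ h" n] by simp
 finally have 1: "bd <= n ^ (3 + 2 * 2 ^ h)" .
 have "9 * n <= n ^ 3"
 proof -
  have "3 * 3 * n <= n * n * n" using n by (intro mult_le_mono) auto
  then show ?thesis by (simp add: power3_eq_cube)
 qed
 then have "4 * n + 1 + 1 <= n ^ 3" using n by linarith
 also have "\<dots> <= n ^ (3 + 2 * 2 ^ h)" using n by (intro power_increasing) auto
 finally have "4 * n + bd + 1 + 1 <= 2 * n ^ (3 + 2 * 2 ^ h)" using 1 by linarith
 also have "\<dots> <= n * n ^ (3 + 2 * 2 ^ h)" using n by (intro mult_le_mono) auto
 also have "\<dots> = n ^ (4 + 2 * 2 ^ h)" by (simp add: numeral_eq_Suc)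
 also have "\<dots> <= n ^ (6 * 2 ^ h)"
 proof (rule power_increasing)
  have "1 <= (2 :: nat) ^ h" by simp
  then show "4 + 2 * 2 ^ h <= 6 * (2 :: nat) ^ h" by linarith
 qed (use n in simp)
 finally have "(4 * n + bd + 1 + 1) ^ (d + 1) <= (n ^ (6 * 2 ^ h)) ^ (d + 1)" by (rule power_mono) simp
 also have "\<dots> = n ^ (6 * (d + 1) * 2 ^ h)" by (simp only: power_mult[symmetric] ac_simps)
 finally have 2: "(4 * n + bd + 1 + 1) ^ (d + 1) <= n ^ (6 * (d + 1) * 2 ^ h)" .
 have "2 * C + 5 <= 2 ^ (2 * C + 5)" using less_exp[of "2 * C + 5"] by (rule less_imp_le)
 also have "\<dots> <= n ^ (2 * C + 5)" using n by (intro power_mono) auto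
 also have "\<dots> <= n ^ ((2 * C + 5) * 2 ^ h)" using n by (intro power_increasing) auto
 finally have "(2 * C + 5) * (4 * n + bd + 1 + 1) ^ (d + 1) <= n ^ ((2 * C + 5) * 2 ^ h) * n ^ (6 * (d + 1) * 2 ^ h)"
  using 2 by (rule mult_le_mono)
 also have "\<dots> = n ^ ((2 * C + 5 + 6 * (d + 1)) * 2 ^ h)" by (simp only: power_add[symmetric] add_mult_distrib)
 finally show ?thesis .
qed

definition program :: "instr list" where
 "program = loop_program initialize read_input increment round halt write_output"

text \<open>With the cap \<open>bd + 1\<close> the arc of \<open>e\<close> can no longer be refuted,
  so there are at most \<open>bd + 1\<close> rounds. All loop bounds stay below \<open>M\<close>,
  and each round takes time polynomial in \<open>M\<close>.\<close>

lemma program_correct: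
 assumes tt: "two_tree ({..<n}, E)" and pos: "\<forall>g\<in>E. 0 < len g" and es: "edge_list E es"
  and e: "e \<in> E" "\<forall>g\<in>E. len g <= len e" and T: "spq_tree_of ({..<n}, E) e T"
  and Cd: "\<And>M. time (initialize;; read_input;; increment;; round;; write_output) M <= C * (M + 1) ^ d"
 shows "solves_realization_within program n es ({..<n}, E) len (n ^ ((2 * C + 5 + 6 * (d + 1)) * 2 ^ height T))"
proof -
 define a where "a = input_config n es len"
 define s where "s = run read_input (run initialize (start_store a))"
 define N where "N = 2 * length es"
 define bd where "bd = n * (2 * n + 1) ^ (4 ^ (height T div 2))"
 \<comment> \<open>\<open>4 * n\<close> covers the \<open>4 * n - 6\<close> arcs and the
   \<open>2 * n\<close> sides, \<open>bd + 1\<close> the cap of the last possible round.\<close>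
 define M where "M = 4 * n + bd + 1"
 note I = input_correct[OF tt pos es, folded a_def s_def N_def]
 interpret arc_graph n E len N "na s src" "na s dst" "ra s wt" by (rule I(1))
 define G where "G = (\<lambda>s. run round (run increment s))"
 have m: "length es + 3 = 2 * n"
 proof -
  have "card E = length (map (\<lambda>(u, v). {u, v}) es)" using es distinct_card unfolding edge_list_def by metis
  then show ?thesis using card_E by simp
 qed
 have cp: "copied_vertices ~: nmods round" by (auto simp: order_defs solve_def solve_defs)
 have stepG: "loaded (G x) & nv (G x) limit = Suc j & nv (G x) copied_vertices = nv x copied_vertices &
   (nv (G x) halt = 1 & good (G x) | nv (G x) halt = 0 & (\<forall>r<N. refuted (Suc j) r)) & loaded (run increment x)"
  if x: "loaded x" "nv x halt = 0" "nv x limit = j" for x j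
 proof -
  have i: "loaded (run increment x)" "nv (run increment x) halt = 0" "nv (run increment x) limit = Suc j"
   using x by (simp_all add: increment_def loaded_def)
  have "nv (run round (run increment x)) copied_vertices = nv x copied_vertices"
   using sameD(1)[OF same_run[OF checked_order_parts(9)] cp, of "run increment x"] by (simp add: increment_def)
  then show ?thesis using round_correct[OF i] i(1) unfolding G_def by simp
 qed
 have cap: "B <= bd" if "\<forall>r<N. refuted B r" for B
 proof -
  obtain u v where uv: "e = {u, v}" using two_tree_edges[OF tt] e(1) by auto
  then obtain r where r: "r < N" "na s src r = u" "na s dst r = v" using arc_ex e(1) by blast
  have "ra s wt i <= ra s wt r" if "i < N" for i using arc[OF that] arc[OF r(1)] e(2) r uv by simp
  then show ?thesis using that r T uv unfolding refuted_def bd_def by blast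
 qed
 \<comment> \<open>The shift by one reflects that the cap is raised at the start of a round: round
   \<open>j\<close>, counted from 0, runs with cap \<open>Suc j\<close>.\<close>
 define stop where "stop j \<longleftrightarrow> nv ((G ^^ Suc j) s) halt ~= 0" for j
 have inv: "loaded ((G ^^ j) s) & nv ((G ^^ j) s) limit = j & nv ((G ^^ j) s) halt = 0 & nv ((G ^^ j) s) copied_vertices = n"
  if "\<forall>i<j. \<not> stop i" for j
  using that
 proof (induction j)
  case 0
  then show ?case using I(2-5) by simp
 next
  case (Suc j)
  then have IH: "loaded ((G ^^ j) s)" "nv ((G ^^ j) s) halt = 0" "nv ((G ^^ j) s) limit = j" "nv ((G ^^ j) s) copied_vertices = n" by auto
  have "nv ((G ^^ Suc j) s) halt = 0" using Suc.prems by (simp add: stop_def)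
  then show ?case using stepG[OF IH(1-3)] IH(4) by simp
 qed
 have "\<exists>j\<le>bd. stop j"
 proof (rule ccontr)
  assume no: "\<not> (\<exists>j\<le>bd. stop j)"
  then have "loaded ((G ^^ bd) s)" "nv ((G ^^ bd) s) limit = bd" "nv ((G ^^ bd) s) halt = 0" using inv[of bd] by (meson less_imp_le)+
  from stepG[OF this(1,3,2)] have "\<forall>r<N. refuted (Suc bd) r" using no by (auto simp: stop_def)
  then show False using cap[of "Suc bd"] by simp
 qed
 then obtain j0 where j0: "j0 <= bd" "stop j0" by blast
 define K where "K = (LEAST j. stop j)"
 have "stop K" unfolding K_def by (rule LeastI[of stop, OF j0(2)])
 moreover have "K <= j0" unfolding K_def by (rule Least_le[of stop, OF j0(2)])
 moreover have "\<not> stop j" if "j < K" for j using that unfolding K_def by (rule not_less_Least)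
 ultimately have K: "stop K" "K <= bd" "\<And>j. j < K ==> \<not> stop j" using j0(1) by auto
 have invK: "loaded ((G ^^ j) s)" "nv ((G ^^ j) s) halt = 0" "nv ((G ^^ j) s) limit = j" "nv ((G ^^ j) s) copied_vertices = n" if "j <= K" for j
 proof -
  have "\<forall>i<j. \<not> stop i" using K(3) that by (meson less_le_trans)
  note inv[OF this]
  then show "loaded ((G ^^ j) s)" "nv ((G ^^ j) s) halt = 0" "nv ((G ^^ j) s) limit = j" "nv ((G ^^ j) s) copied_vertices = n"
   by blast+
 qed
 define z where "z = (G ^^ Suc K) s"
 have z: "nv z copied_vertices = n" "good z" "nv z halt = 1"
  using stepG[OF invK(1-3)[of K]] invK(4)[of K] K(1) by (auto simp: z_def stop_def)
 have sep: "separated initialize" "separated read_input" "separated increment" "separated round" "separated write_output"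
  by (auto simp: io_defs order_defs solve_def solve_defs)
 have b1: "\<forall>y\<in>bounds read_input. nv (run initialize (start_store a)) y <= M"
  using I(6,7) m by (auto simp: io_defs M_def N_def)
 have b3: "\<forall>y\<in>bounds round. nv (run increment ((G ^^ j) s)) y <= M" if "j <= K" for j
 proof -
  define x where "x = run increment ((G ^^ j) s)"
  have "loaded x" using stepG[OF invK(1-3)[OF that]] unfolding x_def by blast
  then have v: "nv x num_vertices = n" "nv x num_arcs = N" "nv x num_sides = 2 * n" "nv x two = 2" by (simp_all add: loaded_def)
  have l: "nv x limit = Suc j" using invK(3)[OF that] by (simp add: increment_def x_def)
  have "bounds round \<subseteq> {num_vertices, num_arcs, num_sides, two, limit}" by (auto simp: order_defs solve_def solve_defs)
  moreover have "N <= 4 * n" using m by (simp add: N_def)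
  ultimately show ?thesis using v l n3 that K(2) unfolding x_def[symmetric] by (auto simp: M_def)
 qed
 have b4: "\<forall>y\<in>bounds write_output. nv ((G ^^ Suc K) s) y <= M"
  using z(1) unfolding z_def[symmetric] by (auto simp: io_defs M_def)
 have "\<exists>b. reach program (2 + time initialize M + time read_input M + Suc K * (time increment M + time round M + 3) + time write_output M) a b &
   halted program b & store_of b = run write_output ((G ^^ Suc K) s)"
  unfolding program_def G_def
 proof (rule loop_program_correct[OF sep])
  show "pc a = 0" by (simp add: a_def input_config_def)
  show "bounds initialize = {}" "bounds increment = {}" by (simp_all add: io_defs)
  show "s = run read_input (run initialize (start_store a))" by (rule s_def)
  show "nv (((\<lambda>s. run round (run increment s)) ^^ Suc j) s) halt = 0" if "j < K" for j
   using K(3)[OF that] by (simp add: stop_def G_def)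
  show "0 < nv (((\<lambda>s. run round (run increment s)) ^^ Suc K) s) halt" using K(1) by (simp add: stop_def G_def)
 qed (use b1 b3 b4 in \<open>simp_all only: G_def\<close>)
 then obtain b where b: "reach program (2 + time initialize M + time read_input M + Suc K * (time increment M + time round M + 3) + time write_output M) a b"
  "halted program b" "store_of b = run write_output z" unfolding z_def by blast
 have "2 + time initialize M + time read_input M + Suc K * (time increment M + time round M + 3) + time write_output M
   <= (2 * C + 5) * (M + 1) ^ (d + 1)"
 proof -
  define S where "S = time (initialize;; read_input;; increment;; round;; write_output) M"
  have le: "2 + time initialize M + time read_input M + time write_output M <= 2 + S" "time increment M + time round M + 3 <= S + 3"
   by (simp_all add: S_def)
  have "Suc K * (time increment M + time round M + 3) <= (M + 1) * (S + 3)"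
   using le(2) K(2) by (intro mult_le_mono) (auto simp: M_def)
  moreover have "2 + S <= (M + 1) * (2 + S)" by simp
  ultimately have "2 + time initialize M + time read_input M + Suc K * (time increment M + time round M + 3) + time write_output M
    <= (M + 1) * (2 + S) + (M + 1) * (S + 3)" using le(1) by linarith
  also have "\<dots> = (M + 1) * (2 * S + 5)" by (simp add: algebra_simps)
  also have "\<dots> <= (M + 1) * ((2 * C + 5) * (M + 1) ^ d)"
  proof (rule mult_le_mono2)
   have "S <= C * (M + 1) ^ d" unfolding S_def by (rule Cd)
   moreover have "5 * 1 <= 5 * (M + 1) ^ d" by (intro mult_le_mono) simp_all
   ultimately have "2 * S + 5 <= 2 * (C * (M + 1) ^ d) + 5 * (M + 1) ^ d" by linarith
   then show "2 * S + 5 <= (2 * C + 5) * (M + 1) ^ d" by (simp only: add_mult_distrib mult.assoc)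
  qed
  also have "\<dots> = (2 * C + 5) * (M + 1) ^ (d + 1)" by (simp only: power_add power_one_right mult_ac)
  finally show ?thesis .
 qed
 also have "\<dots> <= n ^ ((2 * C + 5 + 6 * (d + 1)) * 2 ^ height T)"
  unfolding M_def by (rule size_bound[OF n3 bd_def])
 finally have halts: "halts_within program a (n ^ ((2 * C + 5 + 6 * (d + 1)) * 2 ^ height T)) b"
  by (rule reach_halts[OF b(1,2)])
 have ans: "output_answer b = nv z answer"
 proof -
  have "output_answer b = nv (store_of b) 0" by (simp add: output_answer_def)
  also have "\<dots> = nv z answer" unfolding b(3) write_output_def by (simp add: nv_run io_defs)
  finally show ?thesis .
 qed
 have outp: "output_pos b v = (ra z outx v, ra z outy v)" if "v < n" for v
 proof -
  have "output_pos b v = (rm (store_of b) (2 * v), rm (store_of b) (Suc (2 * v)))" by (simp add: output_pos_def)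
  also have "rm (store_of b) = rm (run write_back z)" unfolding b(3) write_output_def by simp
  finally show ?thesis using write_back_correct[of v z] that z(1) by simp
 qed
 \<comment> \<open>The output is read from raw memory and agrees with the arrays only on the
   vertices; as edges consist of vertices, this is enough.\<close>
 have cong: "planar_realization ({..<n}, E) len (output_pos b)" if r: "planar_realization ({..<n}, E) len (\<lambda>v. (ra z outx v, ra z outy v))"
 proof -
  define q where "q = (\<lambda>v. (ra z outx v, ra z outy v))"
  have eq: "output_pos b v = q v" if "v < n" for v using outp[OF that] by (simp add: q_def)
  have img: "output_pos b ` g = q ` g" if "g \<subseteq> {..<n}" for g using eq that by (intro image_cong) auto
  have sub: "g \<subseteq> {..<n}" if "g \<in> E" for g using two_tree_edges[OF tt] that by fastforce
  have r': "planar_realization ({..<n}, E) len q" using r by (simp add: q_def)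
  have "inj_on (output_pos b) {..<n}" using r' eq by (auto simp: planar_realization_def planar_drawing_def inj_on_def)
  moreover have "output_pos b v \<in> convex hull (output_pos b ` g) --> v \<in> g" if "v < n" "g \<in> E" for v g
   using r' eq[OF that(1)] img[OF sub[OF that(2)]] that by (auto simp: planar_realization_def planar_drawing_def)
  moreover have "convex hull (output_pos b ` f) \<inter> convex hull (output_pos b ` g) \<subseteq> output_pos b ` (f \<inter> g)"
   if "f \<in> E" "g \<in> E" "f ~= g" for f g
  proof -
   have "f \<inter> g \<subseteq> {..<n}" using sub[OF that(1)] by blast
   then show ?thesis using r' img[OF sub[OF that(1)]] img[OF sub[OF that(2)]] img[of "f \<inter> g"] that
    by (simp add: planar_realization_def planar_drawing_def)
  qed
  moreover have "dist (output_pos b u) (output_pos b v) = len {u, v}" if "{u, v} \<in> E" for u v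
   using r' eq E_vertices[OF that] that by (simp add: planar_realization_def)
  ultimately show ?thesis by (auto simp: planar_realization_def planar_drawing_def)
 qed
 show ?thesis
  unfolding solves_realization_within_def
  using halts z(2) ans cong unfolding a_def good_def by (intro exI[of _ b]) auto
qed

theorem theorem10:
  "\<exists>(A :: instr list) (f :: nat \<Rightarrow> nat).
     (\<lambda>h. real (f h)) \<in> O(\<lambda>h. 2 ^ h) \<and>
     (\<forall>(n :: nat) (E :: nat set set) (len :: nat set \<Rightarrow> real) (es :: (nat \<times> nat) list)
        (e :: nat set) (T :: nat spq_tree).
        two_tree ({..<n}, E) \<longrightarrow>
        (\<forall>g\<in>E. len g > 0) \<longrightarrow>
        edge_list E es \<longrightarrow>
        e \<in> E \<longrightarrow>
        (\<forall>g\<in>E. len g \<le> len e) \<longrightarrow>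
        spq_tree_of ({..<n}, E) e T \<longrightarrow>
        solves_realization_within A n es ({..<n}, E) len (n ^ f (height T)))"
proof -
 obtain C d where Cd: "\<And>M. time (initialize;; read_input;; increment;; round;; write_output) M <= C * (M + 1) ^ d"
  using time_poly by blast
 define f where "f = (\<lambda>h :: nat. (2 * C + 5 + 6 * (d + 1)) * 2 ^ h)"
 have "(\<lambda>h. real (f h)) \<in> O(\<lambda>h. 2 ^ h)"
  by (rule bigoI[where c = "real (2 * C + 5 + 6 * (d + 1))"]) (simp add: f_def)
 moreover have "solves_realization_within program n es ({..<n}, E) len (n ^ f (height T))"
  if "two_tree ({..<n}, E)" "\<forall>g\<in>E. len g > 0" "edge_list E es" "e \<in> E" "\<forall>g\<in>E. len g <= len e" "spq_tree_of ({..<n}, E) e T"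
  for n E len es e T
  using program_correct[OF that Cd] by (simp only: f_def)
 ultimately show ?thesis by blast
qed

end
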